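(* Let $\mathcal{P}=\langle\Sigma\mid\mathcal{R}\rangle$ be a semigroup presentation and let $G=\mathcal{D}(\mathcal{P},w)$ for some $w\in\Sigma^+$. Suppose that $A_1,\ldots,A_m$ are spherical diagrams with base $w$ that pairwise commute in $G$. Then there exist a word $v=v_1\cdots v_n$, spherical $(v_j,v_j)$-diagrams $\Delta_j$ $(1\le j\le n)$, integers $d_{ij}$ $(1\le i\le m,\ 1\le j\le n)$ and some $(w,v)$-diagram $\Gamma$ such that $$\Gamma^{-1}A_i\Gamma=\Delta_1^{d_{i1}}+\cdots+\Delta_n^{d_{in}}\qquad\text{for all }1\le i\le m .$$ One can additionally assume that each of the diagrams $\Delta_1,\ldots,\Delta_n$ is either trivial or simple absolutely reduced.
   Context: Semigroup presentations. $\mathcal{P}=\langle\Sigma\mid\mathcal{R}\rangle$ consists of an alphabet $\Sigma$ and a set $\mathcal{R}$ of pairs $(u,v)$ of non-empty words over $\Sigma$, written $u=v$; presentations are assumed anti-symmetric: if $(u=v)\in\mathcal{R}$ then $(v=u)\notin\mathcal{R}$. $\Sigma^+$ and $\Sigma^*$ denote the free semigroup and free monoid on $\Sigma$. Diagrams. Semigroup diagrams over $\mathcal{P}$ are plane directed graphs with edges labelled by $\Sigma$, taken up to isotopy; each diagram $\Delta$ has an initial vertex, a terminal vertex, and a top path and a bottom path joining them (edges directed left to right), between which it lies. For a word $w\in\Sigma^+$ the trivial diagram $\varepsilon(w)$ is a simple path labelled $w$, with no cells. For $x,y\in\Sigma^*$ and words $u,v$ with $(u=v)\in\mathcal{R}$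 or $(v=u)\in\mathcal{R}$, the elementary diagram of $(x,u\to v,y)$ is obtained from a path labelled $xuy$ (the top path) by attaching below its subpath labelled $u$ a path labelled $v$ with the same endpoints; the region between them is a $(u,v)$-cell (with top path labelled $u$ and bottom path labelled $v$), and the bottom path of the diagram has label $xvy$. A $(w_1,w_2)$-diagram is a diagram with top label $w_1$ and bottom label $w_2$. The composition $\Delta_1\circ\Delta_2$ of a $(w_1,w_2)$-diagram and a $(w_2,w_3)$-diagram is the $(w_1,w_3)$-diagram obtained by identifying the bottom path of $\Delta_1$ with the top path of $\Delta_2$. A diagram over $\mathcal{P}$ is a trivial diagram or a finite composition of elementary diagrams. The sum $\Delta_1+\Delta_2$ is obtained by identifying the terminal vertex of $\Delta_1$ with the initial vertex of $\Delta_2$. A $(w,w)$-diagram is called spherical with base $w$. A dipole is a pair consisting of a $(u,v)$-cell and a $(v,u)$-cell such that the bottom path of one is the top path of the other; it is removed by deleting the common path and identifying the remaining top and bottom paths of the two cells. A diagram is reduced if it has no dipoles. By Kilibarda's theorem every diagram has a unique reduced form obtained by removing dipoles; two diagrams are equivalent (written $=$) if they have the same reduced form. $\Delta^{-1}$ denotes the mirror image of $\Delta$ (top and bottom interchanged). The product $\Delta_1\Delta_2$ is $\Delta_1\circ\Delta_2$ up to equivalence. The diagram group $\mathcal{D}(\mathcal{P},w)$ is the group of equivalence classes of $(w,w)$-diagrams under this product, with identity $\varepsilon(w)$. A spherical diagram is absolutely reduced if each of its positive powers $\Delta\circ\cdots\circ\Delta$ is reduced. A diagram is simple if it is nontrivial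 and cannot be decomposed into a sum of two diagrams. *)

theory Defs
  imports "HOL-Algebra.Group"
begin

record 'a presentation =
  alphabet :: "'a set"
  relations :: "('a list \<times> 'a list) set"

definition plus_words :: "'a set \<Rightarrow> 'a list set" where
  "plus_words S = lists S - {[]}"

definition semigroup_presentation :: "'a presentation \<Rightarrow> bool" where
  "semigroup_presentation P \<longleftrightarrow>
     relations P \<subseteq> plus_words (alphabet P) \<times> plus_words (alphabet P) \<and>
     (\<forall>u v. (u, v) \<in> relations P \<longrightarrow> (v, u) \<notin> relations P)"

text \<open>
  A plane diagram is recorded by its directed labelled graph, the set of its cells
  (each cell given by its top path and its bottom path) and its own top and bottom path;
  paths are lists of edges. These data determine the plane diagram up to isotopy, so
  isotopy becomes isomorphism of the recorded structure. The values of \<open>src\<close>, \<open>tgt\<close> and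
  \<open>lab\<close> outside \<open>edges\<close> are irrelevant.
\<close>

record 'a diagram =
  verts :: "nat set"
  edges :: "nat set"
  src :: "nat \<Rightarrow> nat"
  tgt :: "nat \<Rightarrow> nat"
  lab :: "nat \<Rightarrow> 'a"
  cells :: "(nat list \<times> nat list) set"
  top_path :: "nat list"
  bot_path :: "nat list"

definition initial_vertex :: "'a diagram \<Rightarrow> nat" where
  "initial_vertex D = src D (hd (top_path D))"

definition terminal_vertex :: "'a diagram \<Rightarrow> nat" where
  "terminal_vertex D = tgt D (last (top_path D))"

definition path_label :: "'a diagram \<Rightarrow> nat list \<Rightarrow> 'a list" where
  "path_label D p = map (lab D) p"

definition top_label :: "'a diagram \<Rightarrow> 'a list" where
  "top_label D = path_label D (top_path D)"

definition bot_label :: "'a diagram \<Rightarrow> 'a list" where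
  "bot_label D = path_label D (bot_path D)"

definition path_verts :: "'a diagram \<Rightarrow> nat list \<Rightarrow> nat list" where
  "path_verts D p = src D (hd p) # map (tgt D) p"

definition isotopic :: "'a diagram \<Rightarrow> 'a diagram \<Rightarrow> bool" where
  "isotopic D E \<longleftrightarrow> (\<exists>\<phi> \<psi>.
     bij_betw \<phi> (verts D) (verts E) \<and>
     bij_betw \<psi> (edges D) (edges E) \<and>
     (\<forall>e\<in>edges D. src E (\<psi> e) = \<phi> (src D e) \<and> tgt E (\<psi> e) = \<phi> (tgt D e) \<and>
        lab E (\<psi> e) = lab D e) \<and>
     cells E = (\<lambda>(p, q). (map \<psi> p, map \<psi> q)) ` cells D \<and>
     top_path E = map \<psi> (top_path D) \<and>
     bot_path E = map \<psi> (bot_path D))"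

definition triv :: "'a list \<Rightarrow> 'a diagram" where
  "triv w =
     \<lparr>verts = {0..length w},
      edges = {0..<length w},
      src = (\<lambda>e. e),
      tgt = Suc,
      lab = (\<lambda>e. w ! e),
      cells = {},
      top_path = [0..<length w],
      bot_path = [0..<length w]\<rparr>"

text \<open>
  The elementary diagram of \<open>(x, u \<rightarrow> v, y)\<close>, for nonempty \<open>u\<close> and \<open>v\<close>. With \<open>N\<close> the length of
  \<open>xuy\<close>, the edges below \<open>N\<close> and the vertices up to \<open>N\<close> form the top path; the attached path
  has edges \<open>N, \<dots>, N + |v| - 1\<close> and inner vertices \<open>N + 1, \<dots>, N + |v| - 1\<close>, and it runs from
  vertex \<open>|x|\<close> to vertex \<open>|x| + |u|\<close>.
\<close>

definition elementary :: "'a list \<Rightarrow> 'a list \<Rightarrow> 'a list \<Rightarrow> 'a list \<Rightarrow> 'a diagram" where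
  "elementary x u v y =
     (let a = length x; b = length x + length u; N = length (x @ u @ y); M = N + length v in
     \<lparr>verts = {0..<M},
      edges = {0..<M},
      src = (\<lambda>e. if e = N then a else e),
      tgt = (\<lambda>e. if e = M - 1 then b else Suc e),
      lab = (\<lambda>e. (x @ u @ y @ v) ! e),
      cells = {([a..<b], [N..<M])},
      top_path = [0..<N],
      bot_path = [0..<a] @ [N..<M] @ [b..<N]\<rparr>)"

text \<open>
  \<open>collapse \<phi> \<psi>\<close> is the quotient under which a vertex \<open>x\<close> is identified with \<open>\<phi> x\<close> and an
  edge \<open>e\<close> with \<open>\<psi> e\<close>. It is meant for retractions \<open>\<phi>\<close>, \<open>\<psi>\<close> onto the surviving vertices and
  edges, which is why endpoints of surviving edges only need to be pushed along \<open>\<phi>\<close>.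
\<close>

definition collapse :: "(nat \<Rightarrow> nat) \<Rightarrow> (nat \<Rightarrow> nat) \<Rightarrow> 'a diagram \<Rightarrow> 'a diagram" where
  "collapse \<phi> \<psi> D =
     \<lparr>verts = \<phi> ` verts D,
      edges = \<psi> ` edges D,
      src = (\<lambda>e. \<phi> (src D e)),
      tgt = (\<lambda>e. \<phi> (tgt D e)),
      lab = lab D,
      cells = (\<lambda>(p, q). (map \<psi> p, map \<psi> q)) ` cells D,
      top_path = map \<psi> (top_path D),
      bot_path = map \<psi> (bot_path D)\<rparr>"

definition subst_list :: "nat list \<Rightarrow> nat list \<Rightarrow> nat \<Rightarrow> nat" where
  "subst_list xs ys z = (case map_of (zip xs ys) z of None \<Rightarrow> z | Some y \<Rightarrow> y)"

text \<open>Identify the path \<open>p\<close> with the path \<open>q\<close> (of the same label), keeping the edges of \<open>q\<close>.\<close>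

definition identify_paths :: "nat list \<Rightarrow> nat list \<Rightarrow> 'a diagram \<Rightarrow> 'a diagram" where
  "identify_paths p q D =
     collapse (subst_list (path_verts D p) (path_verts D q)) (subst_list p q) D"

text \<open>
  In the disjoint union, vertices and edges of the first diagram are doubled (\<open>2 * e\<close>), those of
  the second become odd (\<open>2 * e + 1\<close>).
\<close>

definition even_copy :: "nat \<Rightarrow> nat" where
  "even_copy e = 2 * e"

definition odd_copy :: "nat \<Rightarrow> nat" where
  "odd_copy e = 2 * e + 1"

definition disjoint_union :: "'a diagram \<Rightarrow> 'a diagram \<Rightarrow> 'a diagram" where
  "disjoint_union D E =
     \<lparr>verts = even_copy ` verts D \<union> odd_copy ` verts E,
      edges = even_copy ` edges D \<union> odd_copy ` edges E,
      src = (\<lambda>e. if even e then even_copy (src D (e div 2)) else odd_copy (src E (e div 2))),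
      tgt = (\<lambda>e. if even e then even_copy (tgt D (e div 2)) else odd_copy (tgt E (e div 2))),
      lab = (\<lambda>e. if even e then lab D (e div 2) else lab E (e div 2)),
      cells = (\<lambda>(p, q). (map even_copy p, map even_copy q)) ` cells D \<union>
              (\<lambda>(p, q). (map odd_copy p, map odd_copy q)) ` cells E,
      top_path = map even_copy (top_path D) @ map odd_copy (top_path E),
      bot_path = map even_copy (bot_path D) @ map odd_copy (bot_path E)\<rparr>"

definition dcomp :: "'a diagram \<Rightarrow> 'a diagram \<Rightarrow> 'a diagram" where
  "dcomp D E =
     identify_paths (map odd_copy (top_path E)) (map even_copy (bot_path D))
       ((disjoint_union D E)
          \<lparr>top_path := map even_copy (top_path D), bot_path := map odd_copy (bot_path E)\<rparr>)"

definition dsum :: "'a diagram \<Rightarrow> 'a diagram \<Rightarrow> 'a diagram" where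
  "dsum D E =
     collapse (id(odd_copy (initial_vertex E) := even_copy (terminal_vertex D))) id (disjoint_union D E)"

fun dsum_list :: "'a diagram list \<Rightarrow> 'a diagram" where
  "dsum_list [D] = D"
| "dsum_list (D # E # Ds) = dsum D (dsum_list (E # Ds))"

definition mirror :: "'a diagram \<Rightarrow> 'a diagram" where
  "mirror D = D\<lparr>cells := (\<lambda>(p, q). (q, p)) ` cells D,
                top_path := bot_path D, bot_path := top_path D\<rparr>"

primrec dpow :: "'a diagram \<Rightarrow> nat \<Rightarrow> 'a diagram" where
  "dpow D 0 = triv (top_label D)"
| "dpow D (Suc k) = dcomp (dpow D k) D"

definition dpowi :: "'a diagram \<Rightarrow> int \<Rightarrow> 'a diagram" where
  "dpowi D k = (if k \<ge> 0 then dpow D (nat k) else dpow (mirror D) (nat (- k)))"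

inductive diagram_over :: "'a presentation \<Rightarrow> 'a diagram \<Rightarrow> bool" for P where
  trivial: "w \<in> plus_words (alphabet P) \<Longrightarrow> diagram_over P (triv w)"
| elementary: "\<lbrakk>x \<in> lists (alphabet P); y \<in> lists (alphabet P);
     (u, v) \<in> relations P \<or> (v, u) \<in> relations P\<rbrakk>
     \<Longrightarrow> diagram_over P (elementary x u v y)"
| composition: "\<lbrakk>diagram_over P D; diagram_over P E; bot_label D = top_label E\<rbrakk>
     \<Longrightarrow> diagram_over P (dcomp D E)"
| isotopy: "\<lbrakk>diagram_over P D; isotopic D E\<rbrakk> \<Longrightarrow> diagram_over P E"

definition wdiagram :: "'a presentation \<Rightarrow> 'a list \<Rightarrow> 'a list \<Rightarrow> 'a diagram \<Rightarrow> bool" where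
  "wdiagram P w1 w2 D \<longleftrightarrow> diagram_over P D \<and> top_label D = w1 \<and> bot_label D = w2"

definition spherical :: "'a presentation \<Rightarrow> 'a list \<Rightarrow> 'a diagram \<Rightarrow> bool" where
  "spherical P w D \<longleftrightarrow> wdiagram P w w D"

text \<open>
  In a dipole the bottom path \<open>q\<close> of the upper cell \<open>(p, q)\<close> is the top path of the lower cell
  \<open>(q, r)\<close>. Removing it deletes both cells, the edges of \<open>q\<close> and the inner vertices of \<open>q\<close>, and
  identifies \<open>r\<close> with \<open>p\<close>.
\<close>

definition dipole :: "'a diagram \<Rightarrow> nat list \<Rightarrow> nat list \<Rightarrow> nat list \<Rightarrow> bool" where
  "dipole D p q r \<longleftrightarrow> (p, q) \<in> cells D \<and> (q, r) \<in> cells D \<and> path_label D p = path_label D r"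

definition remove_dipole ::
  "nat list \<Rightarrow> nat list \<Rightarrow> nat list \<Rightarrow> 'a diagram \<Rightarrow> 'a diagram" where
  "remove_dipole p q r D =
     identify_paths r p
       (D\<lparr>verts := verts D - tgt D ` set (butlast q),
          edges := edges D - set q,
          cells := cells D - {(p, q), (q, r)}\<rparr>)"

definition reduced :: "'a diagram \<Rightarrow> bool" where
  "reduced D \<longleftrightarrow> (\<nexists>p q r. dipole D p q r)"

definition dipole_step :: "'a diagram \<Rightarrow> 'a diagram \<Rightarrow> bool" where
  "dipole_step D E \<longleftrightarrow> (\<exists>p q r. dipole D p q r \<and> E = remove_dipole p q r D)"

definition reduced_form :: "'a diagram \<Rightarrow> 'a diagram \<Rightarrow> bool" where
  "reduced_form D E \<longleftrightarrow> dipole_step\<^sup>*\<^sup>* D E \<and> reduced E"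

definition dequiv :: "'a diagram \<Rightarrow> 'a diagram \<Rightarrow> bool" where
  "dequiv D E \<longleftrightarrow> (\<exists>D' E'. reduced_form D D' \<and> reduced_form E E' \<and> isotopic D' E')"

definition dclass :: "'a presentation \<Rightarrow> 'a diagram \<Rightarrow> 'a diagram set" where
  "dclass P D = {E. diagram_over P E \<and> dequiv D E}"

text \<open>
  The product is the union over all representatives of the classes of their composites; since
  equivalence is a congruence for composition, all of these classes coincide.
\<close>

definition diagram_group :: "'a presentation \<Rightarrow> 'a list \<Rightarrow> 'a diagram set monoid" where
  "diagram_group P w =
     \<lparr>carrier = dclass P ` {D. spherical P w D},
      mult = (\<lambda>X Y. \<Union>D\<in>X. \<Union>E\<in>Y. dclass P (dcomp D E)),
      one = dclass P (triv w)\<rparr>"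

definition absolutely_reduced :: "'a diagram \<Rightarrow> bool" where
  "absolutely_reduced D \<longleftrightarrow> (\<forall>k\<ge>1. reduced (dpow D k))"

definition trivial_diagram :: "'a diagram \<Rightarrow> bool" where
  "trivial_diagram D \<longleftrightarrow> (\<exists>w. isotopic D (triv w))"

definition simple_diagram :: "'a presentation \<Rightarrow> 'a diagram \<Rightarrow> bool" where
  "simple_diagram P D \<longleftrightarrow> \<not> trivial_diagram D \<and>
     \<not> (\<exists>D1 D2. diagram_over P D1 \<and> diagram_over P D2 \<and> isotopic D (dsum D1 D2))"

end

theory Submission
  imports Defs Complex_Main
begin

text \<open>
  Fix a word \<open>w\<close>. Glueing cells one after the other below the path labelled \<open>w\<close>, with two cells
  identified when they cancel, gives a universal complex in which every diagram with top label \<open>w\<close>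
  develops; two such diagrams are equivalent if and only if their bottom paths develop to the same
  path. Thus the diagram group over \<open>w\<close> consists of the paths labelled \<open>w\<close> that can be reached from
  the base path, and it acts on all reachable paths. Two paths are at distance the number of cells by
  which they differ.

  Conjugate one of the commuting elements, \<open>A\<close>, so that it moves the base path by its minimal
  displacement; then its powers are reduced. If \<open>A\<close> is nontrivial and fixes an interior vertex of some
  path, then it fixes an interior vertex of the base path that is next to a moved edge. Everything that
  commutes with \<open>A\<close> fixes this vertex too, so that all elements split into sums, and one uses induction
  on the length of the word. If \<open>A\<close> fixes no interior vertex, look at the tree formed by the edges at the
  initial vertex, where an edge created by a cell is joined to the first edge on the top of that cell:
  \<open>A\<close> moves along a ray of it, and the centralizer of \<open>A\<close> embeds into the integers as the group of
  shifts of that ray. So all elements are powers of a single one. Conjugated to a base of minimal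
  displacement whose word is as short as possible, that element is simple and absolutely reduced.
\<close>

section \<open>Edges of the universal complex\<close>

text \<open>A path in the complex is a concrete list of terms, so equivalence of diagrams becomes
  equality of lists and composition becomes substitution. These lists are manageable because a
  reachable path is determined by the finite set of cells above it, and the cells common to two
  reachable paths again form such a set: any two paths have a meet, through which a shortest
  connection can be routed, and the meet passes through every common vertex. Planarity enters only
  as one coordinate that orders the edges of a path from left to right. The obstacle is that a
  reduced spherical diagram may have unreduced powers: a cell at the start of one copy may cancel
  against a cell of a much earlier copy. Such a cancellation contradicts minimal displacement only
  after all translates of the cancelling segment on the base path are flipped at once; flipping a
  single one need not shorten anything. On the axis, an element commuting with \<open>A\<close> is
  controlled only far out, because it may move the near end off the axis. This is enough, as two
  such elements that agree far out are equal.\<close>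

text \<open>
  Edges are named by their history: \<open>Base i a\<close> is the edge number \<open>i\<close> of the base path, with label \<open>a\<close>,
  and \<open>New p v j\<close> is the edge number \<open>j\<close> of the bottom path, labelled \<open>v\<close>, of a cell glued below the
  path \<open>p\<close>. \<open>VNew p v j\<close> is the inner vertex before that edge.
\<close>

datatype 'a edge = Base nat 'a | New "'a edge list" "'a list" nat

datatype 'a vertex = VBase nat | VNew "'a edge list" "'a list" nat

fun elab :: "'a edge \<Rightarrow> 'a" where
  "elab (Base i a) = a"
| "elab (New p v j) = v ! j"

definition bots :: "'a edge list \<Rightarrow> 'a list \<Rightarrow> 'a edge list" where
  "bots p v = map (New p v) [0..<length v]"

text \<open>
  The other side, labelled \<open>v\<close>, of the cell at \<open>p\<close>: if \<open>p\<close> is the whole bottom path of a cell with top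
  label \<open>v\<close>, one goes back to the top of that cell, so that no dipole arises.
\<close>

definition flip :: "'a edge list \<Rightarrow> 'a list \<Rightarrow> 'a edge list" where
  "flip p v = (case hd p of Base _ _ \<Rightarrow> bots p v
     | New p' u _ \<Rightarrow> if p = bots p' u \<and> map elab p' = v then p' else bots p v)"

lemma length_bots [simp]: "length (bots p v) = length v"
  by (simp add: bots_def)

lemma nth_bots [simp]: "j < length v \<Longrightarrow> bots p v ! j = New p v j"
  by (simp add: bots_def)

lemma set_bots: "set (bots p v) = New p v ` {..<length v}"
  by (auto simp: bots_def)

lemma bots_eq_Nil [simp]: "bots p v = [] \<longleftrightarrow> v = []"
  by (simp add: bots_def)

lemma hd_bots [simp]: "v \<noteq> [] \<Longrightarrow> hd (bots p v) = New p v 0"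
  by (simp add: hd_conv_nth)

lemma last_bots [simp]: "v \<noteq> [] \<Longrightarrow> last (bots p v) = New p v (length v - 1)"
  by (simp add: last_conv_nth)

lemma map_elab_bots [simp]: "map elab (bots p v) = v"
  by (rule nth_equalityI) auto

lemma distinct_bots: "distinct (bots p v)"
  by (auto simp: bots_def distinct_map inj_on_def)

lemma flip_cases:
  obtains "flip p v = bots p v"
  | p' u where "p = bots p' u" "map elab p' = v" "flip p v = p'"
proof (cases "hd p")
  case (Base i a)
  then show ?thesis using that(1) by (simp add: flip_def)
next
  case (New p' u j)
  show ?thesis
  proof (cases "p = bots p' u \<and> map elab p' = v")
    case True
    then show ?thesis using that(2)[of p' u] New by (simp add: flip_def)
  next
    case False
    then have "flip p v = bots p v" using New by (simp only: flip_def edge.case if_False)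
    then show ?thesis by (rule that(1))
  qed
qed

lemma flip_bots: "u \<noteq> [] \<Longrightarrow> flip (bots p u) v = (if map elab p = v then p else bots (bots p u) v)"
  by (simp add: flip_def)

lemma map_elab_flip [simp]: "map elab (flip p v) = v"
  by (cases rule: flip_cases[of p v]) auto

lemma length_flip [simp]: "length (flip p v) = length v"
  by (metis length_map map_elab_flip)

lemma flip_nth_elab: "j < length v \<Longrightarrow> elab (flip p v ! j) = v ! j"
  by (metis length_flip map_elab_flip nth_map)

section \<open>End vertices of edges and a planar coordinate\<close>

lemma size_hd_less [termination_simp]: "p \<noteq> [] \<Longrightarrow> size (hd p) < Suc (size_list size p + n)"
  using size_list_estimation'[of "hd p" p "size (hd p)" size] by fastforce

lemma size_last_less [termination_simp]: "p \<noteq> [] \<Longrightarrow> size (last p) < Suc (size_list size p + n)"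
  using size_list_estimation'[of "last p" p "size (last p)" size] by fastforce

text \<open>The two corners of a cell are not new vertices: they are traced back through the first
  and the last edge of its top. Thus each vertex has one name, and equality of vertices is equality
  of terms.\<close>

fun esrc :: "'a edge \<Rightarrow> 'a vertex" where
  "esrc (Base i a) = VBase i"
| "esrc (New p v j) = (if j = 0 \<and> p \<noteq> [] then esrc (hd p) else VNew p v j)"

fun etgt :: "'a edge \<Rightarrow> 'a vertex" where
  "etgt (Base i a) = VBase (Suc i)"
| "etgt (New p v j) = (if \<not> Suc j < length v \<and> p \<noteq> [] then etgt (last p) else VNew p v (Suc j))"

text \<open>Abscissas of a planar drawing; they show that the edges of a path are distinct.\<close>

fun xleft :: "'a edge \<Rightarrow> real" and xright :: "'a edge \<Rightarrow> real" where
  "xleft (Base i a) = real i"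
| "xleft (New p v j) = (if p = [] then 0 else
     xleft (hd p) + (xright (last p) - xleft (hd p)) * (real j / real (length v)))"
| "xright (Base i a) = real (Suc i)"
| "xright (New p v j) = (if p = [] then 0 else
     xleft (hd p) + (xright (last p) - xleft (hd p)) * (real (Suc j) / real (length v)))"

text \<open>An inner vertex of a bottom path gets the left end of the edge that starts there, so
  that the coordinates of an edge can be read off from its end vertices.\<close>

fun xpos :: "'a vertex \<Rightarrow> real" where
  "xpos (VBase i) = real i"
| "xpos (VNew p v j) = xleft (New p v j)"

fun chain :: "'a vertex \<Rightarrow> 'a edge list \<Rightarrow> 'a vertex \<Rightarrow> bool" where
  "chain a [] b \<longleftrightarrow> a = b"
| "chain a (e # P) b \<longleftrightarrow> esrc e = a \<and> chain (etgt e) P b"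

lemma chain_append [simp]: "chain a (P @ Q) b \<longleftrightarrow> (\<exists>c. chain a P c \<and> chain c Q b)"
  by (induction P arbitrary: a) auto

lemma chain_ends: "chain a P b \<Longrightarrow> P \<noteq> [] \<Longrightarrow> a = esrc (hd P) \<and> b = etgt (last P)"
  by (induction P arbitrary: a) (auto split: if_splits)

lemma chain_last: "chain a P b \<Longrightarrow> P \<noteq> [] \<Longrightarrow> etgt (last P) = b"
  using chain_ends by metis

lemma chain_hd: "chain a P b \<Longrightarrow> P \<noteq> [] \<Longrightarrow> esrc (hd P) = a"
  using chain_ends by metis

lemma chain_nth: "chain a P b \<Longrightarrow> Suc i < length P \<Longrightarrow> etgt (P ! i) = esrc (P ! Suc i)"
proof (induction P arbitrary: a i)
  case (Cons e P)
  have "P \<noteq> []" using Cons.prems(2) by auto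
  then obtain f Q where P: "P = f # Q" by (meson neq_Nil_conv)
  show ?case
  proof (cases i)
    case 0
    then show ?thesis using Cons.prems(1) P by simp
  next
    case (Suc k)
    have "chain (etgt e) P b" "Suc k < length P" using Cons.prems Suc by auto
    then have "etgt (P ! k) = esrc (P ! Suc k)" by (rule Cons.IH)
    then show ?thesis unfolding Suc nth_Cons_Suc .
  qed
qed simp

lemma chain_map:
  "chain a p b \<Longrightarrow> (\<And>e. e \<in> set p \<Longrightarrow> esrc (f e) = F (esrc e) \<and> etgt (f e) = F (etgt e)) \<Longrightarrow>
   chain (F a) (map f p) (F b)"
  by (induction p arbitrary: a) auto

lemma chain_unique_end: "chain a P b \<Longrightarrow> chain a P c \<Longrightarrow> b = c"
  by (induction P arbitrary: a) auto

lemma chain_bots_aux: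
  assumes "p \<noteq> []" "k \<le> length v" "v \<noteq> []"
  shows "chain (esrc (hd p)) (map (New p v) [0..<k])
     (if k = 0 then esrc (hd p) else if k = length v then etgt (last p) else VNew p v k)"
  using assms(2)
proof (induction k)
  case (Suc k)
  then show ?case using assms by (auto split: if_splits)
qed simp

lemma chain_bots:
  assumes "p \<noteq> []" "v \<noteq> []"
  shows "chain (esrc (hd p)) (bots p v) (etgt (last p))"
  using chain_bots_aux[of p "length v" v] assms by (auto simp: bots_def)

text \<open>\<open>R\<close> is the set of relations read in both directions. Irreflexivity is what
  anti-symmetry of the presentation gives for a pair of equal words; it keeps apart the two cells
  that are saved in \<open>simultaneous_flip\<close>.\<close>

locale symmetric_relation =
  fixes R :: "('a list \<times> 'a list) set"
  assumes R_sym: "(u, v) \<in> R \<Longrightarrow> (v, u) \<in> R"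
    and R_ne: "(u, v) \<in> R \<Longrightarrow> u \<noteq> []"
    and R_irr: "(u, u) \<notin> R"
begin

lemma R_ne2: "(u, v) \<in> R \<Longrightarrow> v \<noteq> []"
  using R_ne R_sym by blast

text \<open>The condition on \<open>flip\<close> says that the cell glued at \<open>p\<close> does
  not undo the cell above it. So edges carry only reduced histories, and different terms are
  different edges of the complex.\<close>

inductive ok :: "'a list \<Rightarrow> 'a edge \<Rightarrow> bool" for w where
  ok_Base: "i < length w \<Longrightarrow> ok w (Base i (w ! i))"
| ok_New: "\<forall>e\<in>set p. ok w e \<Longrightarrow> \<exists>a b. chain a p b \<Longrightarrow> (map elab p, v) \<in> R \<Longrightarrow>
     flip p v = bots p v \<Longrightarrow> j < length v \<Longrightarrow> ok w (New p v j)"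

inductive_simps ok_Base_iff: "ok w (Base i a)"
inductive_simps ok_New_iff: "ok w (New p v j)"

definition okl :: "'a list \<Rightarrow> 'a edge list \<Rightarrow> bool" where
  "okl w P \<longleftrightarrow> (\<forall>e\<in>set P. ok w e)"

lemma okl_simps [simp]:
  "okl w []" "okl w (e # P) \<longleftrightarrow> ok w e \<and> okl w P" "okl w (P @ Q) \<longleftrightarrow> okl w P \<and> okl w Q"
  by (auto simp: okl_def)

text \<open>If the flip goes back to the top \<open>p'\<close> of a cell, returning to
  \<open>p\<close> requires that this cell was itself glued as a new one; the well-formedness of the
  edge \<open>New p' u 0\<close> of \<open>p\<close> records exactly that.\<close>

lemma flip_bots_ok:
  assumes "okl w p" "(map elab p, v) \<in> R" "chain a p b"
  shows "okl w (flip p v) \<and> chain a (flip p v) b \<and> flip (flip p v) (map elab p) = p"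
proof -
  have p: "p \<noteq> []" and v: "v \<noteq> []" using assms R_ne R_ne2 by auto
  show ?thesis
  proof (cases rule: flip_cases[of p v])
    case 1
    have "chain a (bots p v) b"
      using chain_bots[OF p v] chain_ends[OF assms(3) p] by simp
    moreover have "okl w (bots p v)"
      using assms 1 by (auto simp: okl_def set_bots ok_New_iff)
    ultimately show ?thesis using 1 v by (simp add: flip_bots)
  next
    case (2 p' u)
    have u: "u \<noteq> []" using p 2 by auto
    have "ok w (New p' u 0)" using assms(1) 2 u by (auto simp: okl_def set_bots)
    then have p': "okl w p'" "\<exists>a b. chain a p' b" "(map elab p', u) \<in> R" "flip p' u = bots p' u"
      by (auto simp: ok_New_iff okl_def)
    have ne: "p' \<noteq> []" using p'(3) R_ne by auto
    obtain a' b' where ab: "chain a' p' b'" using p'(2) by auto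
    have "a' = a \<and> b' = b"
      using chain_ends[OF ab ne] chain_bots[OF ne u] chain_ends[OF assms(3) p] chain_ends[OF chain_bots[OF ne u]] 2 u
      by simp
    then show ?thesis using 2 p' ab u by simp
  qed
qed

lemma flip_ok: "okl w p \<Longrightarrow> (map elab p, v) \<in> R \<Longrightarrow> chain a p b \<Longrightarrow> okl w (flip p v)"
  and flip_chain: "okl w p \<Longrightarrow> (map elab p, v) \<in> R \<Longrightarrow> chain a p b \<Longrightarrow> chain a (flip p v) b"
  and flip_flip: "okl w p \<Longrightarrow> (map elab p, v) \<in> R \<Longrightarrow> chain a p b \<Longrightarrow> flip (flip p v) (map elab p) = p"
  using flip_bots_ok by blast+

text \<open>The bottom of a cell divides the interval over its top into equal parts, and by
  induction this interval has positive length. Since the coordinates depend only on the end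
  vertices, they increase strictly along every path.\<close>

lemma x_ok:
  "ok w e \<Longrightarrow> xleft e < xright e \<and> xleft e = xpos (esrc e) \<and> xright e = xpos (etgt e)"
proof (induction e rule: ok.induct)
  case (ok_New p v j)
  have p: "p \<noteq> []" and v: "v \<noteq> []" using ok_New R_ne R_ne2 by auto
  have *: "chain a q b \<Longrightarrow> q \<noteq> [] \<Longrightarrow> (\<forall>e\<in>set q. xleft e < xright e \<and> xleft e = xpos (esrc e) \<and> xright e = xpos (etgt e))
     \<Longrightarrow> xpos a < xpos b" for a b q
  proof (induction q arbitrary: a)
    case (Cons e q)
    then show ?case by (cases "q = []") force+
  qed simp
  from ok_New obtain a b where ab: "chain a p b" by auto
  have all: "\<forall>e\<in>set p. xleft e < xright e \<and> xleft e = xpos (esrc e) \<and> xright e = xpos (etgt e)"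
    using ok_New(1) by blast
  have "xpos (esrc (hd p)) < xpos (etgt (last p))"
    using *[OF ab p all] chain_ends[OF ab p] by simp
  then have lt: "xleft (hd p) < xright (last p)" using all p by simp
  have A: "xleft (hd p) = xpos (esrc (hd p))" "xright (last p) = xpos (etgt (last p))" using ok_New p by auto
  have "(xright (last p) - xleft (hd p)) * (real j / real (length v)) < (xright (last p) - xleft (hd p)) * (real (Suc j) / real (length v))"
    using lt ok_New v by (intro mult_strict_left_mono divide_strict_right_mono) auto
  moreover have "xright (New p v j) = xpos (etgt (New p v j))"
  proof (cases "Suc j < length v")
    case False
    then have "real (Suc j) / real (length v) = 1" using ok_New v by (simp add: le_antisym not_less)
    then show ?thesis using False p A by simp
  qed (use p in simp)
  ultimately show ?case using p A by auto
qed auto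

lemma chain_x:
  "chain a P b \<Longrightarrow> okl w P \<Longrightarrow> xpos a \<le> xpos b \<and> (\<forall>e\<in>set P. xpos a \<le> xleft e \<and> xright e \<le> xpos b)"
proof (induction P arbitrary: a)
  case (Cons e P)
  then have "xpos (etgt e) \<le> xpos b \<and> (\<forall>f\<in>set P. xpos (etgt e) \<le> xleft f \<and> xright f \<le> xpos b)" by auto
  then show ?case using x_ok[of w e] Cons by force
qed simp

lemma chain_x_less: "chain a P b \<Longrightarrow> okl w P \<Longrightarrow> P \<noteq> [] \<Longrightarrow> xpos a < xpos b"
  by (cases P) (use chain_x x_ok in \<open>force\<close>)+

lemma chain_distinct: "chain a P b \<Longrightarrow> okl w P \<Longrightarrow> distinct P"
proof (induction P arbitrary: a)
  case (Cons e P)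
  then have "\<forall>f\<in>set P. xpos (etgt e) \<le> xleft f" using chain_x by auto
  then have "e \<notin> set P" using x_ok[of w e] Cons by force
  then show ?case using Cons by auto
qed simp

lemma chain_same_src:
  "chain a P b \<Longrightarrow> okl w P \<Longrightarrow> e \<in> set P \<Longrightarrow> f \<in> set P \<Longrightarrow> esrc e = esrc f \<Longrightarrow> e = f"
proof (induction P arbitrary: a)
  case (Cons g P)
  have 1: "\<forall>f\<in>set P. xleft g < xleft f" using Cons chain_x[of "etgt g" P b w] x_ok[of w g] by force
  have "\<forall>e\<in>set (g # P). xleft e = xpos (esrc e)" using Cons x_ok by (auto simp: okl_def)
  then show ?case using 1 Cons by fastforce
qed simp

text \<open>A path runs through its edges from left to right, so there is only one order in which
  they can occur.\<close>

lemma chain_sorted_eq: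
  "chain a P b \<Longrightarrow> chain a Q b \<Longrightarrow> okl w P \<Longrightarrow> okl w Q \<Longrightarrow> set P = set Q \<Longrightarrow> P = Q"
proof (induction P arbitrary: a Q)
  case (Cons e P)
  then obtain f Q' where Q: "Q = f # Q'" by (cases Q) auto
  have "esrc e = esrc f" using Cons Q by auto
  then have ef: "e = f" using chain_same_src[of a "e # P" b w e f] Cons Q by auto
  have "distinct (e # P)" "distinct (f # Q')" using chain_distinct Cons Q by blast+
  then have "set P = set Q'" using Cons(6) ef Q by auto
  then show ?case using Cons Q ef by auto
qed simp

text \<open>The edge of \<open>P\<close> after \<open>e\<close> starts where \<open>e\<close> ends,
  and only one edge of \<open>P\<close> starts there. Hence edges that are consecutive in
  \<open>s\<close> are consecutive in \<open>P\<close>.\<close>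

lemma chain_subsegment:
  "chain a P b \<Longrightarrow> okl w P \<Longrightarrow> chain c s d \<Longrightarrow> set s \<subseteq> set P \<Longrightarrow> s \<noteq> [] \<Longrightarrow> \<exists>X Y. P = X @ s @ Y"
proof (induction s arbitrary: c)
  case (Cons e s)
  show ?case
  proof (cases "s = []")
    case True
    then show ?thesis using Cons split_list[of e P] by auto
  next
    case False
    then obtain X Y where P: "P = X @ s @ Y" using Cons.IH[of "etgt e"] Cons.prems by auto
    have "e \<in> set P" using Cons by auto
    then obtain X' Y' where P': "P = X' @ e # Y'" by (auto dest: split_list)
    obtain f s' where s: "s = f # s'" using False by (cases s) auto
    have et: "etgt e = esrc f" using Cons s by auto
    have "Y' \<noteq> []"
    proof
      assume Y: "Y' = []"
      then have "b = etgt e" using P' Cons by auto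
      moreover have "f \<in> set P" using s P by auto
      moreover have "xright f \<le> xpos b" "ok w f" using chain_x[OF Cons(2,3)] \<open>f \<in> set P\<close> Cons(3) by (auto simp: okl_def)
      ultimately show False using et x_ok[of w f] by auto
    qed
    then obtain g Y'' where Y': "Y' = g # Y''" by (cases Y') auto
    have fP: "f \<in> set P" using P s by auto
    have "esrc g = etgt e" using P' Y' Cons by auto
    then have gf: "g = f" using et chain_same_src[OF Cons(2,3), of g f] P' Y' fP by auto
    have d: "distinct P" using chain_distinct Cons by blast
    have "P = (X' @ [e]) @ f # Y''" "P = X @ f # (s' @ Y)" using P P' Y' gf s by auto
    then have "X' @ [e] = X \<and> Y'' = s' @ Y"
      using d append_Cons_eq_iff[of f "X' @ [e]" Y'' X "s' @ Y"] by auto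
    then have "P = X' @ (e # s) @ Y" using P' Y' gf s by auto
    then show ?thesis by blast
  qed
qed simp

end

section \<open>Maps between universal complexes\<close>

declare map_map [simp del]

definition sbase :: "nat \<Rightarrow> 'a list \<Rightarrow> 'a edge list" where
  "sbase n w = map (\<lambda>i. Base (n + i) (w ! i)) [0..<length w]"

abbreviation base :: "'a list \<Rightarrow> 'a edge list" where
  "base \<equiv> sbase 0"

lemma length_sbase [simp]: "length (sbase n w) = length w"
  by (simp add: sbase_def)

lemma nth_sbase [simp]: "i < length w \<Longrightarrow> sbase n w ! i = Base (n + i) (w ! i)"
  by (simp add: sbase_def)

lemma sbase_eq_Nil [simp]: "sbase n w = [] \<longleftrightarrow> w = []"
  by (simp add: sbase_def)

lemma map_elab_sbase [simp]: "map elab (sbase n w) = w"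
  by (rule nth_equalityI) auto

lemma sbase_append: "sbase n (u @ v) = sbase n u @ sbase (n + length u) v"
  by (rule nth_equalityI) (auto simp: nth_append)

lemma sbase_Cons: "sbase n (a # v) = Base n a # sbase (Suc n) v"
  using sbase_append[of n "[a]" v] by (simp add: sbase_def)

lemma chain_sbase [simp]: "chain (VBase n) (sbase n w) b \<longleftrightarrow> b = VBase (n + length w)"
  by (induction w arbitrary: n) (auto simp: sbase_Cons, simp_all add: sbase_def)

lemma in_set_sbase: "e \<in> set (sbase n w) \<longleftrightarrow> (\<exists>i<length w. e = Base (n + i) (w ! i))"
  by (auto simp: sbase_def)

text \<open>
  If \<open>S\<close> is a path labelled \<open>w\<close> in the complex over \<open>w0\<close>, then \<open>act S\<close> maps the complex over \<open>w\<close> to the one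
  over \<open>w0\<close>, taking the base path to \<open>S\<close>.
\<close>

fun act :: "'a edge list \<Rightarrow> 'a edge \<Rightarrow> 'a edge" where
  "act S (Base i a) = S ! i"
| "act S (New p v j) = flip (map (act S) p) v ! j"

text \<open>A flip may return to an old path, so the image of a new vertex is read off from the
  flipped path and need not be a new vertex. No base edge starts at the final vertex, hence the
  second case for \<open>VBase\<close>.\<close>

fun actv :: "'a edge list \<Rightarrow> 'a vertex \<Rightarrow> 'a vertex" where
  "actv S (VBase i) = (if i < length S then esrc (S ! i) else etgt (last S))"
| "actv S (VNew p v j) = esrc (flip (map (act S) p) v ! j)"

context symmetric_relation
begin

lemma okl_sbase: "okl (w @ v @ u) (sbase (length w) v)"
  by (auto simp: okl_def in_set_sbase ok_Base_iff nth_append)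

lemma okl_base [simp]: "okl w (base w)"
  using okl_sbase[of "[]" w "[]"] by simp

definition lpath :: "'a list \<Rightarrow> 'a list \<Rightarrow> 'a edge list \<Rightarrow> bool" where
  "lpath w0 w S \<longleftrightarrow> okl w0 S \<and> (\<exists>a b. chain a S b) \<and> map elab S = w \<and> S \<noteq> []"

text \<open>The four facts need a common induction: the image of \<open>p\<close> can be flipped
  only if it is known to be a well-formed path with the label of \<open>p\<close>.\<close>

lemma act_ok_aux:
  assumes "lpath w0 w S" "ok w e"
  shows "ok w0 (act S e) \<and> elab (act S e) = elab e \<and> esrc (act S e) = actv S (esrc e) \<and>
     etgt (act S e) = actv S (etgt e)"
  using assms(2)
proof (induction e rule: ok.induct)
  case (ok_Base i)
  have l: "length S = length w" and "map elab S = w" using assms(1) by (auto simp: lpath_def)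
  then have "elab (S ! i) = w ! i" using ok_Base by (metis nth_map)
  moreover have "etgt (S ! i) = actv S (VBase (Suc i))"
  proof (cases "Suc i < length S")
    case True
    obtain a b where "chain a S b" using assms(1) unfolding lpath_def by blast
    from chain_nth[OF this True] True show ?thesis by simp
  next
    case False
    then have "i = length S - 1" using ok_Base l by simp
    then show ?thesis using False by (simp add: last_conv_nth assms(1)[unfolded lpath_def])
  qed
  moreover have "ok w0 (S ! i)" using assms(1) ok_Base l by (auto simp: lpath_def okl_def)
  ultimately show ?case using ok_Base l by simp
next
  case (ok_New p v j)
  have p: "p \<noteq> []" and v: "v \<noteq> []" using ok_New R_ne R_ne2 by auto
  let ?q = "map (act S) p"
  from ok_New obtain a b where ab: "chain a p b" by blast
  have ch: "chain (actv S a) ?q (actv S b)" using chain_map[OF ab, of "act S" "actv S"] ok_New(1) by blast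
  have okq: "okl w0 ?q" using ok_New(1) by (auto simp: okl_def)
  have lab: "map elab ?q = map elab p" using ok_New(1) by (auto simp: map_map)
  have R: "(map elab ?q, v) \<in> R" using ok_New lab by simp
  note F = flip_ok[OF okq R ch] flip_chain[OF okq R ch]
  have len: "length (flip ?q v) = length v" by simp
  have 1: "ok w0 (act S (New p v j))" using F(1) ok_New(5) by (auto simp: okl_def)
  have 2: "elab (act S (New p v j)) = v ! j" using ok_New(5) by (simp add: flip_nth_elab)
  have e: "actv S a = esrc (hd (flip ?q v)) \<and> actv S b = etgt (last (flip ?q v))"
    using chain_ends[OF F(2)] v len by (metis length_0_conv)
  have ab': "a = esrc (hd p)" "b = etgt (last p)" using chain_ends[OF ab p] by auto
  have fne: "flip ?q v \<noteq> []" using v len by (metis length_0_conv)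
  have 3: "esrc (act S (New p v j)) = actv S (esrc (New p v j))"
    using e ab' p fne by (cases "j = 0") (auto simp: hd_conv_nth)
  have 4: "etgt (act S (New p v j)) = actv S (etgt (New p v j))"
  proof (cases "Suc j < length v")
    case True
    then show ?thesis using chain_nth[OF F(2), of j] by simp
  next
    case False
    then have "j = length v - 1" using ok_New by simp
    then show ?thesis using False p e ab' fne by (simp add: last_conv_nth)
  qed
  show ?case using 1 2 3 4 by simp
qed

lemma act_ok: "lpath w0 w S \<Longrightarrow> ok w e \<Longrightarrow> ok w0 (act S e)"
  and act_elab: "lpath w0 w S \<Longrightarrow> ok w e \<Longrightarrow> elab (act S e) = elab e"
  and act_esrc: "lpath w0 w S \<Longrightarrow> ok w e \<Longrightarrow> esrc (act S e) = actv S (esrc e)"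
  and act_etgt: "lpath w0 w S \<Longrightarrow> ok w e \<Longrightarrow> etgt (act S e) = actv S (etgt e)"
  using act_ok_aux by blast+

lemma map_act_elab: "lpath w0 w S \<Longrightarrow> okl w P \<Longrightarrow> map elab (map (act S) P) = map elab P"
  using act_elab by (fastforce simp: okl_def map_map)

lemma map_act_okl: "lpath w0 w S \<Longrightarrow> okl w P \<Longrightarrow> okl w0 (map (act S) P)"
  using act_ok by (auto simp: okl_def)

lemma map_act_chain: "lpath w0 w S \<Longrightarrow> okl w P \<Longrightarrow> chain a P b \<Longrightarrow> chain (actv S a) (map (act S) P) (actv S b)"
  using chain_map[of a P b "act S" "actv S"] act_esrc act_etgt by (auto simp: okl_def)

text \<open>For a flip that glues a new cell this is the definition of \<open>act\<close>. A flip
  that goes back undoes such a flip, so there the image of \<open>p\<close> is itself a flip, and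
  flipping is an involution.\<close>

lemma act_flip:
  assumes "lpath w0 w S" "okl w p" "(map elab p, v) \<in> R" "chain a p b"
  shows "map (act S) (flip p v) = flip (map (act S) p) v"
proof (cases rule: flip_cases[of p v])
  case 1
  then show ?thesis by (auto intro!: nth_equalityI)
next
  case (2 p' u)
  have ne: "p \<noteq> []" using assms R_ne by auto
  then have u: "u \<noteq> []" using 2 by auto
  have "ok w (New p' u 0)" using assms(2) 2 u by (auto simp: okl_def set_bots)
  then have p': "okl w p'" "\<exists>a b. chain a p' b" "(map elab p', u) \<in> R"
    by (auto simp: ok_New_iff okl_def)
  then obtain a' b' where ab: "chain a' p' b'" by blast
  let ?q = "map (act S) p'"
  have R: "(map elab ?q, u) \<in> R" using map_act_elab[OF assms(1) p'(1)] p' by simp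
  have "map (act S) p = flip ?q u" using 2(1) by (auto intro!: nth_equalityI)
  moreover have "flip (flip ?q u) (map elab ?q) = ?q"
    using flip_flip[OF map_act_okl[OF assms(1) p'(1)] R map_act_chain[OF assms(1) p'(1) ab]] .
  ultimately show ?thesis using 2 map_act_elab[OF assms(1) p'(1)] by simp
qed

lemma act_base: "map (act S) (base w) = S" if "length S = length w"
  by (rule nth_equalityI) (use that in auto)

lemma act_base_id: "ok w e \<Longrightarrow> act (base w) e = e"
proof (induction e rule: ok.induct)
  case (ok_New p v j)
  have "map (act (base w)) p = p" using ok_New(1) by (auto intro: map_idI)
  then show ?case using ok_New by simp
qed auto

lemma map_act_base_id: "okl w P \<Longrightarrow> map (act (base w)) P = P"
  using act_base_id by (auto simp: okl_def intro: map_idI)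

lemma act_act:
  assumes S: "lpath w0 w1 S" and T: "lpath w1 w T" and "ok w e"
  shows "act S (act T e) = act (map (act S) T) e"
  using assms(3)
proof (induction e rule: ok.induct)
  case (ok_Base i)
  then show ?case using T by (auto simp: lpath_def)
next
  case (ok_New p v j)
  let ?q = "map (act T) p"
  have okp: "okl w p" using ok_New(1) by (auto simp: okl_def)
  obtain a b where "chain a p b" using ok_New by blast
  then have ch: "chain (actv T a) ?q (actv T b)" using map_act_chain[OF T okp] by blast
  have R: "(map elab ?q, v) \<in> R" using map_act_elab[OF T okp] ok_New by simp
  have "map (act S) (flip ?q v) = flip (map (act S) ?q) v"
    using act_flip[OF S map_act_okl[OF T okp] R ch] .
  moreover have "map (act S) ?q = map (act (map (act S) T)) p" using ok_New(1) by (auto simp: map_map)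
  ultimately have "map (act S) (flip ?q v) ! j = flip (map (act (map (act S) T)) p) v ! j" by simp
  then show ?case using ok_New(5) by simp
qed

lemma map_act_act:
  "lpath w0 w1 S \<Longrightarrow> lpath w1 w T \<Longrightarrow> okl w P \<Longrightarrow> map (act S) (map (act T) P) = map (act (map (act S) T)) P"
  using act_act by (fastforce simp: okl_def map_map)

lemma lpath_base: "w \<noteq> [] \<Longrightarrow> lpath w w (base w)"
proof -
  assume "w \<noteq> []"
  then show ?thesis unfolding lpath_def
    by (intro conjI exI[of _ "VBase 0"] exI[of _ "VBase (0 + length w)"]) auto
qed

text \<open>An edge over \<open>w\<close> refers only to the first \<open>length w\<close> positions
  of a path, so a summand on the right does not affect its image.\<close>

lemma act_append: "lpath w0 w S \<Longrightarrow> ok w e \<Longrightarrow> act (S @ S') e = act S e"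
proof -
  assume S: "lpath w0 w S"
  have l: "length S = length w" using S by (auto simp: lpath_def)
  assume "ok w e"
  then show ?thesis
  proof (induction e rule: ok.induct)
    case (ok_New p v j)
    have "map (act (S @ S')) p = map (act S) p" using ok_New(1) by auto
    then show ?case by (simp only: act.simps)
  qed (use l in \<open>auto simp: nth_append\<close>)
qed

section \<open>Moves across a single cell\<close>

definition flip1 :: "'a edge list \<Rightarrow> 'a edge list \<Rightarrow> bool" where
  "flip1 P Q \<longleftrightarrow> (\<exists>X p Y v. (map elab p, v) \<in> R \<and> P = X @ p @ Y \<and> Q = X @ flip p v @ Y)"

definition okpath :: "'a list \<Rightarrow> 'a vertex \<Rightarrow> 'a edge list \<Rightarrow> 'a vertex \<Rightarrow> bool" where
  "okpath w a P b \<longleftrightarrow> okl w P \<and> chain a P b"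

lemma okpath_append: "okpath w a (P @ Q) b \<longleftrightarrow> (\<exists>c. okpath w a P c \<and> okpath w c Q b)"
  by (auto simp: okpath_def)

lemma flip1_okpath: "flip1 P Q \<Longrightarrow> okpath w a P b \<Longrightarrow> okpath w a Q b \<and> flip1 Q P"
proof -
  assume "flip1 P Q" "okpath w a P b"
  then obtain X p Y v where *: "(map elab p, v) \<in> R" "P = X @ p @ Y" "Q = X @ flip p v @ Y"
    unfolding flip1_def by blast
  then obtain c d where cd: "okpath w a X c" "okpath w c p d" "okpath w d Y b"
    using \<open>okpath w a P b\<close> by (auto simp: okpath_append)
  then have "okpath w c (flip p v) d" "flip (flip p v) (map elab p) = p"
    using flip_ok flip_chain flip_flip * by (auto simp: okpath_def)
  moreover have "(map elab (flip p v), map elab p) \<in> R" using R_sym * by simp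
  ultimately have "flip1 Q P" unfolding flip1_def *
    by (intro exI[of _ X] exI[of _ "flip p v"] exI[of _ Y] exI[of _ "map elab p"]) simp
  moreover have "okpath w a Q b" using cd * \<open>okpath w c (flip p v) d\<close> by (auto simp: okpath_append)
  ultimately show ?thesis by simp
qed

lemma flip1_act:
  assumes "lpath w0 w S" "okpath w a P b" "flip1 P Q"
  shows "flip1 (map (act S) P) (map (act S) Q)"
proof -
  obtain X p Y v where *: "(map elab p, v) \<in> R" "P = X @ p @ Y" "Q = X @ flip p v @ Y"
    using assms unfolding flip1_def by blast
  then obtain c d where cd: "okpath w a X c" "okpath w c p d" "okpath w d Y b"
    using \<open>okpath w a P b\<close> by (auto simp: okpath_append)
  have "map (act S) (flip p v) = flip (map (act S) p) v"
    using act_flip[OF assms(1)] cd * by (auto simp: okpath_def)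
  moreover have "(map elab (map (act S) p), v) \<in> R" using map_act_elab[OF assms(1)] cd * by (auto simp: okpath_def)
  ultimately show ?thesis unfolding flip1_def *
    by (intro exI[of _ "map (act S) X"] exI[of _ "map (act S) p"] exI[of _ "map (act S) Y"] exI[of _ v]) simp
qed

lemma flipn_okpath: "(flip1 ^^ n) P Q \<Longrightarrow> okpath w a P b \<Longrightarrow> okpath w a Q b \<and> (flip1 ^^ n) Q P"
proof (induction n arbitrary: Q)
  case (Suc n)
  then obtain Q' where "(flip1 ^^ n) P Q'" "flip1 Q' Q" by auto
  then show ?case using Suc flip1_okpath by (metis relpowp_Suc_I2)
qed simp

lemma flipn_act: "lpath w0 w S \<Longrightarrow> okpath w a P b \<Longrightarrow> (flip1 ^^ n) P Q \<Longrightarrow> (flip1 ^^ n) (map (act S) P) (map (act S) Q)"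
proof (induction n arbitrary: Q)
  case (Suc n)
  then obtain Q' where "(flip1 ^^ n) P Q'" "flip1 Q' Q" by auto
  then show ?case using Suc flip1_act flipn_okpath by (metis relpowp_Suc_I)
qed simp

lemma flip1_context: "flip1 P Q \<Longrightarrow> flip1 (X @ P @ Y) (X @ Q @ Y)"
proof -
  assume "flip1 P Q"
  then obtain X' p Y' v where *: "(map elab p, v) \<in> R" "P = X' @ p @ Y'" "Q = X' @ flip p v @ Y'"
    unfolding flip1_def by blast
  then show ?thesis unfolding flip1_def
    by (intro exI[of _ "X @ X'"] exI[of _ p] exI[of _ "Y' @ Y"] exI[of _ v]) simp
qed

lemma flipn_context: "(flip1 ^^ n) P Q \<Longrightarrow> (flip1 ^^ n) (X @ P @ Y) (X @ Q @ Y)"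
proof (induction n arbitrary: Q)
  case (Suc n)
  then obtain Q' where "(flip1 ^^ n) P Q'" "flip1 Q' Q" by auto
  then show ?case using Suc flip1_context by (metis relpowp_Suc_I)
qed simp

lemma flipn_append:
  assumes "(flip1 ^^ n) P Q" "(flip1 ^^ m) P' Q'"
  shows "(flip1 ^^ (n + m)) (P @ P') (Q @ Q')"
proof -
  have "(flip1 ^^ n) (P @ P') (Q @ P')" using flipn_context[OF assms(1), of "[]" P'] by simp
  moreover have "(flip1 ^^ m) (Q @ P') (Q @ Q')" using flipn_context[OF assms(2), of Q "[]"] by simp
  ultimately show ?thesis by (meson relpowp_trans)
qed

text \<open>Labels are kept, so whatever can be flipped in the image can be flipped in
  \<open>P\<close>. Together with \<open>flip1_act\<close>, moves from a path correspond to moves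
  from its image; inverses and the isometry of the action rest on this.\<close>

lemma flip1_lift:
  assumes "lpath w0 w S" "okpath w a P b" "flip1 (map (act S) P) Q"
  shows "\<exists>Q'. flip1 P Q' \<and> Q = map (act S) Q'"
proof -
  obtain X p Y v where *: "(map elab p, v) \<in> R" "map (act S) P = X @ p @ Y" "Q = X @ flip p v @ Y"
    using assms(3) unfolding flip1_def by blast
  then obtain X' Z where Z: "P = X' @ Z" "X = map (act S) X'" "map (act S) Z = p @ Y"
    using map_eq_append_conv[of "act S" P X "p @ Y"] by metis
  then obtain p' Y' where "Z = p' @ Y'" "p = map (act S) p'" "Y = map (act S) Y'"
    unfolding map_eq_append_conv by blast
  with Z have P: "P = X' @ p' @ Y'" "X = map (act S) X'" "p = map (act S) p'" "Y = map (act S) Y'" by auto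
  then obtain c d where cd: "okpath w a X' c" "okpath w c p' d" "okpath w d Y' b"
    using \<open>okpath w a P b\<close> by (auto simp: okpath_append)
  have R: "(map elab p', v) \<in> R" using map_act_elab[OF assms(1), of p'] cd * P by (auto simp: okpath_def)
  moreover have "map (act S) (flip p' v) = flip p v"
    using act_flip[OF assms(1) _ R] cd P by (auto simp: okpath_def)
  ultimately have "flip1 P (X' @ flip p' v @ Y')" "Q = map (act S) (X' @ flip p' v @ Y')"
    using P * unfolding flip1_def by auto
  then show ?thesis by blast
qed

lemma flipn_lift:
  "lpath w0 w S \<Longrightarrow> okpath w a P b \<Longrightarrow> (flip1 ^^ n) (map (act S) P) Q \<Longrightarrow> \<exists>Q'. (flip1 ^^ n) P Q' \<and> Q = map (act S) Q'"
proof (induction n arbitrary: Q)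
  case (Suc n)
  then obtain Q1 where "(flip1 ^^ n) (map (act S) P) Q1" "flip1 Q1 Q" by auto
  then obtain Q2 where Q2: "(flip1 ^^ n) P Q2" "Q1 = map (act S) Q2" using Suc by blast
  then have "okpath w a Q2 b" using flipn_okpath Suc by blast
  then show ?case using flip1_lift[OF Suc(2)] Q2 \<open>flip1 Q1 Q\<close> by (metis relpowp_Suc_I)
qed simp

end

section \<open>Reachable paths and their distance\<close>

lemma segments_disjoint:
  assumes "X @ A @ Y = X' @ B @ Y'" "A \<noteq> []" "B \<noteq> []" "set A \<inter> set B = {}"
  obtains Z where "X' = X @ A @ Z" "Y = Z @ B @ Y'" | Z where "X = X' @ B @ Z" "Y' = Z @ A @ Y"
proof -
  consider (a) Z where "X' = X @ Z" "A @ Y = Z @ B @ Y'" | (b) Z where "X = X' @ Z" "B @ Y' = Z @ A @ Y"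
    using assms(1) unfolding append_eq_append_conv2[of X "A @ Y"] by metis
  then show ?thesis
  proof cases
    case a
    obtain U where "A = Z @ U \<and> U @ Y = B @ Y' \<or> A @ U = Z \<and> Y = U @ B @ Y'"
      using a(2) unfolding append_eq_append_conv2[of A Y] by metis
    then show ?thesis
    proof
      assume U: "A = Z @ U \<and> U @ Y = B @ Y'"
      have "U = []"
      proof (rule ccontr)
        assume "U \<noteq> []"
        then have "hd U = hd B" using U assms(3) by (metis hd_append2)
        then show False using U \<open>U \<noteq> []\<close> assms(3,4) by (metis Int_iff Un_iff emptyE hd_in_set set_append)
      qed
      then show ?thesis using that(1)[of "[]"] U a by auto
    next
      assume "A @ U = Z \<and> Y = U @ B @ Y'"
      then show ?thesis using that(1)[of U] a by auto
    qed
  next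
    case b
    obtain U where "B = Z @ U \<and> U @ Y' = A @ Y \<or> B @ U = Z \<and> Y' = U @ A @ Y"
      using b(2) unfolding append_eq_append_conv2[of B Y'] by metis
    then show ?thesis
    proof
      assume U: "B = Z @ U \<and> U @ Y' = A @ Y"
      have "U = []"
      proof (rule ccontr)
        assume "U \<noteq> []"
        then have "hd U = hd A" using U assms(2) by (metis hd_append2)
        then show False using U \<open>U \<noteq> []\<close> assms(2,4) by (metis Int_iff Un_iff emptyE hd_in_set set_append)
      qed
      then show ?thesis using that(2)[of "[]"] U b by auto
    next
      assume "B @ U = Z \<and> Y' = U @ A @ Y"
      then show ?thesis using that(2)[of U] b by auto
    qed
  qed
qed

lemma distinct_segment_eq:
  assumes "X @ s @ Y = X' @ s @ Y'" "distinct (X @ s @ Y)" "s \<noteq> []"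
  shows "X = X' \<and> Y = Y'"
proof -
  obtain e s' where s: "s = e # s'" using assms(3) by (cases s) auto
  have "e \<notin> set X" "e \<notin> set Y" using assms(2) s by auto
  moreover have "distinct (X' @ s @ Y')" using assms by simp
  ultimately show ?thesis using append_Cons_eq_iff[of e X "s' @ Y" X' "s' @ Y'"] assms s by auto
qed

text \<open>The third case, a cut in the interior of \<open>p\<close>, is the one that
  \<open>config_up\<close> has to exclude.\<close>

lemma segment_split:
  assumes "P1 @ P2 = X @ p @ Y"
  obtains Z where "P1 = X @ p @ Z" "Y = Z @ P2" | Z where "P2 = Z @ p @ Y" "X = P1 @ Z"
    | a b where "p = a @ b" "a \<noteq> []" "b \<noteq> []" "P1 = X @ a" "P2 = b @ Y"
proof -
  consider (a) Z where "X = P1 @ Z" "P2 = Z @ p @ Y" | (b) Z where "P1 = X @ Z" "p @ Y = Z @ P2"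
    using assms unfolding append_eq_append_conv2[of P1 P2] by metis
  then show ?thesis
  proof cases
    case b
    obtain U where U: "p = Z @ U \<and> U @ Y = P2 \<or> p @ U = Z \<and> Y = U @ P2"
      using b(2) unfolding append_eq_append_conv2[of p Y] by metis
    consider "p @ U = Z \<and> Y = U @ P2" | "p = Z @ U" "U @ Y = P2" "Z = []"
      | "p = Z @ U" "U @ Y = P2" "U = []" | "p = Z @ U" "U @ Y = P2" "U \<noteq> []" "Z \<noteq> []"
      using U by blast
    then show ?thesis
    proof cases
      case 1
      then show ?thesis using that(1)[of U] b by simp
    next
      case 2
      then show ?thesis using that(2)[of "[]"] b by simp
    next
      case 3
      then show ?thesis using that(1)[of "[]"] b by simp
    next
      case 4
      then show ?thesis using that(3)[of Z U] b by simp
    qed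
  qed (use that(2) in blast)
qed

text \<open>The pair \<open>(p, v)\<close> stands for the cell glued below \<open>p\<close> with bottom label \<open>v\<close>.\<close>

fun ecells :: "'a edge \<Rightarrow> ('a edge list \<times> 'a list) set" where
  "ecells (Base i a) = {}"
| "ecells (New p v j) = insert (p, v) (\<Union> (ecells ` set p))"

definition lcells :: "'a edge list \<Rightarrow> ('a edge list \<times> 'a list) set" where
  "lcells P = \<Union> (ecells ` set P)"

fun vcells :: "'a vertex \<Rightarrow> ('a edge list \<times> 'a list) set" where
  "vcells (VBase i) = {}"
| "vcells (VNew p v j) = insert (p, v) (lcells p)"

lemma lcells_simps [simp]:
  "lcells [] = {}" "lcells (e # P) = ecells e \<union> lcells P" "lcells (P @ Q) = lcells P \<union> lcells Q"
  by (auto simp: lcells_def)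

lemma ecells_New: "ecells (New p v j) = insert (p, v) (lcells p)"
  by (simp add: lcells_def)

declare ecells.simps(2) [simp del]
declare ecells_New [simp]

lemma lcells_bots: "v \<noteq> [] \<Longrightarrow> lcells (bots p v) = insert (p, v) (lcells p)"
  by (auto simp: lcells_def set_bots)

text \<open>A history consists of smaller terms. Taking cells by increasing size therefore never
  takes a cell before those above it.\<close>

lemma ecells_size: "c \<in> ecells e \<Longrightarrow> size_list size (fst c) < size e"
proof (induction e)
  case (New p v j)
  have *: "e \<in> set p \<Longrightarrow> size e \<le> size_list size p" for e
    by (simp add: size_list_estimation')
  from New show ?case using * by (fastforce simp: lcells_def)
qed simp

lemma lcells_size: "c \<in> lcells p \<Longrightarrow> size_list size (fst c) < size_list size p"
proof -
  assume "c \<in> lcells p"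
  then obtain e where "e \<in> set p" "c \<in> ecells e" by (auto simp: lcells_def)
  then show ?thesis using ecells_size[of c e] size_list_estimation'[of e p "size e" size] by simp
qed

lemma not_in_lcells: "(p, v) \<notin> lcells p"
  using lcells_size by fastforce

lemma ecells_down_closed: "(p, v) \<in> ecells e \<Longrightarrow> lcells p \<subseteq> ecells e"
proof (induction e)
  case (New q u j)
  then show ?case by (fastforce simp: lcells_def)
qed simp

lemma lcells_down_closed: "(p, v) \<in> lcells P \<Longrightarrow> lcells p \<subseteq> lcells P"
  using ecells_down_closed by (fastforce simp: lcells_def)

lemma finite_ecells: "finite (ecells e)"
  by (induction e) (auto simp: lcells_def)

lemma finite_lcells: "finite (lcells P)"
  by (simp add: lcells_def finite_ecells)

lemma vcells_down_closed: "(p, v) \<in> vcells z \<Longrightarrow> lcells p \<subseteq> vcells z"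
  using lcells_down_closed by (cases z) auto

definition inner :: "'a edge list \<Rightarrow> 'a vertex set" where
  "inner p = etgt ` set (butlast p)"

text \<open>No edge of a path ends at its initial vertex, which is therefore added
  separately.\<close>

definition vset :: "'a edge list \<Rightarrow> 'a vertex set" where
  "vset P = insert (VBase 0) (etgt ` set P)"

lemma etgt_bots_image:
  assumes "p \<noteq> []" "v \<noteq> []"
  shows "etgt ` set (bots p v) = {VNew p v j | j. 0 < j \<and> j < length v} \<union> {etgt (last p)}"
proof -
  obtain n where n: "length v = Suc n" using assms(2) by (cases v) auto
  have "etgt ` set (bots p v) = (\<lambda>j. etgt (New p v j)) ` {..<Suc n}"
    unfolding set_bots n image_image ..
  also have "\<dots> = (\<lambda>j. VNew p v (Suc j)) ` {..<n} \<union> {etgt (last p)}"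
    using assms n by (auto simp: image_iff lessThan_Suc)
  also have "(\<lambda>j. VNew p v (Suc j)) ` {..<n} = {VNew p v j | j. 0 < j \<and> j < length v}"
    by (auto simp: n image_iff) (metis Suc_less_eq Suc_pred lessThan_iff)
  finally show ?thesis .
qed

lemma chain_split_vertex:
  assumes "chain (VBase 0) P b" "z \<in> vset P"
  shows "\<exists>P1 P2. P = P1 @ P2 \<and> chain (VBase 0) P1 z \<and> chain z P2 b"
proof (cases "z = VBase 0")
  case True
  then show ?thesis using assms by (intro exI[of _ "[]"] exI[of _ P]) auto
next
  case False
  then obtain e where e: "e \<in> set P" "z = etgt e" using assms by (auto simp: vset_def)
  then obtain P1 P2 where P: "P = P1 @ e # P2" by (auto dest: split_list)
  have "chain (VBase 0) (P1 @ [e]) z" "chain z P2 b" using assms(1) e P by auto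
  then show ?thesis using P by (intro exI[of _ "P1 @ [e]"] exI[of _ P2]) auto
qed

lemma chain_vertex_in: "chain (VBase 0) (P1 @ P2) b \<Longrightarrow> chain (VBase 0) P1 z \<Longrightarrow> z \<in> vset (P1 @ P2)"
  using chain_ends[of "VBase 0" P1 z] by (cases "P1 = []") (auto simp: vset_def)

context symmetric_relation
begin

text \<open>The right corner of a cell is also the end of the last edge of its top, hence no younger
  than that edge.\<close>

lemma etgt_cells: "ok w e \<Longrightarrow> vcells (etgt e) \<subseteq> ecells e"
proof (induction e rule: ok.induct)
  case (ok_New p v j)
  have "p \<noteq> []" using ok_New R_ne by auto
  then have "vcells (etgt (last p)) \<subseteq> ecells (last p)" "last p \<in> set p" using ok_New(1) by auto
  then have "vcells (etgt (last p)) \<subseteq> lcells p" by (auto simp: lcells_def)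
  then show ?case by auto
qed auto

lemma chain_same_tgt:
  "chain a P b \<Longrightarrow> okl w P \<Longrightarrow> e \<in> set P \<Longrightarrow> f \<in> set P \<Longrightarrow> etgt e = etgt f \<Longrightarrow> e = f"
proof (induction P arbitrary: a)
  case (Cons g P)
  have 1: "\<forall>f\<in>set P. xpos (etgt g) < xpos (etgt f)"
    using Cons chain_x[of "etgt g" P b w] x_ok by (force simp: okl_def)
  then show ?case using Cons by force
qed simp

lemma chain_split_unique:
  assumes "P1 @ P2 = Q1 @ Q2" "chain a P1 z" "chain a Q1 z" "okl w (P1 @ P2)"
  shows "P1 = Q1 \<and> P2 = Q2"
proof -
  have *: "U = []" if A: "chain a (A @ U) z" "chain a A z" "okl w (A @ U)" for A U
  proof (rule ccontr)
    assume "U \<noteq> []"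
    obtain c where "chain a A c" "chain c U z" using A(1) by auto
    moreover have "c = z" using chain_unique_end A(2) calculation by blast
    ultimately show False using chain_x_less[of z U z w] A \<open>U \<noteq> []\<close> by auto
  qed
  obtain U where "P1 = Q1 @ U \<and> U @ P2 = Q2 \<or> P1 @ U = Q1 \<and> P2 = U @ Q2"
    using assms(1) unfolding append_eq_append_conv2 by metis
  then show ?thesis
  proof
    assume U: "P1 = Q1 @ U \<and> U @ P2 = Q2"
    then have "U = []" using *[of Q1 U] assms by auto
    then show ?thesis using U by simp
  next
    assume U: "P1 @ U = Q1 \<and> P2 = U @ Q2"
    then have "U = []" using *[of P1 U] assms by auto
    then show ?thesis using U by simp
  qed
qed

text \<open>Only new cells are attached here; that undoing cells leads to nothing else is the lemma \<open>flip1_config\<close>.\<close>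

inductive config :: "'a list \<Rightarrow> 'a edge list \<Rightarrow> ('a edge list \<times> 'a list) set \<Rightarrow> bool" for w where
  config_base: "config w (base w) {}"
| config_step: "config w (X @ p @ Y) C \<Longrightarrow> (map elab p, v) \<in> R \<Longrightarrow> flip p v = bots p v \<Longrightarrow>
    config w (X @ bots p v @ Y) (insert (p, v) C)"

definition cellok :: "'a list \<Rightarrow> 'a edge list \<times> 'a list \<Rightarrow> bool" where
  "cellok w c \<longleftrightarrow> okl w (fst c) \<and> fst c \<noteq> [] \<and> snd c \<noteq> [] \<and> (\<exists>a b. chain a (fst c) b) \<and>
     (map elab (fst c), snd c) \<in> R \<and> flip (fst c) (snd c) = bots (fst c) (snd c)"

lemma config_okpath: "config w P C \<Longrightarrow> okpath w (VBase 0) P (VBase (length w))"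
proof (induction rule: config.induct)
  case config_base
  then show ?case by (simp add: okpath_def)
next
  case (config_step X p Y C v)
  then have "flip1 (X @ p @ Y) (X @ bots p v @ Y)" unfolding flip1_def by metis
  then show ?case using flip1_okpath config_step by blast
qed

lemma config_inv:
  "config w P C \<Longrightarrow> C = lcells P \<and> (\<forall>c\<in>C. cellok w c) \<and>
     set P = (set (base w) \<union> (\<Union>(p, v)\<in>C. set (bots p v))) - (\<Union>(p, v)\<in>C. set p) \<and>
     (\<forall>(p, v)\<in>C. \<forall>(p', v')\<in>C. set p \<inter> set p' \<noteq> {} \<longrightarrow> p = p' \<and> v = v') \<and>
     vset P = (VBase ` {..length w} \<union> {VNew p v j | p v j. (p, v) \<in> C \<and> 0 < j \<and> j < length v})
        - (\<Union>(p, v)\<in>C. inner p)"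
proof (induction rule: config.induct)
  case config_base
  have "vset (base w) = VBase ` {..length w}"
    by (auto simp: vset_def in_set_sbase image_iff)
      (metis Suc_pred add.commute add_0 etgt.simps(1) in_set_sbase less_Suc_eq_le neq0_conv not_gr_zero Suc_less_eq)
  moreover have "lcells (base w) = {}" by (auto simp: lcells_def in_set_sbase)
  ultimately show ?case by auto
next
  case (config_step X p Y C v)
  let ?P = "X @ p @ Y"
  have p: "p \<noteq> []" and v: "v \<noteq> []" using config_step R_ne R_ne2 by auto
  have G: "okpath w (VBase 0) ?P (VBase (length w))" by (rule config_okpath[OF config_step.hyps(1)])
  then obtain a b where ab: "chain (VBase 0) X a" "chain a p b" "chain b Y (VBase (length w))" "okl w ?P"
    by (auto simp: okpath_def)
  have d: "distinct ?P" using G chain_distinct unfolding okpath_def by blast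
  note I1 = config_step.IH[THEN conjunct1]
  note I2 = config_step.IH[THEN conjunct2, THEN conjunct1]
  note I3 = config_step.IH[THEN conjunct2, THEN conjunct2, THEN conjunct1]
  note I4 = config_step.IH[THEN conjunct2, THEN conjunct2, THEN conjunct2, THEN conjunct1]
  note I5 = config_step.IH[THEN conjunct2, THEN conjunct2, THEN conjunct2, THEN conjunct2]
  have unc: "set p \<inter> set p' = {}" if "(p', v') \<in> C" for p' v' using I3 that by auto
  have cn: "(p, v) \<notin> C" using unc[of p v] p by auto
  have down: "lcells p' \<subseteq> C" if "(p', v') \<in> C" for p' v' using that I1 lcells_down_closed by blast
  have pC: "lcells p \<subseteq> C" using I1 by auto
  \<comment> \<open>A cell that used up a bottom edge of \<open>(p, v)\<close> would have
    \<open>(p, v)\<close> in the history of its top; but these histories lie in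
    \<open>C\<close>.\<close>
  have new_unc: "set (bots p v) \<inter> set p' = {}" if "(p', v') \<in> insert (p, v) C" for p' v'
  proof -
    have "New p v j \<notin> set p'" for j
    proof
      assume "New p v j \<in> set p'"
      then have "(p, v) \<in> lcells p'" by (force simp: lcells_def)
      then have "(p, v) \<in> C" using that down pC by blast
      then show False using cn by simp
    qed
    then show ?thesis by (auto simp: set_bots)
  qed
  have A1: "insert (p, v) C = lcells (X @ bots p v @ Y)" using I1 lcells_bots[OF v, of p] by auto
  have A2: "\<forall>c\<in>insert (p, v) C. cellok w c"
    using I2 p v ab config_step.hyps by (auto simp: cellok_def)
  have A3: "set (X @ bots p v @ Y) = (set (base w) \<union> (\<Union>(p, v)\<in>insert (p, v) C. set (bots p v)))
     - (\<Union>(p, v)\<in>insert (p, v) C. set p)"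
  proof -
    have 1: "set (X @ bots p v @ Y) = (set ?P - set p) \<union> set (bots p v)" using d by auto
    have 2: "set (bots p v) \<inter> (\<Union>(p, v)\<in>insert (p, v) C. set p) = {}" using new_unc by auto
    show ?thesis unfolding 1 I3 using 2 by auto
  qed
  have A4: "\<forall>(p1, v1)\<in>insert (p, v) C. \<forall>(p', v')\<in>insert (p, v) C. set p1 \<inter> set p' \<noteq> {} \<longrightarrow> p1 = p' \<and> v1 = v'"
    using I4 unc by blast
  have A5: "vset (X @ bots p v @ Y) = (VBase ` {..length w} \<union> {VNew q u j | q u j. (q, u) \<in> insert (p, v) C \<and> 0 < j \<and> j < length u})
        - (\<Union>(p, v)\<in>insert (p, v) C. inner p)"
  proof -
    let ?N = "{VNew p v j | j. 0 < j \<and> j < length v}"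
    have pl: "p = butlast p @ [last p]" using p by simp
    have sp: "set p = set (butlast p) \<union> {last p}" using arg_cong[OF pl, of set] by simp
    have dl: "last p \<notin> set (butlast p)" using d pl by (metis distinct_append not_distinct_conv_prefix)
    have notin: "etgt e \<notin> inner p" if "e \<in> set ?P" "e \<notin> set (butlast p)" for e
    proof
      assume "etgt e \<in> inner p"
      then obtain f where f: "f \<in> set (butlast p)" "etgt e = etgt f" by (auto simp: inner_def)
      then have "f \<in> set ?P" using sp by auto
      then show False using chain_same_tgt[of "VBase 0" ?P "VBase (length w)" w e f] G that f by (auto simp: okpath_def)
    qed
    have z: "VBase 0 \<notin> inner p"
    proof
      assume "VBase 0 \<in> inner p"
      then obtain f where f: "f \<in> set (butlast p)" "VBase 0 = etgt f" by (auto simp: inner_def)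
      then have fP: "f \<in> set ?P" using sp by auto
      then have "ok w f" using G by (auto simp: okpath_def okl_def)
      moreover have "xpos (VBase 0 :: 'a vertex) \<le> xleft f"
        using chain_x[of "VBase 0" ?P "VBase (length w)" w] fP G unfolding okpath_def by blast
      ultimately show False using x_ok f by force
    qed
    have XY: "\<forall>e\<in>set X \<union> set Y \<union> {last p}. e \<in> set ?P \<and> e \<notin> set (butlast p)"
      using d sp dl by auto
    \<comment> \<open>The inner vertices of \<open>p\<close> give way to those of the new bottom,
      while the two corners stay.\<close>
    have 1: "vset (X @ bots p v @ Y) = vset ?P - inner p \<union> ?N"
    proof -
      have "vset (X @ bots p v @ Y) = insert (VBase 0) (etgt ` (set X \<union> set Y \<union> {last p})) \<union> ?N"
        using etgt_bots_image[OF p v] by (auto simp: vset_def image_Un)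
      moreover have "vset ?P - inner p = insert (VBase 0) (etgt ` (set X \<union> set Y \<union> {last p}))"
      proof -
        have "vset ?P = insert (VBase 0) (etgt ` (set X \<union> set Y \<union> {last p})) \<union> inner p"
          using sp by (auto simp: vset_def inner_def)
        moreover have "insert (VBase 0) (etgt ` (set X \<union> set Y \<union> {last p})) \<inter> inner p = {}"
          using z notin XY by blast
        ultimately show ?thesis by auto
      qed
      ultimately show ?thesis by simp
    qed
    have 2: "?N \<inter> inner p' = {}" if "(p', v') \<in> insert (p, v) C" for p' v'
    proof -
      have "VNew p v j \<noteq> etgt e" if "e \<in> set p'" for e j
      proof
        assume j: "VNew p v j = etgt e"
        have "ok w e" using that A2 \<open>(p', v') \<in> insert (p, v) C\<close> by (auto simp: cellok_def okl_def)
        then have "(p, v) \<in> ecells e" using etgt_cells[of w e] j by (metis insertI1 subsetD vcells.simps(2))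
        then have "(p, v) \<in> lcells p'" using that by (auto simp: lcells_def)
        then have "(p, v) \<in> C" using \<open>(p', v') \<in> insert (p, v) C\<close> down pC by blast
        then show False using cn by simp
      qed
      then show ?thesis unfolding inner_def by (blast dest: in_set_butlastD sym)
    qed
    show ?thesis unfolding 1 I5 using 2 by auto
  qed
  show ?case using A1 A2 A3 A4 A5 by (intro conjI)
qed

lemma config_cells: "config w P C \<Longrightarrow> C = lcells P"
  by (rule config_inv[THEN conjunct1])

lemma config_cellok: "config w P C \<Longrightarrow> c \<in> C \<Longrightarrow> cellok w c"
  using config_inv[THEN conjunct2, THEN conjunct1] by blast

lemma config_set: "config w P C \<Longrightarrow> set P = (set (base w) \<union> (\<Union>(p, v)\<in>C. set (bots p v))) - (\<Union>(p, v)\<in>C. set p)"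
  by (rule config_inv[THEN conjunct2, THEN conjunct2, THEN conjunct1])

lemma config_consumed: "config w P C \<Longrightarrow> (p, v) \<in> C \<Longrightarrow> e \<in> set p \<Longrightarrow> e \<notin> set P"
  by (drule config_set) auto

lemma config_tops: "config w P C \<Longrightarrow> (p, v) \<in> C \<Longrightarrow> (p', v') \<in> C \<Longrightarrow> e \<in> set p \<Longrightarrow> e \<in> set p' \<Longrightarrow> p = p' \<and> v = v'"
  using config_inv[THEN conjunct2, THEN conjunct2, THEN conjunct2, THEN conjunct1] by blast

lemma config_vset: "config w P C \<Longrightarrow> vset P = (VBase ` {..length w} \<union>
    {VNew p v j | p v j. (p, v) \<in> C \<and> 0 < j \<and> j < length v}) - (\<Union>(p, v)\<in>C. inner p)"
  by (rule config_inv[THEN conjunct2, THEN conjunct2, THEN conjunct2, THEN conjunct2])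

lemma config_unique: "config w P C \<Longrightarrow> config w Q C \<Longrightarrow> P = Q"
  using config_set[of w P C] config_set[of w Q C] config_okpath[of w P C] config_okpath[of w Q C] chain_sorted_eq[of "VBase 0" P "VBase (length w)" Q w]
  by (simp add: okpath_def)

lemma config_finite: "config w P C \<Longrightarrow> finite C"
  using config_cells finite_lcells by blast

text \<open>The cell \<open>(p, u)\<close> may have been glued early, but later cells did not touch
  its bottom, which is still on the path. So the last cell is either \<open>(p, u)\<close> itself or
  sits on a disjoint segment, and in the second case the two can be glued in the other
  order.\<close>

lemma config_remove:
  "config w P C \<Longrightarrow> P = X @ bots p u @ Y \<Longrightarrow> u \<noteq> [] \<Longrightarrow> (p, u) \<in> C \<and> config w (X @ p @ Y) (C - {(p, u)})"
proof (induction arbitrary: X Y rule: config.induct)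
  case config_base
  have "New p u 0 \<in> set (bots p u)" using config_base by (auto simp: set_bots)
  then have "New p u 0 \<in> set (base w)" using config_base by auto
  then show ?case by (auto simp: in_set_sbase)
next
  case (config_step X0 p0 Y0 C v)
  have full: "config w (X0 @ bots p0 v @ Y0) (insert (p0, v) C)" by (rule config.config_step[OF config_step.hyps])
  have v: "v \<noteq> []" using config_step R_ne2 by auto
  have cn: "(p0, v) \<notin> C"
  proof
    assume "(p0, v) \<in> C"
    moreover have "hd p0 \<in> set p0" using R_ne[OF config_step(2)] by simp
    ultimately show False using config_consumed[OF config_step(1)] by auto
  qed
  show ?case
  proof (cases "(p0, v) = (p, u)")
    case True
    have "distinct (X0 @ bots p0 v @ Y0)" using config_okpath[OF full] chain_distinct unfolding okpath_def by blast
    then have "X0 = X \<and> Y0 = Y" using distinct_segment_eq[of X0 "bots p0 v" Y0 X Y] config_step True v by auto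
    then show ?thesis using True config_step cn by auto
  next
    case False
    then have "set (bots p0 v) \<inter> set (bots p u) = {}" by (auto simp: set_bots)
    then consider (a) Z where "X = X0 @ bots p0 v @ Z" "Y0 = Z @ bots p u @ Y"
      | (b) Z where "X0 = X @ bots p u @ Z" "Y = Z @ bots p0 v @ Y0"
      using segments_disjoint[of X0 "bots p0 v" Y0 X "bots p u" Y] config_step v by (metis bots_eq_Nil)
    then show ?thesis
    proof cases
      case a
      then have "(p, u) \<in> C \<and> config w ((X0 @ p0 @ Z) @ p @ Y) (C - {(p, u)})"
        using config_step.IH[of "X0 @ p0 @ Z" Y] config_step.prems by simp
      then have "config w (X0 @ bots p0 v @ (Z @ p @ Y)) (insert (p0, v) (C - {(p, u)}))"
        using config.config_step[of w X0 p0 "Z @ p @ Y"] config_step by simp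
      moreover have "insert (p0, v) (C - {(p, u)}) = insert (p0, v) C - {(p, u)}" using False by auto
      ultimately show ?thesis using a \<open>_ \<and> config w _ _\<close> by simp
    next
      case b
      then have "(p, u) \<in> C \<and> config w (X @ p @ (Z @ p0 @ Y0)) (C - {(p, u)})"
        using config_step.IH[of X "Z @ p0 @ Y0"] config_step.prems by simp
      then have "config w ((X @ p @ Z) @ bots p0 v @ Y0) (insert (p0, v) (C - {(p, u)}))"
        using config.config_step[of w "X @ p @ Z" p0 Y0] config_step by simp
      moreover have "insert (p0, v) (C - {(p, u)}) = insert (p0, v) C - {(p, u)}" using False by auto
      ultimately show ?thesis using b \<open>_ \<and> config w _ _\<close> by simp
    qed
  qed
qed

lemma flip1_config:
  assumes "flip1 P Q" "config w P C"
  shows "\<exists>c. c \<notin> C \<and> config w Q (insert c C) \<or> c \<in> C \<and> config w Q (C - {c})"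
proof -
  obtain X p Y v where *: "(map elab p, v) \<in> R" "P = X @ p @ Y" "Q = X @ flip p v @ Y"
    using assms unfolding flip1_def by blast
  show ?thesis
  proof (cases rule: flip_cases[of p v])
    case 1
    have "(p, v) \<notin> C"
    proof
      assume "(p, v) \<in> C"
      moreover have "hd p \<in> set p" using R_ne[OF *(1)] by simp
      ultimately show False using config_consumed[OF assms(2)] *(2) by auto
    qed
    then show ?thesis using config_step[of w X p Y C v] assms(2) * 1 by auto
  next
    case (2 p' u)
    have "u \<noteq> []" using 2 * R_ne by fastforce
    then show ?thesis using config_remove[OF assms(2), of X p' u Y] * 2 by auto
  qed
qed

section \<open>Down-closed sets of cells and their paths\<close>

definition down_closed :: "('a edge list \<times> 'a list) set \<Rightarrow> bool" where
  "down_closed E \<longleftrightarrow> (\<forall>c\<in>E. lcells (fst c) \<subseteq> E)"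

definition new1 :: "'a edge list \<Rightarrow> 'a edge list \<Rightarrow> bool" where
  "new1 P Q \<longleftrightarrow> (\<exists>X p Y v. (map elab p, v) \<in> R \<and> flip p v = bots p v \<and> P = X @ p @ Y \<and> Q = X @ bots p v @ Y)"

lemma new1_flip1: "new1 P Q \<Longrightarrow> flip1 P Q"
  unfolding new1_def flip1_def by metis

lemma newn_flipn: "(new1 ^^ n) P Q \<Longrightarrow> (flip1 ^^ n) P Q"
proof (induction n arbitrary: Q)
  case (Suc n)
  then obtain Q' where "(new1 ^^ n) P Q'" "new1 Q' Q" by auto
  then show ?case using Suc new1_flip1 by (metis relpowp_Suc_I)
qed simp

text \<open>The missing cells of \<open>E\<close> are glued one by one, smallest first. The path is
  cut at a vertex \<open>z\<close> which none of them swallows, so each cell falls on one side of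
  the cut and the moves on the two sides can be counted separately. That \<open>E\<close> lies in
  the set \<open>D\<close> of an actual path guarantees that different cells have disjoint
  tops.\<close>

lemma config_up:
  assumes "config w Q D" "E \<subseteq> D" "down_closed E"
  shows "config w (P1 @ P2) C \<Longrightarrow> C \<subseteq> E \<Longrightarrow> chain (VBase 0) P1 z \<Longrightarrow>
     \<forall>c\<in>E - C. z \<notin> inner (fst c) \<Longrightarrow>
     \<exists>P1' P2' n1 n2. config w (P1' @ P2') E \<and> chain (VBase 0) P1' z \<and> (new1 ^^ n1) P1 P1' \<and>
        (new1 ^^ n2) P2 P2' \<and> n1 + n2 = card (E - C)"
proof (induction "card (E - C)" arbitrary: P1 P2 C)
  case 0
  have "finite E" using assms(1,2) config_finite finite_subset by blast
  then have "E = C" using 0 by auto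
  then show ?case using 0 by (intro exI[of _ P1] exI[of _ P2] exI[of _ 0]) auto
next
  case (Suc n)
  have fE: "finite E" using assms(1,2) config_finite finite_subset by blast
  then have "E - C \<noteq> {}" using Suc(2) by (metis card.empty nat.distinct(1))
  \<comment> \<open>Everything in the history of a missing cell of smallest size is already
    glued.\<close>
  then obtain c where c: "c \<in> E - C" and cmin: "\<forall>c'\<in>E - C. size_list size (fst c) \<le> size_list size (fst c')"
    using ex_min_if_finite[of "(\<lambda>c. size_list size (fst c)) ` (E - C)"] fE
    by (metis (no_types, lifting) arg_min_least finite_Diff arg_min_if_finite(1))
  obtain p v where pv: "c = (p, v)" by fastforce
  have cok: "cellok w (p, v)" using config_cellok assms(1,2) c pv by blast
  have pne: "p \<noteq> []" using cok by (auto simp: cellok_def)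
  have lp: "lcells p \<subseteq> C"
  proof
    fix c' assume c': "c' \<in> lcells p"
    then have "c' \<in> E" using assms(3) c pv by (force simp: down_closed_def)
    then show "c' \<in> C" using cmin lcells_size[OF c'] pv by force
  qed
  let ?P = "P1 @ P2"
  \<comment> \<open>The edges of \<open>p\<close> are base edges or made by cells of
    \<open>C\<close>, and no cell of \<open>C\<close> has used them up, as the tops of different
    cells of \<open>D\<close> are disjoint.\<close>
  have "set p \<subseteq> set ?P"
  proof
    fix e assume e: "e \<in> set p"
    have "ok w e" using cok e by (auto simp: cellok_def okl_def)
    then have "e \<in> set (base w) \<union> (\<Union>(p, v)\<in>C. set (bots p v))"
    proof cases
      case (ok_Base i)
      then show ?thesis by (auto simp: in_set_sbase)
    next
      case (ok_New p' v' j)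
      then have "(p', v') \<in> lcells p" using e by (force simp: lcells_def)
      then have "(p', v') \<in> C" using lp by blast
      then show ?thesis using ok_New by (auto simp: set_bots)
    qed
    moreover have "e \<notin> (\<Union>(p, v)\<in>C. set p)"
    proof
      assume "e \<in> (\<Union>(p, v)\<in>C. set p)"
      then obtain p' v' where "(p', v') \<in> C" "e \<in> set p'" by auto
      then show False using config_tops[OF assms(1), of p v p' v' e] e c pv Suc.prems(2) assms(2) by auto
    qed
    ultimately show "e \<in> set ?P" using config_set[OF Suc.prems(1)] by blast
  qed
  moreover obtain a b where "chain a p b" using cok by (auto simp: cellok_def)
  ultimately obtain X Y where XY: "?P = X @ p @ Y"
    using chain_subsegment[of "VBase 0" ?P "VBase (length w)" w a p b] config_okpath[OF Suc.prems(1)] pne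
    unfolding okpath_def by blast
  have next_cfg: "config w (X @ bots p v @ Y) (insert (p, v) C)"
    using config_step[of w X p Y C v] Suc.prems(1) XY cok by (auto simp: cellok_def)
  have R: "(map elab p, v) \<in> R" "flip p v = bots p v" using cok by (auto simp: cellok_def)
  have card: "n = card (E - insert (p, v) C)"
  proof -
    have "E - insert (p, v) C = (E - C) - {(p, v)}" by auto
    then show ?thesis using Suc(2) c pv fE by (metis card_Diff_singleton diff_Suc_1)
  qed
  have sub: "insert (p, v) C \<subseteq> E" using c pv Suc.prems by auto
  have zin: "z \<notin> inner p" using bspec[OF Suc.prems(4) c] pv by simp
  have zall: "\<forall>c\<in>E - insert (p, v) C. z \<notin> inner (fst c)" using Suc.prems(4) by auto
  show ?case
  proof (cases rule: segment_split[OF XY])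
    case (1 Z)
    let ?P1 = "X @ bots p v @ Z"
    have u: "new1 P1 ?P1" unfolding new1_def using R 1 by blast
    have "okpath w (VBase 0) P1 z" using Suc.prems(3) config_okpath[OF Suc.prems(1)] by (auto simp: okpath_def)
    then have "chain (VBase 0) ?P1 z" using flip1_okpath[OF new1_flip1[OF u]] by (auto simp: okpath_def)
    then obtain P1' P2' n1 n2 where *: "config w (P1' @ P2') E" "chain (VBase 0) P1' z" "(new1 ^^ n1) ?P1 P1'"
        "(new1 ^^ n2) P2 P2'" "n1 + n2 = n"
      using Suc.hyps(1)[OF card, of ?P1 P2] next_cfg sub zall 1 card by auto
    have "(new1 ^^ Suc n1) P1 P1'" using u *(3) by (meson relpowp_Suc_I2)
    then show ?thesis using * Suc(2) by (metis add_Suc)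
  next
    case (2 Z)
    let ?P2 = "Z @ bots p v @ Y"
    have u: "new1 P2 ?P2" unfolding new1_def using R 2 by blast
    obtain P1' P2' n1 n2 where *: "config w (P1' @ P2') E" "chain (VBase 0) P1' z" "(new1 ^^ n1) P1 P1'"
        "(new1 ^^ n2) ?P2 P2'" "n1 + n2 = n"
      using Suc.hyps(1)[OF card, of P1 ?P2] next_cfg sub Suc.prems(3) zall 2 card by auto
    have "(new1 ^^ Suc n2) P2 P2'" using u *(4) by (meson relpowp_Suc_I2)
    then show ?thesis using * Suc(2) by (metis add_Suc_right)
  next
    case (3 a b)
    then have "z = etgt (last a)" using Suc.prems(3) chain_ends[of _ a z] by auto
    moreover have "last a \<in> set (butlast p)" using 3 by (simp add: butlast_append)
    ultimately show ?thesis using zin by (auto simp: inner_def)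
  qed
qed

lemma config_lpath:
  assumes "config w Q D" "E \<subseteq> D" "down_closed E"
  shows "\<exists>P. config w P E"
proof -
  have "VBase 0 \<in> vset Q" by (simp add: vset_def)
  then have zin: "\<forall>c\<in>E. VBase 0 \<notin> inner (fst c)" using config_vset[OF assms(1)] assms(2) by fastforce
  show ?thesis
  using config_up[OF assms, where ?P1.0 = "[]" and ?P2.0 = "base w" and C = "{}" and z = "VBase 0"] config_base zin
    by auto
qed

definition reach :: "'a list \<Rightarrow> 'a edge list \<Rightarrow> bool" where
  "reach w P \<longleftrightarrow> config w P (lcells P)"

lemma config_reach: "config w P C \<Longrightarrow> reach w P"
  using config_cells unfolding reach_def by blast

lemma reach_base [simp]: "reach w (base w)"
  using config_base config_reach by blast

lemma reach_flip1: "flip1 P Q \<Longrightarrow> reach w P \<Longrightarrow> reach w Q"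
  using flip1_config config_reach unfolding reach_def by metis

lemma reach_flipn: "(flip1 ^^ n) P Q \<Longrightarrow> reach w P \<Longrightarrow> reach w Q"
  by (induction n arbitrary: Q) (auto intro: reach_flip1)

lemma reach_okpath: "reach w P \<Longrightarrow> okpath w (VBase 0) P (VBase (length w))"
  using config_okpath unfolding reach_def by blast

lemma reach_okl: "reach w P \<Longrightarrow> okl w P"
  using reach_okpath unfolding okpath_def by blast

lemma reach_chain: "reach w P \<Longrightarrow> chain (VBase 0) P (VBase (length w))"
  using reach_okpath unfolding okpath_def by blast

lemma reach_down_closed: "down_closed (lcells P)"
  unfolding down_closed_def using lcells_down_closed by (metis prod.collapse)

lemma down_closed_Int: "down_closed A \<Longrightarrow> down_closed B \<Longrightarrow> down_closed (A \<inter> B)"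
  by (auto simp: down_closed_def)

lemma reach_vset_uncons: "reach w P \<Longrightarrow> z \<in> vset P \<Longrightarrow> c \<in> lcells P \<Longrightarrow> z \<notin> inner (fst c)"
  using config_vset[of w P "lcells P"] unfolding reach_def by fastforce

lemma up_split:
  assumes "reach w (P1 @ P2)" "reach w (Q1 @ Q2)" "lcells (P1 @ P2) \<subseteq> lcells (Q1 @ Q2)"
    "chain (VBase 0) P1 z" "chain (VBase 0) Q1 z"
  shows "\<exists>n1 n2. (new1 ^^ n1) P1 Q1 \<and> (new1 ^^ n2) P2 Q2 \<and> n1 + n2 = card (lcells (Q1 @ Q2) - lcells (P1 @ P2))"
proof -
  have z: "z \<in> vset (Q1 @ Q2)" using chain_vertex_in reach_chain assms by blast
  then have "\<forall>c\<in>lcells (Q1 @ Q2) - lcells (P1 @ P2). z \<notin> inner (fst c)" using reach_vset_uncons assms(2) by blast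
  then obtain P1' P2' n1 n2 where *: "config w (P1' @ P2') (lcells (Q1 @ Q2))" "chain (VBase 0) P1' z"
      "(new1 ^^ n1) P1 P1'" "(new1 ^^ n2) P2 P2'" "n1 + n2 = card (lcells (Q1 @ Q2) - lcells (P1 @ P2))"
    using config_up[of w "Q1 @ Q2" "lcells (Q1 @ Q2)" "lcells (Q1 @ Q2)" P1 P2 "lcells (P1 @ P2)" z]
      assms reach_down_closed unfolding reach_def by blast
  then have "P1' @ P2' = Q1 @ Q2" using config_unique assms(2) unfolding reach_def by blast
  then have "P1' = Q1 \<and> P2' = Q2" using chain_split_unique * assms reach_okl by metis
  then show ?thesis using * by blast
qed

lemma up_whole:
  assumes "reach w P" "reach w Q" "lcells P \<subseteq> lcells Q"
  shows "(new1 ^^ card (lcells Q - lcells P)) P Q"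
proof -
  obtain n1 n2 where "(new1 ^^ n1) [] []" "(new1 ^^ n2) P Q" "n1 + n2 = card (lcells Q - lcells P)"
    using up_split[of w "[]" P "[]" Q "VBase 0"] assms by auto
  moreover have "n1 = 0"
  proof (cases n1)
    case (Suc m)
    then obtain P' where "new1 P' []" using calculation by auto
    then show ?thesis unfolding new1_def using R_ne2 by fastforce
  qed
  ultimately show ?thesis by simp
qed

section \<open>Meets and distances of reachable paths\<close>

definition cdist :: "'a edge list \<Rightarrow> 'a edge list \<Rightarrow> nat" where
  "cdist P Q = card (lcells P - lcells Q) + card (lcells Q - lcells P)"

lemma cdist_step: "reach w Q \<Longrightarrow> flip1 Q Q' \<Longrightarrow> cdist P Q' \<le> Suc (cdist P Q)"
proof -
  assume "reach w Q" "flip1 Q Q'"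
  then obtain c where "lcells Q' = insert c (lcells Q) \<or> lcells Q' = lcells Q - {c}"
    using flip1_config config_cells unfolding reach_def by metis
  then show ?thesis
  proof
    assume Q': "lcells Q' = insert c (lcells Q)"
    have "card (lcells P - lcells Q') \<le> card (lcells P - lcells Q)"
      using Q' by (intro card_mono) (auto simp: finite_lcells)
    moreover have "card (lcells Q' - lcells P) \<le> card (insert c (lcells Q - lcells P))"
      using Q' by (intro card_mono) (auto simp: finite_lcells)
    ultimately show ?thesis unfolding cdist_def
      using card_insert_le_m1[of "Suc (card (lcells Q - lcells P))" "lcells Q - lcells P" c] by simp
  next
    assume Q': "lcells Q' = lcells Q - {c}"
    have "card (lcells Q' - lcells P) \<le> card (lcells Q - lcells P)"
      using Q' by (intro card_mono) (auto simp: finite_lcells)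
    moreover have "card (lcells P - lcells Q') \<le> card (insert c (lcells P - lcells Q))"
      using Q' by (intro card_mono) (auto simp: finite_lcells)
    ultimately show ?thesis unfolding cdist_def
      using card_insert_le_m1[of "Suc (card (lcells P - lcells Q))" "lcells P - lcells Q" c] by simp
  qed
qed

lemma cdist_le: "reach w P \<Longrightarrow> (flip1 ^^ n) P Q \<Longrightarrow> cdist P Q \<le> n"
proof (induction n arbitrary: Q)
  case (Suc n)
  then obtain Q' where "(flip1 ^^ n) P Q'" "flip1 Q' Q" by auto
  then show ?case using Suc cdist_step[of w Q' Q P] reach_flipn by fastforce
qed (simp add: cdist_def)

lemma vset_cells: "reach w P \<Longrightarrow> z \<in> vset P \<Longrightarrow> vcells z \<subseteq> lcells P"
  using etgt_cells reach_okl by (fastforce simp: vset_def lcells_def okl_def)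

lemma reach_lpath: "reach w Q \<Longrightarrow> E \<subseteq> lcells Q \<Longrightarrow> down_closed E \<Longrightarrow> \<exists>P. reach w P \<and> lcells P = E"
  using config_lpath[of w Q "lcells Q" E] config_reach config_cells unfolding reach_def by metis

lemma reach_vset_mono:
  assumes "reach w P" "reach w Q" "lcells P \<subseteq> lcells Q" "z \<in> vset Q" "vcells z \<subseteq> lcells P"
  shows "z \<in> vset P"
proof -
  have *: "z \<in> VBase ` {..length w} \<union> {VNew p v j | p v j. (p, v) \<in> lcells Q \<and> 0 < j \<and> j < length v}"
    "\<forall>(p, v)\<in>lcells Q. z \<notin> inner p"
    using config_vset[of w Q "lcells Q"] assms(2,4) unfolding reach_def by auto
  then have "z \<in> VBase ` {..length w} \<union> {VNew p v j | p v j. (p, v) \<in> lcells P \<and> 0 < j \<and> j < length v}"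
    using assms(5) by auto
  then show ?thesis using *(2) config_vset[of w P "lcells P"] assms(1,3) unfolding reach_def by auto
qed

lemma newn_rev_flipn: "(new1 ^^ n) P Q \<Longrightarrow> okpath w a P b \<Longrightarrow> (flip1 ^^ n) Q P"
  using newn_flipn flipn_okpath by blast

text \<open>The common cells of the two paths belong to a path \<open>M\<close>, which still passes
  through \<open>z\<close> because the history of \<open>z\<close> lies in both sets. Undoing cells
  as far as \<open>M\<close> and then gluing new ones takes one move for each cell of the symmetric
  difference, and every move stays on one side of \<open>z\<close>.\<close>

lemma geo_split:
  assumes "reach w (P1 @ P2)" "reach w (Q1 @ Q2)" "chain (VBase 0) P1 z" "chain (VBase 0) Q1 z"
  shows "\<exists>n1 n2. (flip1 ^^ n1) P1 Q1 \<and> (flip1 ^^ n2) P2 Q2 \<and> n1 + n2 = cdist (P1 @ P2) (Q1 @ Q2)"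
proof -
  let ?P = "P1 @ P2" and ?Q = "Q1 @ Q2"
  have zP: "z \<in> vset ?P" and zQ: "z \<in> vset ?Q" using chain_vertex_in reach_chain assms by blast+
  obtain M where M: "reach w M" "lcells M = lcells ?P \<inter> lcells ?Q"
    using reach_lpath[of w ?P "lcells ?P \<inter> lcells ?Q"] assms(1) reach_down_closed down_closed_Int by blast
  have "vcells z \<subseteq> lcells M" using M vset_cells zP zQ assms by blast
  then have "z \<in> vset M" using reach_vset_mono[of w M ?P z] M assms zP by blast
  then obtain M1 M2 where MM: "M = M1 @ M2" "chain (VBase 0) M1 z" "chain z M2 (VBase (length w))"
    using chain_split_vertex reach_chain M by blast
  obtain a1 a2 where a: "(new1 ^^ a1) M1 P1" "(new1 ^^ a2) M2 P2" "a1 + a2 = card (lcells ?P - lcells M)"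
    using up_split[of w M1 M2 P1 P2 z] M MM assms by auto
  obtain b1 b2 where b: "(new1 ^^ b1) M1 Q1" "(new1 ^^ b2) M2 Q2" "b1 + b2 = card (lcells ?Q - lcells M)"
    using up_split[of w M1 M2 Q1 Q2 z] M MM assms by auto
  have "okl w M" using M reach_okl by blast
  then have "okpath w (VBase 0) M1 z" "okpath w z M2 (VBase (length w))" using MM by (auto simp: okpath_def)
  then have "(flip1 ^^ a1) P1 M1" "(flip1 ^^ a2) P2 M2" using a newn_rev_flipn by blast+
  then have "(flip1 ^^ (a1 + b1)) P1 Q1" "(flip1 ^^ (a2 + b2)) P2 Q2"
    using b newn_flipn by (meson relpowp_trans)+
  moreover have "lcells ?P - lcells M = lcells ?P - lcells ?Q" "lcells ?Q - lcells M = lcells ?Q - lcells ?P"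
    using M by auto
  then have "a1 + b1 + (a2 + b2) = cdist ?P ?Q" using a b by (simp add: cdist_def)
  ultimately show ?thesis by blast
qed

lemma geo: "reach w P \<Longrightarrow> reach w Q \<Longrightarrow> (flip1 ^^ cdist P Q) P Q"
proof -
  assume PQ: "reach w P" "reach w Q"
  then obtain n1 n2 where "(flip1 ^^ n1) [] []" "(flip1 ^^ n2) P Q" "n1 + n2 = cdist P Q"
    using geo_split[of w "[]" P "[]" Q "VBase 0"] by auto
  moreover have "n1 = 0"
  proof (cases n1)
    case (Suc m)
    then obtain P' where "flip1 P' []" using calculation by auto
    then obtain p v where "(map elab p, v) \<in> R" "flip p v = []" unfolding flip1_def by auto
    then show ?thesis using R_ne2 length_flip by (metis list.size(3) length_0_conv)
  qed
  ultimately show ?thesis by simp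
qed

text \<open>Unlike \<open>cdist\<close>, the number of moves makes sense for pieces of paths and
  behaves well under renumbering of the base edges; both are needed to add up distances over the
  parts of a path.\<close>

definition fdist :: "'a edge list \<Rightarrow> 'a edge list \<Rightarrow> nat" where
  "fdist P Q = (LEAST n. (flip1 ^^ n) P Q)"

lemma fdist_le: "(flip1 ^^ n) P Q \<Longrightarrow> fdist P Q \<le> n"
  unfolding fdist_def by (rule Least_le)

lemma fdist_flipn: "(flip1 ^^ n) P Q \<Longrightarrow> (flip1 ^^ fdist P Q) P Q"
  unfolding fdist_def by (rule LeastI)

lemma fdist_refl [simp]: "fdist P P = 0"
  using fdist_le[of 0 P P] by simp

lemma fdist_0: "(flip1 ^^ n) P Q \<Longrightarrow> fdist P Q = 0 \<Longrightarrow> P = Q"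
  using fdist_flipn by fastforce

lemma fdist_cdist: "reach w P \<Longrightarrow> reach w Q \<Longrightarrow> fdist P Q = cdist P Q"
  using geo[of w P Q] fdist_le fdist_flipn cdist_le by (metis le_antisym)

text \<open>Some shortest connection between the two paths never moves across the common
  vertex.\<close>

lemma fdist_split:
  assumes "reach w (P1 @ P2)" "reach w (Q1 @ Q2)" "chain (VBase 0) P1 z" "chain (VBase 0) Q1 z"
  shows "fdist (P1 @ P2) (Q1 @ Q2) = fdist P1 Q1 + fdist P2 Q2 \<and> (flip1 ^^ fdist P1 Q1) P1 Q1 \<and> (flip1 ^^ fdist P2 Q2) P2 Q2"
proof -
  obtain n1 n2 where n: "(flip1 ^^ n1) P1 Q1" "(flip1 ^^ n2) P2 Q2" "n1 + n2 = fdist (P1 @ P2) (Q1 @ Q2)"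
    using geo_split[OF assms] fdist_cdist assms by metis
  then have c: "(flip1 ^^ fdist P1 Q1) P1 Q1" "(flip1 ^^ fdist P2 Q2) P2 Q2" using fdist_flipn by blast+
  then have "fdist (P1 @ P2) (Q1 @ Q2) \<le> fdist P1 Q1 + fdist P2 Q2"
    using fdist_le flipn_append by blast
  then show ?thesis using c n fdist_le[OF n(1)] fdist_le[OF n(2)] by simp
qed

lemma fdist_base: "reach w P \<Longrightarrow> fdist (base w) P = card (lcells P)"
proof -
  assume P: "reach w P"
  have "lcells (base w) = {}" by (auto simp: lcells_def in_set_sbase)
  then show ?thesis using fdist_cdist[OF reach_base P] by (simp add: cdist_def)
qed

section \<open>The groupoid of reachable paths, whose arrows are classes of diagrams\<close>

definition mor :: "'a list \<Rightarrow> 'a list \<Rightarrow> 'a edge list \<Rightarrow> bool" where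
  "mor w w' S \<longleftrightarrow> w \<noteq> [] \<and> reach w S \<and> map elab S = w'"

lemma mor_lpath: "mor w w' S \<Longrightarrow> lpath w w' S"
proof -
  assume S: "mor w w' S"
  then have c: "chain (VBase 0) S (VBase (length w))" using reach_chain mor_def by blast
  moreover have "S \<noteq> []"
  proof
    assume "S = []"
    then have "VBase 0 = (VBase (length w) :: 'a vertex)" using c by simp
    then show False using S by (simp add: mor_def)
  qed
  ultimately show ?thesis using S reach_okl unfolding mor_def lpath_def by blast
qed

lemma mor_ne: "mor w w' S \<Longrightarrow> w' \<noteq> [] \<and> w \<noteq> [] \<and> S \<noteq> []"
  using mor_lpath by (auto simp: lpath_def mor_def)

lemma mor_length: "mor w w' S \<Longrightarrow> length S = length w'"
  by (auto simp: mor_def)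

lemma mor_base: "w \<noteq> [] \<Longrightarrow> mor w w (base w)"
  by (simp add: mor_def)

lemma mor_act_base: "mor w w' S \<Longrightarrow> map (act S) (base w') = S"
  using act_base mor_length by blast

lemma act_reach: "mor w w' S \<Longrightarrow> reach w' P \<Longrightarrow> reach w (map (act S) P)"
proof -
  assume S: "mor w w' S" and P: "reach w' P"
  have "(flip1 ^^ cdist (base w') P) (base w') P" using geo[OF reach_base P] .
  then have "(flip1 ^^ cdist (base w') P) (map (act S) (base w')) (map (act S) P)"
    using flipn_act[OF mor_lpath[OF S] reach_okpath[OF reach_base]] by blast
  then show ?thesis using reach_flipn S mor_act_base[OF S] unfolding mor_def by metis
qed

lemma mor_comp: "mor w w' S \<Longrightarrow> mor w' w'' T \<Longrightarrow> mor w w'' (map (act S) T)"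
  using act_reach map_act_elab mor_lpath reach_okl unfolding mor_def by metis

lemma mor_act_act: "mor w w' S \<Longrightarrow> mor w' w'' T \<Longrightarrow> okl w'' P \<Longrightarrow>
    map (act S) (map (act T) P) = map (act (map (act S) T)) P"
  using map_act_act mor_lpath by blast

text \<open>Moves leading from \<open>S\<close> back to the base path are lifted along the action.
  The lifted moves end in a path over \<open>w'\<close> whose image is the base path, that is, in an
  inverse.\<close>

lemma mor_inv_ex: "mor w w' S \<Longrightarrow> \<exists>S'. mor w' w S' \<and> map (act S) S' = base w"
proof -
  assume S: "mor w w' S"
  have "(flip1 ^^ cdist S (base w)) S (base w)" using geo[OF _ reach_base] S unfolding mor_def by blast
  then have "(flip1 ^^ cdist S (base w)) (map (act S) (base w')) (base w)" using mor_act_base[OF S] by simp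
  then obtain S' where S': "(flip1 ^^ cdist S (base w)) (base w') S'" "base w = map (act S) S'"
    using flipn_lift[OF mor_lpath[OF S] reach_okpath[OF reach_base]] by blast
  have r: "reach w' S'" using S' reach_flipn by auto
  moreover have "map elab S' = w" using map_act_elab[OF mor_lpath[OF S] reach_okl[OF r]] S' by (metis map_elab_sbase)
  ultimately show ?thesis using S' mor_ne[OF S] unfolding mor_def by auto
qed

lemma mor_inv_ex2: "mor w w' S \<Longrightarrow> \<exists>S'. mor w' w S' \<and> map (act S) S' = base w \<and> map (act S') S = base w'"
proof -
  assume S: "mor w w' S"
  obtain S' where S': "mor w' w S'" "map (act S) S' = base w" using mor_inv_ex S by blast
  obtain S'' where S'': "mor w w' S''" "map (act S') S'' = base w'" using mor_inv_ex S' by blast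
  have ok'': "okl w S''" using S'' reach_okl unfolding mor_def by blast
  have "S'' = map (act (map (act S) S')) S''" using S' map_act_base_id ok'' by simp
  also have "\<dots> = map (act S) (map (act S') S'')" using mor_act_act[OF S S'(1) ok''] by simp
  also have "\<dots> = S" using S'' mor_act_base[OF S] by simp
  finally show ?thesis using S' S'' by blast
qed

definition minv :: "'a list \<Rightarrow> 'a edge list \<Rightarrow> 'a edge list" where
  "minv w S = (SOME S'. mor (map elab S) w S' \<and> map (act S) S' = base w \<and> map (act S') S = base (map elab S))"

lemma minv: "mor w w' S \<Longrightarrow> mor w' w (minv w S) \<and> map (act S) (minv w S) = base w \<and> map (act (minv w S)) S = base w'"
proof -
  assume S: "mor w w' S"
  then have "w' = map elab S" by (simp add: mor_def)
  then show ?thesis unfolding minv_def using someI_ex[OF mor_inv_ex2[OF S]] by simp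
qed

lemma minv_act: "mor w w' S \<Longrightarrow> okl w' P \<Longrightarrow> map (act (minv w S)) (map (act S) P) = P"
  using mor_act_act[of w' w "minv w S" w' S P] minv[of w w' S] map_act_base_id by simp

lemma act_minv: "mor w w' S \<Longrightarrow> okl w P \<Longrightarrow> map (act S) (map (act (minv w S)) P) = P"
  using mor_act_act[of w w' S w "minv w S" P] minv[of w w' S] map_act_base_id by simp

lemma act_inj: "mor w w' S \<Longrightarrow> okl w' P \<Longrightarrow> okl w' Q \<Longrightarrow> map (act S) P = map (act S) Q \<Longrightarrow> P = Q"
  using minv_act by metis

text \<open>Moves can be pushed forward and lifted along the action, so distances neither grow nor
  shrink.\<close>

lemma fdist_act:
  assumes "mor w w' S" "okpath w' a P b" "(flip1 ^^ n) P Q"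
  shows "fdist (map (act S) P) (map (act S) Q) = fdist P Q"
proof (rule le_antisym)
  show "fdist (map (act S) P) (map (act S) Q) \<le> fdist P Q"
    using flipn_act[OF mor_lpath[OF assms(1)] assms(2)] fdist_flipn[OF assms(3)] fdist_le by blast
  have "(flip1 ^^ fdist (map (act S) P) (map (act S) Q)) (map (act S) P) (map (act S) Q)"
    using flipn_act[OF mor_lpath[OF assms(1)] assms(2,3)] fdist_flipn by blast
  then obtain Q' where Q': "(flip1 ^^ fdist (map (act S) P) (map (act S) Q)) P Q'" "map (act S) Q = map (act S) Q'"
    using flipn_lift[OF mor_lpath[OF assms(1)] assms(2)] by blast
  have "okl w' Q" "okl w' Q'" using assms(2,3) Q' flipn_okpath unfolding okpath_def by blast+
  then have "Q = Q'" using act_inj[OF assms(1)] Q' by blast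
  then show "fdist P Q \<le> fdist (map (act S) P) (map (act S) Q)" using Q' fdist_le by blast
qed

lemma fdist_act_reach: "mor w w' S \<Longrightarrow> reach w' P \<Longrightarrow> reach w' Q \<Longrightarrow> fdist (map (act S) P) (map (act S) Q) = fdist P Q"
  using fdist_act[of w w' S "VBase 0" P "VBase (length w')"] reach_okpath geo by blast

definition path_group :: "'a list \<Rightarrow> 'a edge list monoid" where
  "path_group w = \<lparr>carrier = {S. mor w w S}, mult = (\<lambda>S T. map (act S) T), one = base w\<rparr>"

lemma path_group_simps [simp]:
  "S \<in> carrier (path_group w) \<longleftrightarrow> mor w w S" "S \<otimes>\<^bsub>path_group w\<^esub> T = map (act S) T" "\<one>\<^bsub>path_group w\<^esub> = base w"
  by (simp_all add: path_group_def)

lemma path_group_group: "w \<noteq> [] \<Longrightarrow> group (path_group w)"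
proof (rule groupI, unfold path_group_simps)
  fix S assume S: "mor w w S"
  then show "map (act (base w)) S = S" using map_act_base_id reach_okl unfolding mor_def by blast
  show "\<exists>T\<in>carrier (path_group w). map (act T) S = base w" using minv[OF S] by auto
next
  fix S T U assume "mor w w S" "mor w w T" "mor w w U"
  then show "map (act (map (act S) T)) U = map (act S) (map (act T) U)"
    using mor_act_act reach_okl unfolding mor_def by metis
qed (auto intro: mor_comp mor_base)

lemma path_group_inv: "mor w w S \<Longrightarrow> inv\<^bsub>path_group w\<^esub> S = minv w S"
  using group.inv_equality[OF path_group_group[of w], of "minv w S" S] minv[of w w S] mor_ne by auto

section \<open>Minimal displacement\<close>

text \<open>Note that \<open>card (lcells S)\<close> is the distance between the base path and its image \<open>S\<close>.\<close>

definition min_disp :: "'a list \<Rightarrow> 'a edge list \<Rightarrow> bool" where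
  "min_disp w S \<longleftrightarrow> (\<forall>P. reach w P \<longrightarrow> card (lcells S) \<le> fdist P (map (act S) P))"

definition conj :: "'a list \<Rightarrow> 'a edge list \<Rightarrow> 'a edge list \<Rightarrow> 'a edge list" where
  "conj w \<Gamma> S = map (act (minv w \<Gamma>)) (map (act S) \<Gamma>)"

lemma conj_mor: "mor w w' \<Gamma> \<Longrightarrow> mor w w S \<Longrightarrow> mor w' w' (conj w \<Gamma> S)"
  unfolding conj_def using mor_comp minv by blast

lemma conj_eq: "mor w w' \<Gamma> \<Longrightarrow> mor w w S \<Longrightarrow> map (act \<Gamma>) (conj w \<Gamma> S) = map (act S) \<Gamma>"
  unfolding conj_def using act_minv mor_comp reach_okl unfolding mor_def by metis

lemma conj_act:
  assumes "mor w w' \<Gamma>" "mor w w S" "okl w' P"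
  shows "map (act \<Gamma>) (map (act (conj w \<Gamma> S)) P) = map (act S) (map (act \<Gamma>) P)"
  using mor_act_act[OF assms(1) conj_mor[OF assms(1,2)] assms(3)] mor_act_act[OF assms(2,1,3)] conj_eq[OF assms(1,2)]
  by simp

lemma conj_mult:
  assumes "mor w w' \<Gamma>" "mor w w S" "mor w w T"
  shows "map (act (conj w \<Gamma> S)) (conj w \<Gamma> T) = conj w \<Gamma> (map (act S) T)"
proof -
  have S': "mor w' w' (conj w \<Gamma> S)" and T': "mor w' w' (conj w \<Gamma> T)" using conj_mor assms by auto
  have ST: "mor w w (map (act S) T)" using mor_comp assms by blast
  have o: "okl w' (conj w \<Gamma> T)" "okl w' (map (act (conj w \<Gamma> S)) (conj w \<Gamma> T))" "okl w' (conj w \<Gamma> (map (act S) T))" "okl w \<Gamma>"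
    "okl w' \<Gamma>'" if "\<Gamma>' = conj w \<Gamma> T" for \<Gamma>'
    using S' T' mor_comp[OF S' T'] conj_mor[OF assms(1) ST] reach_okl assms(1) that unfolding mor_def by blast+
  have "map (act \<Gamma>) (map (act (conj w \<Gamma> S)) (conj w \<Gamma> T)) = map (act S) (map (act \<Gamma>) (conj w \<Gamma> T))"
    using conj_act[OF assms(1,2)] o by blast
  also have "\<dots> = map (act S) (map (act T) \<Gamma>)" using conj_eq assms by simp
  also have "\<dots> = map (act (map (act S) T)) \<Gamma>"
    using map_act_act[OF mor_lpath[OF assms(2)] mor_lpath[OF assms(3)]] o by blast
  also have "\<dots> = map (act \<Gamma>) (conj w \<Gamma> (map (act S) T))" using conj_eq[OF assms(1) ST] by simp
  finally show ?thesis using act_inj[OF assms(1)] o by blast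
qed

lemma conj_fdist:
  assumes "mor w w' \<Gamma>" "mor w w S" "reach w' P"
  shows "fdist (map (act \<Gamma>) P) (map (act S) (map (act \<Gamma>) P)) = fdist P (map (act (conj w \<Gamma> S)) P)"
proof -
  have S': "mor w' w' (conj w \<Gamma> S)" using conj_mor assms by auto
  show ?thesis using conj_act[OF assms(1,2) reach_okl[OF assms(3)]] fdist_act_reach[OF assms(1,3) act_reach[OF S' assms(3)]]
    by simp
qed

text \<open>Conjugating by \<Gamma> amounts to measuring the displacement of \<open>S\<close> at the
  path \<Gamma> instead of the base path. Minimizing over conjugates is thus minimizing over
  reachable paths.\<close>

lemma card_conj: "mor w w' \<Gamma> \<Longrightarrow> mor w w S \<Longrightarrow> card (lcells (conj w \<Gamma> S)) = fdist \<Gamma> (map (act S) \<Gamma>)"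
  using conj_fdist[of w w' \<Gamma> S "base w'"] mor_act_base fdist_base conj_mor reach_base unfolding mor_def by metis

lemma min_disp_conj:
  assumes "mor w w' \<Gamma>" "mor w w S" "\<And>P. reach w P \<Longrightarrow> fdist \<Gamma> (map (act S) \<Gamma>) \<le> fdist P (map (act S) P)"
  shows "min_disp w' (conj w \<Gamma> S)"
  unfolding min_disp_def using conj_fdist[OF assms(1,2)] card_conj[OF assms(1,2)] assms(3) act_reach[OF assms(1)] by metis

lemma ex_min_disp:
  assumes "mor w w S"
  shows "\<exists>\<Gamma> w'. mor w w' \<Gamma> \<and> min_disp w' (conj w \<Gamma> S)"
proof -
  obtain \<Gamma> where \<Gamma>: "reach w \<Gamma>" "\<And>P. reach w P \<Longrightarrow> fdist \<Gamma> (map (act S) \<Gamma>) \<le> fdist P (map (act S) P)"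
    using ex_has_least_nat[of "reach w" "base w" "\<lambda>P. fdist P (map (act S) P)"] by auto
  then have "mor w (map elab \<Gamma>) \<Gamma>" using mor_ne[OF assms] by (simp add: mor_def)
  then show ?thesis using min_disp_conj[OF _ assms] \<Gamma>(2) by blast
qed

lemma map_fixed: "map f p = p \<Longrightarrow> \<forall>x\<in>set p. f x = x"
  by (induction p) auto

lemma mor_actv_0: "mor w w' S \<Longrightarrow> actv S (VBase 0) = VBase 0"
  using mor_ne[of w w' S] mor_length[of w w' S] chain_hd[OF reach_chain[of w S]]
  by (auto simp: mor_def hd_conv_nth)

lemma mor_actv_end: "mor w w' S \<Longrightarrow> actv S (VBase (length w')) = VBase (length w)"
  using mor_ne[of w w' S] mor_length[of w w' S] chain_last[OF reach_chain[of w S]]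
  by (auto simp: mor_def)

declare actv.simps [simp del]

lemma act_chain0:
  "mor w w' S \<Longrightarrow> reach w' (P1 @ P2) \<Longrightarrow> chain (VBase 0) P1 z \<Longrightarrow> chain (VBase 0) (map (act S) P1) (actv S z)"
  using map_act_chain[OF mor_lpath, of w w' S P1 "VBase 0" z] reach_okl[of w' "P1 @ P2"] mor_actv_0 by auto

lemma act_vset: "mor w w' S \<Longrightarrow> reach w' P \<Longrightarrow> z \<in> vset P \<Longrightarrow> actv S z \<in> vset (map (act S) P)"
proof -
  assume a: "mor w w' S" "reach w' P" "z \<in> vset P"
  then obtain P1 P2 where P: "P = P1 @ P2" "chain (VBase 0) P1 z" using chain_split_vertex reach_chain by blast
  then have "chain (VBase 0) (map (act S) P1) (actv S z)" using act_chain0 a by blast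
  then show ?thesis using chain_vertex_in reach_chain[OF act_reach[OF a(1,2)]] P by (metis map_append)
qed

lemma actv_act:
  assumes "mor w w1 S" "mor w1 w' T" "ok w' e"
  shows "actv S (actv T (etgt e)) = actv (map (act S) T) (etgt e)"
    and "actv S (actv T (esrc e)) = actv (map (act S) T) (esrc e)"
proof -
  have s: "lpath w w1 S" "lpath w1 w' T" "lpath w w' (map (act S) T)" using assms mor_lpath mor_comp by blast+
  have "act S (act T e) = act (map (act S) T) e" using act_act s assms by blast
  then show "actv S (actv T (etgt e)) = actv (map (act S) T) (etgt e)"
    and "actv S (actv T (esrc e)) = actv (map (act S) T) (esrc e)"
    using act_etgt[OF s(1) act_ok[OF s(2) assms(3)]] act_etgt[OF s(2) assms(3)] act_etgt[OF s(3) assms(3)]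
      act_esrc[OF s(1) act_ok[OF s(2) assms(3)]] act_esrc[OF s(2) assms(3)] act_esrc[OF s(3) assms(3)] by auto
qed

section \<open>What the action does to newly glued cells\<close>

lemma new1_cells:
  assumes "reach w (X @ p @ Y)" "(map elab p, v) \<in> R" "flip p v = bots p v"
  shows "lcells (X @ bots p v @ Y) = insert (p, v) (lcells (X @ p @ Y)) \<and> (p, v) \<notin> lcells (X @ p @ Y)"
proof -
  have "config w (X @ bots p v @ Y) (insert (p, v) (lcells (X @ p @ Y)))"
    using config_step assms unfolding reach_def by blast
  moreover have "hd p \<in> set p" using assms(2) R_ne by (metis list.map_disc_iff list.set_sel(1))
  then have "(p, v) \<notin> lcells (X @ p @ Y)"
    using config_consumed[of w "X @ p @ Y" "lcells (X @ p @ Y)" p v "hd p"] assms(1) unfolding reach_def by auto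
  ultimately show ?thesis using config_cells by metis
qed

lemma remove_cells:
  assumes "reach w (X @ bots p u @ Y)" "u \<noteq> []"
  shows "lcells (X @ p @ Y) = lcells (X @ bots p u @ Y) - {(p, u)} \<and> (p, u) \<in> lcells (X @ bots p u @ Y)"
  using config_remove[of w "X @ bots p u @ Y" "lcells (X @ bots p u @ Y)" X p u Y] assms config_cells
  unfolding reach_def by metis

lemma newn_reach: "(new1 ^^ n) P Q \<Longrightarrow> reach w P \<Longrightarrow> reach w Q"
  using newn_flipn reach_flipn by blast

lemma newn_cells: "(new1 ^^ n) P Q \<Longrightarrow> reach w P \<Longrightarrow> lcells P \<subseteq> lcells Q \<and> card (lcells Q) = card (lcells P) + n"
proof (induction n arbitrary: Q)
  case (Suc n)
  then obtain Q' where Q': "(new1 ^^ n) P Q'" "new1 Q' Q" by auto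
  then have IH: "lcells P \<subseteq> lcells Q'" "card (lcells Q') = card (lcells P) + n" and r: "reach w Q'"
    using Suc newn_reach by blast+
  obtain X p Y v where *: "(map elab p, v) \<in> R" "flip p v = bots p v" "Q' = X @ p @ Y" "Q = X @ bots p v @ Y"
    using Q' unfolding new1_def by blast
  then have "lcells Q = insert (p, v) (lcells Q') \<and> (p, v) \<notin> lcells Q'" using new1_cells r by metis
  then show ?case using IH finite_lcells[of Q'] by auto
qed simp

lemma flipn_card: "(flip1 ^^ n) P Q \<Longrightarrow> reach w P \<Longrightarrow> card (lcells Q) \<le> card (lcells P) + n"
proof -
  assume a: "(flip1 ^^ n) P Q" "reach w P"
  have "(flip1 ^^ card (lcells P)) (base w) P" using up_whole[OF reach_base a(2)] newn_flipn
    by (metis card_Diff_subset config_base config_cells diff_zero card.empty finite.emptyI empty_subsetI)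
  then have "(flip1 ^^ (card (lcells P) + n)) (base w) Q" using a by (meson relpowp_trans)
  then show ?thesis using fdist_le fdist_base reach_flipn[OF a] by metis
qed

lemma flip1_card: "flip1 P Q \<Longrightarrow> reach w P \<Longrightarrow> card (lcells Q) \<le> Suc (card (lcells P))"
  using flipn_card[of "Suc 0" P Q w] by (simp add: OO_def)

text \<open>Otherwise the flip would be \<open>q\<close>, and \<open>q\<close> would occur in its
  own history.\<close>

lemma flip_bots_bots_ne: "u \<noteq> [] \<Longrightarrow> v \<noteq> [] \<Longrightarrow> flip (bots q u) v = bots (bots q u) v \<Longrightarrow> map elab q \<noteq> v"
proof
  assume a: "u \<noteq> []" "v \<noteq> []" "flip (bots q u) v = bots (bots q u) v" "map elab q = v"
  then have "q = bots (bots q u) v" by (simp add: flip_bots)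
  then have "lcells q = insert (bots q u, v) (insert (q, u) (lcells q))"
    using lcells_bots[of v "bots q u"] lcells_bots[of u q] a by metis
  then show False using not_in_lcells[of q u] by blast
qed

text \<open>The action commutes with the flip at \<open>p\<close>. In the image this flip either
  glues a new cell or cancels the cell whose bottom is the image of \<open>p\<close>.\<close>

lemma image_step:
  assumes S: "mor w0 w S" and r: "reach w (X @ p @ Y)" and R: "(map elab p, v) \<in> R" "flip p v = bots p v"
    and Q: "Q = X @ bots p v @ Y"
  shows "flip1 (map (act S) (X @ p @ Y)) (map (act S) Q) \<and>
    (flip (map (act S) p) v = bots (map (act S) p) v \<and> new1 (map (act S) (X @ p @ Y)) (map (act S) Q) \<and>
        lcells (map (act S) Q) = insert (map (act S) p, v) (lcells (map (act S) (X @ p @ Y))) \<and>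
        (map (act S) p, v) \<notin> lcells (map (act S) (X @ p @ Y)) \<or>
     (\<exists>p' u. u \<noteq> [] \<and> map (act S) p = bots p' u \<and> map elab p' = v \<and> (p', u) \<in> lcells (map (act S) (X @ p @ Y)) \<and>
        lcells (map (act S) Q) = lcells (map (act S) (X @ p @ Y)) - {(p', u)}))"
proof -
  let ?q = "map (act S) p"
  note sub = mor_lpath[OF S]
  obtain c d where cd: "okl w X" "okl w p" "okl w Y" "chain c p d"
    using reach_okpath[OF r] by (auto simp: okpath_def)
  have fl: "map (act S) (flip p v) = flip ?q v" using act_flip[OF sub cd(2) R(1) cd(4)] .
  have R': "(map elab ?q, v) \<in> R" using R map_act_elab[OF sub cd(2)] by simp
  have r': "reach w0 (map (act S) X @ ?q @ map (act S) Y)" using act_reach[OF S r] by simp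
  have e: "map (act S) Q = map (act S) X @ flip ?q v @ map (act S) Y" using fl R Q by simp
  have s: "flip1 (map (act S) (X @ p @ Y)) (map (act S) Q)" unfolding flip1_def using R' e by auto
  show ?thesis
  proof (cases rule: flip_cases[of ?q v])
    case 1
    then have "new1 (map (act S) (X @ p @ Y)) (map (act S) Q)" unfolding new1_def e using R' by auto
    then show ?thesis using s 1 e new1_cells[OF r' R' 1] by simp
  next
    case (2 p' u)
    have u: "u \<noteq> []" using R' R_ne 2 by fastforce
    then show ?thesis using s 2 e remove_cells[of w0 "map (act S) X" p' u "map (act S) Y"] r' by auto
  qed
qed

definition pushc :: "'a edge list \<Rightarrow> 'a edge list \<times> 'a list \<Rightarrow> 'a edge list \<times> 'a list" where
  "pushc S c = (map (act S) (fst c), snd c)"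

text \<open>A move changes the number of cells by one at most. If the image gains one cell per move
  on the whole, each single move must glue a new cell there.\<close>

lemma image_up:
  assumes S: "mor w0 w S" and P: "reach w P"
  shows "(new1 ^^ n) P Q \<Longrightarrow> card (lcells (map (act S) P)) + n \<le> card (lcells (map (act S) Q)) \<Longrightarrow>
    (new1 ^^ n) (map (act S) P) (map (act S) Q) \<and>
    lcells (map (act S) Q) = lcells (map (act S) P) \<union> pushc S ` (lcells Q - lcells P) \<and>
    (\<forall>c\<in>lcells Q - lcells P. flip (map (act S) (fst c)) (snd c) = bots (map (act S) (fst c)) (snd c))"
proof (induction n arbitrary: Q)
  case (Suc n)
  then obtain Q' where Q': "(new1 ^^ n) P Q'" "new1 Q' Q" by auto
  then have r: "reach w Q'" and lPQ': "lcells P \<subseteq> lcells Q'" using P newn_reach newn_cells by blast+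
  obtain X p Y v where *: "(map elab p, v) \<in> R" "flip p v = bots p v" "Q' = X @ p @ Y" "Q = X @ bots p v @ Y"
    using Q' unfolding new1_def by blast
  have lQ: "lcells Q = insert (p, v) (lcells Q') \<and> (p, v) \<notin> lcells Q'" using new1_cells r * by metis
  have rS: "reach w0 (map (act S) P)" "reach w0 (map (act S) Q')" using act_reach[OF S] P r by auto
  have "(flip1 ^^ n) (map (act S) P) (map (act S) Q')"
    using flipn_act[OF mor_lpath[OF S] reach_okpath[OF P]] newn_flipn Q' by blast
  then have c1: "card (lcells (map (act S) Q')) \<le> card (lcells (map (act S) P)) + n" using flipn_card rS by blast
  note im = image_step[OF S r[unfolded *(3)] *(1,2,4), folded *(3)]
  have "card (lcells (map (act S) Q)) \<le> Suc (card (lcells (map (act S) Q')))"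
    using im flip1_card rS(2) by blast
  then have "card (lcells (map (act S) P)) + n \<le> card (lcells (map (act S) Q'))" using Suc.prems(2) by simp
  note IH = Suc.IH[OF Q'(1) this]
  have up: "flip (map (act S) p) v = bots (map (act S) p) v \<and> new1 (map (act S) Q') (map (act S) Q) \<and>
        lcells (map (act S) Q) = insert (map (act S) p, v) (lcells (map (act S) Q'))"
  proof (rule ccontr)
    assume "\<not> ?thesis"
    then obtain c where "c \<in> lcells (map (act S) Q')" "lcells (map (act S) Q) = lcells (map (act S) Q') - {c}" using im by blast
    then have "card (lcells (map (act S) Q)) < card (lcells (map (act S) Q'))"
      using finite_lcells by (metis card_Diff1_less)
    then show False using c1 Suc.prems(2) by simp
  qed
  have "lcells Q - lcells P = insert (p, v) (lcells Q' - lcells P)" using lQ lPQ' by auto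
  then show ?case using IH up by (auto simp: pushc_def intro: relpowp_Suc_I)
qed simp

text \<open>Take the first cell whose image cancels some \<open>(p', u)\<close>. If
  \<open>(p', u)\<close> came from a cell glued after \<open>P\<close>, injectivity of the action
  would make the two cells cancel before \<open>S\<close> is applied. So \<open>(p', u)\<close> was
  there from the start with its bottom on the image of \<open>P\<close>, and injectivity puts the
  cancelling segment \<open>p\<close> on \<open>P\<close> itself.\<close>

lemma image_down_closed:
  assumes S: "mor w0 w S" and P: "reach w P"
  shows "(new1 ^^ n) P Q \<Longrightarrow> \<not> card (lcells (map (act S) P)) + n \<le> card (lcells (map (act S) Q)) \<Longrightarrow>
    \<exists>p v p' u. (p, v) \<in> lcells Q - lcells P \<and> set p \<subseteq> set P \<and> u \<noteq> [] \<and> map (act S) p = bots p' u \<and>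
      map elab p' = v \<and> (p', u) \<in> lcells (map (act S) P)"
proof (induction n arbitrary: Q)
  case (Suc n)
  then obtain Q' where Q': "(new1 ^^ n) P Q'" "new1 Q' Q" by auto
  then have r: "reach w Q'" and lPQ': "lcells P \<subseteq> lcells Q'" using P newn_reach newn_cells by blast+
  obtain X p Y v where *: "(map elab p, v) \<in> R" "flip p v = bots p v" "Q' = X @ p @ Y" "Q = X @ bots p v @ Y"
    using Q' unfolding new1_def by blast
  have lQ: "lcells Q = insert (p, v) (lcells Q') \<and> (p, v) \<notin> lcells Q'" using new1_cells r * by metis
  show ?case
  proof (cases "card (lcells (map (act S) P)) + n \<le> card (lcells (map (act S) Q'))")
    case False
    then show ?thesis using Suc.IH[OF Q'(1)] lQ by blast
  next
    case True
    note up = image_up[OF S P Q'(1) True]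
    have rS: "reach w0 (map (act S) P)" "reach w0 (map (act S) Q')" using act_reach[OF S] P r by auto
    note im = image_step[OF S r[unfolded *(3)] *(1,2,4), folded *(3)]
    have v: "v \<noteq> []" using * R_ne2 by blast
    have "\<not> (lcells (map (act S) Q) = insert (map (act S) p, v) (lcells (map (act S) Q')) \<and>
        (map (act S) p, v) \<notin> lcells (map (act S) Q'))"
    proof
      assume a: "lcells (map (act S) Q) = insert (map (act S) p, v) (lcells (map (act S) Q')) \<and>
        (map (act S) p, v) \<notin> lcells (map (act S) Q')"
      then have "card (lcells (map (act S) Q)) = Suc (card (lcells (map (act S) Q')))" by (simp add: finite_lcells card_insert_disjoint)
      then show False using Suc.prems(2) True by simp
    qed
    then obtain p' u where pu: "u \<noteq> []" "map (act S) p = bots p' u" "map elab p' = v" "(p', u) \<in> lcells (map (act S) Q')"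
      using im by blast
    have okQ': "okl w Q'" using r reach_okl by blast
    then have okp: "okl w p" using * by auto
    have c: "(p', u) \<in> lcells (map (act S) P)"
    proof (rule ccontr)
      assume "(p', u) \<notin> lcells (map (act S) P)"
      then obtain c where c: "c \<in> lcells Q' - lcells P" "(p', u) = pushc S c" using pu(4) up by auto
      obtain q v' where qv: "c = (q, v')" by fastforce
      have cq: "cellok w (q, v')" using c qv r config_cellok unfolding reach_def by blast
      then have okq: "okl w q" "v' \<noteq> []" by (auto simp: cellok_def)
      have p'q: "p' = map (act S) q" "u = v'" using c qv by (auto simp: pushc_def)
      have "flip (map (act S) q) v' = bots (map (act S) q) v'" using up c qv by (metis fst_conv snd_conv)
      then have "map (act S) (bots q v') = bots p' u" using p'q by (auto intro!: nth_equalityI)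
      moreover have "okl w (bots q v')" using cq flip_ok[of w q v'] by (auto simp: cellok_def)
      ultimately have "p = bots q v'" using pu(2) act_inj[OF S okp] by metis
      moreover have "map elab q = v" using p'q pu(3) map_act_elab[OF mor_lpath[OF S] okq(1)] by simp
      ultimately show False using *(2) flip_bots_bots_ne[OF okq(2) v, of q] by blast
    qed
    have "set (bots p' u) \<subseteq> set (map (act S) P)"
    proof
      fix e assume e: "e \<in> set (bots p' u)"
      have "e \<in> set (map (act S) Q')" using e pu(2) *(3) by auto
      then have "\<forall>(p, v)\<in>lcells (map (act S) Q'). e \<notin> set p" using config_consumed rS unfolding reach_def by blast
      moreover have "lcells (map (act S) P) \<subseteq> lcells (map (act S) Q')" using up by blast
      ultimately have "\<forall>(p, v)\<in>lcells (map (act S) P). e \<notin> set p" by blast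
      then show "e \<in> set (map (act S) P)"
        using config_set[of w0 "map (act S) P" "lcells (map (act S) P)"] rS(1) c e unfolding reach_def by blast
    qed
    moreover have "e \<in> set P" if ep: "e \<in> set p" "act S e \<in> set (map (act S) P)" for e
    proof -
      obtain f where f: "f \<in> set P" "act S e = act S f" using ep by auto
      have "okl w [e]" "okl w [f]" using that f okp reach_okl[OF P] by (auto simp: okl_def)
      then have "[e] = [f]" using act_inj[OF S, of "[e]" "[f]"] f by simp
      then show ?thesis using f by simp
    qed
    ultimately have "set p \<subseteq> set P" using pu(2) by (metis image_eqI list.set_map subset_code(1))
    moreover have "(p, v) \<in> lcells Q - lcells P" using lQ lPQ' by blast
    ultimately show ?thesis using pu c by blast
  qed
qed simp

text \<open>The history of \<open>z\<close> is down-closed and so belongs to a path. This path, the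
  gate of \<open>z\<close>, has the fewest cells among all paths through \<open>z\<close>, and its
  cells occur in each of them.\<close>

lemma gate_ex:
  assumes "reach w P" "z \<in> vset P"
  shows "\<exists>G. reach w G \<and> lcells G = vcells z \<and> z \<in> vset G"
proof -
  have "down_closed (vcells z)" unfolding down_closed_def using vcells_down_closed by (metis prod.collapse)
  moreover have s: "vcells z \<subseteq> lcells P" using vset_cells assms by blast
  ultimately obtain G where G: "reach w G" "lcells G = vcells z" using reach_lpath[OF assms(1)] by blast
  have "z \<in> vset G" by (rule reach_vset_mono[OF G(1) assms(1) _ assms(2)]) (use G s in auto)
  then show ?thesis using G by blast
qed

lemma fixed_hereditary:
  assumes "\<And>p v j. (p, v) \<in> V \<Longrightarrow> j < length v \<Longrightarrow> act S (New p v j) = New (map (act S) p) v j"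
  shows "ok w e \<Longrightarrow> ecells e \<subseteq> V \<Longrightarrow> act S e = e \<Longrightarrow> c \<in> ecells e \<Longrightarrow> f \<in> set (fst c) \<Longrightarrow> act S f = f"
proof (induction e rule: ok.induct)
  case (ok_New p v j)
  have "(p, v) \<in> V" using ok_New.prems(1) by auto
  then have "map (act S) p = p" using assms[of p v j] ok_New by simp
  then have fp: "\<forall>f\<in>set p. act S f = f" by (rule map_fixed)
  show ?case
  proof (cases "c = (p, v)")
    case True
    then show ?thesis using fp ok_New.prems by auto
  next
    case False
    then obtain e' where e': "e' \<in> set p" "c \<in> ecells e'" using ok_New.prems by (auto simp: lcells_def)
    then have "ecells e' \<subseteq> V" using ok_New.prems by (auto simp: lcells_def)
    then show ?thesis using ok_New.IH e' fp ok_New.prems by blast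
  qed
qed simp

text \<open>The gate of a fixed vertex has minimal displacement, so every cell below it stays a new cell
  under the action; the fixed vertex then forces these cells to be fixed.\<close>

lemma fixed_vertex_gate:
  assumes S: "mor w w S" and m: "min_disp w S" and P: "reach w P" "z \<in> vset P" and z: "actv S z = z"
  shows "\<exists>G. reach w G \<and> z \<in> vset G \<and> lcells G = vcells z \<and> fdist G (map (act S) G) = card (lcells S) \<and>
     (\<forall>c\<in>vcells z. \<forall>f\<in>set (fst c). act S f = f)"
proof -
  obtain G where G: "reach w G" "lcells G = vcells z" "z \<in> vset G" using gate_ex P by blast
  let ?G = "map (act S) G" and ?k = "card (lcells G)"
  have rG: "reach w ?G" using act_reach S G by blast
  \<comment> \<open>The image of the gate passes through the fixed vertex and hence contains all
    cells of the gate. Its displacement is therefore a difference of two cell counts, which is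
    bounded above by \<open>card (lcells S)\<close>, and minimality bounds it below.\<close>
  have "z \<in> vset ?G" using act_vset[OF S G(1,3)] z by simp
  then have sub: "lcells G \<subseteq> lcells ?G" using vset_cells[OF rG] G by blast
  have b: "lcells (base w) = {}" by (auto simp: lcells_def in_set_sbase)
  have "fdist G ?G = card (lcells ?G) - ?k"
    using fdist_cdist[OF G(1) rG] sub by (simp add: cdist_def finite_lcells card_Diff_subset Diff_eq_empty_iff[THEN iffD2])
  moreover have "?k \<le> card (lcells ?G)" using sub card_mono finite_lcells by blast
  moreover have up: "(new1 ^^ ?k) (base w) G" using up_whole[OF reach_base G(1)] b by simp
  moreover have Sb: "map (act S) (base w) = S" using mor_act_base S by blast
  moreover have rS: "reach w S" using S by (simp add: mor_def)
  moreover have "(flip1 ^^ ?k) S ?G" using flipn_act[OF mor_lpath[OF S] reach_okpath[OF reach_base]] newn_flipn up Sb by metis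
  then have "card (lcells ?G) \<le> card (lcells S) + ?k" using flipn_card rS by blast
  moreover have "card (lcells S) \<le> fdist G ?G" using m G unfolding min_disp_def by blast
  ultimately have e: "fdist G ?G = card (lcells S)" "card (lcells ?G) = card (lcells S) + ?k" by linarith+
  note im = image_up[OF S reach_base up, unfolded Sb]
  have new: "\<forall>c\<in>lcells G. flip (map (act S) (fst c)) (snd c) = bots (map (act S) (fst c)) (snd c)"
    using im e b by simp
  have act_new: "act S (New p v j) = New (map (act S) p) v j" if "(p, v) \<in> vcells z" "j < length v" for p v j
    using new that G by fastforce
  have "\<forall>c\<in>vcells z. \<forall>f\<in>set (fst c). act S f = f"
  proof (cases z)
    case (VNew p v j)
    have pv: "(p, v) \<in> vcells z" using VNew by simp
    have "z \<in> {VNew p v j | p v j. (p, v) \<in> lcells G \<and> 0 < j \<and> j < length v}"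
      using config_vset[of w G "lcells G"] G VNew unfolding reach_def by auto
    then have j: "0 < j" "j < length v" using VNew by auto
    \<comment> \<open>The cell that makes \<open>z\<close> stays new in the image, so the fixed
      vertex is compared with its image as a term and the top \<open>p\<close> must be
      fixed.\<close>
    have "flip (map (act S) p) v = bots (map (act S) p) v" using new pv G by fastforce
    then have "VNew (map (act S) p) v j = VNew p v j" using z VNew j by (simp add: actv.simps)
    then have mp: "map (act S) p = p" by simp
    then have fp: "\<forall>f\<in>set p. act S f = f" by (rule map_fixed)
    have okp: "okl w p" using config_cellok[of w G "lcells G" "(p, v)"] G pv unfolding reach_def cellok_def by auto
    show ?thesis
    proof (intro ballI)
      fix c f assume c: "c \<in> vcells z" "f \<in> set (fst c)"
      show "act S f = f"
      proof (cases "c = (p, v)")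
        case True
        then show ?thesis using fp c by auto
      next
        case False
        then obtain e where e: "e \<in> set p" "c \<in> ecells e" using c VNew by (auto simp: lcells_def)
        moreover have "ecells e \<subseteq> vcells z" using e VNew by (auto simp: lcells_def)
        moreover have "ok w e" using okp e by (auto simp: okl_def)
        ultimately show ?thesis using fixed_hereditary[of "vcells z" S w e c f] act_new fp c by blast
      qed
    qed
  qed simp
  then show ?thesis using G e by blast
qed

text \<open>The cells of the gate use up fixed edges only, so a moved base edge is still on
  it.\<close>

lemma nonfixed_in_gate:
  assumes "reach w G" "lcells G = vcells z" "\<forall>c\<in>vcells z. \<forall>f\<in>set (fst c). act S f = f"
    "e \<in> set (base w)" "act S e \<noteq> e"
  shows "e \<in> set G"
proof -
  have "e \<notin> (\<Union>(p, v)\<in>lcells G. set p)" using assms by fastforce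
  then show ?thesis using config_set[of w G "lcells G"] assms unfolding reach_def by blast
qed

lemma chain_split_two:
  assumes "chain (VBase 0) G b" "okl w G" "z \<in> vset G" "z' \<in> vset G"
  shows "xpos z < xpos z' \<Longrightarrow> \<exists>E1 E2 E3. G = E1 @ E2 @ E3 \<and> chain (VBase 0) E1 z \<and> chain z E2 z' \<and> chain z' E3 b \<and> E2 \<noteq> []"
    and "xpos z = xpos z' \<Longrightarrow> z = z'"
proof -
  have *: "(\<exists>E1 E2 E3. G = E1 @ E2 @ E3 \<and> chain (VBase 0) E1 z \<and> chain z E2 z' \<and> chain z' E3 b) \<or>
      (\<exists>E1 E2 E3. G = E1 @ E2 @ E3 \<and> chain (VBase 0) E1 z' \<and> chain z' E2 z \<and> chain z E3 b)"
  proof -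
    obtain A Y where 1: "G = A @ Y" "chain (VBase 0) A z" "chain z Y b" using chain_split_vertex assms by blast
    obtain A' Y' where 2: "G = A' @ Y'" "chain (VBase 0) A' z'" "chain z' Y' b" using chain_split_vertex assms by blast
    obtain U where "A = A' @ U \<and> U @ Y = Y' \<or> A @ U = A' \<and> Y = U @ Y'"
      using 1(1) 2(1) append_eq_append_conv2[of A Y A' Y'] by metis
    then show ?thesis
    proof
      assume U: "A = A' @ U \<and> U @ Y = Y'"
      then have "chain z' U z" using 1 2 chain_unique_end by (metis chain_append)
      then show ?thesis using U 1 2 by (metis append.assoc)
    next
      assume U: "A @ U = A' \<and> Y = U @ Y'"
      then have "chain z U z'" using 1 2 chain_unique_end by (metis chain_append)
      then show ?thesis using U 1 2 by (metis append.assoc)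
    qed
  qed
  have x: "xpos a < xpos c \<or> E = []" if "chain a E c" "G = E1 @ E @ E3" for a c E E1 E3
    using chain_x_less[of a E c w] that assms(2) by auto
  show "z = z'" if "xpos z = xpos z'" using * x that by (metis chain.simps(1) less_irrefl)
  show "\<exists>E1 E2 E3. G = E1 @ E2 @ E3 \<and> chain (VBase 0) E1 z \<and> chain z E2 z' \<and> chain z' E3 b \<and> E2 \<noteq> []" if lt: "xpos z < xpos z'"
    using *
  proof
    assume "\<exists>E1 E2 E3. G = E1 @ E2 @ E3 \<and> chain (VBase 0) E1 z \<and> chain z E2 z' \<and> chain z' E3 b"
    then obtain E1 E2 E3 where E: "G = E1 @ E2 @ E3 \<and> chain (VBase 0) E1 z \<and> chain z E2 z' \<and> chain z' E3 b" by blast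
    moreover have "E2 \<noteq> []" using E lt by auto
    ultimately show ?thesis by blast
  next
    assume "\<exists>E1 E2 E3. G = E1 @ E2 @ E3 \<and> chain (VBase 0) E1 z' \<and> chain z' E2 z \<and> chain z E3 b"
    then obtain E1 E2 E3 where E: "G = E1 @ E2 @ E3" "chain z' E2 z" by blast
    then have "xpos z' < xpos z \<or> E2 = []" using x by blast
    then show ?thesis using lt E by auto
  qed
qed

text \<open>Displacements add up over the two sides of a fixed vertex. If one of the left parts were
  displaced less than the other, exchanging them at \<open>z\<close> would give a path displaced by
  less than the minimum.\<close>

lemma min_disp_left_eq:
  assumes S: "mor w w S" and m: "min_disp w S"
    and P: "reach w (P1 @ P2)" "chain (VBase 0) P1 z" "fdist (P1 @ P2) (map (act S) (P1 @ P2)) = card (lcells S)"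
    and Q: "reach w (Q1 @ Q2)" "chain (VBase 0) Q1 z" "fdist (Q1 @ Q2) (map (act S) (Q1 @ Q2)) = card (lcells S)"
    and z: "actv S z = z"
  shows "fdist P1 (map (act S) P1) = fdist Q1 (map (act S) Q1)"
proof -
  have *: "fdist P1 (map (act S) P1) \<le> fdist Q1 (map (act S) Q1)"
    if P: "reach w (P1 @ P2)" "chain (VBase 0) P1 z" "fdist (P1 @ P2) (map (act S) (P1 @ P2)) = card (lcells S)"
    and Q: "reach w (Q1 @ Q2)" "chain (VBase 0) Q1 z" "fdist (Q1 @ Q2) (map (act S) (Q1 @ Q2)) = card (lcells S)"
    for P1 P2 Q1 Q2
  proof -
    have "\<exists>n. (flip1 ^^ n) P1 Q1" using geo_split[OF P(1) Q(1) P(2) Q(2)] by blast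
    then have r: "reach w (Q1 @ P2)" using flipn_context[of _ P1 Q1 "[]" P2] reach_flipn P(1) by fastforce
    have "fdist (P1 @ P2) (map (act S) P1 @ map (act S) P2) = fdist P1 (map (act S) P1) + fdist P2 (map (act S) P2)"
      using fdist_split[of w P1 P2 "map (act S) P1" "map (act S) P2" z] P act_reach[OF S P(1)] act_chain0[OF S P(1,2)] z
      by simp
    moreover have "fdist (Q1 @ P2) (map (act S) Q1 @ map (act S) P2) = fdist Q1 (map (act S) Q1) + fdist P2 (map (act S) P2)"
      using fdist_split[of w Q1 P2 "map (act S) Q1" "map (act S) P2" z] Q r act_reach[OF S r] act_chain0[OF S r Q(2)] z
      by simp
    moreover have "card (lcells S) \<le> fdist (Q1 @ P2) (map (act S) (Q1 @ P2))" using m r unfolding min_disp_def by blast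
    ultimately show ?thesis using P(3) by simp
  qed
  show ?thesis using *[OF P Q] *[OF Q P] by simp
qed

text \<open>Compare the path with the one in which everything up to \<open>z'\<close> is replaced by
  its image. Splitting this distance at \<open>z'\<close> and at \<open>z\<close> must give the same
  number, and \<open>eq\<close> then leaves no distance for the part after \<open>z\<close>.\<close>

lemma left_eq_fixed:
  assumes S: "mor w w S"
    and G: "reach w (E1 @ E2 @ E3)" "chain (VBase 0) E1 z" "chain z E2 z'"
    and z: "actv S z = z" "actv S z' = z'"
    and eq: "fdist E1 (map (act S) E1) = fdist (E1 @ E2) (map (act S) (E1 @ E2))"
  shows "map (act S) E2 = E2"
proof -
  let ?g = "map (act S)"
  have c: "chain (VBase 0) (E1 @ E2) z'" using G by auto
  have c': "chain (VBase 0) (?g E1) z" "chain (VBase 0) (?g E1 @ ?g E2) z'"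
    using act_chain0[OF S G(1,2)] act_chain0[OF S, of "E1 @ E2" E3 z'] c G z by auto
  have s: "(flip1 ^^ fdist (E1 @ E2) (?g (E1 @ E2))) (E1 @ E2) (?g (E1 @ E2))"
    using fdist_split[of w "E1 @ E2" E3 "?g E1 @ ?g E2" "?g E3" z'] act_reach[OF S G(1)] G(1) c c' by simp
  have r: "reach w (?g E1 @ ?g E2 @ E3)" using flipn_context[OF s, of "[]" E3] reach_flipn G(1) by fastforce
  have d1: "fdist (E1 @ E2 @ E3) (?g E1 @ ?g E2 @ E3) = fdist (E1 @ E2) (?g E1 @ ?g E2)"
    using fdist_split[of w "E1 @ E2" E3 "?g E1 @ ?g E2" E3 z'] r G(1) c c' by simp
  have d2: "fdist (E1 @ E2 @ E3) (?g E1 @ ?g E2 @ E3) = fdist E1 (?g E1) + fdist (E2 @ E3) (?g E2 @ E3) \<and>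
      (flip1 ^^ fdist (E2 @ E3) (?g E2 @ E3)) (E2 @ E3) (?g E2 @ E3)"
    using fdist_split[of w E1 "E2 @ E3" "?g E1" "?g E2 @ E3" z] r G c' by simp
  have "fdist (E2 @ E3) (?g E2 @ E3) = 0" using d1 d2 eq by simp
  then show ?thesis using fdist_0 d2 by fastforce
qed

lemma esrc_vset: "chain (VBase 0) P b \<Longrightarrow> e \<in> set P \<Longrightarrow> esrc e \<in> vset P"
proof -
  assume a: "chain (VBase 0) P b" "e \<in> set P"
  then obtain X Y where P: "P = X @ e # Y" by (auto dest: split_list)
  then have "chain (VBase 0) X (esrc e)" using a by auto
  then show ?thesis using chain_vertex_in a P by metis
qed

lemma commute_act:
  assumes "mor w w S" "mor w w T" "map (act S) T = map (act T) S" "okl w P"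
  shows "map (act S) (map (act T) P) = map (act T) (map (act S) P)"
  using mor_act_act[OF assms(1,2,4)] mor_act_act[OF assms(2,1,4)] assms(3) by simp

lemma minv_commute:
  assumes S: "mor w w S" and T: "mor w w T" and c: "map (act S) T = map (act T) S"
  shows "map (act S) (minv w T) = map (act (minv w T)) S"
proof -
  have T': "mor w w (minv w T)" and e: "map (act T) (minv w T) = base w" using minv[OF T] by auto
  have ok: "okl w (minv w T)" "okl w S" "okl w (map (act S) (minv w T))"
    using T' S mor_comp[OF S T'] reach_okl unfolding mor_def by blast+
  have "map (act T) (map (act S) (minv w T)) = map (act S) (map (act T) (minv w T))"
    using commute_act[OF S T c ok(1)] by simp
  also have "\<dots> = S" using e mor_act_base[OF S] by simp
  finally show ?thesis using minv_act[OF T ok(3)] by simp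
qed

text \<open>The image of the vertex under \<open>T\<close> is fixed by \<open>S\<close> as well. Its
  gate has minimal displacement and contains the moved edge \<open>f\<close>, hence also the vertex
  itself. The parts of the gate to the left of these two vertices are displaced equally, since
  \<open>T\<close> is an isometry commuting with \<open>S\<close>. So the segment between them is
  fixed and cannot contain \<open>f\<close>.\<close>

lemma commute_moves:
  assumes S: "mor w w S" and m: "min_disp w S" and T: "mor w w T" and com: "map (act S) T = map (act T) S"
    and i: "0 < i" "i < length w" and z: "actv S (VBase i) = VBase i"
    and f: "f \<in> set (base w)" "act S f \<noteq> f"
  shows "(esrc f = VBase i \<longrightarrow> xpos (actv T (VBase i)) \<le> xpos (VBase i :: 'a vertex)) \<and>
    (etgt f = VBase i \<longrightarrow> xpos (VBase i :: 'a vertex) \<le> xpos (actv T (VBase i))) \<and>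
    (esrc f = VBase i \<or> etgt f = VBase i \<longrightarrow>
      (\<exists>G. reach w G \<and> VBase i \<in> vset G \<and> actv T (VBase i) \<in> vset G))"
proof -
  let ?g = "map (act S)" and ?z = "VBase i :: 'a vertex" and ?z' = "actv T (VBase i)"
  let ?W1 = "sbase 0 (take i w)" and ?W2 = "sbase i (drop i w)"
  have W: "base w = ?W1 @ ?W2" using sbase_append[of 0 "take i w" "drop i w"] i by simp
  have cW: "chain (VBase 0) ?W1 ?z" using i by simp
  let ?e = "Base (i - 1) (w ! (i - 1)) :: 'a edge"
  have oke: "ok w ?e" using i by (auto simp: ok_Base_iff)
  have ze: "?z = etgt ?e" using i by simp
  have z': "actv S ?z' = ?z'"
    using actv_act(1)[OF S T oke, folded ze] actv_act(1)[OF T S oke, folded ze] com z by metis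
  have rT: "reach w T" "T = map (act T) ?W1 @ map (act T) ?W2"
    using T mor_act_base[OF T] W by (auto simp: mor_def) 
  have cT: "chain (VBase 0) (map (act T) ?W1) ?z'" using act_chain0[OF T, of ?W1 ?W2 ?z] W cW by (metis reach_base)
  have z'T: "?z' \<in> vset T" using chain_vertex_in[of "map (act T) ?W1" "map (act T) ?W2" "VBase (length w)" ?z'] reach_chain[OF rT(1)] cT
    unfolding rT(2)[symmetric] by blast
  obtain G where G: "reach w G" "?z' \<in> vset G" "lcells G = vcells ?z'" "fdist G (?g G) = card (lcells S)"
      "\<forall>c\<in>vcells ?z'. \<forall>f\<in>set (fst c). act S f = f"
    using fixed_vertex_gate[OF S m rT(1) z'T z'] by blast
  have fG: "f \<in> set G" using nonfixed_in_gate[OF G(1,3,5) f] .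
  have okG: "okl w G" and chG: "chain (VBase 0) G (VBase (length w))" using reach_okl reach_chain G by auto
  have disp_base: "fdist (base w) (?g (base w)) = card (lcells S)"
    using mor_act_base[OF S] fdist_base S unfolding mor_def by metis
  have okT: "okl w T" "okl w S" using rT(1) S reach_okl unfolding mor_def by blast+
  have disp_T: "fdist T (?g T) = card (lcells S)"
    using com fdist_act_reach[OF T reach_base, of S] mor_act_base[OF T] S fdist_base unfolding mor_def by metis
  have left: "fdist ?W1 (?g ?W1) = fdist A (?g A)" if "G = A @ B" "chain (VBase 0) A ?z" for A B
  proof -
    have rW: "reach w (?W1 @ ?W2)" using W by (metis reach_base)
    have dW: "fdist (?W1 @ ?W2) (?g (?W1 @ ?W2)) = card (lcells S)" using disp_base W by metis
    have "reach w (A @ B)" "fdist (A @ B) (?g (A @ B)) = card (lcells S)" using G that by blast+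
    then show ?thesis using min_disp_left_eq[OF S m rW cW dW _ that(2) _ z] by blast
  qed
  have WW: "fdist ?W1 (?g ?W1) = fdist (map (act T) ?W1) (?g (map (act T) ?W1))"
  proof -
    have "okpath w (VBase 0) (base w) (VBase (length w))" using reach_okpath by auto
    then have g1: "okpath w (VBase 0) ?W1 ?z" using W cW by (auto simp: okpath_def)
    have "(flip1 ^^ fdist ?W1 (?g ?W1)) ?W1 (?g ?W1)"
      using fdist_split[of w ?W1 ?W2 "?g ?W1" "?g ?W2" ?z] W cW act_chain0[OF S, of ?W1 ?W2 ?z] z act_reach[OF S, of "base w"]
      by (metis map_append reach_base)
    then have "fdist (map (act T) ?W1) (map (act T) (?g ?W1)) = fdist ?W1 (?g ?W1)"
      using fdist_act[OF T g1] by blast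
    then show ?thesis using commute_act[OF S T com, of ?W1] g1 by (simp add: okpath_def)
  qed
  have left': "fdist ?W1 (?g ?W1) = fdist A (?g A)" if "G = A @ B" "chain (VBase 0) A ?z'" for A B
  proof -
    have "reach w (A @ B)" "fdist (A @ B) (?g (A @ B)) = card (lcells S)" using G that by blast+
    moreover have "reach w (map (act T) ?W1 @ map (act T) ?W2)" using rT by metis
    moreover have "fdist (map (act T) ?W1 @ map (act T) ?W2) (?g (map (act T) ?W1 @ map (act T) ?W2)) = card (lcells S)"
      using rT(2) disp_T by metis
    ultimately have "fdist (map (act T) ?W1) (?g (map (act T) ?W1)) = fdist A (?g A)"
      using min_disp_left_eq[OF S m _ cT _ _ that(2) _ z'] by blast
    then show ?thesis using WW by (rule trans[rotated])
  qed
  have A: "xpos ?z' \<le> xpos ?z" if s: "esrc f = ?z"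
  proof (rule ccontr)
    assume "\<not> xpos ?z' \<le> xpos ?z"
    moreover have "?z \<in> vset G" using esrc_vset[OF chG fG] s by simp
    ultimately obtain E1 E2 E3 where E: "G = E1 @ E2 @ E3" "chain (VBase 0) E1 ?z" "chain ?z E2 ?z'" "E2 \<noteq> []"
      using chain_split_two(1)[OF chG okG, of ?z ?z'] G(2) by auto
    have "fdist E1 (?g E1) = fdist (E1 @ E2) (?g (E1 @ E2))"
      using left[of E1 "E2 @ E3"] left'[of "E1 @ E2" E3] E by auto
    then have "?g E2 = E2" using left_eq_fixed[OF S, of E1 E2 E3 ?z ?z'] G(1) E z z' by simp
    moreover have "hd E2 = f" using chain_same_src[OF chG okG, of "hd E2" f] E fG s chain_hd[OF E(3,4)] by auto
    then have "f \<in> set E2" using E(4) by auto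
    ultimately show False using f(2) by (metis in_set_conv_nth nth_map)
  qed
  have B: "xpos ?z \<le> xpos ?z'" if s: "etgt f = ?z"
  proof (rule ccontr)
    assume "\<not> xpos ?z \<le> xpos ?z'"
    moreover have "?z \<in> vset G" using fG s unfolding vset_def by (metis image_eqI insertCI)
    ultimately obtain E1 E2 E3 where E: "G = E1 @ E2 @ E3" "chain (VBase 0) E1 ?z'" "chain ?z' E2 ?z" "E2 \<noteq> []"
      using chain_split_two(1)[OF chG okG, of ?z' ?z] G(2) by auto
    have "fdist E1 (?g E1) = fdist (E1 @ E2) (?g (E1 @ E2))"
      using left'[of E1 "E2 @ E3"] left[of "E1 @ E2" E3] E by auto
    then have "?g E2 = E2" using left_eq_fixed[OF S, of E1 E2 E3 ?z' ?z] G(1) E z z' by simp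
    moreover have "last E2 = f" using chain_same_tgt[OF chG okG, of "last E2" f] E fG s chain_last[OF E(3,4)] by auto
    then have "f \<in> set E2" using E(4) by auto
    ultimately show False using f(2) by (metis in_set_conv_nth nth_map)
  qed
  have "?z \<in> vset G" if "esrc f = ?z \<or> etgt f = ?z"
    using that esrc_vset[OF chG fG] fG unfolding vset_def by (metis image_eqI insertCI)
  then show ?thesis using A B G by blast
qed

text \<open>Neither \<open>T\<close> nor its inverse moves the vertex across \<open>f\<close>. As
  the action preserves left and right, the inverse would move the vertex in the opposite direction;
  so neither of them moves it.\<close>

lemma commute_fixes:
  assumes S: "mor w w S" and m: "min_disp w S" and T: "mor w w T" and com: "map (act S) T = map (act T) S"
    and i: "0 < i" "i < length w" and z: "actv S (VBase i) = VBase i"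
    and f: "f \<in> set (base w)" "act S f \<noteq> f" "esrc f = VBase i \<or> etgt f = VBase i"
  shows "actv T (VBase i) = VBase i"
proof -
  let ?z = "VBase i :: 'a vertex" and ?z' = "actv T (VBase i)" and ?T = "minv w T"
  have T': "mor w w ?T" and e: "map (act ?T) T = base w" using minv[OF T] by auto
  have com': "map (act S) ?T = map (act ?T) S" using minv_commute[OF S T com] .
  note M = commute_moves[OF S m T com i z f(1,2)] and M' = commute_moves[OF S m T' com' i z f(1,2)]
  let ?e = "Base (i - 1) (w ! (i - 1)) :: 'a edge"
  have oke: "ok w ?e" and ze: "?z = etgt ?e" using i by (auto simp: ok_Base_iff)
  have b: "actv (base w) ?z = ?z" using i by (simp add: actv.simps)
  have bk: "actv ?T ?z' = ?z" using actv_act(1)[OF T' T oke, folded ze] e b by metis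
  obtain G where G: "reach w G" "?z \<in> vset G" "?z' \<in> vset G" using M f(3) by blast
  have chG: "chain (VBase 0) G (VBase (length w))" and okG: "okl w G" using G reach_chain reach_okl by auto
  have *: "xpos (actv ?T u) < xpos (actv ?T v)" if uv: "xpos u < xpos v" "u \<in> vset G" "v \<in> vset G" for u v
  proof -
    obtain E1 E2 E3 where E: "G = E1 @ E2 @ E3" "chain u E2 v" "E2 \<noteq> []"
      using chain_split_two(1)[OF chG okG uv(2,3,1)] by blast
    have "okl w E2" using okG E by auto
    then have "chain (actv ?T u) (map (act ?T) E2) (actv ?T v)" "okl w (map (act ?T) E2)"
      using map_act_chain[OF mor_lpath[OF T']] map_act_okl[OF mor_lpath[OF T']] E by blast+
    then show ?thesis using chain_x_less E by blast
  qed
  have "\<not> xpos ?z' < xpos ?z"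
  proof
    assume a: "xpos ?z' < xpos ?z"
    then have s: "esrc f = ?z" using M f(3) by (meson not_less)
    have "xpos ?z < xpos (actv ?T ?z)" using *[OF a G(3,2)] bk by simp
    then show False using M' s by (meson not_less)
  qed
  moreover have "\<not> xpos ?z < xpos ?z'"
  proof
    assume a: "xpos ?z < xpos ?z'"
    then have s: "etgt f = ?z" using M f(3) by (meson not_less)
    have "xpos (actv ?T ?z) < xpos ?z" using *[OF a G(2,3)] bk by simp
    then show False using M' s by (meson not_less)
  qed
  ultimately have "xpos ?z = xpos ?z'" by linarith
  from chain_split_two(2)[OF chG okG G(2,3) this] show ?thesis by (rule sym)
qed

section \<open>Powers of an element of minimal displacement\<close>

abbreviation pw :: "'a list \<Rightarrow> 'a edge list \<Rightarrow> nat \<Rightarrow> 'a edge list" where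
  "pw w S k \<equiv> S [^]\<^bsub>path_group w\<^esub> k"

lemma pw_Suc: "pw w S (Suc k) = map (act (pw w S k)) S"
  by simp

lemma pw_mor: "mor w w S \<Longrightarrow> mor w w (pw w S k)"
  using monoid.nat_pow_closed[OF group.is_monoid[OF path_group_group[of w]], of S k] mor_ne[of w w S] by simp

lemma pw_add: "mor w w S \<Longrightarrow> map (act (pw w S m)) (pw w S n) = pw w S (m + n)"
  using monoid.nat_pow_mult[OF group.is_monoid[OF path_group_group[of w]], of S m n] mor_ne[of w w S] by simp

lemma pw_1: "mor w w S \<Longrightarrow> pw w S 1 = S"
  using pw_Suc[of w S 0] map_act_base_id reach_okl unfolding mor_def by simp

lemma pw_Suc2: "mor w w S \<Longrightarrow> pw w S (Suc k) = map (act S) (pw w S k)"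
  using pw_add[of w S 1 k] pw_1 by simp

lemma pw_okl: "mor w w S \<Longrightarrow> okl w (pw w S k)"
  using pw_mor reach_okl unfolding mor_def by blast

lemma pw_reach: "mor w w S \<Longrightarrow> reach w (pw w S k)"
  using pw_mor unfolding mor_def by blast

lemma lcells_base [simp]: "lcells (base w) = {}"
  by (auto simp: lcells_def in_set_sbase)

lemma up_base: "reach w P \<Longrightarrow> (new1 ^^ card (lcells P)) (base w) P"
  using up_whole[OF reach_base, of w P] by simp

lemma card_lcells_comp:
  assumes "mor w w' S" "reach w' T"
  shows "card (lcells (map (act S) T)) \<le> card (lcells S) + card (lcells T)"
proof -
  have "(flip1 ^^ card (lcells T)) (map (act S) (base w')) (map (act S) T)"
    using flipn_act[OF mor_lpath[OF assms(1)] reach_okpath[OF reach_base]] up_base[OF assms(2)] newn_flipn by blast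
  then show ?thesis using flipn_card mor_act_base[OF assms(1)] assms(1) unfolding mor_def by metis
qed

lemma map_act_in: "mor w0 w S \<Longrightarrow> okl w p \<Longrightarrow> okl w P \<Longrightarrow> set (map (act S) p) \<subseteq> set (map (act S) P) \<Longrightarrow> set p \<subseteq> set P"
proof
  fix e assume a: "mor w0 w S" "okl w p" "okl w P" "set (map (act S) p) \<subseteq> set (map (act S) P)" "e \<in> set p"
  then obtain f where f: "f \<in> set P" "act S e = act S f" by auto
  have "okl w [e]" "okl w [f]" using a f by (auto simp: okl_def)
  then have "[e] = [f]" using act_inj[OF a(1), of "[e]" "[f]"] f by simp
  then show "e \<in> set P" using f by simp
qed

lemma produced_stays:
  assumes "reach w P" "reach w Q" "lcells P \<subseteq> lcells Q" "(p, u) \<in> lcells P" "set (bots p u) \<subseteq> set Q"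
  shows "set (bots p u) \<subseteq> set P"
proof
  fix e assume e: "e \<in> set (bots p u)"
  then have "\<forall>(p, v)\<in>lcells Q. e \<notin> set p" using config_consumed assms unfolding reach_def by blast
  then have "\<forall>(p, v)\<in>lcells P. e \<notin> set p" using assms by blast
  then show "e \<in> set P" using config_set[of w P "lcells P"] assms e unfolding reach_def by blast
qed

text \<open>The cells \<open>(q i, a)\<close> sit on pairwise disjoint segments of the base path that the action shifts
  along, \<open>q (Suc i)\<close> to \<open>q i\<close>; flipping all of them at once shortens the displacement by two.\<close>

lemma simultaneous_flip:
  assumes S: "mor w w S" and k: "0 < k" and c: "(p', u) \<in> lcells S"
    and q0: "q 0 = bots p' u" "map elab p' = a" "(u, a) \<in> R"
    and q: "\<And>i. i < k \<Longrightarrow> set (q (Suc i)) \<subseteq> set (base w) \<and> okl w (q (Suc i)) \<and> map (act S) (q (Suc i)) = q i"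
    and ch: "\<And>i. i \<le> k \<Longrightarrow> (\<exists>x y. chain x (q i) y) \<and> map elab (q i) = u"
    and disj: "\<And>i j. i < j \<Longrightarrow> j < k \<Longrightarrow> set (q (Suc i)) \<inter> set (q (Suc j)) = {}"
    and last: "(q k, a) \<in> lcells S"
  shows "\<exists>M. reach w M \<and> fdist M (map (act S) M) < card (lcells S)"
proof -
  have une: "u \<noteq> []" and ane: "a \<noteq> []" using q0 R_ne R_ne2 by blast+
  have qne: "q i \<noteq> []" if "i \<le> k" for i using ch[OF that] une by auto
  have fl: "flip (q (Suc i)) a = bots (q (Suc i)) a" if "i < k" for i
  proof -
    have "hd (q (Suc i)) \<in> set (base w)" using q[OF that] qne[of "Suc i"] that by auto
    then show ?thesis by (auto simp: in_set_sbase flip_def)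
  qed
  have rS: "reach w S" and Sb: "map (act S) (base w) = S" using S mor_act_base by (auto simp: mor_def)
  \<comment> \<open>The cells are glued at \<open>q 1\<close>, \<open>q 2\<close>, ... in this
    order. The image lags one step behind: it flips \<open>q 0\<close>, which cancels
    \<open>(p', u)\<close>, and then glues at \<open>q 1\<close>, \<open>q 2\<close>, and so
    on.\<close>
  have key: "i \<le> k \<Longrightarrow> \<exists>M. reach w M \<and> lcells M = (\<lambda>j. (q (Suc j), a)) ` {..<i} \<and>
      (\<forall>j. i \<le> j \<and> j < k \<longrightarrow> set (q (Suc j)) \<subseteq> set M) \<and>
      lcells (map (act S) M) = (if i = 0 then lcells S else lcells S - {(p', u)} \<union> (\<lambda>j. (q (Suc j), a)) ` {..<i - 1})" for i
  proof (induction i)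
    case 0
    show ?case using q Sb by (intro exI[of _ "base w"]) auto
  next
    case (Suc i)
    then obtain M where M: "reach w M" "lcells M = (\<lambda>j. (q (Suc j), a)) ` {..<i}"
       "\<forall>j. i \<le> j \<and> j < k \<longrightarrow> set (q (Suc j)) \<subseteq> set M"
       "lcells (map (act S) M) = (if i = 0 then lcells S else lcells S - {(p', u)} \<union> (\<lambda>j. (q (Suc j), a)) ` {..<i - 1})"
      by auto
    have ik: "i < k" using Suc by simp
    obtain x y where "chain x (q (Suc i)) y" using ch[of "Suc i"] ik by auto
    then obtain X Y where XY: "M = X @ q (Suc i) @ Y"
      using chain_subsegment[OF reach_chain[OF M(1)] reach_okl[OF M(1)], of x "q (Suc i)" y] M(3) ik qne[of "Suc i"] by auto
    let ?M = "X @ bots (q (Suc i)) a @ Y"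
    have R1: "(map elab (q (Suc i)), a) \<in> R" using ch[of "Suc i"] ik q0 by simp
    have lM: "lcells ?M = insert (q (Suc i), a) (lcells M)" using new1_cells[OF M(1)[unfolded XY] R1 fl[OF ik]] XY by simp
    have u: "new1 M ?M" unfolding new1_def using R1 fl[OF ik] XY by blast
    have rM: "reach w ?M" using reach_flip1[OF new1_flip1[OF u] M(1)] .
    have A: "\<forall>j. Suc i \<le> j \<and> j < k \<longrightarrow> set (q (Suc j)) \<subseteq> set ?M"
    proof (intro allI impI)
      fix j assume j: "Suc i \<le> j \<and> j < k"
      then have "set (q (Suc j)) \<subseteq> set M" "set (q (Suc i)) \<inter> set (q (Suc j)) = {}" using M(3) disj by auto
      then show "set (q (Suc j)) \<subseteq> set ?M" using XY by auto
    qed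
    have rgM: "reach w (map (act S) X @ q i @ map (act S) Y)" "map (act S) M = map (act S) X @ q i @ map (act S) Y"
      using act_reach[OF S M(1)] XY q[OF ik] by auto
    have gM: "map (act S) ?M = map (act S) X @ flip (q i) a @ map (act S) Y"
    proof -
      obtain x y where "chain x (q (Suc i)) y" using ch[of "Suc i"] ik by auto
      then have "map (act S) (flip (q (Suc i)) a) = flip (map (act S) (q (Suc i))) a"
        using act_flip[OF mor_lpath[OF S]] R1 q[OF ik] by blast
      then show ?thesis using fl[OF ik] q[OF ik] by simp
    qed
    have lgM: "lcells (map (act S) ?M) = lcells S - {(p', u)} \<union> (\<lambda>j. (q (Suc j), a)) ` {..<i}"
    proof (cases i)
      case 0
      have "flip (q 0) a = p'" using q0 une by (simp add: flip_bots)
      then show ?thesis using gM 0 remove_cells[of w "map (act S) X" p' u "map (act S) Y"] rgM q0 une M(4) by simp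
    next
      case (Suc i')
      have R2: "(map elab (q i), a) \<in> R" using ch[of i] ik q0 by simp
      have fi: "flip (q i) a = bots (q i) a" using fl[of i'] Suc ik by simp
      have "lcells (map (act S) ?M) = insert (q i, a) (lcells (map (act S) M))"
        using new1_cells[OF rgM(1) R2 fi] gM fi rgM(2) by simp
      moreover have "{..<i} = insert i' {..<i - 1}" using Suc by auto
      ultimately show ?thesis using M(4) Suc by auto
    qed
    have "{..<Suc i} = insert i {..<i}" by auto
    then show ?case using rM lM M(2) A lgM by (intro exI[of _ ?M]) auto
  qed
  obtain M where M: "reach w M" "lcells M = (\<lambda>j. (q (Suc j), a)) ` {..<k}"
       "lcells (map (act S) M) = lcells S - {(p', u)} \<union> (\<lambda>j. (q (Suc j), a)) ` {..<k - 1}"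
    using key[of k] k by auto
  have qk: "k = Suc (k - 1)" using k by simp
  have ne: "(q k, a) \<noteq> (p', u)" using q0 R_irr by auto
  have kk: "{..<k} = insert (k - 1) {..<k - 1}" using k by auto
  have sub: "lcells M \<subseteq> lcells (map (act S) M)"
    unfolding M kk using last ne qk by auto
  \<comment> \<open>Two cells of \<open>S\<close> are saved: \<open>(p', u)\<close> has been
    cancelled in the image, and \<open>(q k, a)\<close> now belongs to \<open>M\<close> as
    well.\<close>
  have "lcells (map (act S) M) - lcells M \<subseteq> lcells S - {(p', u), (q k, a)}"
    unfolding M kk using qk by auto
  then have "card (lcells (map (act S) M) - lcells M) \<le> card (lcells S - {(p', u), (q k, a)})"
    by (intro card_mono) (auto simp: finite_lcells)
  also have "\<dots> < card (lcells S)" using c finite_lcells by (intro psubset_card_mono) auto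
  finally have "cdist M (map (act S) M) < card (lcells S)"
    using sub by (simp add: cdist_def Diff_eq_empty_iff[THEN iffD2])
  then show ?thesis using fdist_cdist M act_reach[OF S M(1)] by metis
qed

text \<open>In other words, all powers are reduced.\<close>

lemma min_disp_powers:
  assumes S: "mor w w S" and m: "min_disp w S"
  shows "card (lcells (pw w S N)) = N * card (lcells S)"
proof (induction N rule: less_induct)
  case (less N)
  let ?x = "\<lambda>k. pw w S k" and ?l = "card (lcells S)"
  note xm = pw_mor[OF S] and xr = pw_reach[OF S] and xo = pw_okl[OF S]
  have okb: "okl w (base w)" by simp
  have rS: "reach w S" and okS: "okl w S" using S reach_okl by (auto simp: mor_def)
  have xb: "map (act (?x k)) (base w) = ?x k" for k using mor_act_base xm by blast
  show ?case
  proof (cases "N \<le> 1")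
    case True
    then consider "N = 0" | "N = 1" by linarith
    then show ?thesis using pw_1[OF S] by cases auto
  next
    case False
    then obtain k where N: "N = Suc k" and k: "1 \<le> k" by (cases N) auto
    have upS: "(new1 ^^ ?l) (base w) S" using up_base rS by blast
    have leN: "card (lcells (?x N)) \<le> N * ?l"
      using card_lcells_comp[OF xm rS, of k] less[of k] N by (simp add: pw_Suc del: nat_pow_Suc)
    show ?thesis
    proof (rule ccontr)
      assume "\<not> ?thesis"
      then have lt: "card (lcells (?x N)) < card (lcells (?x k)) + ?l" using leN less[of k] N by simp
      \<comment> \<open>By induction the powers up to \<open>k\<close> are reduced, so each further
        copy of \<open>S\<close> up to there only adds cells.\<close>
      have mono: "lcells (?x j) \<subseteq> lcells (?x (Suc j))
          \<and> (\<forall>c\<in>lcells S. flip (map (act (?x j)) (fst c)) (snd c) = bots (map (act (?x j)) (fst c)) (snd c))" if "j < k" for j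
      proof -
        have "card (lcells (map (act (?x j)) (base w))) + ?l \<le> card (lcells (map (act (?x j)) S))"
          using less[of j] less[of "Suc j"] that N xb by (simp add: pw_Suc[symmetric] del: nat_pow_Suc)
        from image_up[OF xm reach_base upS this] xb show ?thesis by (simp add: pw_Suc del: nat_pow_Suc)
      qed
      have mono2: "i \<le> j \<Longrightarrow> j \<le> k \<Longrightarrow> lcells (?x i) \<subseteq> lcells (?x j)" for i j
      proof (induction j)
        case (Suc j)
        then show ?case using mono[of j] by (cases "i = Suc j") (auto simp del: nat_pow_Suc)
      qed simp
      have "\<not> card (lcells (map (act (?x k)) (base w))) + ?l \<le> card (lcells (map (act (?x k)) S))"
        using lt N xb by (simp add: pw_Suc[symmetric] del: nat_pow_Suc)
      \<comment> \<open>The last copy therefore cancels a cell of the power number \<open>k\<close>,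
        and the cancelling cell of \<open>S\<close> can be taken with its top on the base
        path.\<close>
      from image_down_closed[OF xm reach_base upS this] obtain p v p' u where
        pv: "(p, v) \<in> lcells S" "set p \<subseteq> set (base w)" "u \<noteq> []" "map (act (?x k)) p = bots p' u"
          "map elab p' = v" "(p', u) \<in> lcells (?x k)"
        using xb by auto
      let ?b = "bots p' u"
      have cok: "cellok w (p, v)" using config_cellok rS pv(1) unfolding reach_def by blast
      have okp: "okl w p" using cok by (auto simp: cellok_def)
      have okbt: "okl w ?b" using map_act_okl[OF mor_lpath[OF xm] okp, of k] pv(4) by simp
      have bx: "set ?b \<subseteq> set (?x k)" using pv(2,4) xb[of k] by (metis image_mono list.set_map)
      have ubp: "map elab p = u" using map_act_elab[OF mor_lpath[OF xm] okp, of k] pv(4) by simp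
      have Rua: "(u, v) \<in> R" using cok ubp by (auto simp: cellok_def)
      \<comment> \<open>A cell of the power number \<open>k\<close> outside the first copy is the
        image under \<open>S\<close> of a cell of the power before. Removing one copy of
        \<open>S\<close> from the front, the cancellation would occur one power earlier, where there
        is none.\<close>
      have cS: "(p', u) \<in> lcells S"
      proof (rule ccontr)
        assume nS: "(p', u) \<notin> lcells S"
        obtain k' where k': "k = Suc k'" using k by (cases k) auto
        have up': "(new1 ^^ card (lcells (?x k'))) (base w) (?x k')" using up_base xr by blast
        have "card (lcells (map (act S) (base w))) + card (lcells (?x k')) \<le> card (lcells (map (act S) (?x k')))"
          using less[of k] less[of k'] k' N mor_act_base[OF S] pw_Suc2[OF S, of k'] by (simp del: nat_pow_Suc)
        note im = image_up[OF S reach_base up' this]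
        have xk: "?x k = map (act S) (?x k')" using pw_Suc2[OF S] k' by simp
        obtain c where c: "c \<in> lcells (?x k')" "(p', u) = pushc S c"
          using im pv(6) nS mor_act_base[OF S] unfolding xk by auto
        obtain p1 where p1: "c = (p1, u)" "p' = map (act S) p1" using c by (cases c) (auto simp: pushc_def)
        have "flip (map (act S) p1) u = bots (map (act S) p1) u" using im c p1 by (metis DiffI empty_iff fst_conv snd_conv lcells_base)
        then have bp: "map (act S) (bots p1 u) = ?b" using p1 by (auto intro!: nth_equalityI)
        have c1: "cellok w (p1, u)" using config_cellok xr c p1 unfolding reach_def by blast
        then have ok1: "okl w (bots p1 u)" "okl w p1" using flip_ok[of w p1 u] by (auto simp: cellok_def)
        have "map (act S) (map (act (?x k')) p) = map (act S) (bots p1 u)"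
          using mor_act_act[OF S xm okp, of k'] pw_Suc2[OF S, of k'] k' pv(4) bp by metis
        then have e: "map (act (?x k')) p = bots p1 u"
          using act_inj[OF S _ ok1(1)] map_act_okl[OF mor_lpath[OF xm] okp] by blast
        have "flip (map (act (?x k')) p) v = bots (map (act (?x k')) p) v" using mono[of k'] k' pv(1) by fastforce
        moreover have "map elab p1 = v" using map_act_elab[OF mor_lpath[OF S] ok1(2)] p1 pv(5) by simp
        ultimately show False using flip_bots_bots_ne[of u v p1] e pv(3) Rua R_ne2 by simp
      qed
      \<comment> \<open>The cell is made in the first copy and its bottom is still on the power
        number \<open>k\<close>, so the bottom lies on all powers in between. Pulling it back from
        these powers gives the segments \<open>q i\<close> of the base path.\<close>
      have bxj: "set ?b \<subseteq> set (?x j)" if "1 \<le> j" "j \<le> k" for j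
        using produced_stays[OF xr xr mono2[OF that(2) order_refl] _ bx] mono2[of 1 j] that cS pw_1[OF S] by auto
      define q where "q i = map (act (minv w (?x i))) ?b" for i
      have inv: "map (act (?x i)) (q i) = ?b" for i unfolding q_def using act_minv[OF xm okbt] .
      have okq: "okl w (q i)" for i unfolding q_def using map_act_okl mor_lpath minv[OF xm] okbt by blast
      have shift: "map (act (?x d)) (q (i + d)) = q i" for d i
      proof -
        have "map (act (?x i)) (map (act (?x d)) (q (i + d))) = map (act (?x i)) (q i)"
          using mor_act_act[OF xm[of i] xm[of d] okq] pw_add[OF S, of i d] inv by simp
        then show ?thesis using act_inj[OF xm _ okq] map_act_okl[OF mor_lpath[OF xm] okq] by blast
      qed
      have q0: "q 0 = ?b" using inv[of 0] map_act_base_id[OF okq] by simp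
      have qb: "set (q i) \<subseteq> set (base w)" if "1 \<le> i" "i \<le> k" for i
        using map_act_in[OF xm okq okb, of i i] inv[of i] xb[of i] bxj[OF that] by simp
      have qch: "(\<exists>x y. chain x (q i) y) \<and> map elab (q i) = u" for i
      proof -
        obtain x y where "chain x p y" using cok by (auto simp: cellok_def)
        then have "\<exists>x y. chain x ?b y" using map_act_chain[OF mor_lpath[OF xm] okp] pv(4) by metis
        then show ?thesis unfolding q_def using map_act_chain[OF mor_lpath okbt] map_act_elab[OF mor_lpath okbt] minv[OF xm]
          by (metis map_elab_bots)
      qed
      have qk: "q k = p" using act_inj[OF xm okq okp] inv[of k] pv(4) by metis
      have "\<exists>M. reach w M \<and> fdist M (map (act S) M) < card (lcells S)"
      proof (rule simultaneous_flip[OF S, of k p' u q v])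
        show "0 < k" using k by simp
        show "(p', u) \<in> lcells S" "q 0 = bots p' u" "map elab p' = v" "(u, v) \<in> R" "(q k, v) \<in> lcells S"
          using cS q0 pv qk Rua by auto
        show "set (q (Suc i)) \<subseteq> set (base w) \<and> okl w (q (Suc i)) \<and> map (act S) (q (Suc i)) = q i" if "i < k" for i
          using qb[of "Suc i"] okq that shift[of 1 i] pw_1[OF S] by simp
        show "(\<exists>x y. chain x (q i) y) \<and> map elab (q i) = u" if "i \<le> k" for i using qch .
        \<comment> \<open>One and the same power would map a common edge both into
          \<open>bots p' u\<close> and onto the base path.\<close>
        show "set (q (Suc i)) \<inter> set (q (Suc j)) = {}" if ij: "i < j" "j < k" for i j
        proof (rule ccontr)
          assume "set (q (Suc i)) \<inter> set (q (Suc j)) \<noteq> {}"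
          then obtain e where e: "e \<in> set (q (Suc i))" "e \<in> set (q (Suc j))" by auto
          have "act (?x (Suc i)) e \<in> set ?b" using e(1) inv[of "Suc i"] by (metis image_eqI list.set_map)
          moreover have "act (?x (Suc i)) e \<in> set (q (j - i))"
            using e(2) shift[of "Suc i" "j - i"] ij by (metis Suc_diff_le Suc_leI add_Suc_right diff_add image_eqI less_imp_le list.set_map)
          then have "act (?x (Suc i)) e \<in> set (base w)"
          proof -
            have "1 \<le> j - i" "j - i \<le> k" using ij by linarith+
            then show ?thesis using qb \<open>act (?x (Suc i)) e \<in> set (q (j - i))\<close> by blast
          qed
          ultimately show False by (auto simp: set_bots in_set_sbase)
        qed
      qed
      then show False using m unfolding min_disp_def by (meson not_less)
    qed
  qed
qed

end

section \<open>Elements without fixed interior vertices\<close>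

fun parent :: "'a edge \<Rightarrow> 'a edge" where
  "parent (Base i a) = Base i a"
| "parent (New p v j) = hd p"

fun ldepth :: "'a edge \<Rightarrow> nat" where
  "ldepth (Base i a) = 0"
| "ldepth (New p v j) = (if p = [] then 0 else Suc (ldepth (hd p)))"

context symmetric_relation
begin

lemma ok_parent: "ok w e \<Longrightarrow> ok w (parent e)"
proof (cases e)
  case (New p v j)
  assume "ok w e"
  then have "\<forall>e\<in>set p. ok w e" "p \<noteq> []" using New R_ne by (auto simp: ok_New_iff)
  then show ?thesis using New by simp
qed simp

lemma ok_parn: "ok w e \<Longrightarrow> ok w ((parent ^^ n) e)"
  by (induction n) (auto intro: ok_parent)

lemma ldepth_parent: "ok w e \<Longrightarrow> ldepth (parent e) = ldepth e - 1"
  by (cases e) (auto simp: ok_New_iff dest: R_ne)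

lemma ldepth_parn: "ok w e \<Longrightarrow> ldepth ((parent ^^ n) e) = ldepth e - n"
  by (induction n) (auto simp: ldepth_parent[OF ok_parn])

lemma reach_nonempty: "reach w P \<Longrightarrow> w \<noteq> [] \<Longrightarrow> P \<noteq> []"
  using reach_chain by fastforce

text \<open>Only a cell glued at the left end changes the first edge, and it moves it one step away
  from the root.\<close>

lemma head_up:
  assumes "w \<noteq> []" "reach w P"
  shows "(new1 ^^ n) P Q \<Longrightarrow> \<exists>m. (parent ^^ m) (hd Q) = hd P \<and> ldepth (hd Q) = ldepth (hd P) + m \<and>
    (\<forall>i<m. \<exists>p v. (parent ^^ i) (hd Q) = New p v 0 \<and> p \<noteq> [] \<and> v \<noteq> [] \<and> (p, v) \<in> lcells Q - lcells P)"
proof (induction n arbitrary: Q)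
  case 0
  then show ?case by (intro exI[of _ 0]) auto
next
  case (Suc n)
  then obtain Q' where Q': "(new1 ^^ n) P Q'" "new1 Q' Q" by auto
  then have r: "reach w Q'" and lPQ': "lcells P \<subseteq> lcells Q'" using assms newn_reach newn_cells by blast+
  obtain X p Y v where *: "(map elab p, v) \<in> R" "flip p v = bots p v" "Q' = X @ p @ Y" "Q = X @ bots p v @ Y"
    using Q' unfolding new1_def by blast
  have ne: "p \<noteq> []" "v \<noteq> []" using * R_ne R_ne2 by auto
  have lQ: "lcells Q = insert (p, v) (lcells Q') \<and> (p, v) \<notin> lcells Q'" using new1_cells r * by metis
  obtain m where m: "(parent ^^ m) (hd Q') = hd P" "ldepth (hd Q') = ldepth (hd P) + m"
    "\<forall>i<m. \<exists>p v. (parent ^^ i) (hd Q') = New p v 0 \<and> p \<noteq> [] \<and> v \<noteq> [] \<and> (p, v) \<in> lcells Q' - lcells P"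
    using Suc.IH[OF Q'(1)] by blast
  show ?case
  proof (cases "X = []")
    case False
    then have "hd Q = hd Q'" using * by simp
    then show ?thesis using m lQ by (intro exI[of _ m]) auto
  next
    case True
    then have hQ: "hd Q = New p v 0" "hd Q' = hd p" using * ne by auto
    have "(parent ^^ Suc m) (hd Q) = hd P" unfolding funpow_Suc_right o_def using hQ m(1) by simp
    moreover have "ldepth (hd Q) = ldepth (hd P) + Suc m" using hQ m(2) ne by simp
    moreover have "\<exists>p v. (parent ^^ i) (hd Q) = New p v 0 \<and> p \<noteq> [] \<and> v \<noteq> [] \<and> (p, v) \<in> lcells Q - lcells P" if "i < Suc m" for i
    proof (cases i)
      case 0
      then show ?thesis using hQ lQ lPQ' ne by auto
    next
      case (Suc i')
      have "(parent ^^ i) (hd Q) = (parent ^^ i') (hd Q')" unfolding Suc funpow_Suc_right o_def using hQ by simp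
      then show ?thesis using m(3) that Suc lQ by auto
    qed
    ultimately show ?thesis by blast
  qed
qed

text \<open>Nothing is cancelled in the image, so every step of the first edge away from the root is
  mapped to such a step.\<close>

lemma head_image:
  assumes w: "w \<noteq> []" and S: "mor w0 w S" and P: "reach w P" and u: "(new1 ^^ n) P Q"
    and c: "card (lcells (map (act S) P)) + n \<le> card (lcells (map (act S) Q))"
  shows "\<exists>m. ldepth (hd Q) = ldepth (hd P) + m \<and> ldepth (hd (map (act S) Q)) = ldepth (hd (map (act S) P)) + m \<and>
    (parent ^^ m) (hd (map (act S) Q)) = hd (map (act S) P)"
proof -
  obtain m where m: "(parent ^^ m) (hd Q) = hd P" "ldepth (hd Q) = ldepth (hd P) + m"
    "\<forall>i<m. \<exists>p v. (parent ^^ i) (hd Q) = New p v 0 \<and> p \<noteq> [] \<and> v \<noteq> [] \<and> (p, v) \<in> lcells Q - lcells P"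
    using head_up[OF w P u] by blast
  note im = image_up[OF S P u c]
  have key: "i \<le> m \<Longrightarrow> (parent ^^ i) (act S (hd Q)) = act S ((parent ^^ i) (hd Q)) \<and>
     ldepth (act S (hd Q)) = ldepth (act S ((parent ^^ i) (hd Q))) + i" for i
  proof (induction i)
    case (Suc i)
    then obtain p v where pv: "(parent ^^ i) (hd Q) = New p v 0" "p \<noteq> []" "v \<noteq> []" "(p, v) \<in> lcells Q - lcells P"
      using m(3) by (metis Suc_le_lessD)
    then have "flip (map (act S) p) v = bots (map (act S) p) v" using im by (metis fst_conv snd_conv)
    then have "act S (New p v 0) = New (map (act S) p) v 0" using pv(3) by simp
    then have "parent (act S (New p v 0)) = act S (hd p)" "ldepth (act S (New p v 0)) = Suc (ldepth (act S (hd p)))"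
      using pv(2) by (auto simp: hd_map)
    then show ?case using Suc pv by simp
  qed simp
  have "P \<noteq> []" "Q \<noteq> []" using reach_nonempty w P newn_reach[OF u P] by blast+
  then show ?thesis using key[of m] m by (intro exI[of _ m]) (simp add: hd_map)
qed

text \<open>Such a cell is glued at the very left. Its first bottom edge becomes the first edge of
  the path and later remains one of its ancestors.\<close>

lemma leftmost_cells:
  assumes "w \<noteq> []"
  shows "config w P C \<Longrightarrow> (p, v) \<in> C \<Longrightarrow> esrc (hd p) = VBase 0 \<Longrightarrow> \<exists>m. New p v 0 = (parent ^^ m) (hd P)"
proof (induction rule: config.induct)
  case (config_step X q Y C u)
  have ne: "q \<noteq> []" "u \<noteq> []" using config_step R_ne R_ne2 by auto
  show ?case
  proof (cases "(p, v) = (q, u)")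
    case True
    have "X = []"
    proof (rule ccontr)
      assume X: "X \<noteq> []"
      obtain c where "chain (VBase 0) X c" "chain c q (etgt (last q))" "okl w X"
        using config_okpath[OF config_step.hyps(1)] chain_ends by (fastforce simp: okpath_def ne)
      then have "xpos (VBase 0 :: 'a vertex) < xpos (esrc (hd q))" using chain_x_less X chain_hd ne by metis
      then show False using config_step.prems True by simp
    qed
    then show ?thesis using True ne by (intro exI[of _ 0]) auto
  next
    case False
    then obtain m where m: "New p v 0 = (parent ^^ m) (hd (X @ q @ Y))" using config_step by auto
    show ?thesis
    proof (cases "X = []")
      case True
      then have "(parent ^^ Suc m) (hd (X @ bots q u @ Y)) = (parent ^^ m) (hd (X @ q @ Y))"
        unfolding funpow_Suc_right o_def using ne by simp
      then show ?thesis using m by metis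
    next
      case False
      then show ?thesis using m by auto
    qed
  qed
qed simp

section \<open>Fixed interior vertices, conjugation and commuting elements\<close>

definition no_split :: "'a list \<Rightarrow> 'a edge list \<Rightarrow> bool" where
  "no_split w S \<longleftrightarrow> (\<forall>P z. reach w P \<longrightarrow> z \<in> vset P \<longrightarrow> actv S z = z \<longrightarrow> z = VBase 0 \<or> z = VBase (length w))"

lemma vset_etgt: "reach w P \<Longrightarrow> z \<in> vset P \<Longrightarrow> z \<noteq> VBase 0 \<Longrightarrow> \<exists>e\<in>set P. ok w e \<and> z = etgt e"
  using reach_okl unfolding vset_def okl_def by blast

lemma conj_fixed:
  assumes G: "mor w w' \<Gamma>" and S: "mor w w S" and P: "reach w' P" "z \<in> vset P" "z \<noteq> VBase 0"
  shows "actv (conj w \<Gamma> S) z = z \<longleftrightarrow> actv S (actv \<Gamma> z) = actv \<Gamma> z"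
proof -
  let ?S = "conj w \<Gamma> S" and ?\<Delta> = "minv w \<Gamma>"
  have S': "mor w' w' ?S" using conj_mor G S by blast
  have D: "mor w' w ?\<Delta>" and DG: "map (act ?\<Delta>) \<Gamma> = base w'" using minv[OF G] by auto
  obtain e where e: "ok w' e" "z = etgt e" using vset_etgt P by blast
  have okSe: "ok w' (act ?S e)" using act_ok[OF mor_lpath[OF S']] e by blast
  have 1: "actv \<Gamma> (actv ?S z) = actv S (actv \<Gamma> z)"
    using actv_act(1)[OF G S' e(1)] actv_act(1)[OF S G e(1)] conj_eq[OF G S] e(2) by simp
  have 2: "actv ?\<Delta> (actv \<Gamma> y) = y" if "ok w' f" "y = etgt f" for f y
  proof -
    have "actv ?\<Delta> (actv \<Gamma> y) = actv (base w') y" using actv_act(1)[OF D G that(1)] that(2) DG by simp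
    also have "\<dots> = y"
      using act_etgt[OF lpath_base that(1)] act_base_id[OF that(1)] that(2) mor_ne[OF G] by simp
    finally show ?thesis .
  qed
  have z': "actv ?S z = etgt (act ?S e)" using act_etgt[OF mor_lpath[OF S'] e(1)] e(2) by simp
  show ?thesis
  proof
    assume "actv ?S z = z"
    then show "actv S (actv \<Gamma> z) = actv \<Gamma> z" using 1 by simp
  next
    assume "actv S (actv \<Gamma> z) = actv \<Gamma> z"
    then have "actv ?\<Delta> (actv \<Gamma> (actv ?S z)) = actv ?\<Delta> (actv \<Gamma> z)" using 1 by simp
    then show "actv ?S z = z" using 2[OF okSe z'] 2[OF e] by simp
  qed
qed

lemma actv_ends_iff:
  assumes G: "mor w w' \<Gamma>" and P: "reach w' P" "z \<in> vset P"
  shows "actv \<Gamma> z = VBase 0 \<longleftrightarrow> z = VBase 0" "actv \<Gamma> z = VBase (length w) \<longleftrightarrow> z = VBase (length w')"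
proof -
  obtain P1 P2 where s: "P = P1 @ P2" "chain (VBase 0) P1 z" "chain z P2 (VBase (length w'))"
    using chain_split_vertex reach_chain P by blast
  have ok: "okl w' P1" "okl w' P2" using reach_okl[OF P(1)] s by auto
  note mc = map_act_chain[OF mor_lpath[OF G]] and mo = map_act_okl[OF mor_lpath[OF G]]
  have c1: "chain (VBase 0) (map (act \<Gamma>) P1) (actv \<Gamma> z)" using mc[OF ok(1) s(2)] mor_actv_0[OF G] by simp
  have c2: "chain (actv \<Gamma> z) (map (act \<Gamma>) P2) (VBase (length w))" using mc[OF ok(2) s(3)] mor_actv_end[OF G] by simp
  show "actv \<Gamma> z = VBase 0 \<longleftrightarrow> z = VBase 0"
  proof
    assume a: "actv \<Gamma> z = VBase 0"
    have "P1 = []" using chain_x_less[OF c1 mo[OF ok(1)]] a by fastforce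
    then show "z = VBase 0" using s by simp
  qed (use mor_actv_0[OF G] in simp)
  show "actv \<Gamma> z = VBase (length w) \<longleftrightarrow> z = VBase (length w')"
  proof
    assume a: "actv \<Gamma> z = VBase (length w)"
    have "P2 = []" using chain_x_less[OF c2 mo[OF ok(2)]] a by fastforce
    then show "z = VBase (length w')" using s by simp
  qed (use mor_actv_end[OF G] in simp)
qed

lemma no_split_conj:
  assumes G: "mor w w' \<Gamma>" and S: "mor w w S" and n: "no_split w S"
  shows "no_split w' (conj w \<Gamma> S)"
  unfolding no_split_def
proof (intro allI impI)
  fix P z assume a: "reach w' P" "z \<in> vset P" "actv (conj w \<Gamma> S) z = z"
  show "z = VBase 0 \<or> z = VBase (length w')"
  proof (rule ccontr)
    assume b: "\<not> ?thesis"
    then have "actv S (actv \<Gamma> z) = actv \<Gamma> z" using conj_fixed[OF G S a(1,2)] a(3) by blast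
    moreover have "actv \<Gamma> z \<in> vset (map (act \<Gamma>) P)" "reach w (map (act \<Gamma>) P)"
      using act_vset act_reach G a by blast+
    ultimately have "actv \<Gamma> z = VBase 0 \<or> actv \<Gamma> z = VBase (length w)" using n unfolding no_split_def by blast
    then show False using actv_ends_iff[OF G a(1,2)] b by blast
  qed
qed

lemma ok_Base_below: "ok w e \<Longrightarrow> e \<in> set (base w) \<or> (\<exists>c\<in>ecells e. \<exists>f\<in>set (fst c). f \<in> set (base w))"
proof (induction e rule: ok.induct)
  case (ok_New p v j)
  then have "p \<noteq> []" using R_ne by auto
  then have "hd p \<in> set p" by simp
  then consider "hd p \<in> set (base w)" | c f where "c \<in> ecells (hd p)" "f \<in> set (fst c)" "f \<in> set (base w)"
    using ok_New(1) by blast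
  then show ?case
  proof cases
    case 1
    then show ?thesis using \<open>hd p \<in> set p\<close> by auto
  next
    case 2
    then show ?thesis using \<open>hd p \<in> set p\<close> by (force simp: lcells_def)
  qed
qed (auto simp: in_set_sbase)

lemma adjacent_change:
  fixes Q :: "nat \<Rightarrow> bool"
  assumes "Q a" "\<not> Q b" "a < n" "b < n"
  shows "\<exists>i. 0 < i \<and> i < n \<and> (Q (i - 1) \<and> \<not> Q i \<or> \<not> Q (i - 1) \<and> Q i)"
proof (rule ccontr)
  assume "\<not> ?thesis"
  then have step: "Suc j < n \<Longrightarrow> Q (Suc j) = Q j" for j by (metis diff_Suc_1 zero_less_Suc)
  have "j < n \<Longrightarrow> Q j = Q 0" for j by (induction j) (use step in auto)
  then show False using assms by metis
qed

text \<open>If some base edges are fixed and some are moved, a fixed one and a moved one are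
  adjacent. If all are moved, the gate of \<open>z\<close> has no cell, because the tops of its
  cells are fixed and every history leads back to a base edge; then \<open>z\<close> is itself a
  base vertex, next to moved edges.\<close>

lemma boundary_exists:
  assumes T: "mor w w T" and ne: "T \<noteq> base w" and P: "reach w P" "z \<in> vset P" and m: "min_disp w T"
    and z: "actv T z = z" "z \<noteq> VBase 0" "z \<noteq> VBase (length w)"
  shows "\<exists>i f. 0 < i \<and> i < length w \<and> actv T (VBase i) = VBase i \<and> f \<in> set (base w) \<and> act T f \<noteq> f \<and>
     (esrc f = VBase i \<or> etgt f = VBase i)"
proof -
  let ?e = "\<lambda>i. Base i (w ! i)"
  have oke: "ok w (?e i)" "?e i \<in> set (base w)" if "i < length w" for i using that by (auto simp: ok_Base_iff in_set_sbase)
  have "\<exists>b<length w. act T (?e b) \<noteq> ?e b"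
  proof (rule ccontr)
    assume "\<not> ?thesis"
    then have "act T (?e i) = ?e i" if "i < length w" for i using that by blast
    then have "\<forall>e\<in>set (base w). act T e = e" by (auto simp: in_set_sbase)
    then have "map (act T) (base w) = base w" by (simp add: map_idI)
    then show False using ne mor_act_base[OF T] by simp
  qed
  then obtain b where b: "b < length w" "act T (?e b) \<noteq> ?e b" by blast
  show ?thesis
  proof (cases "\<exists>a<length w. act T (?e a) = ?e a")
    case True
    then obtain a where a: "a < length w" "act T (?e a) = ?e a" by blast
    obtain i where i: "0 < i" "i < length w" "act T (?e (i - 1)) = ?e (i - 1) \<and> act T (?e i) \<noteq> ?e i \<or>
        act T (?e (i - 1)) \<noteq> ?e (i - 1) \<and> act T (?e i) = ?e i"
      using adjacent_change[of "\<lambda>i. act T (?e i) = ?e i" a b "length w"] a b by auto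
    have "actv T (etgt (?e (i - 1))) = etgt (act T (?e (i - 1)))" "actv T (esrc (?e i)) = esrc (act T (?e i))"
      using act_etgt[OF mor_lpath[OF T] oke(1)[of "i - 1"]] act_esrc[OF mor_lpath[OF T] oke(1)[of i]] i(1,2) by simp_all
    then have "actv T (VBase i) = VBase i" using i(1,3) by auto
    moreover have "\<exists>f. f \<in> set (base w) \<and> act T f \<noteq> f \<and> (esrc f = VBase i \<or> etgt f = VBase i)"
      using i(3)
    proof
      assume "act T (?e (i - 1)) = ?e (i - 1) \<and> act T (?e i) \<noteq> ?e i"
      then show ?thesis using i oke by (intro exI[of _ "?e i"]) auto
    next
      assume "act T (?e (i - 1)) \<noteq> ?e (i - 1) \<and> act T (?e i) = ?e i"
      then show ?thesis using i oke[of "i - 1"] by (intro exI[of _ "?e (i - 1)"]) auto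
    qed
    ultimately show ?thesis using i by blast
  next
    case False
    obtain G where G: "reach w G" "z \<in> vset G" "lcells G = vcells z" "\<forall>c\<in>vcells z. \<forall>f\<in>set (fst c). act T f = f"
      using fixed_vertex_gate[OF T m P z(1)] by blast
    obtain i where zi: "z = VBase i"
    proof (cases z)
      case (VNew p v j)
      then have "(p, v) \<in> lcells G" using G by simp
      then have cok: "cellok w (p, v)" using config_cellok G unfolding reach_def by blast
      then have "hd p \<in> set p" "ok w (hd p)" by (auto simp: cellok_def okl_def)
      from ok_Base_below[OF this(2)] have "\<exists>f\<in>set (base w). act T f = f"
      proof
        assume "hd p \<in> set (base w)"
        moreover have "act T (hd p) = hd p" using bspec[OF G(4), of "(p, v)"] \<open>hd p \<in> set p\<close> VNew by simp
        ultimately show ?thesis by blast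
      next
        assume "\<exists>c\<in>ecells (hd p). \<exists>f\<in>set (fst c). f \<in> set (base w)"
        then obtain c f where cf: "c \<in> ecells (hd p)" "f \<in> set (fst c)" "f \<in> set (base w)" by blast
        have "c \<in> vcells z" using cf(1) VNew \<open>hd p \<in> set p\<close> by (auto simp: lcells_def)
        then show ?thesis using G(4) cf by blast
      qed
      then show ?thesis using False by (auto simp: in_set_sbase)
    qed
    have "i \<le> length w" using config_vset[of w G "lcells G"] G zi unfolding reach_def by auto
    then have "0 < i \<and> i < length w" using z zi by (cases "i = 0"; cases "i = length w") auto
    then show ?thesis using False z zi oke[of i] by (intro exI[of _ i] exI[of _ "?e i"]) auto
  qed
qed

lemma conj_base_iff: 
  assumes G: "mor w w' \<Gamma>" and S: "mor w w S"
  shows "conj w \<Gamma> S = base w' \<longleftrightarrow> S = base w"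
proof
  assume "conj w \<Gamma> S = base w'"
  then have e: "map (act S) \<Gamma> = \<Gamma>" using conj_eq[OF G S] mor_act_base[OF G] by simp
  have D: "mor w' w (minv w \<Gamma>)" "map (act \<Gamma>) (minv w \<Gamma>) = base w" using minv[OF G] by auto
  have "okl w' (minv w \<Gamma>)" using D reach_okl unfolding mor_def by blast
  have "S = map (act S) (map (act \<Gamma>) (minv w \<Gamma>))" using D mor_act_base[OF S] by simp
  also have "\<dots> = map (act (map (act S) \<Gamma>)) (minv w \<Gamma>)"
    using map_act_act[OF mor_lpath[OF S] mor_lpath[OF G]] \<open>okl w' (minv w \<Gamma>)\<close> by blast
  also have "\<dots> = base w" using e D by simp
  finally show "S = base w" .
next
  assume "S = base w"
  then show "conj w \<Gamma> S = base w'"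
    unfolding conj_def using map_act_base_id[of w \<Gamma>] reach_okl[of w \<Gamma>] G minv[OF G] by (simp add: mor_def)
qed

text \<open>An element with a fixed interior vertex has, at a base of minimal displacement, a fixed base vertex
  next to a moved edge, and everything commuting with it fixes that vertex.\<close>

lemma fixing_commutes_no_split:
  assumes S: "mor w w S" and n: "no_split w S" and T: "mor w w T" and com: "map (act S) T = map (act T) S"
    and P: "reach w P" "z \<in> vset P" and z: "actv T z = z" "z \<noteq> VBase 0" "z \<noteq> VBase (length w)"
  shows "T = base w"
proof (rule ccontr)
  assume ne: "T \<noteq> base w"
  obtain \<Gamma> w' where G: "mor w w' \<Gamma>" and m: "min_disp w' (conj w \<Gamma> T)" using ex_min_disp[OF T] by blast
  let ?T = "conj w \<Gamma> T" and ?S = "conj w \<Gamma> S" and ?D = "minv w \<Gamma>"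
  have T': "mor w' w' ?T" and S': "mor w' w' ?S" using conj_mor G T S by auto
  have D: "mor w' w ?D" "map (act \<Gamma>) ?D = base w" using minv[OF G] by auto
  have com': "map (act ?T) ?S = map (act ?S) ?T" using conj_mult[OF G T S] conj_mult[OF G S T] com by simp
  have ne': "?T \<noteq> base w'" using conj_base_iff[OF G T] ne by simp
  let ?z = "actv ?D z" and ?P = "map (act ?D) P"
  have z': "?z \<in> vset ?P" "reach w' ?P" using act_vset act_reach D P by blast+
  have z0: "?z \<noteq> VBase 0" "?z \<noteq> VBase (length w')" using actv_ends_iff[OF D(1) P] z by auto
  have "actv \<Gamma> ?z = z"
  proof -
    obtain e where e: "ok w e" "z = etgt e" using vset_etgt P z by blast
    have "actv \<Gamma> ?z = actv (base w) z" using actv_act(1)[OF G D(1) e(1)] e(2) D(2) by simp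
    then show ?thesis using act_etgt[OF lpath_base e(1)] act_base_id[OF e(1)] e(2) mor_ne[OF G] by simp
  qed
  then have fz: "actv ?T ?z = ?z" using conj_fixed[OF G T z'(2,1) z0(1)] z(1) by simp
  obtain i f where i: "0 < i" "i < length w'" "actv ?T (VBase i) = VBase i" "f \<in> set (base w')" "act ?T f \<noteq> f"
     "esrc f = VBase i \<or> etgt f = VBase i"
    using boundary_exists[OF T' ne' z'(2,1) m fz z0] by blast
  have "actv ?S (VBase i) = VBase i" using commute_fixes[OF T' m S' com' i(1,2,3,4,5,6)] .
  moreover have "VBase i \<in> vset (base w')"
    using i config_vset[OF config_base, of w'] by auto
  ultimately show False using no_split_conj[OF G S n] i reach_base unfolding no_split_def by blast
qed

end

lemma ecells_hd: "p \<noteq> [] \<Longrightarrow> ecells (hd p) \<subseteq> lcells p"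
  by (cases p) auto

text \<open>The sequence cannot go down more than \<open>f 0\<close> times in a row from the start.
  So it goes up within the first \<open>Suc (f 0)\<close> steps, and from then on always.\<close>

lemma up_run:
  fixes f :: "nat \<Rightarrow> nat"
  assumes step: "\<And>k. f (Suc k) = Suc (f k) \<or> f k = Suc (f (Suc k))"
    and persist: "\<And>k. f (Suc k) = Suc (f k) \<Longrightarrow> f (Suc (Suc k)) = Suc (f (Suc k))"
  shows "f 0 \<le> k \<Longrightarrow> f (Suc k) = Suc (f k)"
proof -
  have "\<exists>k\<le>f 0. f (Suc k) = Suc (f k)"
  proof (rule ccontr)
    assume "\<not> ?thesis"
    then have "k \<le> f 0 \<Longrightarrow> f k = Suc (f (Suc k))" for k using step by blast
    then have *: "k \<le> f 0 \<Longrightarrow> f k = Suc (f (Suc k))" for k .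
    have "k \<le> Suc (f 0) \<Longrightarrow> f k + k = f 0" for k
    proof (induction k)
      case (Suc k)
      then show ?case using *[of k] by simp
    qed simp
    from this[of "Suc (f 0)"] show False by simp
  qed
  then obtain k0 where k0: "k0 \<le> f 0" "f (Suc k0) = Suc (f k0)" by blast
  have "f (Suc (k0 + j)) = Suc (f (k0 + j))" for j by (induction j) (use k0 persist in auto)
  then show "f 0 \<le> k \<Longrightarrow> f (Suc k) = Suc (f k)" using k0(1) by (metis le_add_diff_inverse le_trans)
qed

context symmetric_relation
begin

section \<open>Centralizers\<close>

definition centralizer :: "'a list \<Rightarrow> 'a edge list \<Rightarrow> 'a edge list set" where
  "centralizer w S = {T. mor w w T \<and> map (act S) T = map (act T) S}"

lemma centralizer_mult: "mor w w S \<Longrightarrow> T \<in> centralizer w S \<Longrightarrow> U \<in> centralizer w S \<Longrightarrow> map (act T) U \<in> centralizer w S"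
proof -
  assume S: "mor w w S" and T: "T \<in> centralizer w S" and U: "U \<in> centralizer w S"
  have m: "mor w w T" "mor w w U" "map (act S) T = map (act T) S" "map (act S) U = map (act U) S"
    using T U by (auto simp: centralizer_def)
  have o: "okl w U" "okl w S" using m S reach_okl unfolding mor_def by blast+
  have "map (act S) (map (act T) U) = map (act T) (map (act S) U)" using commute_act[OF S m(1,3) o(1)] .
  also have "\<dots> = map (act (map (act T) U)) S" using m(4) mor_act_act[OF m(1,2) o(2)] by simp
  finally show ?thesis using mor_comp m by (auto simp: centralizer_def)
qed

lemma centralizer_inv: "mor w w S \<Longrightarrow> T \<in> centralizer w S \<Longrightarrow> minv w T \<in> centralizer w S"
  using minv_commute minv unfolding centralizer_def by blast

lemma centralizer_base: "mor w w S \<Longrightarrow> base w \<in> centralizer w S"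
  using mor_act_base map_act_base_id[of w S] reach_okl[of w S] mor_base[of w] by (auto simp: centralizer_def mor_def)

lemma centralizer_self: "mor w w S \<Longrightarrow> S \<in> centralizer w S"
  by (auto simp: centralizer_def)

lemma centralizer_pw: "mor w w S \<Longrightarrow> T \<in> centralizer w S \<Longrightarrow> pw w T n \<in> centralizer w S"
proof (induction n)
  case (Suc n)
  then show ?case using centralizer_mult[of w S "pw w T n" T] by (simp add: pw_Suc)
qed (simp add: centralizer_base)

end

text \<open>The edges at the initial vertex form a tree in which a non-splitting element of minimal displacement
  moves along an axis \<open>e 0, e 1, \<dots>\<close>; everything commuting with it acts on the far end of the
  axis by a shift.\<close>

locale axis = symmetric_relation +
  fixes w :: "'a list" and S :: "'a edge list"
  assumes S: "mor w w S" and m: "min_disp w S" and ne: "S \<noteq> base w" and ns: "no_split w S"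
begin

abbreviation x :: "nat \<Rightarrow> 'a edge list" where "x k \<equiv> pw w S k"

text \<open>The translation length of \<open>S\<close> on the axis, in steps of the tree.\<close>

definition t :: nat where "t = ldepth (hd S)"

lemma w: "w \<noteq> []"
  using S by (simp add: mor_def)

lemma rS: "reach w S"
  using S by (simp add: mor_def)

lemma hd_base: "hd (base w) = Base 0 (w ! 0)"
  using w by (simp add: hd_conv_nth)

lemma x_ne: "x k \<noteq> []"
  using reach_nonempty[OF pw_reach[OF S] w] .

text \<open>Otherwise the first base edge is fixed, and with it its end vertex. This vertex cannot
  be interior, so the base path consists of that edge alone and \<open>S\<close> is trivial.\<close>

lemma t_pos: "0 < t"
proof (rule ccontr)
  assume "\<not> 0 < t"
  then have t: "ldepth (hd S) = 0" by (simp add: t_def)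
  obtain n where n: "(parent ^^ n) (hd S) = hd (base w)" "ldepth (hd S) = ldepth (hd (base w)) + n"
    using head_up[OF w reach_base up_base[OF rS]] by blast
  then have "hd S = hd (base w)" using t by simp
  moreover have "hd S = act S (hd (base w))" using mor_act_base[OF S] w by (metis hd_map sbase_eq_Nil)
  ultimately have "act S (Base 0 (w ! 0)) = Base 0 (w ! 0)" using hd_base by simp
  moreover have "ok w (Base 0 (w ! 0))" using w by (simp add: ok_Base_iff)
  ultimately have "actv S (VBase (Suc 0)) = VBase (Suc 0)" using act_etgt[OF mor_lpath[OF S]] by fastforce
  moreover have "VBase (Suc 0) \<in> vset (base w)"
    using config_vset[OF config_base, of w] w by (cases w) auto
  ultimately have "length w = Suc 0" using ns reach_base unfolding no_split_def by force
  then have "length S = Suc 0" using mor_length[OF S] by simp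
  then have "S = [hd S]" by (cases S) auto
  also have "\<dots> = base w" using \<open>hd S = hd (base w)\<close> \<open>length w = Suc 0\<close> by (simp add: sbase_def)
  finally show False using ne by simp
qed

text \<open>As all powers are reduced, every further copy of \<open>S\<close> moves the first edge
  away from the root by the same \<open>t\<close> steps.\<close>

lemma heads: "ldepth (hd (x N)) = N * t \<and> (parent ^^ t) (hd (x (Suc N))) = hd (x N)"
proof -
  have step: "ldepth (hd (x (Suc N))) = ldepth (hd (x N)) + t \<and> (parent ^^ t) (hd (x (Suc N))) = hd (x N)" for N
  proof -
    have xb: "map (act (x N)) (base w) = x N" using mor_act_base pw_mor[OF S] by blast
    have "card (lcells (map (act (x N)) (base w))) + card (lcells S) \<le> card (lcells (map (act (x N)) S))"
      using min_disp_powers[OF S m, of N] min_disp_powers[OF S m, of "Suc N"] xb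
      by (simp add: pw_Suc[symmetric] del: nat_pow_Suc)
    from head_image[OF w pw_mor[OF S] reach_base up_base[OF rS] this] xb hd_base show ?thesis
      by (auto simp: t_def)
  qed
  have "ldepth (hd (x N)) = N * t" by (induction N) (use step hd_base in \<open>auto simp del: nat_pow_Suc\<close>)
  then show ?thesis using step by blast
qed

text \<open>The axis consists of the lines from the root to the first edges of the powers. The power
  number \<open>k\<close> reaches far enough, since its first edge has depth \<open>k * t\<close>,
  which is at least \<open>k\<close>.\<close>

definition e :: "nat \<Rightarrow> 'a edge" where
  "e k = (parent ^^ (k * t - k)) (hd (x k))"

lemma ok_hd_x: "ok w (hd (x N))"
  using pw_okl[OF S, of N] x_ne[of N] by (auto simp: okl_def)

lemma e_eq: "k \<le> N * t \<Longrightarrow> (parent ^^ (N * t - k)) (hd (x N)) = e k"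
proof -
  have step: "(parent ^^ (Suc N * t - k)) (hd (x (Suc N))) = (parent ^^ (N * t - k)) (hd (x N))" if "k \<le> N * t" for N
  proof -
    have "Suc N * t - k = (N * t - k) + t" using that by simp
    then show ?thesis using heads[of N] by (simp add: funpow_add del: nat_pow_Suc)
  qed
  have mono: "(parent ^^ ((N + j) * t - k)) (hd (x (N + j))) = (parent ^^ (N * t - k)) (hd (x N))" if "k \<le> N * t" for N j
  proof (induction j)
    case (Suc j)
    have "k \<le> (N + j) * t" using that by (simp add: add_mult_distrib)
    then show ?case using step[of "N + j"] Suc by (simp del: nat_pow_Suc)
  qed simp
  have kt: "k \<le> k * t" using t_pos by simp
  assume N: "k \<le> N * t"
  show ?thesis
  proof (cases "k \<le> N")
    case True
    then show ?thesis using mono[OF kt, of "N - k"] by (simp add: e_def)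
  next
    case False
    then show ?thesis using mono[OF N, of "k - N"] by (simp add: e_def)
  qed
qed

lemma e_mult: "e (N * t) = hd (x N)"
  using e_eq[of "N * t" N] by simp

lemma ok_e: "ok w (e k)"
  unfolding e_def using ok_parn ok_hd_x by blast

lemma ldepth_e: "ldepth (e k) = k"
  unfolding e_def using ldepth_parn[OF ok_hd_x] heads[of k] t_pos by simp

lemma e_inj: "e i = e j \<Longrightarrow> i = j"
  using ldepth_e by metis

lemma le_mult_t: "k \<le> k * t"
  using t_pos by simp

lemma parent_e: "parent (e (Suc k)) = e k"
proof -
  have k: "Suc k \<le> Suc k * t" using le_mult_t .
  then have "Suc k * t - k = Suc (Suc k * t - Suc k)" by linarith
  then have "e k = parent ((parent ^^ (Suc k * t - Suc k)) (hd (x (Suc k))))"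
    using e_eq[of k "Suc k"] k by simp
  then show ?thesis using e_eq[OF k] by simp
qed

lemma e_New: "\<exists>p v. e (Suc k) = New p v 0 \<and> p \<noteq> [] \<and> v \<noteq> [] \<and> hd p = e k"
proof -
  obtain n where n: "ldepth (hd (x (Suc k))) = ldepth (hd (base w)) + n"
    "\<forall>i<n. \<exists>p v. (parent ^^ i) (hd (x (Suc k))) = New p v 0 \<and> p \<noteq> [] \<and> v \<noteq> [] \<and> (p, v) \<in> lcells (x (Suc k)) - lcells (base w)"
    using head_up[OF w reach_base up_base[OF pw_reach[OF S]]] by blast
  have "n = Suc k * t" using n(1) heads[of "Suc k"] hd_base by simp
  then have "Suc k * t - Suc k < n" using t_pos by (cases t) auto
  then obtain p v where "e (Suc k) = New p v 0" "p \<noteq> []" "v \<noteq> []" using n(2) unfolding e_def by blast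
  then show ?thesis using parent_e[of k] by simp
qed

lemma e_0: "e 0 = Base 0 (w ! 0)"
  by (simp add: e_def hd_base)

lemma esrc_e: "esrc (e k) = VBase 0"
proof (induction k)
  case (Suc k)
  obtain p v where "e (Suc k) = New p v 0" "p \<noteq> []" "hd p = e k" using e_New by blast
  then show ?case using Suc by simp
qed (simp add: e_0)

lemma ecells_e: "i \<le> j \<Longrightarrow> ecells (e i) \<subseteq> ecells (e j)"
proof (induction j)
  case (Suc j)
  obtain p v where pv: "e (Suc j) = New p v 0" "p \<noteq> []" "hd p = e j" using e_New by blast
  then have "ecells (e j) \<subseteq> ecells (e (Suc j))" using ecells_hd[of p] by auto
  then show ?case using Suc by (cases "i = Suc j") auto
qed simp

definition cl :: "nat \<Rightarrow> 'a edge list \<times> 'a list" where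
  "cl k = (SOME c. e (Suc k) = New (fst c) (snd c) 0 \<and> fst c \<noteq> [] \<and> snd c \<noteq> [] \<and> hd (fst c) = e k)"

lemma cl: "e (Suc k) = New (fst (cl k)) (snd (cl k)) 0 \<and> fst (cl k) \<noteq> [] \<and> snd (cl k) \<noteq> [] \<and> hd (fst (cl k)) = e k"
proof -
  have "\<exists>c. e (Suc k) = New (fst c) (snd c) 0 \<and> fst c \<noteq> [] \<and> snd c \<noteq> [] \<and> hd (fst c) = e k"
    using e_New[of k] by (metis fst_conv snd_conv)
  then show ?thesis unfolding cl_def by (rule someI_ex)
qed

lemma cl_inj: "cl i = cl j \<Longrightarrow> i = j"
  using cl[of i] cl[of j] e_inj by (metis Suc_inject)

lemma cl_in_e: "i < j \<Longrightarrow> cl i \<in> ecells (e j)"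
proof -
  assume "i < j"
  then have "ecells (e (Suc i)) \<subseteq> ecells (e j)" using ecells_e[of "Suc i" j] by simp
  moreover have "cl i \<in> ecells (e (Suc i))" using cl[of i] by simp
  ultimately show ?thesis by blast
qed

lemma cl_lcells_down_closed: "cl i \<in> lcells P \<Longrightarrow> j \<le> i \<Longrightarrow> cl j \<in> lcells P"
proof (cases "i = j")
  case False
  assume a: "cl i \<in> lcells P" "j \<le> i"
  then have "cl j \<in> ecells (hd (fst (cl i)))" using cl_in_e[of j i] cl[of i] False by simp
  then have "cl j \<in> lcells (fst (cl i))" using cl[of i] ecells_hd[of "fst (cl i)"] by blast
  then show ?thesis using lcells_down_closed[of "fst (cl i)" "snd (cl i)" P] a by auto
qed simp

definition shift :: "'a edge list \<Rightarrow> int \<Rightarrow> bool" where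
  "shift T s \<longleftrightarrow> (\<exists>K. \<forall>k\<ge>K. 0 \<le> int k + s \<and> act T (e k) = e (nat (int k + s)))"

lemma pw_centralizer_act:
  assumes "T \<in> centralizer w S"
  shows "map (act T) (x N) = map (act (x N)) T"
proof -
  have "x N \<in> centralizer w T" using centralizer_pw[of w T S N] assms S by (auto simp: centralizer_def)
  then show ?thesis by (simp add: centralizer_def)
qed

text \<open>By injectivity of \<open>T\<close>, the images of the axis edges run through the tree
  without turning back, so eventually away from the root. Commuting with \<open>S\<close>, the
  element \<open>T\<close> moves all powers of \<open>S\<close> by the same distance
  \<open>card (lcells T)\<close>. If an image lay off the axis, the image of a far power would miss
  more cells along the axis than this distance allows.\<close>

lemma shift_exists:
  assumes T: "T \<in> centralizer w S"
  shows "\<exists>s. shift T s"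
proof -
  have mT: "mor w w T" using T by (simp add: centralizer_def)
  let ?f = "\<lambda>k. act T (e k)" and ?c = "card (lcells T)"
  have okf: "ok w (?f k)" for k using act_ok[OF mor_lpath[OF mT] ok_e] .
  have finj: "?f i = ?f j \<Longrightarrow> i = j" for i j
    using act_inj[OF mT, of "[e i]" "[e j]"] ok_e e_inj by (auto simp: okl_def)
  \<comment> \<open>The cell between two consecutive axis edges is mapped to a new cell or flipped
    back over an old one; in both cases the images are neighbours in the tree.\<close>
  have adj: "parent (?f (Suc k)) = ?f k \<and> ldepth (?f (Suc k)) = Suc (ldepth (?f k)) \<or> parent (?f k) = ?f (Suc k) \<and> ldepth (?f k) = Suc (ldepth (?f (Suc k)))" for k
  proof -
    obtain p v where pv: "e (Suc k) = New p v 0" "p \<noteq> []" "v \<noteq> []" "hd p = e k" using e_New by blast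
    have okN: "ok w (New p v 0)" using ok_e[of "Suc k"] pv by simp
    have fk: "hd (map (act T) p) = ?f k" using pv by (simp add: hd_map)
    show ?thesis
    proof (cases rule: flip_cases[of "map (act T) p" v])
      case 1
      then have "?f (Suc k) = New (map (act T) p) v 0" using pv by simp
      then show ?thesis using fk pv by simp
    next
      case (2 p' u)
      have u: "u \<noteq> []" using 2(1) pv(2) by (metis Nil_is_map_conv bots_eq_Nil)
      have p': "p' \<noteq> []" using 2 pv by auto
      have "?f k = New p' u 0" using fk 2 u by simp
      moreover have "?f (Suc k) = hd p'" using pv 2 p' by (simp add: hd_conv_nth)
      ultimately show ?thesis using p' by simp
    qed
  qed
  have run: "ldepth (?f 0) \<le> k \<Longrightarrow> ldepth (?f (Suc k)) = Suc (ldepth (?f k))" for k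
  proof (rule up_run[of "\<lambda>k. ldepth (?f k)"])
    show "ldepth (?f (Suc k)) = Suc (ldepth (?f k)) \<or> ldepth (?f k) = Suc (ldepth (?f (Suc k)))" for k using adj[of k] by blast
    show "ldepth (?f (Suc (Suc k))) = Suc (ldepth (?f (Suc k)))" if up: "ldepth (?f (Suc k)) = Suc (ldepth (?f k))" for k
    proof (rule ccontr)
      assume "\<not> ?thesis"
      then have "parent (?f (Suc k)) = ?f (Suc (Suc k))" using adj[of "Suc k"] by blast
      moreover have "parent (?f (Suc k)) = ?f k" using adj[of k] up by auto
      ultimately have "Suc (Suc k) = k" using finj by metis
      then show False by simp
    qed
  qed
  let ?b = "ldepth (?f 0)"
  have desc: "ldepth (?f (k + j)) = ldepth (?f k) + j \<and> (parent ^^ j) (?f (k + j)) = ?f k" if "?b \<le> k" for k j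
  proof (induction j)
    case (Suc j)
    have u: "ldepth (?f (Suc (k + j))) = Suc (ldepth (?f (k + j)))" using run[of "k + j"] that by simp
    then have "parent (?f (Suc (k + j))) = ?f (k + j)" using adj[of "k + j"] by auto
    then show ?case using Suc u by (simp add: funpow_Suc_right del: funpow.simps)
  qed simp
  have main: "?f k = e (ldepth (?f k))" if k: "Suc ?b \<le> k" for k
  proof -
    have "ldepth (?f k) = Suc (ldepth (?f (k - 1)))" using run[of "k - 1"] k by (cases k) auto
    then obtain l where l: "ldepth (?f k) = Suc l" by blast
    \<comment> \<open>With this \<open>N\<close> the edge \<open>e k\<close> is an ancestor of the
      first edge of the power number \<open>N\<close>, and more than \<open>?c\<close> axis cells
      lie between depth \<open>l\<close> and the depth \<open>N * t\<close> of that edge.\<close>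
    define N where "N = k + Suc l + ?c"
    have Nt: "k \<le> N * t" "Suc l + ?c \<le> N * t" using le_mult_t[of N] by (auto simp: N_def)
    let ?y = "map (act T) (x N)"
    have ry: "reach w ?y" using act_reach mT pw_reach[OF S] by blast
    have hy: "hd ?y = ?f (N * t)" using x_ne[of N] e_mult[of N] by (simp add: hd_map)
    have d: "ldepth (hd ?y) = Suc l + (N * t - k)" "(parent ^^ (N * t - k)) (hd ?y) = ?f k"
      using desc[of k "N * t - k"] k Nt l hy by auto
    have "fdist (x N) ?y = ?c"
      using pw_centralizer_act[OF T, of N] fdist_act_reach[OF pw_mor[OF S] reach_base, of T N] mor_act_base[OF pw_mor[OF S], of N] mT
        fdist_base[of w T] unfolding mor_def by simp
    then have sdc: "card (lcells (x N) - lcells ?y) \<le> ?c"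
      using fdist_cdist[OF pw_reach[OF S] ry] by (simp add: cdist_def)
    have "cl l \<in> lcells ?y"
    proof (rule ccontr)
      assume n: "cl l \<notin> lcells ?y"
      have "cl ` {l..<N * t} \<subseteq> lcells (x N) - lcells ?y"
      proof
        fix c assume "c \<in> cl ` {l..<N * t}"
        then obtain i where i: "c = cl i" "l \<le> i" "i < N * t" by auto
        have "c \<in> ecells (hd (x N))" using cl_in_e[OF i(3)] i e_mult by simp
        then have "c \<in> lcells (x N)" using x_ne[of N] ecells_hd[of "x N"] by blast
        moreover have "c \<notin> lcells ?y" using cl_lcells_down_closed n i by blast
        ultimately show "c \<in> lcells (x N) - lcells ?y" by blast
      qed
      then have "card (cl ` {l..<N * t}) \<le> card (lcells (x N) - lcells ?y)"
        by (intro card_mono) (auto simp: finite_lcells)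
      moreover have "card (cl ` {l..<N * t}) = N * t - l"
        by (subst card_image) (auto simp: inj_on_def dest: cl_inj)
      ultimately show False using sdc Nt by linarith
    qed
    moreover have "esrc (hd (fst (cl l))) = VBase 0" using cl[of l] esrc_e[of l] by simp
    ultimately obtain j where j: "New (fst (cl l)) (snd (cl l)) 0 = (parent ^^ j) (hd ?y)"
      using leftmost_cells[OF w, of ?y "lcells ?y" "fst (cl l)" "snd (cl l)"] ry unfolding reach_def by auto
    then have ej: "e (Suc l) = (parent ^^ j) (hd ?y)" using cl[of l] by simp
    have "ok w (hd ?y)" using hy okf by simp
    then have "Suc l = ldepth (hd ?y) - j" using ldepth_parn ej ldepth_e by metis
    then have "j = N * t - k" using d(1) by linarith
    then show ?thesis using ej d(2) l by simp
  qed
  let ?s = "int (ldepth (?f ?b)) - int ?b"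
  have "shift T ?s" unfolding shift_def
  proof (intro exI[of _ "Suc ?b"] allI impI)
    fix k assume k: "Suc ?b \<le> k"
    have "ldepth (?f k) = ldepth (?f ?b) + (k - ?b)" using desc[of ?b "k - ?b"] k by simp
    then have "int k + ?s = int (ldepth (?f k))" using k by simp
    then show "0 \<le> int k + ?s \<and> ?f k = e (nat (int k + ?s))" using main[OF k] by simp
  qed
  then show ?thesis by blast
qed

lemma shift_unique: "shift T s \<Longrightarrow> shift T s' \<Longrightarrow> s = s'"
proof -
  assume "shift T s" "shift T s'"
  then obtain K K' where K: "\<forall>k\<ge>K. 0 \<le> int k + s \<and> act T (e k) = e (nat (int k + s))"
      "\<forall>k\<ge>K'. 0 \<le> int k + s' \<and> act T (e k) = e (nat (int k + s'))"
    unfolding shift_def by blast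
  let ?k = "max K K'"
  have "e (nat (int ?k + s)) = e (nat (int ?k + s'))" "0 \<le> int ?k + s" "0 \<le> int ?k + s'"
    using K by (metis max.cobounded1 max.cobounded2)+
  then show ?thesis using e_inj by fastforce
qed

lemma shift_mult:
  assumes "mor w w T" "mor w w U" "shift T s" "shift U s'"
  shows "shift (map (act T) U) (s + s')"
proof -
  obtain K K' where K: "\<forall>k\<ge>K. 0 \<le> int k + s \<and> act T (e k) = e (nat (int k + s))"
      "\<forall>k\<ge>K'. 0 \<le> int k + s' \<and> act U (e k) = e (nat (int k + s'))"
    using assms unfolding shift_def by blast
  show ?thesis unfolding shift_def
  proof (intro exI[of _ "K' + nat (int K - s')"] allI impI)
    fix k assume k: "K' + nat (int K - s') \<le> k"
    then have 1: "0 \<le> int k + s'" "act U (e k) = e (nat (int k + s'))" using K(2) by auto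
    have "K \<le> nat (int k + s')" using k by linarith
    then have 2: "0 \<le> int (nat (int k + s')) + s \<and> act T (e (nat (int k + s'))) = e (nat (int (nat (int k + s')) + s))"
      using K(1) by blast
    have "act (map (act T) U) (e k) = act T (act U (e k))"
      using act_act[OF mor_lpath[OF assms(1)] mor_lpath[OF assms(2)] ok_e] by simp
    moreover have "int (nat (int k + s')) + s = int k + (s + s')" using 1 by simp
    ultimately show "0 \<le> int k + (s + s') \<and> act (map (act T) U) (e k) = e (nat (int k + (s + s')))"
      using 1 2 by metis
  qed
qed

lemma shift_base: "shift (base w) 0"
  unfolding shift_def using act_base_id[OF ok_e] by simp

lemma shift_S: "shift S (int t)"
proof -
  obtain s where s: "shift S s" using shift_exists centralizer_self[OF S] by blast
  then obtain K where K: "\<forall>k\<ge>K. 0 \<le> int k + s \<and> act S (e k) = e (nat (int k + s))" unfolding shift_def by blast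
  have "act S (e (K * t)) = hd (map (act S) (x K))" using e_mult[of K] x_ne[of K] by (simp add: hd_map)
  also have "\<dots> = e (Suc K * t)" using pw_Suc2[OF S, of K] e_mult[of "Suc K"] by metis
  finally have "e (nat (int (K * t) + s)) = e (Suc K * t)" "0 \<le> int (K * t) + s" using K le_mult_t[of K] by metis+
  then have "nat (int (K * t) + s) = Suc K * t" using e_inj by blast
  then have "s = int t" using \<open>0 \<le> int (K * t) + s\<close> by (simp add: nat_eq_iff)
  then show ?thesis using s by simp
qed

text \<open>\<open>T\<close> fixes the first edge of a far power and thus its end vertex. If this
  vertex is interior, then \<open>T\<close> is trivial, as it commutes with an element that fixes
  none. Otherwise the whole power is this one fixed edge.\<close>

lemma shift_0:
  assumes T: "T \<in> centralizer w S" and s: "shift T 0"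
  shows "T = base w"
proof -
  have mT: "mor w w T" and com: "map (act S) T = map (act T) S" using T by (auto simp: centralizer_def)
  obtain K where K: "\<forall>k\<ge>K. act T (e k) = e k" using s unfolding shift_def by auto
  obtain h E where E: "x K = h # E" using x_ne[of K] by (metis neq_Nil_conv)
  then have hx: "hd (x K) = h" by simp
  have fx: "act T h = h" using K le_mult_t[of K] e_mult[of K] unfolding hx by metis
  let ?z = "etgt h"
  have okh: "ok w h" using ok_hd_x[of K] unfolding hx .
  have z: "?z \<in> vset (x K)" unfolding E by (simp add: vset_def)
  have fz: "actv T ?z = ?z" using act_etgt[OF mor_lpath[OF mT] okh] fx by simp
  have ch: "chain (VBase 0) [h] ?z" "chain ?z E (VBase (length w))" "okl w E"
    using reach_chain[OF pw_reach[OF S], of K] pw_okl[OF S, of K] unfolding E by auto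
  have z0: "?z \<noteq> VBase 0" using chain_x_less[OF ch(1)] okh by fastforce
  show ?thesis
  proof (cases "?z = VBase (length w)")
    case True
    have "E = []" using chain_x_less[OF ch(2,3)] True by fastforce
    then have "map (act T) (x K) = x K" unfolding E using fx by simp
    then have "map (act (x K)) T = map (act (x K)) (base w)" using pw_centralizer_act[OF T, of K] mor_act_base[OF pw_mor[OF S], of K] by simp
    then show ?thesis using act_inj[OF pw_mor[OF S], of T "base w" K] mT reach_okl unfolding mor_def by auto
  next
    case False
    then show ?thesis using fixing_commutes_no_split[OF S ns mT com pw_reach[OF S] z fz z0] by blast
  qed
qed

text \<open>By \<open>shift_mult\<close> and \<open>shift_0\<close>, the shift is an injective
  homomorphism of the centralizer into the integers. A generator is an element of least positive
  shift, and \<open>S\<close> itself shows that positive shifts occur.\<close>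

lemma centralizer_cyclic: "\<exists>C. C \<in> centralizer w S \<and> (\<forall>T\<in>centralizer w S. \<exists>k::int. T = C [^]\<^bsub>path_group w\<^esub> k)"
proof -
  interpret G: group "path_group w" using path_group_group w .
  have ex: "\<exists>d>0. \<exists>C\<in>centralizer w S. shift C (int d)" using shift_S t_pos centralizer_self[OF S] by blast
  define d where "d = (LEAST d. d > 0 \<and> (\<exists>C\<in>centralizer w S. shift C (int d)))"
  have d: "d > 0 \<and> (\<exists>C\<in>centralizer w S. shift C (int d))" unfolding d_def by (rule LeastI_ex) (use ex in blast)
  have dmin: "d \<le> d'" if "d' > 0" "C \<in> centralizer w S" "shift C (int d')" for d' C
    unfolding d_def by (rule Least_le) (use that in blast)
  obtain C where C: "C \<in> centralizer w S" "shift C (int d)" using d by blast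
  have mC: "mor w w C" using C by (simp add: centralizer_def)
  have pwn: "shift (pw w C n) (int n * int d) \<and> pw w C n \<in> centralizer w S" for n
  proof (induction n)
    case 0
    then show ?case using shift_base centralizer_base[OF S] by simp
  next
    case (Suc n)
    have "shift (pw w C (Suc n)) (int n * int d + int d)"
      unfolding pw_Suc using shift_mult[OF pw_mor[OF mC] mC] Suc C by blast
    moreover have "int n * int d + int d = int (Suc n) * int d" by (simp add: algebra_simps)
    ultimately show ?case using centralizer_pw[OF S C(1)] by metis
  qed
  have invs: "shift (minv w T) (- s)" if T: "T \<in> centralizer w S" "shift T s" for T s
  proof -
    have mT: "mor w w T" "mor w w (minv w T)" using T minv by (auto simp: centralizer_def)
    obtain s' where s': "shift (minv w T) s'" using shift_exists centralizer_inv[OF S T(1)] by blast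
    have "shift (base w) (s + s')" using shift_mult[OF mT T(2) s'] minv[OF mT(1)] by simp
    then have "s + s' = 0" using shift_unique shift_base by blast
    then have "s' = - s" by linarith
    then show ?thesis using s' by simp
  qed
  have pwi: "shift (C [^]\<^bsub>path_group w\<^esub> k) (k * int d) \<and> C [^]\<^bsub>path_group w\<^esub> k \<in> centralizer w S" for k :: int
  proof (cases "0 \<le> k")
    case True
    then show ?thesis using pwn[of "nat k"] by (metis int_nat_eq int_pow_int)
  next
    case False
    then have k: "k = - int (nat (- k))" by simp
    have "C \<in> carrier (path_group w)" using mC by simp
    from G.int_pow_neg_int[OF this, of "nat (- k)"] have "C [^]\<^bsub>path_group w\<^esub> k = minv w (pw w C (nat (- k)))"
      using path_group_inv[OF pw_mor[OF mC]] k by metis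
    then show ?thesis using invs[of "pw w C (nat (- k))" "int (nat (- k)) * int d"] pwn[of "nat (- k)"] centralizer_inv[OF S] False
      by simp
  qed
  have "\<exists>k::int. T = C [^]\<^bsub>path_group w\<^esub> k" if T: "T \<in> centralizer w S" for T
  proof -
    obtain s where s: "shift T s" using shift_exists T by blast
    let ?k = "s div int d" and ?Ck = "C [^]\<^bsub>path_group w\<^esub> (s div int d)"
    have mT: "mor w w T" and mk: "mor w w ?Ck" using T pwi by (auto simp: centralizer_def)
    let ?U = "map (act T) (minv w ?Ck)"
    have U: "?U \<in> centralizer w S" using centralizer_mult[OF S T] centralizer_inv[OF S] pwi by blast
    have "shift ?U (s + - (?k * int d))"
      using shift_mult[OF mT _ s invs] minv[OF mk] pwi by blast
    moreover have "s + - (?k * int d) = s mod int d" by (simp add: minus_div_mult_eq_mod)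
    ultimately have sU: "shift ?U (s mod int d)" by simp
    have "s mod int d = 0"
    proof (rule ccontr)
      assume n: "s mod int d \<noteq> 0"
      have "0 \<le> s mod int d" "s mod int d < int d" using d by auto
      then have "shift ?U (int (nat (s mod int d)))" "nat (s mod int d) > 0" "nat (s mod int d) < d" using n sU by auto
      then show False using dmin U by (meson not_less)
    qed
    then have "?U = base w" using shift_0 U sU by simp
    then have "T \<otimes>\<^bsub>path_group w\<^esub> inv\<^bsub>path_group w\<^esub> ?Ck = \<one>\<^bsub>path_group w\<^esub>" using path_group_inv[OF mk] by simp
    then have "T = ?Ck" using G.inv_equality[of T "inv\<^bsub>path_group w\<^esub> ?Ck"] mT mk G.inv_inv[of ?Ck] G.inv_closed[of ?Ck] by simp
    then show ?thesis by blast
  qed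
  then show ?thesis using C by blast
qed

end

section \<open>Sums and the normal form of commuting elements\<close>

fun shift_edge :: "nat \<Rightarrow> 'a edge \<Rightarrow> 'a edge" where
  "shift_edge n (Base i a) = Base (n + i) a"
| "shift_edge n (New p v j) = New (map (shift_edge n) p) v j"

lemma shift_edge_inj: "shift_edge n e = shift_edge n f \<longleftrightarrow> e = f"
proof (induction e arbitrary: f)
  case (Base i a)
  then show ?case by (cases f) auto
next
  case (New p v j)
  have *: "map (shift_edge n) p = map (shift_edge n) q \<longleftrightarrow> p = q" for q
    using New by (auto simp: list_eq_iff_nth_eq)
  show ?case by (cases f) (auto simp: *)
qed

lemma map_shift_edge_inj: "map (shift_edge n) P = map (shift_edge n) Q \<longleftrightarrow> P = Q"
  using shift_edge_inj by (metis inj_map_eq_map injI)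

lemma elab_shift_edge [simp]: "elab (shift_edge n e) = elab e"
  by (cases e) auto

lemma map_elab_shift_edge [simp]: "map elab (map (shift_edge n) P) = map elab P"
  by (induction P) auto

lemma shift_edge_bots: "map (shift_edge n) (bots p v) = bots (map (shift_edge n) p) v"
  by (rule nth_equalityI) auto

lemma shift_edge_shift_edge: "shift_edge n (shift_edge m e) = shift_edge (n + m) e"
  by (induction e) (auto simp: map_map)

lemma shift_edge_sbase: "map (shift_edge n) (sbase m v) = sbase (n + m) v"
  by (rule nth_equalityI) auto

lemma shift_edge_flip: "p \<noteq> [] \<Longrightarrow> flip (map (shift_edge n) p) v = map (shift_edge n) (flip p v)"
proof (cases "hd p")
  case (Base i a)
  moreover assume "p \<noteq> []"
  ultimately show ?thesis by (simp add: flip_def hd_map shift_edge_bots)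
next
  case (New p' u j)
  moreover assume "p \<noteq> []"
  moreover have "map (shift_edge n) p = bots (map (shift_edge n) p') u \<longleftrightarrow> p = bots p' u" unfolding shift_edge_bots[symmetric] map_shift_edge_inj ..
  ultimately show ?thesis by (simp add: flip_def hd_map shift_edge_bots)
qed

definition ssum :: "'a list \<Rightarrow> 'a edge list \<Rightarrow> 'a edge list \<Rightarrow> 'a edge list" where
  "ssum w S T = S @ map (shift_edge (length w)) T"

lemma ssum_assoc: "ssum w S (ssum v T U) = ssum (w @ v) (ssum w S T) U"
  by (simp add: ssum_def map_map shift_edge_shift_edge o_def)

lemma ssum_base: "ssum w (base w) (base v) = base (w @ v)"
  using sbase_append[of 0 w v] by (simp add: ssum_def shift_edge_sbase)

context symmetric_relation
begin

text \<open>Renumbering base edges is thereby an instance of the action and inherits the lemmas on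
  moves.\<close>

lemma act_sbase: "ok v e \<Longrightarrow> act (sbase n v) e = shift_edge n e"
proof (induction e rule: ok.induct)
  case (ok_New p u j)
  have "p \<noteq> []" using ok_New R_ne by auto
  have "map (act (sbase n v)) p = map (shift_edge n) p" using ok_New(1) by auto
  then have "act (sbase n v) (New p u j) = flip (map (shift_edge n) p) u ! j" by (simp only: act.simps)
  then show ?case using shift_edge_flip[OF \<open>p \<noteq> []\<close>, of n u] ok_New by (simp add: shift_edge_bots)
qed auto

lemma map_act_sbase: "okl v P \<Longrightarrow> map (act (sbase n v)) P = map (shift_edge n) P"
  using act_sbase by (auto simp: okl_def)

lemma lpath_sbase: "v \<noteq> [] \<Longrightarrow> lpath (w @ v) v (sbase (length w) v)"
  unfolding lpath_def using okl_sbase[of w v "[]"]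
  by (intro conjI exI[of _ "VBase (length w)"] exI[of _ "VBase (length w + length v)"]) auto

lemma lpath_sbase0: "v \<noteq> [] \<Longrightarrow> lpath (v @ u) v (base v)"
  unfolding lpath_def using okl_sbase[of "[]" v u]
  by (intro conjI exI[of _ "VBase 0"] exI[of _ "VBase (0 + length v)"]) auto

lemma ok_append: "w \<noteq> [] \<Longrightarrow> ok w e \<Longrightarrow> ok (w @ v) e"
  using act_ok[OF lpath_sbase0] act_base_id by metis

lemma flipn_shift_edge: "reach v P \<Longrightarrow> v \<noteq> [] \<Longrightarrow> (flip1 ^^ n) P Q \<Longrightarrow> (flip1 ^^ n) (map (shift_edge k) P) (map (shift_edge k) Q)"
proof -
  assume a: "reach v P" "v \<noteq> []" "(flip1 ^^ n) P Q"
  \<comment> \<open>The letter is arbitrary; a word of length \<open>k\<close> is put in front so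
    that the base segment of \<open>v\<close> starts at position \<open>k\<close>.\<close>
  obtain a0 where "length (replicate k a0 :: 'a list) = k" by simp
  then have s: "lpath (replicate k a0 @ v) v (sbase k v)" using lpath_sbase[OF a(2), of "replicate k a0"] by simp
  have "reach v Q" using reach_flipn a by blast
  then show ?thesis using flipn_act[OF s reach_okpath[OF a(1)] a(3)] map_act_sbase reach_okl a(1) by metis
qed

lemma flipn_shift_edge_lift:
  assumes "reach v P" "v \<noteq> []" "(flip1 ^^ n) (map (shift_edge k) P) (map (shift_edge k) Q)"
  shows "(flip1 ^^ n) P Q"
proof -
  obtain a0 where "length (replicate k a0 :: 'a list) = k" by simp
  then have s: "lpath (replicate k a0 @ v) v (sbase k v)" using lpath_sbase[OF assms(2), of "replicate k a0"] by simp
  have "(flip1 ^^ n) (map (act (sbase k v)) P) (map (shift_edge k) Q)" using assms(3) map_act_sbase reach_okl assms(1) by metis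
  then obtain Q' where Q': "(flip1 ^^ n) P Q'" "map (shift_edge k) Q = map (act (sbase k v)) Q'"
    using flipn_lift[OF s reach_okpath[OF assms(1)]] by blast
  have "okl v Q'" using Q' reach_flipn assms(1) reach_okl by blast
  then have "Q = Q'" using Q'(2) map_act_sbase map_shift_edge_inj by metis
  then show ?thesis using Q' by simp
qed

lemma fdist_shift_edge: "reach v P \<Longrightarrow> v \<noteq> [] \<Longrightarrow> (flip1 ^^ n) P Q \<Longrightarrow> fdist (map (shift_edge k) P) (map (shift_edge k) Q) = fdist P Q"
proof (rule le_antisym)
  assume a: "reach v P" "v \<noteq> []" "(flip1 ^^ n) P Q"
  show "fdist (map (shift_edge k) P) (map (shift_edge k) Q) \<le> fdist P Q" using fdist_le[OF flipn_shift_edge[OF a(1,2) fdist_flipn[OF a(3)]]] .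
  show "fdist P Q \<le> fdist (map (shift_edge k) P) (map (shift_edge k) Q)"
    using fdist_le[OF flipn_shift_edge_lift[OF a(1,2) fdist_flipn[OF flipn_shift_edge[OF a]]]] .
qed

lemma reach_ssum:
  assumes "reach w P" "reach v Q" "w \<noteq> []" "v \<noteq> []"
  shows "reach (w @ v) (ssum w P Q)"
proof -
  have "(flip1 ^^ cdist (base w) P) (base w) P" using geo reach_base assms by blast
  moreover have "(flip1 ^^ cdist (base v) Q) (sbase (length w) v) (map (shift_edge (length w)) Q)"
    using flipn_shift_edge[OF reach_base assms(4) geo[OF reach_base assms(2)], of "length w"] shift_edge_sbase[of "length w" 0 v] by simp
  ultimately have "(flip1 ^^ (cdist (base w) P + cdist (base v) Q)) (base (w @ v)) (ssum w P Q)"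
    using flipn_append sbase_append[of 0 w v] by (fastforce simp: ssum_def)
  then show ?thesis using reach_flipn reach_base by blast
qed

lemma mor_ssum: "mor w w' S \<Longrightarrow> mor v v' T \<Longrightarrow> mor (w @ v) (w' @ v') (ssum w S T)"
proof -
  assume a: "mor w w' S" "mor v v' T"
  then have "reach (w @ v) (ssum w S T)" using reach_ssum unfolding mor_def using mor_ne by blast
  moreover have "map elab (ssum w S T) = w' @ v'" using a by (simp add: mor_def ssum_def)
  ultimately show ?thesis using a by (simp add: mor_def)
qed

text \<open>An edge over \<open>w'\<close> refers only to positions inside \<open>S\<close>. On the
  second part, renumbering is itself an action, so the claim reduces to composing actions.\<close>

lemma ssum_comp:
  assumes S: "mor w w' S" and T: "mor v v' T" and P: "mor w' w'' P" and Q: "mor v' v'' Q"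
  shows "map (act (ssum w S T)) (ssum w' P Q) = ssum w (map (act S) P) (map (act T) Q)"
proof -
  let ?T = "map (shift_edge (length w)) T"
  have okP: "okl w' P" and okQ: "okl v' Q" and okT: "okl v T" using P Q T reach_okl unfolding mor_def by blast+
  have sT: "?T = map (act (sbase (length w) v)) T" using map_act_sbase okT by simp
  have 1: "map (act (S @ ?T)) P = map (act S) P"
    using act_append[OF mor_lpath[OF S]] okP by (auto simp: okl_def)
  have ls: "length S = length w'" using mor_length S by blast
  have lt: "length T = length v'" using mor_length T by blast
  have b: "map (act (S @ ?T)) (sbase (length w') v') = ?T"
    by (rule nth_equalityI) (auto simp: ls lt nth_append)
  have v': "v' \<noteq> []" using mor_ne T by blast
  have v: "v \<noteq> []" using mor_ne T by blast
  have s1: "lpath (w @ v) (w' @ v') (S @ ?T)" using mor_lpath[OF mor_ssum[OF S T]] by (simp add: ssum_def)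
  have "map (act (S @ ?T)) (map (shift_edge (length w')) Q) = map (act (S @ ?T)) (map (act (sbase (length w') v')) Q)"
    by (simp only: map_act_sbase[OF okQ, of "length w'"])
  also have "\<dots> = map (act ?T) Q" using map_act_act[OF s1 lpath_sbase[OF v'] okQ] b by simp
  also have "\<dots> = map (act (sbase (length w) v)) (map (act T) Q)"
    unfolding sT using map_act_act[OF lpath_sbase[OF v] mor_lpath[OF T] okQ] by simp
  also have "\<dots> = map (shift_edge (length w)) (map (act T) Q)"
    using map_act_sbase map_act_okl[OF mor_lpath[OF T] okQ] by blast
  finally show ?thesis using 1 by (simp add: ssum_def)
qed

text \<open>The base path and its image share the cut vertex, so the two halves are moved separately
  and their displacements add up. The moves of the right half lift to the complex over
  \<open>w2\<close> and give \<open>S2\<close>.\<close>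

lemma split_fixed:
  assumes S: "mor (w1 @ w2) (w1 @ w2) S" and z: "actv S (VBase (length w1)) = VBase (length w1)" and ne: "w1 \<noteq> []" "w2 \<noteq> []"
  shows "\<exists>S1 S2. mor w1 w1 S1 \<and> mor w2 w2 S2 \<and> S = ssum w1 S1 S2 \<and>
     card (lcells S) = card (lcells S1) + card (lcells S2)"
proof -
  let ?B = "sbase (length w1) w2"
  have W: "base (w1 @ w2) = base w1 @ ?B" using sbase_append[of 0 w1 w2] by simp
  let ?S1 = "map (act S) (base w1)" and ?S2' = "map (act S) ?B"
  have SS: "S = ?S1 @ ?S2'" using mor_act_base[OF S] W by (metis map_append)
  have rS: "reach (w1 @ w2) S" using S by (simp add: mor_def)
  have c: "chain (VBase 0) (base w1) (VBase (length w1))" by simp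
  have c': "chain (VBase 0) ?S1 (VBase (length w1))" using act_chain0[OF S _ c, of ?B] W z by (metis reach_base)
  have d: "fdist (base w1 @ ?B) (?S1 @ ?S2') = fdist (base w1) ?S1 + fdist ?B ?S2' \<and>
     (flip1 ^^ fdist (base w1) ?S1) (base w1) ?S1 \<and> (flip1 ^^ fdist ?B ?S2') ?B ?S2'"
    using fdist_split[OF _ _ c c', of "w1 @ w2" ?B ?S2'] W SS rS by (metis reach_base)
  have B: "?B = map (shift_edge (length w1)) (base w2)" using shift_edge_sbase[of "length w1" 0 w2] by simp
  have B': "?B = map (act (sbase (length w1) w2)) (base w2)" by (rule trans[OF B map_act_sbase[OF okl_base, symmetric]])
  obtain S2 where S2: "(flip1 ^^ fdist ?B ?S2') (base w2) S2" "?S2' = map (act (sbase (length w1) w2)) S2"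
    using flipn_lift[OF lpath_sbase[OF ne(2)] reach_okpath[OF reach_base]] d B' by metis
  have r2: "reach w2 S2" using reach_flipn S2 reach_base by blast
  then have S2': "?S2' = map (shift_edge (length w1)) S2" using S2 map_act_sbase reach_okl by metis
  have okB: "okl (w1 @ w2) (base w1 @ ?B)" using W okl_base by metis
  have "map elab ?S1 = w1" using map_act_elab[OF mor_lpath[OF S], of "base w1"] okB by simp
  then have m1: "mor w1 w1 ?S1" using d reach_flipn reach_base ne unfolding mor_def by blast
  have "map elab ?S2' = w2" using map_act_elab[OF mor_lpath[OF S], of ?B] okB by simp
  then have m2: "mor w2 w2 S2" using r2 ne S2' unfolding mor_def by (metis map_elab_shift_edge)
  have "fdist ?B ?S2' = fdist (base w2) S2" using fdist_shift_edge[OF reach_base ne(2) S2(1), of "length w1"] B S2' by simp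
  moreover have "fdist (base (w1 @ w2)) S = card (lcells S)" using fdist_base rS by blast
  ultimately have "card (lcells S) = card (lcells ?S1) + card (lcells S2)"
    using d W SS fdist_base m1 m2 unfolding mor_def by metis
  then show ?thesis using m1 m2 SS S2' by (metis ssum_def)
qed

text \<open>The displacement of a sum of paths is at most the sum of the displacements. Varying one
  summand while the other stays at its base path yields the minimality of each.\<close>

lemma min_disp_ssum:
  assumes S1: "mor w1 w1 S1" and S2: "mor w2 w2 S2" and m: "min_disp (w1 @ w2) (ssum w1 S1 S2)"
    and c: "card (lcells (ssum w1 S1 S2)) = card (lcells S1) + card (lcells S2)"
  shows "min_disp w1 S1" "min_disp w2 S2"
proof -
  have ne: "w1 \<noteq> []" "w2 \<noteq> []" using mor_ne S1 S2 by blast+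
  have le: "card (lcells S1) + card (lcells S2) \<le> fdist P (map (act S1) P) + fdist Q (map (act S2) Q)"
    if P: "reach w1 P" and Q: "reach w2 Q" for P Q
  proof -
    have mP: "mor w1 (map elab P) P" and mQ: "mor w2 (map elab Q) Q" using P Q ne by (auto simp: mor_def)
    have rP: "reach w1 (map (act S1) P)" and rQ: "reach w2 (map (act S2) Q)" using act_reach S1 S2 P Q by blast+
    have "card (lcells S1) + card (lcells S2) \<le> fdist (ssum w1 P Q) (map (act (ssum w1 S1 S2)) (ssum w1 P Q))"
      using m c reach_ssum[OF P Q ne] unfolding min_disp_def by metis
    also have "\<dots> = fdist (P @ map (shift_edge (length w1)) Q) (map (act S1) P @ map (shift_edge (length w1)) (map (act S2) Q))"
      by (subst ssum_comp[OF S1 S2 mP mQ]) (simp add: ssum_def)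
    also have "\<dots> \<le> fdist P (map (act S1) P) + fdist (map (shift_edge (length w1)) Q) (map (shift_edge (length w1)) (map (act S2) Q))"
      by (rule fdist_le, rule flipn_append) (use geo[OF P rP] geo[OF Q rQ] flipn_shift_edge[OF Q ne(2)] fdist_flipn in blast)+
    also have "\<dots> = fdist P (map (act S1) P) + fdist Q (map (act S2) Q)"
      using fdist_shift_edge[OF Q ne(2) geo[OF Q rQ]] by simp
    finally show ?thesis .
  qed
  have b: "fdist (base w1) (map (act S1) (base w1)) = card (lcells S1)" "fdist (base w2) (map (act S2) (base w2)) = card (lcells S2)"
    using mor_act_base S1 S2 fdist_base unfolding mor_def by metis+
  show "min_disp w1 S1" unfolding min_disp_def using le[OF _ reach_base] b by (metis add_le_cancel_right)
  show "min_disp w2 S2" unfolding min_disp_def using le[OF reach_base] b by (metis add_le_cancel_left)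
qed

text \<open>The last conjunct says that \<open>D\<close> is not a sum of two diagrams.\<close>

definition simple_abs :: "'a list \<Rightarrow> 'a edge list \<Rightarrow> bool" where
  "simple_abs v D \<longleftrightarrow> D \<noteq> base v \<and> (\<forall>k. card (lcells (pw v D k)) = k * card (lcells D)) \<and>
     \<not> (\<exists>D1 D2 B1 B2 m n. D = D1 @ D2 \<and> base v = B1 @ B2 \<and> D1 \<noteq> [] \<and> D2 \<noteq> [] \<and> B1 \<noteq> [] \<and> B2 \<noteq> [] \<and>
        (flip1 ^^ m) B1 D1 \<and> (flip1 ^^ n) B2 D2)"

text \<open>A common vertex of the top and the bottom path at different positions would give a shorter word
  of the same minimal displacement.\<close>

lemma lexmin_simple:
  assumes D: "mor v v D" and m: "min_disp v D" and ne: "D \<noteq> base v" and ns: "no_split v D"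
    and lex: "\<And>P. reach v P \<Longrightarrow> fdist P (map (act D) P) \<le> card (lcells D) \<Longrightarrow> length v \<le> length P"
  shows "simple_abs v D"
  unfolding simple_abs_def
proof (intro conjI allI notI)
  show "D = base v \<Longrightarrow> False" using ne by simp
  show "card (lcells (pw v D k)) = k * card (lcells D)" for k using min_disp_powers[OF D m] .
  assume "\<exists>D1 D2 B1 B2 m n. D = D1 @ D2 \<and> base v = B1 @ B2 \<and> D1 \<noteq> [] \<and> D2 \<noteq> [] \<and> B1 \<noteq> [] \<and> B2 \<noteq> [] \<and>
        (flip1 ^^ m) B1 D1 \<and> (flip1 ^^ n) B2 D2"
  then obtain D1 D2 B1 B2 k l where c: "D = D1 @ D2" "base v = B1 @ B2" "D1 \<noteq> []" "D2 \<noteq> []" "B1 \<noteq> []" "B2 \<noteq> []"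
      "(flip1 ^^ k) B1 D1" "(flip1 ^^ l) B2 D2" by blast
  have gb: "okpath v (VBase 0) (B1 @ B2) (VBase (length v))" using reach_okpath[OF reach_base, of v] c by simp
  then obtain z where z: "okpath v (VBase 0) B1 z" "okpath v z B2 (VBase (length v))" by (auto simp: okpath_append)
  have gD: "okpath v (VBase 0) D1 z" "okpath v z D2 (VBase (length v))" using flipn_okpath c z by blast+
  have rD: "reach v D" using D by (simp add: mor_def)
  have Db: "map (act D) B1 @ map (act D) B2 = D" using mor_act_base[OF D] c by (metis map_append)
  have ds: "fdist B1 D1 + fdist B2 D2 = card (lcells D) \<and> (flip1 ^^ fdist B1 D1) B1 D1 \<and> (flip1 ^^ fdist B2 D2) B2 D2"
    using fdist_split[of v B1 B2 D1 D2 z] reach_base[of v] rD c z gD fdist_base[OF rD] by (simp add: okpath_def)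
  have a1: "(flip1 ^^ fdist B1 D1) (map (act D) B1) (map (act D) D1)" and a2: "(flip1 ^^ fdist B2 D2) (map (act D) B2) (map (act D) D2)"
    using flipn_act[OF mor_lpath[OF D]] ds z by blast+
  have len: "length B1 + length B2 = length v" "length D1 + length D2 = length v"
    using c mor_length[OF D] by (metis length_append length_sbase)+
  show False
  \<comment> \<open>If the cut has the same position on both paths, it is a fixed interior vertex.
    Otherwise exchanging one half gives a shorter path on a shortest way from the base path to its
    image, and such a path is displaced no further.\<close>
  proof (cases "length D1 = length B1")
    case True
    then have "D1 = map (act D) B1" using Db c(1) by (metis append_eq_append_conv length_map)
    then have "actv D z = z" using act_etgt[OF mor_lpath[OF D], of "last B1"] z(1) gD(1) c(3,5) chain_last
      by (metis (no_types, lifting) okpath_def last_in_set last_map okl_def)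
    moreover have "z \<in> vset (base v)" unfolding c(2)
      using chain_vertex_in[of B1 B2 "VBase (length v)" z] gb z by (simp add: okpath_def)
    ultimately have "z = VBase 0 \<or> z = VBase (length v)" using ns reach_base unfolding no_split_def by blast
    moreover have "xpos (VBase 0 :: 'a vertex) < xpos z" "xpos z < xpos (VBase (length v) :: 'a vertex)"
      using chain_x_less z c(5,6) unfolding okpath_def by blast+
    ultimately show False by auto
  next
    case False
    then consider "length D1 < length B1" | "length B1 < length D1" by linarith
    then show False
    proof cases
      case 1
      have r: "reach v (D1 @ B2)" using flipn_context[OF c(7), of "[]" B2] reach_flipn reach_base[of v] c(2) by fastforce
      have "(flip1 ^^ fdist B2 D2) (D1 @ B2) D" using flipn_context[of _ B2 D2 D1 "[]"] ds c by simp
      moreover have "(flip1 ^^ fdist B1 D1) D (map (act D) (D1 @ B2))"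
        using flipn_context[OF a1, of "[]" "map (act D) B2"] Db by simp
      ultimately have "(flip1 ^^ (fdist B2 D2 + fdist B1 D1)) (D1 @ B2) (map (act D) (D1 @ B2))" by (meson relpowp_trans)
      then have "fdist (D1 @ B2) (map (act D) (D1 @ B2)) \<le> card (lcells D)" using fdist_le ds by (metis add.commute)
      then show False using lex[OF r] 1 len by simp
    next
      case 2
      have r: "reach v (B1 @ D2)" using flipn_context[OF c(8), of B1 "[]"] reach_flipn reach_base[of v] c(2) by fastforce
      have "(flip1 ^^ fdist B1 D1) (B1 @ D2) D" using flipn_context[of _ B1 D1 "[]" D2] ds c by simp
      moreover have "(flip1 ^^ fdist B2 D2) D (map (act D) (B1 @ D2))"
        using flipn_context[OF a2, of "map (act D) B1" "[]"] Db by simp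
      ultimately have "(flip1 ^^ (fdist B1 D1 + fdist B2 D2)) (B1 @ D2) (map (act D) (B1 @ D2))" by (meson relpowp_trans)
      then have "fdist (B1 @ D2) (map (act D) (B1 @ D2)) \<le> card (lcells D)" using fdist_le ds by metis
      then show False using lex[OF r] 2 len by simp
    qed
  qed
qed

lemma ex_lexmin:
  assumes C: "mor w w C" and ne: "C \<noteq> base w" and ns: "no_split w C"
  shows "\<exists>\<Gamma> w'. mor w w' \<Gamma> \<and> simple_abs w' (conj w \<Gamma> C)"
proof -
  let ?d = "\<lambda>P. fdist P (map (act C) P)"
  obtain \<Gamma>0 where G0: "reach w \<Gamma>0" "\<And>P. reach w P \<Longrightarrow> ?d \<Gamma>0 \<le> ?d P"
    using ex_has_least_nat[of "reach w" "base w" ?d] by auto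
  obtain \<Gamma> where G: "reach w \<Gamma> \<and> ?d \<Gamma> \<le> ?d \<Gamma>0" "\<And>P. reach w P \<and> ?d P \<le> ?d \<Gamma>0 \<Longrightarrow> length \<Gamma> \<le> length P"
    using ex_has_least_nat[of "\<lambda>P. reach w P \<and> ?d P \<le> ?d \<Gamma>0" \<Gamma>0 length] G0 by auto
  let ?w = "map elab \<Gamma>" and ?C = "conj w \<Gamma> C"
  have mG: "mor w ?w \<Gamma>" using G mor_ne[OF C] by (simp add: mor_def)
  have C': "mor ?w ?w ?C" using conj_mor mG C by blast
  have min: "?d \<Gamma> \<le> ?d P" if "reach w P" for P using G(1) G0(2)[OF that] by simp
  have "simple_abs ?w ?C"
  proof (rule lexmin_simple[OF C'])
    show "min_disp ?w ?C" using min_disp_conj[OF mG C] min by blast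
    show "?C \<noteq> base ?w" using conj_base_iff[OF mG C] ne by simp
    show "no_split ?w ?C" using no_split_conj[OF mG C ns] .
    fix P assume P: "reach ?w P" "fdist P (map (act ?C) P) \<le> card (lcells ?C)"
    then have "?d (map (act \<Gamma>) P) \<le> ?d \<Gamma>" using conj_fdist[OF mG C P(1)] card_conj[OF mG C] by simp
    then have "?d (map (act \<Gamma>) P) \<le> ?d \<Gamma>0" using G(1) by simp
    then show "length ?w \<le> length P" using G(2)[of "map (act \<Gamma>) P"] act_reach[OF mG P(1)] by simp
  qed
  then show ?thesis using mG by blast
qed

section \<open>Normal forms of families of elements\<close>

abbreviation pwi :: "'a list \<Rightarrow> 'a edge list \<Rightarrow> int \<Rightarrow> 'a edge list" where
  "pwi w S k \<equiv> S [^]\<^bsub>path_group w\<^esub> k"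

lemma pwi_mor: "mor w w S \<Longrightarrow> mor w w (pwi w S k)"
  using group.int_pow_closed[OF path_group_group[of w], of S k] mor_ne[of w w S] by simp

lemma pwi_nat: "pwi w S (int n) = pw w S n"
  by (simp add: int_pow_int del: nat_pow_Suc)

lemma conj_pwi:
  assumes G: "mor w w' \<Gamma>" and C: "mor w w C"
  shows "conj w \<Gamma> (pwi w C k) = pwi w' (conj w \<Gamma> C) k"
proof -
  have "group_hom (path_group w) (path_group w') (conj w \<Gamma>)"
    unfolding group_hom_def group_hom_axioms_def hom_def
    using path_group_group mor_ne[OF G] conj_mor[OF G] conj_mult[OF G] by auto
  then show ?thesis using group_hom.hom_int_pow[of "path_group w" "path_group w'" "conj w \<Gamma>" C k] C by simp
qed

text \<open>A summand \<open>(v, D, f)\<close> stands for a \<open>(v, v)\<close>-diagram \<open>D\<close> with exponent \<open>f i\<close> in the element number \<open>i\<close>.\<close>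

fun sum_powers :: "nat \<Rightarrow> ('a list \<times> 'a edge list \<times> (nat \<Rightarrow> int)) list \<Rightarrow> 'a edge list" where
  "sum_powers i [] = []"
| "sum_powers i ((v, D, f) # cs) = ssum v (pwi v D (f i)) (sum_powers i cs)"

definition comps_word :: "('a list \<times> 'a edge list \<times> (nat \<Rightarrow> int)) list \<Rightarrow> 'a list" where
  "comps_word cs = concat (map fst cs)"

definition comps :: "('a list \<times> 'a edge list \<times> (nat \<Rightarrow> int)) list \<Rightarrow> bool" where
  "comps cs \<longleftrightarrow> cs \<noteq> [] \<and> (\<forall>(v, D, f)\<in>set cs. mor v v D \<and> (D = base v \<or> simple_abs v D))"

text \<open>The equation of the theorem, multiplied by \<Gamma> on the left so that no inverse
  occurs.\<close>

definition normal_form :: "nat set \<Rightarrow> 'a list \<Rightarrow> (nat \<Rightarrow> 'a edge list) \<Rightarrow> bool" where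
  "normal_form I w A \<longleftrightarrow> (\<exists>\<Gamma> cs. comps cs \<and> mor w (comps_word cs) \<Gamma> \<and> (\<forall>i\<in>I. map (act (A i)) \<Gamma> = map (act \<Gamma>) (sum_powers i cs)))"

lemma sum_powers_append: "sum_powers i (cs @ ds) = ssum (comps_word cs) (sum_powers i cs) (sum_powers i ds)"
proof (induction cs)
  case Nil
  have "shift_edge 0 e = e" for e :: "'a edge" by (induction e) (auto intro: map_idI)
  then show ?case by (simp add: ssum_def comps_word_def map_idI)
next
  case (Cons c cs)
  obtain v D f where "c = (v, D, f)" by (cases c) auto
  then show ?case using Cons ssum_assoc by (simp add: comps_word_def)
qed

lemma sum_powers_mor: "comps cs \<Longrightarrow> mor (comps_word cs) (comps_word cs) (sum_powers i cs)"
proof (induction cs)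
  case (Cons c cs)
  obtain v D f where c: "c = (v, D, f)" by (cases c) auto
  then have D: "mor v v (pwi v D (f i))" using Cons pwi_mor by (auto simp: comps_def)
  show ?case
  proof (cases "cs = []")
    case True
    then show ?thesis using D c by (simp add: comps_word_def ssum_def)
  next
    case False
    then have "comps cs" using Cons by (auto simp: comps_def)
    then show ?thesis using mor_ssum[OF D Cons.IH] c by (simp add: comps_word_def)
  qed
qed (simp add: comps_def)

lemma normal_form_conj:
  assumes G: "mor w w' \<Gamma>" and A: "\<And>i. i \<in> I \<Longrightarrow> mor w w (A i)" and g: "normal_form I w' (\<lambda>i. conj w \<Gamma> (A i))"
  shows "normal_form I w A"
proof -
  obtain \<Delta> cs where D: "comps cs" "mor w' (comps_word cs) \<Delta>" "\<And>i. i \<in> I \<Longrightarrow> map (act (conj w \<Gamma> (A i))) \<Delta> = map (act \<Delta>) (sum_powers i cs)"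
    using g unfolding normal_form_def by blast
  have okD: "okl w' \<Delta>" using D reach_okl unfolding mor_def by blast
  have "map (act (A i)) (map (act \<Gamma>) \<Delta>) = map (act (map (act \<Gamma>) \<Delta>)) (sum_powers i cs)" if i: "i \<in> I" for i
  proof -
    have "okl (comps_word cs) (sum_powers i cs)" using sum_powers_mor[OF D(1)] reach_okl unfolding mor_def by blast
    then show ?thesis using conj_act[OF G A[OF i] okD] D(3)[OF i] mor_act_act[OF G D(2)] by simp
  qed
  then show ?thesis unfolding normal_form_def using D(1) mor_comp[OF G D(2)] by blast
qed

lemma normal_form_ssum:
  assumes g: "normal_form I w1 A1" "normal_form I w2 A2" and A: "\<And>i. i \<in> I \<Longrightarrow> mor w1 w1 (A1 i) \<and> mor w2 w2 (A2 i)"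
  shows "normal_form I (w1 @ w2) (\<lambda>i. ssum w1 (A1 i) (A2 i))"
proof -
  obtain \<Gamma>1 cs where 1: "comps cs" "mor w1 (comps_word cs) \<Gamma>1" "\<And>i. i \<in> I \<Longrightarrow> map (act (A1 i)) \<Gamma>1 = map (act \<Gamma>1) (sum_powers i cs)"
    using g unfolding normal_form_def by blast
  obtain \<Gamma>2 ds where 2: "comps ds" "mor w2 (comps_word ds) \<Gamma>2" "\<And>i. i \<in> I \<Longrightarrow> map (act (A2 i)) \<Gamma>2 = map (act \<Gamma>2) (sum_powers i ds)"
    using g unfolding normal_form_def by blast
  have c: "comps (cs @ ds)" using 1 2 by (auto simp: comps_def)
  have w: "comps_word (cs @ ds) = comps_word cs @ comps_word ds" by (simp add: comps_word_def)
  have "map (act (ssum w1 (A1 i) (A2 i))) (ssum w1 \<Gamma>1 \<Gamma>2) = map (act (ssum w1 \<Gamma>1 \<Gamma>2)) (sum_powers i (cs @ ds))" if i: "i \<in> I" for i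
    unfolding sum_powers_append
    using ssum_comp[of w1 w1 "A1 i" w2 w2 "A2 i" "comps_word cs" \<Gamma>1 "comps_word ds" \<Gamma>2] A[OF i] 1 2 i
      ssum_comp[OF 1(2) 2(2) sum_powers_mor[OF 1(1)] sum_powers_mor[OF 2(1)], of i i] by simp
  then show ?thesis unfolding normal_form_def using c w mor_ssum[OF 1(2) 2(2)] by metis
qed

lemma sum_powers_upd: "i \<noteq> j \<Longrightarrow> sum_powers i (map (\<lambda>(v, D, f). (v, D, f(j := 0))) cs) = sum_powers i cs"
  by (induction cs) auto

lemma sum_powers_upd0: "sum_powers j (map (\<lambda>(v, D, f). (v, D, f(j := 0))) cs) = base (comps_word cs)"
proof (induction cs)
  case (Cons c cs)
  then show ?case by (cases c) (simp add: ssum_base comps_word_def)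
qed (simp add: comps_word_def sbase_def)

text \<open>Since \<open>j\<close> is not in \<open>I\<close>, its exponents can be set to zero
  without touching those of the other elements.\<close>

lemma normal_form_trivial_insert:
  assumes g: "normal_form I w A" and A: "A j = base w" "j \<notin> I"
  shows "normal_form (insert j I) w A"
proof -
  obtain \<Gamma> cs where 1: "comps cs" "mor w (comps_word cs) \<Gamma>" "\<And>i. i \<in> I \<Longrightarrow> map (act (A i)) \<Gamma> = map (act \<Gamma>) (sum_powers i cs)"
    using g unfolding normal_form_def by blast
  let ?cs = "map (\<lambda>(v, D, f). (v, D, f(j := 0))) cs"
  have w: "comps_word ?cs = comps_word cs" unfolding comps_word_def by (induction cs) auto
  have c: "comps ?cs" using 1(1) by (fastforce simp: comps_def)
  have "map (act (A i)) \<Gamma> = map (act \<Gamma>) (sum_powers i ?cs)" if i: "i \<in> insert j I" for i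
  proof (cases "i = j")
    case True
    have "okl w \<Gamma>" using 1 reach_okl unfolding mor_def by blast
    then show ?thesis using True A sum_powers_upd0 mor_act_base[OF 1(2)] map_act_base_id by simp
  next
    case False
    then show ?thesis using 1(3) i sum_powers_upd[of i j] by simp
  qed
  then show ?thesis unfolding normal_form_def using c w 1(2) by metis
qed

lemma normal_form_cyclic:
  assumes C: "mor w w C" and ne: "C \<noteq> base w" and ns: "no_split w C" and A: "\<And>i. i \<in> I \<Longrightarrow> A i = pwi w C (f i)"
  shows "normal_form I w A"
proof -
  obtain \<Gamma> w' where G: "mor w w' \<Gamma>" "simple_abs w' (conj w \<Gamma> C)" using ex_lexmin[OF C ne ns] by blast
  let ?C = "conj w \<Gamma> C"
  have C': "mor w' w' ?C" using conj_mor G C by blast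
  have "normal_form I w' (\<lambda>i. conj w \<Gamma> (A i))" unfolding normal_form_def
  proof (intro exI conjI ballI)
    show "comps [(w', ?C, f)]" using G C' by (simp add: comps_def)
    show "mor w' (comps_word [(w', ?C, f)]) (base w')" using mor_ne[OF G(1)] by (simp add: comps_word_def mor_def)
    fix i assume i: "i \<in> I"
    have p: "mor w' w' (pwi w' ?C (f i))" using pwi_mor C' by blast
    then have "map (act (base w')) (pwi w' ?C (f i)) = pwi w' ?C (f i)" using map_act_base_id reach_okl unfolding mor_def by blast
    then show "map (act (conj w \<Gamma> (A i))) (base w') = map (act (base w')) (sum_powers i [(w', ?C, f)])"
      using A[OF i] conj_pwi[OF G(1) C] mor_act_base[OF p] by (simp add: ssum_def)
  qed
  then show ?thesis using normal_form_conj[OF G(1)] A pwi_mor[OF C] by metis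
qed

text \<open>The outer induction is on the number of elements, the inner one on the length of a word
  at which one element \<open>A m\<close> has minimal displacement. Only a trivial
  \<open>A m\<close> calls on the outer hypothesis. Otherwise the word is split, where minimal
  displacement passes to both summands, or all elements are powers of one.\<close>

lemma commuting_normal_form:
  assumes "finite I" "w \<noteq> []" "\<And>i. i \<in> I \<Longrightarrow> mor w w (A i)"
    "\<And>i j. i \<in> I \<Longrightarrow> j \<in> I \<Longrightarrow> map (act (A i)) (A j) = map (act (A j)) (A i)"
  shows "normal_form I w A"
  using assms
proof (induction I arbitrary: w A rule: finite_induct)
  case empty
  have "comps [(w, base w, \<lambda>_. 0)]" "mor w (comps_word [(w, base w, \<lambda>_. 0)]) (base w)"
    using empty by (auto simp: comps_def comps_word_def mor_base)
  then show ?case unfolding normal_form_def by blast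
next
  case (insert m I)
  have inner: "normal_form (insert m I) w A"
    if "w \<noteq> []" "\<And>i. i \<in> insert m I \<Longrightarrow> mor w w (A i)"
      "\<And>i j. i \<in> insert m I \<Longrightarrow> j \<in> insert m I \<Longrightarrow> map (act (A i)) (A j) = map (act (A j)) (A i)"
      "min_disp w (A m)" for w A
    using that
  proof (induction "length w" arbitrary: w A rule: less_induct)
    case (less w A)
    have Am: "mor w w (A m)" using less by blast
    show ?case
    proof (cases "A m = base w")
      case True
      have "normal_form I w A" using insert.IH[of w A] less.prems by blast
      then show ?thesis using normal_form_trivial_insert True insert.hyps by blast
    next
      case nt: False
      show ?thesis
      proof (cases "\<exists>i f. 0 < i \<and> i < length w \<and> actv (A m) (VBase i) = VBase i \<and> f \<in> set (base w) \<and> act (A m) f \<noteq> f \<and>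
          (esrc f = VBase i \<or> etgt f = VBase i)")
        case True
        then obtain i f where i: "0 < i" "i < length w" "actv (A m) (VBase i) = VBase i" "f \<in> set (base w)" "act (A m) f \<noteq> f"
            "esrc f = VBase i \<or> etgt f = VBase i" by blast
        let ?w1 = "take i w" and ?w2 = "drop i w"
        have w: "w = ?w1 @ ?w2" "length ?w1 = i" "?w1 \<noteq> []" "?w2 \<noteq> []" using i by auto
        have fixed: "actv (A k) (VBase i) = VBase i" if "k \<in> insert m I" for k
          using commute_fixes[OF Am less.prems(4) _ _ i(1-6)] less.prems(2,3) that by blast
        have "\<forall>k\<in>insert m I. \<exists>S1 S2. mor ?w1 ?w1 S1 \<and> mor ?w2 ?w2 S2 \<and> A k = ssum ?w1 S1 S2 \<and>
            card (lcells (A k)) = card (lcells S1) + card (lcells S2)"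
          using split_fixed[of ?w1 ?w2] fixed less.prems(2) w by metis
        then obtain A1 A2 where AA: "\<And>k. k \<in> insert m I \<Longrightarrow> mor ?w1 ?w1 (A1 k) \<and> mor ?w2 ?w2 (A2 k) \<and> A k = ssum ?w1 (A1 k) (A2 k) \<and>
            card (lcells (A k)) = card (lcells (A1 k)) + card (lcells (A2 k))" by metis
        have com: "map (act (A1 j)) (A1 k) = map (act (A1 k)) (A1 j) \<and> map (act (A2 j)) (A2 k) = map (act (A2 k)) (A2 j)"
          if jk: "j \<in> insert m I" "k \<in> insert m I" for j k
        proof -
          have "ssum ?w1 (map (act (A1 j)) (A1 k)) (map (act (A2 j)) (A2 k)) = ssum ?w1 (map (act (A1 k)) (A1 j)) (map (act (A2 k)) (A2 j))"
            using less.prems(3)[OF jk] AA[OF jk(1)] AA[OF jk(2)]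
              ssum_comp[of ?w1 ?w1 "A1 j" ?w2 ?w2 "A2 j" ?w1 "A1 k" ?w2 "A2 k"]
              ssum_comp[of ?w1 ?w1 "A1 k" ?w2 ?w2 "A2 k" ?w1 "A1 j" ?w2 "A2 j"] by simp
          moreover have "length (map (act (A1 j)) (A1 k)) = length (map (act (A1 k)) (A1 j))"
            using mor_length AA jk by (metis length_map)
          ultimately show ?thesis unfolding ssum_def by (simp add: map_shift_edge_inj)
        qed
        have mm: "min_disp ?w1 (A1 m)" "min_disp ?w2 (A2 m)"
          using min_disp_ssum[of ?w1 "A1 m" ?w2 "A2 m"] AA[of m] less.prems(4) w by auto
        have "normal_form (insert m I) ?w1 A1"
          by (rule less.hyps) (use w i AA com mm in auto)
        moreover have "normal_form (insert m I) ?w2 A2"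
          by (rule less.hyps) (use w i AA com mm in auto)
        ultimately have "normal_form (insert m I) (?w1 @ ?w2) (\<lambda>k. ssum ?w1 (A1 k) (A2 k))"
          using normal_form_ssum AA by blast
        then show ?thesis using AA w unfolding normal_form_def by metis
      next
        case False
        \<comment> \<open>Without a fixed base vertex next to a moved edge, \<open>A m\<close> fixes
          no interior vertex of any reachable path.\<close>
        have ns: "no_split w (A m)" unfolding no_split_def
          using boundary_exists[OF Am nt _ _ less.prems(4)] False by blast
        interpret ax: axis R w "A m" by unfold_locales (use Am less.prems(4) nt ns in auto)
        obtain C where C: "C \<in> centralizer w (A m)" "\<forall>T\<in>centralizer w (A m). \<exists>k::int. T = pwi w C k"
          using ax.centralizer_cyclic by blast
        have mC: "mor w w C" using C by (simp add: centralizer_def)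
        obtain f where f: "\<And>k. k \<in> insert m I \<Longrightarrow> A k = pwi w C (f k)"
        proof -
          have "\<forall>k\<in>insert m I. A k \<in> centralizer w (A m)" using less.prems(2,3) by (auto simp: centralizer_def)
          then have "\<forall>k\<in>insert m I. \<exists>z. A k = pwi w C z" using C(2) by blast
          then show ?thesis using that by metis
        qed
        have nC: "C \<noteq> base w"
        proof
          assume "C = base w"
          then have "A m = base w" using f[of m] group.int_pow_one[OF path_group_group[OF less.prems(1)]] by simp
          then show False using nt by simp
        qed
        \<comment> \<open>\<open>C\<close> commutes with \<open>A m\<close>, which fixes no interior
          vertex; if \<open>C\<close> fixed one, it would be trivial.\<close>
        have "no_split w C" unfolding no_split_def
        proof (intro allI impI)
          fix P z assume z: "reach w P" "z \<in> vset P" "actv C z = z"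
          have "map (act (A m)) C = map (act C) (A m)" using C by (simp add: centralizer_def)
          then show "z = VBase 0 \<or> z = VBase (length w)"
            using fixing_commutes_no_split[OF Am ns mC _ z] nC by blast
        qed
        then show ?thesis using normal_form_cyclic[OF mC nC] f by blast
      qed
    qed
  qed
  have Am: "mor w w (A m)" using insert by blast
  obtain \<Gamma> w' where G: "mor w w' \<Gamma>" "min_disp w' (conj w \<Gamma> (A m))" using ex_min_disp[OF Am] by blast
  have "normal_form (insert m I) w' (\<lambda>i. conj w \<Gamma> (A i))"
  proof (rule inner)
    show "w' \<noteq> []" using mor_ne G by blast
    show "mor w' w' (conj w \<Gamma> (A i))" if "i \<in> insert m I" for i using conj_mor G insert.prems(2) that by blast
    show "map (act (conj w \<Gamma> (A i))) (conj w \<Gamma> (A j)) = map (act (conj w \<Gamma> (A j))) (conj w \<Gamma> (A i))"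
      if "i \<in> insert m I" "j \<in> insert m I" for i j
      using conj_mult[OF G(1)] insert.prems(2,3) that by simp
    show "min_disp w' (conj w \<Gamma> (A m))" using G by simp
  qed
  then show ?case using normal_form_conj[OF G(1)] insert.prems(2) by blast
qed

end

section \<open>Development of diagrams\<close>

lemma map_inj_in: "inj_on f A \<Longrightarrow> set p \<subseteq> A \<Longrightarrow> set q \<subseteq> A \<Longrightarrow> map f p = map f q \<Longrightarrow> p = q"
  by (rule map_inj_on[of f]) (auto intro: inj_on_subset)

definition diagram_path :: "'a diagram \<Rightarrow> nat list \<Rightarrow> bool" where
  "diagram_path D p \<longleftrightarrow> (\<forall>i. Suc i < length p \<longrightarrow> tgt D (p ! i) = src D (p ! Suc i))"

definition dinner :: "'a diagram \<Rightarrow> nat list \<Rightarrow> nat set" where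
  "dinner D q = tgt D ` set (butlast q)"

lemma dinner_iff: "x \<in> dinner D q \<longleftrightarrow> (\<exists>k. Suc k < length q \<and> x = tgt D (q ! k))"
proof -
  have "e \<in> set (butlast q) \<longleftrightarrow> (\<exists>k. Suc k < length q \<and> e = q ! k)" for e
    unfolding in_set_conv_nth length_butlast by (metis Suc_eq_plus1 length_butlast less_diff_conv nth_butlast)
  then have "set (butlast q) = {q ! k | k. Suc k < length q}" by blast
  then show ?thesis unfolding dinner_def by (simp only: image_iff Bex_def mem_Collect_eq) fast
qed

text \<open>
  Read downwards, the diagram grows without identifications: each edge and each vertex appears exactly
  once, on the top path or on the bottom of one cell.
\<close>

definition top_generated :: "'a diagram \<Rightarrow> bool" where
  "top_generated D \<longleftrightarrow> top_path D \<noteq> [] \<and> diagram_path D (top_path D) \<and>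
     (\<forall>c\<in>cells D. snd c \<noteq> [] \<and> diagram_path D (snd c)) \<and>
     edges D = set (top_path D) \<union> (\<Union>c\<in>cells D. set (snd c)) \<and>
     (\<forall>c\<in>cells D. set (top_path D) \<inter> set (snd c) = {}) \<and>
     (\<forall>c\<in>cells D. \<forall>c'\<in>cells D. set (snd c) \<inter> set (snd c') \<noteq> {} \<longrightarrow> c = c') \<and>
     verts D = set (path_verts D (top_path D)) \<union> (\<Union>c\<in>cells D. dinner D (snd c)) \<and>
     (\<forall>c\<in>cells D. set (path_verts D (top_path D)) \<inter> dinner D (snd c) = {}) \<and>
     (\<forall>c\<in>cells D. \<forall>c'\<in>cells D. dinner D (snd c) \<inter> dinner D (snd c') \<noteq> {} \<longrightarrow> c = c')"

lemma mirror_simps [simp]: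
  "verts (mirror D) = verts D" "edges (mirror D) = edges D" "src (mirror D) = src D" "tgt (mirror D) = tgt D"
  "lab (mirror D) = lab D" "cells (mirror D) = prod.swap ` cells D" "top_path (mirror D) = bot_path D"
  "bot_path (mirror D) = top_path D"
  by (auto simp: mirror_def)

lemma mirror_paths [simp]: "diagram_path (mirror D) = diagram_path D" "dinner (mirror D) = dinner D" "path_verts (mirror D) = path_verts D"
  "path_label (mirror D) = path_label D" "mirror (mirror D) = D"
  by (auto simp: diagram_path_def dinner_def path_verts_def path_label_def fun_eq_iff mirror_def image_image split_beta)

lemma halfD:
  assumes "top_generated D"
  shows "top_path D \<noteq> []" "diagram_path D (top_path D)"
    "c \<in> cells D \<Longrightarrow> snd c \<noteq> []" "c \<in> cells D \<Longrightarrow> diagram_path D (snd c)"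
    "edges D = set (top_path D) \<union> (\<Union>c\<in>cells D. set (snd c))"
    "c \<in> cells D \<Longrightarrow> e \<in> set (snd c) \<Longrightarrow> e \<notin> set (top_path D)"
    "c \<in> cells D \<Longrightarrow> c' \<in> cells D \<Longrightarrow> e \<in> set (snd c) \<Longrightarrow> e \<in> set (snd c') \<Longrightarrow> c = c'"
    "verts D = set (path_verts D (top_path D)) \<union> (\<Union>c\<in>cells D. dinner D (snd c))"
    "c \<in> cells D \<Longrightarrow> x \<in> dinner D (snd c) \<Longrightarrow> x \<notin> set (path_verts D (top_path D))"
    "c \<in> cells D \<Longrightarrow> c' \<in> cells D \<Longrightarrow> x \<in> dinner D (snd c) \<Longrightarrow> x \<in> dinner D (snd c') \<Longrightarrow> c = c'"
proof -
  note H1 = assms[unfolded top_generated_def, THEN conjunct2]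
  note H2 = H1[THEN conjunct2]
  note H3 = H2[THEN conjunct2]
  note H4 = H3[THEN conjunct2]
  note H5 = H4[THEN conjunct2]
  note H6 = H5[THEN conjunct2]
  note H7 = H6[THEN conjunct2]
  note H8 = H7[THEN conjunct2]
  show "top_path D \<noteq> []" by (rule assms[unfolded top_generated_def, THEN conjunct1])
  show "diagram_path D (top_path D)" by (rule H1[THEN conjunct1])
  show "c \<in> cells D \<Longrightarrow> snd c \<noteq> []" "c \<in> cells D \<Longrightarrow> diagram_path D (snd c)" using H2[THEN conjunct1] by blast+
  show "edges D = set (top_path D) \<union> (\<Union>c\<in>cells D. set (snd c))" by (rule H3[THEN conjunct1])
  show "c \<in> cells D \<Longrightarrow> e \<in> set (snd c) \<Longrightarrow> e \<notin> set (top_path D)" using H4[THEN conjunct1] by blast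
  show "c \<in> cells D \<Longrightarrow> c' \<in> cells D \<Longrightarrow> e \<in> set (snd c) \<Longrightarrow> e \<in> set (snd c') \<Longrightarrow> c = c'"
    using H5[THEN conjunct1] by blast
  show "verts D = set (path_verts D (top_path D)) \<union> (\<Union>c\<in>cells D. dinner D (snd c))" by (rule H6[THEN conjunct1])
  show "c \<in> cells D \<Longrightarrow> x \<in> dinner D (snd c) \<Longrightarrow> x \<notin> set (path_verts D (top_path D))"
    using H7[THEN conjunct1] by blast
  show "c \<in> cells D \<Longrightarrow> c' \<in> cells D \<Longrightarrow> x \<in> dinner D (snd c) \<Longrightarrow> x \<in> dinner D (snd c') \<Longrightarrow> c = c'"
    using H8 by blast
qed

lemma top_generated_mirrorD:
  assumes "top_generated (mirror D)"
  shows "bot_path D \<noteq> []" "diagram_path D (bot_path D)"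
    "c \<in> cells D \<Longrightarrow> fst c \<noteq> []" "c \<in> cells D \<Longrightarrow> diagram_path D (fst c)"
    "edges D = set (bot_path D) \<union> (\<Union>c\<in>cells D. set (fst c))"
    "c \<in> cells D \<Longrightarrow> e \<in> set (fst c) \<Longrightarrow> e \<notin> set (bot_path D)"
    "c \<in> cells D \<Longrightarrow> c' \<in> cells D \<Longrightarrow> e \<in> set (fst c) \<Longrightarrow> e \<in> set (fst c') \<Longrightarrow> c = c'"
    "verts D = set (path_verts D (bot_path D)) \<union> (\<Union>c\<in>cells D. dinner D (fst c))"
    "c \<in> cells D \<Longrightarrow> x \<in> dinner D (fst c) \<Longrightarrow> x \<notin> set (path_verts D (bot_path D))"
    "c \<in> cells D \<Longrightarrow> c' \<in> cells D \<Longrightarrow> x \<in> dinner D (fst c) \<Longrightarrow> x \<in> dinner D (fst c') \<Longrightarrow> c = c'"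
proof -
  note H = halfD[OF assms, simplified]
  have s: "prod.swap c \<in> prod.swap ` cells D" if "c \<in> cells D" for c using that by blast
  have i: "prod.swap c = prod.swap c' \<Longrightarrow> c = c'" for c c' :: "nat list \<times> nat list" by (metis swap_swap)
  show "bot_path D \<noteq> []" "diagram_path D (bot_path D)" using H(1,2) by auto
  show "c \<in> cells D \<Longrightarrow> fst c \<noteq> []" "c \<in> cells D \<Longrightarrow> diagram_path D (fst c)"
    using H(3,4)[OF s, of c] by auto
  show "edges D = set (bot_path D) \<union> (\<Union>c\<in>cells D. set (fst c))" using H(5) by simp
  show "c \<in> cells D \<Longrightarrow> e \<in> set (fst c) \<Longrightarrow> e \<notin> set (bot_path D)" using H(6)[OF s, of c e] by simp
  show "c \<in> cells D \<Longrightarrow> c' \<in> cells D \<Longrightarrow> e \<in> set (fst c) \<Longrightarrow> e \<in> set (fst c') \<Longrightarrow> c = c'"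
    using H(7)[OF s s, of c c' e] i by simp
  show "verts D = set (path_verts D (bot_path D)) \<union> (\<Union>c\<in>cells D. dinner D (fst c))" using H(8) by simp
  show "c \<in> cells D \<Longrightarrow> x \<in> dinner D (fst c) \<Longrightarrow> x \<notin> set (path_verts D (bot_path D))" using H(9)[OF s, of c x] by simp
  show "c \<in> cells D \<Longrightarrow> c' \<in> cells D \<Longrightarrow> x \<in> dinner D (fst c) \<Longrightarrow> x \<in> dinner D (fst c') \<Longrightarrow> c = c'"
    using H(10)[OF s s, of c c' x] i by simp
qed

context symmetric_relation
begin

text \<open>
  \<open>\<theta>\<close> and \<open>\<eta>\<close> develop the diagram in the complex over its top label; the rank \<open>h\<close> orders the cells so that
  each one is attached after the cells above it.
\<close>

definition devmap :: "'a diagram \<Rightarrow> (nat \<Rightarrow> 'a edge) \<Rightarrow> (nat \<Rightarrow> 'a vertex) \<Rightarrow> (nat \<Rightarrow> nat) \<Rightarrow> bool" where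
  "devmap D \<theta> \<eta> h \<longleftrightarrow> top_generated D \<and> top_generated (mirror D) \<and> finite (cells D) \<and>
     (\<forall>c\<in>cells D. src D (hd (fst c)) = src D (hd (snd c)) \<and> tgt D (last (fst c)) = tgt D (last (snd c)) \<and>
        (path_label D (fst c), path_label D (snd c)) \<in> R \<and> (\<forall>e\<in>set (fst c). \<forall>f\<in>set (snd c). h e < h f) \<and>
        map \<theta> (snd c) = flip (map \<theta> (fst c)) (path_label D (snd c))) \<and>
     src D (hd (top_path D)) = src D (hd (bot_path D)) \<and> tgt D (last (top_path D)) = tgt D (last (bot_path D)) \<and>
     map \<theta> (top_path D) = base (top_label D) \<and>
     (\<forall>e\<in>edges D. ok (top_label D) (\<theta> e) \<and> elab (\<theta> e) = lab D e \<and> esrc (\<theta> e) = \<eta> (src D e) \<and> etgt (\<theta> e) = \<eta> (tgt D e)) \<and>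
     mor (top_label D) (bot_label D) (map \<theta> (bot_path D))"

definition develops :: "'a diagram \<Rightarrow> 'a edge list \<Rightarrow> bool" where
  "develops D T \<longleftrightarrow> (\<exists>\<theta> \<eta> h. devmap D \<theta> \<eta> h \<and> T = map \<theta> (bot_path D))"

lemma wfdD:
  assumes "devmap D \<theta> \<eta> h"
  shows "top_generated D" "top_generated (mirror D)" "finite (cells D)"
    "c \<in> cells D \<Longrightarrow> src D (hd (fst c)) = src D (hd (snd c))" "c \<in> cells D \<Longrightarrow> tgt D (last (fst c)) = tgt D (last (snd c))"
    "c \<in> cells D \<Longrightarrow> (path_label D (fst c), path_label D (snd c)) \<in> R"
    "c \<in> cells D \<Longrightarrow> e \<in> set (fst c) \<Longrightarrow> f \<in> set (snd c) \<Longrightarrow> h e < h f"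
    "c \<in> cells D \<Longrightarrow> map \<theta> (snd c) = flip (map \<theta> (fst c)) (path_label D (snd c))"
    "src D (hd (top_path D)) = src D (hd (bot_path D))" "tgt D (last (top_path D)) = tgt D (last (bot_path D))"
    "map \<theta> (top_path D) = base (top_label D)"
    "e \<in> edges D \<Longrightarrow> ok (top_label D) (\<theta> e)" "e \<in> edges D \<Longrightarrow> elab (\<theta> e) = lab D e"
    "e \<in> edges D \<Longrightarrow> esrc (\<theta> e) = \<eta> (src D e)" "e \<in> edges D \<Longrightarrow> etgt (\<theta> e) = \<eta> (tgt D e)"
    "mor (top_label D) (bot_label D) (map \<theta> (bot_path D))"
  using assms unfolding devmap_def by blast+

lemma devmap_edges:
  assumes "devmap D \<theta> \<eta> h"
  shows "set (top_path D) \<subseteq> edges D" "set (bot_path D) \<subseteq> edges D"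
    "c \<in> cells D \<Longrightarrow> set (fst c) \<subseteq> edges D" "c \<in> cells D \<Longrightarrow> set (snd c) \<subseteq> edges D"
  using halfD(5)[OF wfdD(1)[OF assms]] top_generated_mirrorD(5)[OF wfdD(2)[OF assms]] by blast+

lemma devmap_chain:
  assumes "devmap D \<theta> \<eta> h" "diagram_path D p" "set p \<subseteq> edges D" "p \<noteq> []"
  shows "chain (\<eta> (src D (hd p))) (map \<theta> p) (\<eta> (tgt D (last p)))"
  using assms(2-)
proof (induction p)
  case (Cons e p)
  show ?case
  proof (cases "p = []")
    case True
    then show ?thesis using Cons wfdD(14,15)[OF assms(1)] by auto
  next
    case False
    have "diagram_path D p" using Cons(2) unfolding diagram_path_def by (metis Suc_mono length_Cons nth_Cons_Suc)
    then have "chain (\<eta> (src D (hd p))) (map \<theta> p) (\<eta> (tgt D (last p)))" using Cons False by auto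
    moreover have "tgt D e = src D (hd p)" using Cons(2) False unfolding diagram_path_def
      by (metis (no_types, lifting) Suc_less_eq hd_conv_nth length_Cons length_greater_0_conv nth_Cons_0 nth_Cons_Suc)
    ultimately show ?thesis using Cons False wfdD(14,15)[OF assms(1), of e] by auto
  qed
qed simp

lemma devmap_okl: "devmap D \<theta> \<eta> h \<Longrightarrow> set p \<subseteq> edges D \<Longrightarrow> okl (top_label D) (map \<theta> p)"
  using wfdD(12) by (fastforce simp: okl_def)

lemma devmap_elab: "devmap D \<theta> \<eta> h \<Longrightarrow> set p \<subseteq> edges D \<Longrightarrow> map elab (map \<theta> p) = path_label D p"
  using wfdD(13) by (fastforce simp: path_label_def map_map)

lemma devmap_distinct:
  assumes "devmap D \<theta> \<eta> h" "diagram_path D p" "set p \<subseteq> edges D"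
  shows "distinct p"
proof (cases "p = []")
  case False
  then have "distinct (map \<theta> p)" using chain_distinct devmap_chain[OF assms False] devmap_okl[OF assms(1,3)] by blast
  then show ?thesis by (simp add: distinct_map)
qed simp

lemma devmap_cell:
  assumes "devmap D \<theta> \<eta> h" "c \<in> cells D"
  shows "fst c \<noteq> []" "snd c \<noteq> []" "diagram_path D (fst c)" "diagram_path D (snd c)" "distinct (fst c)" "distinct (snd c)"
proof -
  show "fst c \<noteq> []" "snd c \<noteq> []" "diagram_path D (fst c)" "diagram_path D (snd c)"
    using halfD(3,4)[OF wfdD(1)[OF assms(1)] assms(2)] top_generated_mirrorD(3,4)[OF wfdD(2)[OF assms(1)] assms(2)] by auto
  then show "distinct (fst c)" "distinct (snd c)" using devmap_distinct[OF assms(1)] devmap_edges(3,4)[OF assms] by auto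
qed

lemma rank_induct [consumes 2, case_names top cell]:
  assumes w: "devmap D \<theta> \<eta> h" and e: "e \<in> edges D"
    and top: "\<And>e. e \<in> set (top_path D) \<Longrightarrow> Q e"
    and cell: "\<And>c e. c \<in> cells D \<Longrightarrow> e \<in> set (snd c) \<Longrightarrow> (\<And>f. f \<in> edges D \<Longrightarrow> h f < h e \<Longrightarrow> Q f) \<Longrightarrow>
        (\<And>f. f \<in> set (fst c) \<Longrightarrow> Q f) \<Longrightarrow> Q e"
  shows "Q e"
  using e
proof (induction "h e" arbitrary: e rule: less_induct)
  case less
  consider "e \<in> set (top_path D)" | c where "c \<in> cells D" "e \<in> set (snd c)"
    using less(2) halfD(5)[OF wfdD(1)[OF w]] by blast
  then show ?case
  proof cases
    case 2
    show ?thesis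
    proof (rule cell[OF 2])
      fix f assume "f \<in> set (fst c)"
      then show "Q f" using less(1) wfdD(7)[OF w 2(1) _ 2(2)] devmap_edges(3)[OF w 2(1)] by blast
    qed (use less in blast)
  qed (use top in blast)
qed

section \<open>Uniqueness of developments and embedding of reduced diagrams\<close>

lemma develops_unique:
  assumes "develops D T" "develops D T'"
  shows "T = T'"
proof -
  obtain \<theta> \<eta> h \<theta>' \<eta>' h' where w: "devmap D \<theta> \<eta> h" "devmap D \<theta>' \<eta>' h'" and T: "T = map \<theta> (bot_path D)" "T' = map \<theta>' (bot_path D)"
    using assms unfolding develops_def by blast
  have "\<theta> e = \<theta>' e" if "e \<in> edges D" for e
    using w(1) that
  proof (induction e rule: rank_induct)
    case (top e)
    have "map \<theta> (top_path D) = map \<theta>' (top_path D)" using wfdD(11) w by metis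
    then show ?case using top by simp
  next
    case (cell c e)
    have "map \<theta> (fst c) = map \<theta>' (fst c)" using cell by simp
    then have "map \<theta> (snd c) = map \<theta>' (snd c)" using wfdD(8)[OF w(1) cell(1)] wfdD(8)[OF w(2) cell(1)] by metis
    then show ?case using cell(2) by simp
  qed
  then show ?thesis using T devmap_edges(2)[OF w(1)] by (auto simp: subset_iff)
qed

text \<open>Cells are added from the top down. If the flip at a cell went back to the top of an
  older one, injectivity so far would make the bottom of a cell of the diagram equal to the top of
  the present cell, and the two would form a dipole. If the new bottom edges met old images, two
  cells would have the same top.\<close>

lemma reduced_embeds:
  assumes w: "devmap D \<theta> \<eta> h" and red: "reduced D"
  shows "inj_on \<theta> (edges D) \<and> (\<forall>c\<in>cells D. flip (map \<theta> (fst c)) (path_label D (snd c)) = bots (map \<theta> (fst c)) (path_label D (snd c)))"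
proof -
  let ?new = "\<lambda>c. flip (map \<theta> (fst c)) (path_label D (snd c)) = bots (map \<theta> (fst c)) (path_label D (snd c))"
  let ?E = "\<lambda>K. set (top_path D) \<union> (\<Union>c\<in>K. set (snd c))"
  note hd_ = halfD[OF wfdD(1)[OF w]] and hm_ = top_generated_mirrorD[OF wfdD(2)[OF w]]
  have \<theta>top: "\<theta> e \<noteq> New p u j" if "e \<in> set (top_path D)" for e p u j
  proof -
    have "\<theta> e \<in> set (base (top_label D))" using wfdD(11)[OF w] that by (metis image_eqI list.set_map)
    then show ?thesis by (auto simp: in_set_sbase)
  qed
  \<comment> \<open>The set \<open>K\<close> is closed upwards: each edge on the top of one of its
    cells is on the top path or made by a cell of \<open>K\<close>.\<close>
  have main: "finite K \<Longrightarrow> K \<subseteq> cells D \<Longrightarrow> (\<forall>c\<in>K. set (fst c) \<subseteq> ?E K) \<Longrightarrow> inj_on \<theta> (?E K) \<and> (\<forall>c\<in>K. ?new c)" for K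
  proof (induction "card K" arbitrary: K)
    case 0
    then have "K = {}" by simp
    moreover have "inj_on \<theta> (set (top_path D))"
    proof -
      have "distinct (map \<theta> (top_path D))" unfolding wfdD(11)[OF w]
        using chain_distinct reach_chain[OF reach_base] okl_base by blast
      then show ?thesis by (simp add: distinct_map)
    qed
    ultimately show ?case by simp
  next
    case (Suc n)
    \<comment> \<open>A cell whose top reaches the largest rank can be taken off: ranks increase
      across cells, so no top in \<open>K\<close> meets its bottom.\<close>
    let ?mx = "\<lambda>c. Max (h ` set (fst c))"
    have "K \<noteq> {}" using Suc(2) by auto
    then have "Max (?mx ` K) \<in> ?mx ` K" using Suc.prems(1) by (intro Max_in) auto
    then obtain c where cK: "c \<in> K" "?mx c = Max (?mx ` K)" by auto
    have c: "c \<in> K" "\<And>c'. c' \<in> K \<Longrightarrow> ?mx c' \<le> ?mx c"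
      using cK Suc.prems(1) by auto
    have cD: "c \<in> cells D" using c Suc.prems by blast
    have no: "set (fst c') \<inter> set (snd c) = {}" if c': "c' \<in> K" for c'
    proof (rule ccontr)
      assume "\<not> ?thesis"
      then obtain e where e: "e \<in> set (fst c')" "e \<in> set (snd c)" by blast
      have "?mx c \<in> h ` set (fst c)" using hm_(3)[OF cD] by (intro Max_in) auto
      then have "?mx c < h e" using wfdD(7)[OF w cD _ e(2)] by auto
      also have "h e \<le> ?mx c'" using e by (intro Max_ge) auto
      finally show False using c(2)[OF c'] by simp
    qed
    let ?K = "K - {c}"
    have Kd: "\<forall>c'\<in>?K. set (fst c') \<subseteq> ?E ?K"
    proof
      fix c' assume c': "c' \<in> ?K"
      then have "set (fst c') \<subseteq> ?E K" "set (fst c') \<inter> set (snd c) = {}" using Suc.prems(3) no by blast+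
      then show "set (fst c') \<subseteq> ?E ?K" by blast
    qed
    have "n = card ?K" using Suc(2) c(1) Suc.prems(1) by simp
    then have IH: "inj_on \<theta> (?E ?K)" "\<forall>c\<in>?K. ?new c" using Suc.hyps(1)[of ?K] Kd Suc.prems by auto
    have cE: "set (fst c) \<subseteq> ?E ?K" using Suc.prems(3) c(1) no[OF c(1)] by blast
    have ne: "fst c \<noteq> []" "snd c \<noteq> []" using devmap_cell[OF w cD] by auto
    let ?v = "path_label D (snd c)"
    have v: "?v \<noteq> []" using ne by (simp add: path_label_def)
    have lift: "\<exists>c1\<in>?K. map \<theta> (fst c1) = p' \<and> path_label D (snd c1) = u \<and> e \<in> set (snd c1)"
      if e: "e \<in> ?E ?K" "\<theta> e = New p' u j" for e p' u j
    proof -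
      have "e \<notin> set (top_path D)" using \<theta>top e(2) by blast
      then obtain c1 where c1: "c1 \<in> ?K" "e \<in> set (snd c1)" using e by blast
      have "map \<theta> (snd c1) = bots (map \<theta> (fst c1)) (path_label D (snd c1))"
      proof -
        have "c1 \<in> cells D" using c1(1) Suc.prems(2) by blast
        from wfdD(8)[OF w this] show ?thesis using IH(2) c1(1) by simp
      qed
      then have "\<theta> e \<in> set (bots (map \<theta> (fst c1)) (path_label D (snd c1)))" using c1(2) by (metis image_eqI list.set_map)
      then show ?thesis using e(2) c1 by (auto simp: set_bots)
    qed
    have nc: "?new c"
    proof (cases rule: flip_cases[of "map \<theta> (fst c)" ?v])
      case (2 p' u)
      have u: "u \<noteq> []" using 2(1) ne by (metis Nil_is_map_conv bots_eq_Nil)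
      have h0: "\<theta> (hd (fst c)) = New p' u 0" using 2(1) u ne(1) by (metis hd_bots hd_map)
      have "hd (fst c) \<in> ?E ?K" by (rule subsetD[OF cE]) (use ne(1) in simp)
      then obtain c1 where c1: "c1 \<in> ?K" "map \<theta> (fst c1) = p'" "path_label D (snd c1) = u" using lift h0 by blast
      have "map \<theta> (snd c1) = map \<theta> (fst c)"
      proof -
        have "c1 \<in> cells D" using c1(1) Suc.prems(2) by blast
        from wfdD(8)[OF w this] show ?thesis using bspec[OF IH(2) c1(1)] c1 2(1) by simp
      qed
      moreover have "set (snd c1) \<subseteq> ?E ?K" using c1(1) by blast
      ultimately have eq: "snd c1 = fst c" using map_inj_in[OF IH(1) _ cE] by blast
      have c1D: "c1 \<in> cells D" using c1 Suc.prems by blast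
      have "path_label D (fst c1) = ?v" using 2(2) c1(2) devmap_elab[OF w devmap_edges(3)[OF w c1D]] by simp
      then have "dipole D (fst c1) (fst c) (snd c)" unfolding dipole_def using c1D cD eq by (metis prod.collapse)
      then show ?thesis using red unfolding reduced_def by blast
    qed simp
    have \<theta>c: "map \<theta> (snd c) = bots (map \<theta> (fst c)) ?v" using wfdD(8)[OF w cD] nc by simp
    have "inj_on \<theta> (?E ?K \<union> set (snd c))"
    proof (subst inj_on_Un, intro conjI)
      show "inj_on \<theta> (?E ?K)" by (rule IH(1))
      have "distinct (map \<theta> (snd c))" unfolding \<theta>c by (rule distinct_bots)
      then show "inj_on \<theta> (set (snd c))" by (simp add: distinct_map)
      show "\<theta> ` (?E ?K - set (snd c)) \<inter> \<theta> ` (set (snd c) - ?E ?K) = {}"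
      proof (rule ccontr)
        assume "\<not> ?thesis"
        then obtain e f where ef: "e \<in> ?E ?K" "f \<in> set (snd c)" "\<theta> e = \<theta> f" by auto
        have "\<theta> f \<in> set (bots (map \<theta> (fst c)) ?v)" using \<theta>c ef(2) by (metis image_eqI list.set_map)
        then obtain j where "\<theta> f = New (map \<theta> (fst c)) ?v j" by (auto simp: set_bots)
        then obtain c1 where c1: "c1 \<in> ?K" "map \<theta> (fst c1) = map \<theta> (fst c)" using lift ef by metis
        have "set (fst c1) \<subseteq> ?E ?K" using Kd c1 by blast
        then have "fst c1 = fst c" using map_inj_in[OF IH(1) _ cE c1(2)] by blast
        then have "c1 = c" using hm_(7)[of c1 c "hd (fst c)"] c1 cD ne Suc.prems(2) by auto
        then show False using c1 by simp
      qed
    qed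
    moreover have "?E K = ?E ?K \<union> set (snd c)" using c(1) by blast
    ultimately show ?case using IH(2) nc by auto
  qed
  have "\<forall>c\<in>cells D. set (fst c) \<subseteq> ?E (cells D)" using hm_(5) hd_(5) by blast
  from main[OF wfdD(3)[OF w] order_refl this] show ?thesis unfolding hd_(5) .
qed

definition dcell :: "'a diagram \<Rightarrow> (nat \<Rightarrow> 'a edge) \<Rightarrow> nat list \<times> nat list \<Rightarrow> 'a edge list \<times> 'a list" where
  "dcell D \<theta> c = (map \<theta> (fst c), path_label D (snd c))"

text \<open>An edge that is not on the bottom path is on the top of a cell, whose bottom edges have
  larger rank and contain its history. Going down in this way, every history ends up in that of the
  bottom path.\<close>

lemma reduced_cells:
  assumes w: "devmap D \<theta> \<eta> h" and red: "reduced D"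
  shows "lcells (map \<theta> (bot_path D)) = dcell D \<theta> ` cells D" "inj_on (dcell D \<theta>) (cells D)"
proof -
  let ?T = "map \<theta> (bot_path D)" and ?CC = "dcell D \<theta> ` cells D"
  note inj = reduced_embeds[OF w red, THEN conjunct1] and new = reduced_embeds[OF w red, THEN conjunct2]
  have \<theta>c: "map \<theta> (snd c) = bots (map \<theta> (fst c)) (path_label D (snd c))" if "c \<in> cells D" for c
    using wfdD(8)[OF w that] new that by simp
  have sub: "ecells (\<theta> e) \<subseteq> ?CC" if "e \<in> edges D" for e
    using w that
  proof (induction e rule: rank_induct)
    case (top e)
    then have "\<theta> e \<in> set (base (top_label D))" using wfdD(11)[OF w] by (metis image_eqI list.set_map)
    then show ?case by (auto simp: in_set_sbase)
  next
    case (cell c e)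
    then have "\<theta> e \<in> set (bots (map \<theta> (fst c)) (path_label D (snd c)))" using \<theta>c by (metis image_eqI list.set_map)
    then obtain j where "\<theta> e = New (map \<theta> (fst c)) (path_label D (snd c)) j" by (auto simp: set_bots)
    moreover have "lcells (map \<theta> (fst c)) \<subseteq> ?CC" using cell(4) by (auto simp: lcells_def)
    ultimately show ?case using cell(1) by (auto simp: dcell_def)
  qed
  have fin: "finite (edges D)" using halfD(5)[OF wfdD(1)[OF w]] wfdD(3)[OF w] by auto
  have sup: "ecells (\<theta> e) \<subseteq> lcells ?T" if "e \<in> edges D" for e
    using that
  proof (induction "Max (h ` edges D) - h e" arbitrary: e rule: less_induct)
    case less
    consider "e \<in> set (bot_path D)" | c where "c \<in> cells D" "e \<in> set (fst c)"
      using less(2) top_generated_mirrorD(5)[OF wfdD(2)[OF w]] by blast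
    then show ?case
    proof cases
      case 1
      then show ?thesis by (auto simp: lcells_def)
    next
      case (2 c)
      let ?f = "hd (snd c)"
      have f: "?f \<in> set (snd c)" using devmap_cell(2)[OF w 2(1)] by simp
      then have fe: "?f \<in> edges D" using devmap_edges(4)[OF w 2(1)] by blast
      have "h ?f \<le> Max (h ` edges D)" using fe fin by simp
      moreover have "h e < h ?f" using wfdD(7)[OF w 2 f] .
      ultimately have "ecells (\<theta> ?f) \<subseteq> lcells ?T" using less(1)[of ?f] fe by linarith
      moreover have "\<theta> ?f \<in> set (bots (map \<theta> (fst c)) (path_label D (snd c)))" using \<theta>c[OF 2(1)] f by (metis image_eqI list.set_map)
      then obtain j where "\<theta> ?f = New (map \<theta> (fst c)) (path_label D (snd c)) j" by (auto simp: set_bots)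
      moreover have "ecells (\<theta> e) \<subseteq> lcells (map \<theta> (fst c))" using 2(2) by (auto simp: lcells_def)
      ultimately show ?thesis by auto
    qed
  qed
  show "lcells ?T = ?CC"
  proof
    show "lcells ?T \<subseteq> ?CC" using sub devmap_edges(2)[OF w] by (auto simp: lcells_def)
    show "?CC \<subseteq> lcells ?T"
    proof
      fix x assume "x \<in> ?CC"
      then obtain c where c: "c \<in> cells D" "x = dcell D \<theta> c" by blast
      have f: "hd (snd c) \<in> set (snd c)" using devmap_cell(2)[OF w c(1)] by simp
      have "\<theta> (hd (snd c)) \<in> set (bots (map \<theta> (fst c)) (path_label D (snd c)))" using \<theta>c[OF c(1)] f by (metis image_eqI list.set_map)
      then have "x \<in> ecells (\<theta> (hd (snd c)))" using c(2) by (auto simp: set_bots dcell_def)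
      then show "x \<in> lcells ?T" using sup f devmap_edges(4)[OF w c(1)] by blast
    qed
  qed
  show "inj_on (dcell D \<theta>) (cells D)"
  proof (rule inj_onI)
    fix c c' assume c: "c \<in> cells D" "c' \<in> cells D" "dcell D \<theta> c = dcell D \<theta> c'"
    then have "fst c = fst c'"
      using map_inj_in[OF inj devmap_edges(3)[OF w c(1)] devmap_edges(3)[OF w c(2)]] by (simp add: dcell_def)
    then show "c = c'" using top_generated_mirrorD(7)[OF wfdD(2)[OF w] c(1,2), of "hd (fst c)"] devmap_cell(1)[OF w c(1)] by auto
  qed
qed

lemma devmap_verts:
  assumes w: "devmap D \<theta> \<eta> h"
  shows "i < length (path_verts D (top_path D)) \<Longrightarrow> path_verts D (top_path D) ! i \<in> verts D"
    "c \<in> cells D \<Longrightarrow> Suc k < length (snd c) \<Longrightarrow> tgt D (snd c ! k) \<in> verts D"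
    "e \<in> edges D \<Longrightarrow> src D e \<in> verts D" "e \<in> edges D \<Longrightarrow> tgt D e \<in> verts D"
proof -
  note hd_ = halfD[OF wfdD(1)[OF w]]
  let ?n = "length (top_path D)"
  have ln: "length (top_path D) = ?n" by simp
  have vtop: "path_verts D (top_path D) ! i \<in> verts D" if "i \<le> ?n" for i
  proof -
    have "i < length (path_verts D (top_path D))" using that ln by (simp add: path_verts_def)
    then show ?thesis using hd_(8) nth_mem by blast
  qed
  have vin: "tgt D (snd c ! k) \<in> verts D" if "c \<in> cells D" "Suc k < length (snd c)" for c k
    using that hd_(8) dinner_iff by blast
  show "i < length (path_verts D (top_path D)) \<Longrightarrow> path_verts D (top_path D) ! i \<in> verts D"
    using hd_(8) nth_mem by blast
  show "c \<in> cells D \<Longrightarrow> Suc k < length (snd c) \<Longrightarrow> tgt D (snd c ! k) \<in> verts D" by (rule vin)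
  have both: "src D e \<in> verts D \<and> tgt D e \<in> verts D" if "e \<in> edges D" for e
    using w that
  proof (induction e rule: rank_induct)
    case (top e)
    then obtain i where i: "i < length (top_path D)" "e = top_path D ! i" by (metis in_set_conv_nth)
    have "tgt D e = path_verts D (top_path D) ! Suc i" using i by (simp add: path_verts_def)
    then have t: "tgt D e \<in> verts D" using vtop[of "Suc i"] i ln by simp
    have "src D e = path_verts D (top_path D) ! i"
    proof (cases i)
      case 0
      then show ?thesis using i hd_(1) by (simp add: path_verts_def hd_conv_nth)
    next
      case (Suc k)
      then show ?thesis using i hd_(2) by (simp add: path_verts_def diagram_path_def)
    qed
    then show ?case using t vtop[of i] i ln by simp
  next
    case (cell c e)
    note ne = devmap_cell[OF w cell(1)]
    obtain i where i: "i < length (snd c)" "e = snd c ! i" using cell(2) by (metis in_set_conv_nth)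
    have "tgt D e \<in> verts D"
    proof (cases "Suc i < length (snd c)")
      case True
      then show ?thesis using vin[OF cell(1)] i by blast
    next
      case False
      then have "e = last (snd c)" using i ne by (metis Suc_lessI diff_Suc_1 last_conv_nth)
      then show ?thesis using wfdD(5)[OF w cell(1)] cell(4)[of "last (fst c)"] ne by simp
    qed
    moreover have "src D e \<in> verts D"
    proof (cases i)
      case 0
      then have "e = hd (snd c)" using i ne by (simp add: hd_conv_nth)
      then show ?thesis using wfdD(4)[OF w cell(1)] cell(4)[of "hd (fst c)"] ne by simp
    next
      case (Suc k)
      then show ?thesis using i ne(4) vin[OF cell(1), of k] by (simp add: diagram_path_def)
    qed
    ultimately show ?case by simp
  qed
  then show "e \<in> edges D \<Longrightarrow> src D e \<in> verts D" "e \<in> edges D \<Longrightarrow> tgt D e \<in> verts D" by blast+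
qed

text \<open>The image is described by the top label and the developed bottom path alone. So two
  reduced diagrams that agree in these are mapped onto the same part of the complex.\<close>

lemma reduced_verts:
  assumes w: "devmap D \<theta> \<eta> h" and red: "reduced D"
  shows "inj_on \<eta> (verts D)"
    "\<eta> ` verts D = VBase ` {..length (top_label D)} \<union>
        {VNew p v j | p v j. (p, v) \<in> lcells (map \<theta> (bot_path D)) \<and> 0 < j \<and> j < length v}"
proof -
  let ?T = "map \<theta> (bot_path D)" and ?n = "length (top_label D)"
  note hd_ = halfD[OF wfdD(1)[OF w]]
  note new = reduced_embeds[OF w red, THEN conjunct2]
  have ln: "length (top_path D) = ?n" by (simp add: top_label_def path_label_def)
  have \<theta>c: "map \<theta> (snd c) = bots (map \<theta> (fst c)) (path_label D (snd c))" if "c \<in> cells D" for c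
    using wfdD(8)[OF w that] new that by simp
  have top_nth: "\<eta> (path_verts D (top_path D) ! i) = VBase i" if "i \<le> ?n" for i
  proof -
    have t: "\<theta> (top_path D ! i) = Base i (top_label D ! i)" if "i < ?n" for i
      using wfdD(11)[OF w] that ln by (metis add_0 nth_map nth_sbase)
    show ?thesis
    proof (cases i)
      case 0
      have "hd (top_path D) = top_path D ! 0" "0 < ?n" using hd_(1) ln by (auto simp: hd_conv_nth)
      then show ?thesis using 0 t[of 0] wfdD(14)[OF w, of "hd (top_path D)"] devmap_edges(1)[OF w] hd_(1)
        by (simp add: path_verts_def subset_iff)
    next
      case (Suc k)
      then have "top_path D ! k \<in> edges D" using that ln devmap_edges(1)[OF w] by auto
      then show ?thesis using Suc t[of k] wfdD(15)[OF w, of "top_path D ! k"] that ln by (simp add: path_verts_def)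
    qed
  qed
  have inner_eta: "\<eta> (tgt D (snd c ! k)) = VNew (map \<theta> (fst c)) (path_label D (snd c)) (Suc k)"
    if c: "c \<in> cells D" and k: "Suc k < length (snd c)" for c k
  proof -
    have l: "length (path_label D (snd c)) = length (snd c)" by (simp add: path_label_def)
    have "\<theta> (snd c ! k) = New (map \<theta> (fst c)) (path_label D (snd c)) k"
      using \<theta>c[OF c] k l by (metis Suc_lessD nth_bots nth_map)
    moreover have "snd c ! k \<in> edges D" using devmap_edges(4)[OF w c] k by auto
    ultimately show ?thesis using wfdD(15)[OF w, of "snd c ! k"] k l by simp
  qed
  have vcase: "(\<exists>i\<le>?n. x = path_verts D (top_path D) ! i) \<or> (\<exists>c\<in>cells D. \<exists>k. Suc k < length (snd c) \<and> x = tgt D (snd c ! k))"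
    if "x \<in> verts D" for x
  proof -
    have "x \<in> set (path_verts D (top_path D)) \<or> (\<exists>c\<in>cells D. x \<in> dinner D (snd c))" using that hd_(8) by blast
    then show ?thesis
    proof
      assume "x \<in> set (path_verts D (top_path D))"
      then obtain i where "i < length (path_verts D (top_path D))" "x = path_verts D (top_path D) ! i" by (metis in_set_conv_nth)
      then show ?thesis using ln by (auto simp: path_verts_def less_Suc_eq_le)
    next
      assume "\<exists>c\<in>cells D. x \<in> dinner D (snd c)"
      then show ?thesis using dinner_iff by blast
    qed
  qed
  have vtop: "path_verts D (top_path D) ! i \<in> verts D" if "i \<le> ?n" for i
    using devmap_verts(1)[OF w, of i] that ln by (simp add: path_verts_def)
  note vin = devmap_verts(2)[OF w]
  show "inj_on \<eta> (verts D)"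
  proof (rule inj_onI)
    fix x y assume xy: "x \<in> verts D" "y \<in> verts D" "\<eta> x = \<eta> y"
    from vcase[OF xy(1)] show "x = y"
    proof
      assume "\<exists>i\<le>?n. x = path_verts D (top_path D) ! i"
      then obtain i where i: "i \<le> ?n" "x = path_verts D (top_path D) ! i" by blast
      from vcase[OF xy(2)] show ?thesis
      proof
        assume "\<exists>j\<le>?n. y = path_verts D (top_path D) ! j"
        then obtain j where "j \<le> ?n" "y = path_verts D (top_path D) ! j" by blast
        then show ?thesis using i top_nth[of i] top_nth[of j] xy(3) by simp
      next
        assume "\<exists>c\<in>cells D. \<exists>k. Suc k < length (snd c) \<and> y = tgt D (snd c ! k)"
        then obtain c k where "c \<in> cells D" "Suc k < length (snd c)" "y = tgt D (snd c ! k)" by blast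
        then show ?thesis using inner_eta[of c k] i top_nth[of i] xy(3) by simp
      qed
    next
      assume "\<exists>c\<in>cells D. \<exists>k. Suc k < length (snd c) \<and> x = tgt D (snd c ! k)"
      then obtain c k where c: "c \<in> cells D" "Suc k < length (snd c)" "x = tgt D (snd c ! k)" by blast
      from vcase[OF xy(2)] show ?thesis
      proof
        assume "\<exists>i\<le>?n. y = path_verts D (top_path D) ! i"
        then obtain i where "\<eta> y = VBase i" using top_nth by blast
        then show ?thesis using inner_eta[OF c(1,2)] c(3) xy(3) by simp
      next
        assume "\<exists>c\<in>cells D. \<exists>k. Suc k < length (snd c) \<and> y = tgt D (snd c ! k)"
        then obtain c' k' where c': "c' \<in> cells D" "Suc k' < length (snd c')" "y = tgt D (snd c' ! k')" by blast
        have "k = k'" "dcell D \<theta> c = dcell D \<theta> c'" using inner_eta c c' xy(3) by (auto simp: dcell_def)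
        then show ?thesis using reduced_cells(2)[OF w red] c c' by (metis inj_onD)
      qed
    qed
  qed
  show "\<eta> ` verts D = VBase ` {..?n} \<union> {VNew p v j | p v j. (p, v) \<in> lcells ?T \<and> 0 < j \<and> j < length v}"
  proof
    show "\<eta> ` verts D \<subseteq> VBase ` {..?n} \<union> {VNew p v j | p v j. (p, v) \<in> lcells ?T \<and> 0 < j \<and> j < length v}"
    proof
      fix z assume "z \<in> \<eta> ` verts D"
      then obtain x where x: "x \<in> verts D" "z = \<eta> x" by blast
      from vcase[OF x(1)] show "z \<in> VBase ` {..?n} \<union> {VNew p v j | p v j. (p, v) \<in> lcells ?T \<and> 0 < j \<and> j < length v}"
      proof
        assume "\<exists>i\<le>?n. x = path_verts D (top_path D) ! i"
        then show ?thesis using top_nth x by auto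
      next
        assume "\<exists>c\<in>cells D. \<exists>k. Suc k < length (snd c) \<and> x = tgt D (snd c ! k)"
        then obtain c k where c: "c \<in> cells D" "Suc k < length (snd c)" "x = tgt D (snd c ! k)" by blast
        have "(map \<theta> (fst c), path_label D (snd c)) \<in> lcells ?T"
          unfolding reduced_cells(1)[OF w red] using c(1) by (force simp: dcell_def)
        moreover have "Suc k < length (path_label D (snd c))" using c by (simp add: path_label_def)
        ultimately show ?thesis using inner_eta[OF c(1,2)] c(3) x(2) by auto
      qed
    qed
    show "VBase ` {..?n} \<union> {VNew p v j | p v j. (p, v) \<in> lcells ?T \<and> 0 < j \<and> j < length v} \<subseteq> \<eta> ` verts D"
    proof
      fix z assume "z \<in> VBase ` {..?n} \<union> {VNew p v j | p v j. (p, v) \<in> lcells ?T \<and> 0 < j \<and> j < length v}"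
      then consider i where "i \<le> ?n" "z = VBase i" | p v j where "(p, v) \<in> lcells ?T" "0 < j" "j < length v" "z = VNew p v j"
        by blast
      then show "z \<in> \<eta> ` verts D"
      proof cases
        case 1
        then show ?thesis using top_nth vtop by (metis image_eqI)
      next
        case 2
        then obtain c where c: "c \<in> cells D" "(p, v) = dcell D \<theta> c" unfolding reduced_cells(1)[OF w red] by blast
        then have "Suc (j - 1) < length (snd c)" using 2 by (auto simp: dcell_def path_label_def)
        then have "z = \<eta> (tgt D (snd c ! (j - 1)))" "tgt D (snd c ! (j - 1)) \<in> verts D"
          using inner_eta[OF c(1), of "j - 1"] vin[OF c(1), of "j - 1"] c(2) 2 by (auto simp: dcell_def)
        then show ?thesis by blast
      qed
    qed
  qed
qed

lemma reduced_edges: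
  assumes w: "devmap D \<theta> \<eta> h" and red: "reduced D"
  shows "\<theta> ` edges D = set (base (top_label D)) \<union> (\<Union>(p, v)\<in>lcells (map \<theta> (bot_path D)). set (bots p v))"
proof -
  note new = reduced_embeds[OF w red, THEN conjunct2]
  have \<theta>c: "\<theta> ` set (snd c) = set (bots (map \<theta> (fst c)) (path_label D (snd c)))" if "c \<in> cells D" for c
    using wfdD(8)[OF w that] new that by (metis list.set_map)
  have "\<theta> ` edges D = \<theta> ` set (top_path D) \<union> (\<Union>c\<in>cells D. \<theta> ` set (snd c))"
    unfolding halfD(5)[OF wfdD(1)[OF w]] by blast
  also have "\<theta> ` set (top_path D) = set (base (top_label D))" using wfdD(11)[OF w] by (metis list.set_map)
  also have "(\<Union>c\<in>cells D. \<theta> ` set (snd c)) = (\<Union>(p, v)\<in>lcells (map \<theta> (bot_path D)). set (bots p v))"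
    unfolding reduced_cells(1)[OF w red] using \<theta>c by (auto simp: dcell_def)
  finally show ?thesis .
qed

text \<open>This contains the uniqueness part of Kilibarda's theorem.\<close>

lemma reduced_isotopic:
  assumes D: "develops D T" "reduced D" and E: "develops E T" "reduced E" and top: "top_label D = top_label E"
  shows "isotopic D E"
proof -
  obtain \<theta> \<eta> h where w: "devmap D \<theta> \<eta> h" "T = map \<theta> (bot_path D)" using D(1) unfolding develops_def by blast
  obtain \<theta>' \<eta>' h' where w': "devmap E \<theta>' \<eta>' h'" "T = map \<theta>' (bot_path E)" using E(1) unfolding develops_def by blast
  note inj = reduced_embeds[OF w(1) D(2), THEN conjunct1] and inj' = reduced_embeds[OF w'(1) E(2), THEN conjunct1]
  define \<psi> where "\<psi> e = inv_into (edges E) \<theta>' (\<theta> e)" for e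
  define \<phi> where "\<phi> x = inv_into (verts E) \<eta>' (\<eta> x)" for x
  have im: "\<theta> ` edges D = \<theta>' ` edges E"
    using reduced_edges[OF w(1) D(2)] reduced_edges[OF w'(1) E(2)] w(2) w'(2) top by simp
  have imv: "\<eta> ` verts D = \<eta>' ` verts E"
    using reduced_verts(2)[OF w(1) D(2)] reduced_verts(2)[OF w'(1) E(2)] w(2) w'(2) top by simp
  have bij: "bij_betw \<psi> (edges D) (edges E)"
  proof -
    have "bij_betw (inv_into (edges E) \<theta>' \<circ> \<theta>) (edges D) (edges E)"
      using inj inj' im by (intro bij_betw_trans[of \<theta> _ "\<theta> ` edges D"] bij_betw_inv_into) (auto simp: bij_betw_def)
    then show ?thesis by (simp add: \<psi>_def o_def cong: bij_betw_cong)
  qed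
  have bijv: "bij_betw \<phi> (verts D) (verts E)"
  proof -
    have "bij_betw (inv_into (verts E) \<eta>' \<circ> \<eta>) (verts D) (verts E)"
      using reduced_verts(1)[OF w(1) D(2)] reduced_verts(1)[OF w'(1) E(2)] imv
      by (intro bij_betw_trans[of \<eta> _ "\<eta> ` verts D"] bij_betw_inv_into) (auto simp: bij_betw_def)
    then show ?thesis by (simp add: \<phi>_def o_def cong: bij_betw_cong)
  qed
  have \<psi>: "\<psi> e \<in> edges E" "\<theta>' (\<psi> e) = \<theta> e" if "e \<in> edges D" for e
  proof -
    have "\<theta> e \<in> \<theta>' ` edges E" using that im by blast
    then show "\<psi> e \<in> edges E" "\<theta>' (\<psi> e) = \<theta> e" unfolding \<psi>_def by (rule inv_into_into, rule f_inv_into_f)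
  qed
  have \<psi>_list: "map \<psi> p = q" if "set p \<subseteq> edges D" "set q \<subseteq> edges E" "map \<theta> p = map \<theta>' q" for p q
  proof -
    have "map \<theta>' (map \<psi> p) = map \<theta> p" using that(1) \<psi>(2) by (auto simp: map_map)
    then have "map \<theta>' (map \<psi> p) = map \<theta>' q" using that(3) by simp
    moreover have "set (map \<psi> p) \<subseteq> edges E" using \<psi>(1) that(1) by auto
    ultimately show ?thesis using map_inj_in[OF inj' _ that(2)] by blast
  qed
  have \<phi>: "\<phi> x = y" if "x \<in> verts D" "y \<in> verts E" "\<eta> x = \<eta>' y" for x y
    using that reduced_verts(1)[OF w'(1) E(2)] by (simp add: \<phi>_def)
  have inc: "src E (\<psi> e) = \<phi> (src D e) \<and> tgt E (\<psi> e) = \<phi> (tgt D e) \<and> lab E (\<psi> e) = lab D e" if e: "e \<in> edges D" for e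
  proof -
    note a = devmap_verts(3,4)[OF w(1) e] devmap_verts(3,4)[OF w'(1) \<psi>(1)[OF e]]
    have "\<eta> (src D e) = \<eta>' (src E (\<psi> e))" "\<eta> (tgt D e) = \<eta>' (tgt E (\<psi> e))"
      using wfdD(14,15)[OF w(1) e] wfdD(14,15)[OF w'(1) \<psi>(1)[OF e]] \<psi>(2)[OF e] by simp_all
    then have "\<phi> (src D e) = src E (\<psi> e)" "\<phi> (tgt D e) = tgt E (\<psi> e)" using \<phi> a by blast+
    then show ?thesis using wfdD(13)[OF w(1) e] wfdD(13)[OF w'(1) \<psi>(1)[OF e]] \<psi>(2)[OF e] by simp
  qed
  have cell_match: "\<exists>c'\<in>cells E. fst c' = map \<psi> (fst c) \<and> snd c' = map \<psi> (snd c)" if c: "c \<in> cells D" for c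
  proof -
    have "dcell D \<theta> c \<in> dcell E \<theta>' ` cells E"
      using reduced_cells(1)[OF w(1) D(2)] reduced_cells(1)[OF w'(1) E(2)] w(2) w'(2) c by auto
    then obtain c' where c': "c' \<in> cells E" "dcell D \<theta> c = dcell E \<theta>' c'" by blast
    have 1: "map \<theta> (fst c) = map \<theta>' (fst c')" "path_label D (snd c) = path_label E (snd c')" using c'(2) by (auto simp: dcell_def)
    then have "map \<theta> (snd c) = map \<theta>' (snd c')" using wfdD(8)[OF w(1) c] wfdD(8)[OF w'(1) c'(1)] by simp
    then show ?thesis using \<psi>_list 1 devmap_edges(3,4)[OF w(1) c] devmap_edges(3,4)[OF w'(1) c'(1)] c'(1) by metis
  qed
  have "cells E = (\<lambda>(p, q). (map \<psi> p, map \<psi> q)) ` cells D"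
  proof
    show "(\<lambda>(p, q). (map \<psi> p, map \<psi> q)) ` cells D \<subseteq> cells E"
      using cell_match by (fastforce simp: split_beta)
    show "cells E \<subseteq> (\<lambda>(p, q). (map \<psi> p, map \<psi> q)) ` cells D"
    proof
      fix c' assume c': "c' \<in> cells E"
      have "dcell E \<theta>' c' \<in> dcell D \<theta> ` cells D"
        using reduced_cells(1)[OF w(1) D(2)] reduced_cells(1)[OF w'(1) E(2)] w(2) w'(2) c' by auto
      then obtain c where c: "c \<in> cells D" "dcell E \<theta>' c' = dcell D \<theta> c" by blast
      have 1: "map \<theta> (fst c) = map \<theta>' (fst c')" "path_label D (snd c) = path_label E (snd c')" using c(2) by (auto simp: dcell_def)
      then have "map \<theta> (snd c) = map \<theta>' (snd c')" using wfdD(8)[OF w(1) c(1)] wfdD(8)[OF w'(1) c'(1)] by simp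
      then have "c' = (map \<psi> (fst c), map \<psi> (snd c))"
        using \<psi>_list 1 devmap_edges(3,4)[OF w(1) c(1)] devmap_edges(3,4)[OF w'(1) c'] by (metis prod.collapse)
      then show "c' \<in> (\<lambda>(p, q). (map \<psi> p, map \<psi> q)) ` cells D" using c(1) by (force simp: split_beta)
    qed
  qed
  moreover have "top_path E = map \<psi> (top_path D)" "bot_path E = map \<psi> (bot_path D)"
    using \<psi>_list devmap_edges(1,2)[OF w(1)] devmap_edges(1,2)[OF w'(1)] wfdD(11)[OF w(1)] wfdD(11)[OF w'(1)] top w(2) w'(2) by metis+
  ultimately show ?thesis unfolding isotopic_def using bij bijv inc by blast
qed

lemma reduced_card: "develops D T \<Longrightarrow> reduced D \<Longrightarrow> card (cells D) = card (lcells T)"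
  unfolding develops_def using reduced_cells by (metis card_image)

end

section \<open>Removal of dipoles\<close>

lemma subst_list_nth: "distinct xs \<Longrightarrow> length xs = length ys \<Longrightarrow> i < length xs \<Longrightarrow> subst_list xs ys (xs ! i) = ys ! i"
  unfolding subst_list_def by (simp add: map_of_zip_nth)

lemma subst_list_notin: "z \<notin> set xs \<Longrightarrow> length xs = length ys \<Longrightarrow> subst_list xs ys z = z"
proof -
  assume "z \<notin> set xs" "length xs = length ys"
  then have "map_of (zip xs ys) z = None" by (subst map_of_zip_is_None) auto
  then show ?thesis by (simp add: subst_list_def)
qed

lemma collapse_simps [simp]:
  "verts (collapse \<phi> \<psi> D) = \<phi> ` verts D" "edges (collapse \<phi> \<psi> D) = \<psi> ` edges D"
  "src (collapse \<phi> \<psi> D) e = \<phi> (src D e)" "tgt (collapse \<phi> \<psi> D) e = \<phi> (tgt D e)" "lab (collapse \<phi> \<psi> D) = lab D"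
  "cells (collapse \<phi> \<psi> D) = (\<lambda>(p, q). (map \<psi> p, map \<psi> q)) ` cells D"
  "top_path (collapse \<phi> \<psi> D) = map \<psi> (top_path D)" "bot_path (collapse \<phi> \<psi> D) = map \<psi> (bot_path D)"
  by (simp_all add: collapse_def)

lemma hom_diagram_path:
  assumes "\<And>e. e \<in> set p \<Longrightarrow> src N (\<psi> e) = \<phi> (src D e) \<and> tgt N (\<psi> e) = \<phi> (tgt D e)" "diagram_path D p"
  shows "diagram_path N (map \<psi> p)"
  using assms by (auto simp: diagram_path_def)

lemma hom_path_verts:
  assumes "\<And>e. e \<in> set p \<Longrightarrow> src N (\<psi> e) = \<phi> (src D e) \<and> tgt N (\<psi> e) = \<phi> (tgt D e)" "p \<noteq> []"
  shows "path_verts N (map \<psi> p) = map \<phi> (path_verts D p)"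
  using assms by (auto simp: path_verts_def hd_map map_map)

lemma hom_dinner:
  assumes "\<And>e. e \<in> set p \<Longrightarrow> src N (\<psi> e) = \<phi> (src D e) \<and> tgt N (\<psi> e) = \<phi> (tgt D e)"
  shows "dinner N (map \<psi> p) = \<phi> ` dinner D p"
proof -
  have "set (butlast p) \<subseteq> set p" by (auto dest: in_set_butlastD)
  then have "(\<lambda>e. tgt N (\<psi> e)) ` set (butlast p) = (\<lambda>e. \<phi> (tgt D e)) ` set (butlast p)"
    using assms by (intro image_cong) auto
  then show ?thesis by (simp add: dinner_def map_butlast[symmetric] image_image)
qed

text \<open>\<open>Q\<close> and \<open>Q'\<close> are deleted, while \<open>R\<close> and
  \<open>R'\<close> are identified with something that survives outside them. In this form the lemma
  serves for the removal of a dipole and, with the roles of its outer paths exchanged, for the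
  mirror image.\<close>

lemma top_generated_quotient:
  assumes H: "top_generated D" and X: "X \<subseteq> cells D" "(\<Union>c\<in>X. set (snd c)) = Q \<union> R" "(\<Union>c\<in>X. dinner D (snd c)) = Q' \<union> R'"
    and rq: "R \<inter> Q = {}" "R' \<inter> Q' = {}"
    and A1: "\<And>e f. e \<in> edges D - Q \<Longrightarrow> f \<in> edges D - Q \<Longrightarrow> \<psi> e = \<psi> f \<Longrightarrow> e = f \<or> e \<in> R \<or> f \<in> R"
    and A2: "\<And>e. e \<in> R \<Longrightarrow> \<exists>f\<in>edges D. \<psi> f = \<psi> e \<and> f \<notin> Q \<and> f \<notin> R"
    and B1: "\<And>x y. x \<in> verts D - Q' \<Longrightarrow> y \<in> verts D - Q' \<Longrightarrow> \<phi> x = \<phi> y \<Longrightarrow> x = y \<or> x \<in> R' \<or> y \<in> R'"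
    and B2: "\<And>x. x \<in> R' \<Longrightarrow> \<exists>y\<in>verts D. \<phi> y = \<phi> x \<and> y \<notin> Q' \<and> y \<notin> R'"
    and N: "verts N = \<phi> ` (verts D - Q')" "edges N = \<psi> ` (edges D - Q)"
      "cells N = (\<lambda>c. (map \<psi> (fst c), map \<psi> (snd c))) ` (cells D - X)" "top_path N = map \<psi> (top_path D)"
    and hom: "\<And>e. e \<in> edges D - Q \<Longrightarrow> src N (\<psi> e) = \<phi> (src D e) \<and> tgt N (\<psi> e) = \<phi> (tgt D e)"
  shows "top_generated N"
proof -
  let ?K = "cells D - X" and ?t = "top_path D"
  note h = halfD[OF H]
  have tE: "set ?t \<subseteq> edges D - Q" using h(5) h(6) X(1,2) by blast
  have tr: "set ?t \<inter> R = {}" using h(6) X(1,2) by blast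
  have kq: "set (snd k) \<inter> Q = {}" "set (snd k) \<inter> R = {}" if "k \<in> ?K" for k
    using h(7)[of k] X(1,2) that by blast+
  have kE: "set (snd k) \<subseteq> edges D - Q" if "k \<in> ?K" for k using h(5) kq[OF that] that by blast
  have homt: "\<And>e. e \<in> set ?t \<Longrightarrow> src N (\<psi> e) = \<phi> (src D e) \<and> tgt N (\<psi> e) = \<phi> (tgt D e)" using hom tE by blast
  have homk: "\<And>e. e \<in> set (snd k) \<Longrightarrow> src N (\<psi> e) = \<phi> (src D e) \<and> tgt N (\<psi> e) = \<phi> (tgt D e)" if "k \<in> ?K" for k
    using hom kE[OF that] by blast
  have pvt: "path_verts N (top_path N) = map \<phi> (path_verts D ?t)"
    unfolding N(4) by (rule hom_path_verts[OF _ h(1)]) (rule homt)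
  have dik: "dinner N (map \<psi> (snd k)) = \<phi> ` dinner D (snd k)" if "k \<in> ?K" for k
    by (rule hom_dinner) (rule homk[OF that])
  have tv: "set (path_verts D ?t) \<subseteq> verts D - Q'" "set (path_verts D ?t) \<inter> R' = {}"
    using h(8) h(9) X(1,3) by blast+
  have kv: "dinner D (snd k) \<subseteq> verts D - Q'" "dinner D (snd k) \<inter> R' = {}" if "k \<in> ?K" for k
    using h(8) h(10)[of k] X(1,3) that by blast+
  have E0: "edges D - Q = set ?t \<union> (\<Union>k\<in>?K. set (snd k)) \<union> R"
  proof -
    have "edges D = set ?t \<union> (\<Union>k\<in>?K. set (snd k)) \<union> (Q \<union> R)" using h(5) X(1) unfolding X(2)[symmetric] by blast
    then show ?thesis using tE kE rq(1) by blast
  qed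
  have V0: "verts D - Q' = set (path_verts D ?t) \<union> (\<Union>k\<in>?K. dinner D (snd k)) \<union> R'"
  proof -
    have "verts D = set (path_verts D ?t) \<union> (\<Union>k\<in>?K. dinner D (snd k)) \<union> (Q' \<union> R')"
      using h(8) X(1) unfolding X(3)[symmetric] by blast
    moreover have "set (path_verts D ?t) \<inter> Q' = {}" using tv(1) by blast
    moreover have "(\<Union>k\<in>?K. dinner D (snd k)) \<inter> Q' = {}" using kv(1) by blast
    ultimately show ?thesis using rq(2) by blast
  qed
  have "edges N = \<psi> ` set ?t \<union> (\<Union>k\<in>?K. \<psi> ` set (snd k))"
  proof -
    have "\<psi> ` R \<subseteq> \<psi> ` set ?t \<union> (\<Union>k\<in>?K. \<psi> ` set (snd k))"
    proof
      fix x assume "x \<in> \<psi> ` R"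
      then obtain f where f: "f \<in> edges D" "\<psi> f = x" "f \<notin> Q" "f \<notin> R" using A2 by blast
      then have "f \<in> set ?t \<union> (\<Union>k\<in>?K. set (snd k))" using E0 by blast
      then show "x \<in> \<psi> ` set ?t \<union> (\<Union>k\<in>?K. \<psi> ` set (snd k))" using f(2) by blast
    qed
    then show ?thesis unfolding N(2) E0 by blast
  qed
  then have e5: "edges N = set (top_path N) \<union> (\<Union>c\<in>cells N. set (snd c))" unfolding N(3,4) by simp
  have "verts N = \<phi> ` set (path_verts D ?t) \<union> (\<Union>k\<in>?K. \<phi> ` dinner D (snd k))"
  proof -
    have "\<phi> ` R' \<subseteq> \<phi> ` set (path_verts D ?t) \<union> (\<Union>k\<in>?K. \<phi> ` dinner D (snd k))"
    proof
      fix x assume "x \<in> \<phi> ` R'"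
      then obtain y where y: "y \<in> verts D" "\<phi> y = x" "y \<notin> Q'" "y \<notin> R'" using B2 by blast
      then have "y \<in> set (path_verts D ?t) \<union> (\<Union>k\<in>?K. dinner D (snd k))" using V0 by blast
      then show "x \<in> \<phi> ` set (path_verts D ?t) \<union> (\<Union>k\<in>?K. \<phi> ` dinner D (snd k))" using y(2) by blast
    qed
    then show ?thesis unfolding N(1) V0 by blast
  qed
  then have e8: "verts N = set (path_verts N (top_path N)) \<union> (\<Union>c\<in>cells N. dinner N (snd c))"
    unfolding pvt N(3) using dik by simp
  have e4: "set (top_path N) \<inter> set (snd c) = {}" if cN: "c \<in> cells N" for c
  proof (rule ccontr)
    assume a: "\<not> ?thesis"
    obtain k where k0: "k \<in> ?K" "c = (map \<psi> (fst k), map \<psi> (snd k))" using cN unfolding N(3) by blast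
    then have k: "k \<in> ?K" "snd c = map \<psi> (snd k)" by simp_all
    then obtain e f where ef: "e \<in> set ?t" "f \<in> set (snd k)" "\<psi> e = \<psi> f" using a unfolding N(4) by auto
    have "e = f \<or> e \<in> R \<or> f \<in> R" using A1[OF _ _ ef(3)] tE kE[OF k(1)] ef by blast
    then have "e = f" using tr kq[OF k(1)] ef by blast
    then show False using h(6)[of k] k ef by auto
  qed
  have e5': "c = c'" if cN: "c \<in> cells N" "c' \<in> cells N" and ne: "set (snd c) \<inter> set (snd c') \<noteq> {}" for c c'
  proof -
    obtain k k' where k: "k \<in> ?K" "c = (map \<psi> (fst k), map \<psi> (snd k))" "k' \<in> ?K" "c' = (map \<psi> (fst k'), map \<psi> (snd k'))"
      using cN unfolding N(3) by blast
    then obtain e f where ef: "e \<in> set (snd k)" "f \<in> set (snd k')" "\<psi> e = \<psi> f" using ne by auto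
    have "e = f \<or> e \<in> R \<or> f \<in> R" using A1[OF _ _ ef(3)] kE[OF k(1)] kE[OF k(3)] ef by blast
    then have "e = f" using kq[OF k(1)] kq[OF k(3)] ef by blast
    then have "k = k'" using h(7)[of k k' e] k ef by auto
    then show ?thesis using k by simp
  qed
  have e9: "set (path_verts N (top_path N)) \<inter> dinner N (snd c) = {}" if cN: "c \<in> cells N" for c
  proof (rule ccontr)
    assume a: "\<not> ?thesis"
    obtain k where k0: "k \<in> ?K" "c = (map \<psi> (fst k), map \<psi> (snd k))" using cN unfolding N(3) by blast
    then have k: "k \<in> ?K" "snd c = map \<psi> (snd k)" by simp_all
    then obtain x y where xy: "x \<in> set (path_verts D ?t)" "y \<in> dinner D (snd k)" "\<phi> x = \<phi> y" using a dik pvt by auto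
    have "x = y \<or> x \<in> R' \<or> y \<in> R'" using B1[OF _ _ xy(3)] tv kv[OF k(1)] xy by blast
    then have "x = y" using tv kv[OF k(1)] xy by blast
    then show False using h(9)[of k] k xy by auto
  qed
  have e10: "c = c'" if cN: "c \<in> cells N" "c' \<in> cells N" and ne: "dinner N (snd c) \<inter> dinner N (snd c') \<noteq> {}" for c c'
  proof -
    obtain k k' where k: "k \<in> ?K" "c = (map \<psi> (fst k), map \<psi> (snd k))" "k' \<in> ?K" "c' = (map \<psi> (fst k'), map \<psi> (snd k'))"
      using cN unfolding N(3) by blast
    then obtain x y where xy: "x \<in> dinner D (snd k)" "y \<in> dinner D (snd k')" "\<phi> x = \<phi> y" using ne dik[OF k(1)] dik[OF k(3)] by auto
    have "x = y \<or> x \<in> R' \<or> y \<in> R'" using B1[OF _ _ xy(3)] kv[OF k(1)] kv[OF k(3)] xy by blast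
    then have "x = y" using kv[OF k(1)] kv[OF k(3)] xy by blast
    then have "k = k'" using h(10)[of k k' x] k xy by auto
    then show ?thesis using k by simp
  qed
  have e2: "diagram_path N (top_path N)" unfolding N(4) by (rule hom_diagram_path[OF _ h(2)]) (rule homt)
  have e3: "snd c \<noteq> [] \<and> diagram_path N (snd c)" if cN: "c \<in> cells N" for c
  proof -
    obtain k where k0: "k \<in> ?K" "c = (map \<psi> (fst k), map \<psi> (snd k))" using cN unfolding N(3) by blast
    then have k: "k \<in> ?K" "snd c = map \<psi> (snd k)" by simp_all
    have "diagram_path N (map \<psi> (snd k))" by (rule hom_diagram_path[OF _ h(4)]) (use homk[OF k(1)] k in auto)
    then show ?thesis using k h(3)[of k] by auto
  qed
  have e1: "top_path N \<noteq> []" using h(1) N(4) by simp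
  show ?thesis unfolding top_generated_def
  proof (intro conjI)
    show "\<forall>c\<in>cells N. snd c \<noteq> [] \<and> diagram_path N (snd c)" using e3 by blast
    show "\<forall>c\<in>cells N. set (top_path N) \<inter> set (snd c) = {}" using e4 by blast
    show "\<forall>c\<in>cells N. \<forall>c'\<in>cells N. set (snd c) \<inter> set (snd c') \<noteq> {} \<longrightarrow> c = c'" by (intro ballI impI) (rule e5')
    show "\<forall>c\<in>cells N. set (path_verts N (top_path N)) \<inter> dinner N (snd c) = {}" using e9 by blast
    show "\<forall>c\<in>cells N. \<forall>c'\<in>cells N. dinner N (snd c) \<inter> dinner N (snd c') \<noteq> {} \<longrightarrow> c = c'" by (intro ballI impI) (rule e10)
  qed (rule e1 e2 e5 e8)+
qed

lemma top_generated_image: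
  assumes H: "top_generated D" and inj: "inj_on \<psi> (edges D)" "inj_on \<phi> (verts D)"
    and N: "verts N = \<phi> ` verts D" "edges N = \<psi> ` edges D"
      "cells N = (\<lambda>c. (map \<psi> (fst c), map \<psi> (snd c))) ` cells D" "top_path N = map \<psi> (top_path D)"
    and hom: "\<And>e. e \<in> edges D \<Longrightarrow> src N (\<psi> e) = \<phi> (src D e) \<and> tgt N (\<psi> e) = \<phi> (tgt D e)"
  shows "top_generated N"
  by (rule top_generated_quotient[OF H, of "{}" "{}" "{}" "{}" "{}" \<psi> \<phi>]) (use N hom inj in \<open>auto dest: inj_onD\<close>)

context symmetric_relation
begin

lemma chain_verts_distinct: "chain a P b \<Longrightarrow> okl w P \<Longrightarrow> distinct (a # map etgt P)"
proof (induction P arbitrary: a)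
  case (Cons e P)
  have "xpos a < xpos v" if v: "v \<in> set (map etgt (e # P))" for v
  proof -
    obtain f where f: "f \<in> set (e # P)" "v = etgt f" using v by auto
    have "xpos a \<le> xleft f" "ok w f" using chain_x[OF Cons(2,3)] f Cons(3) by (auto simp: okl_def)
    then show ?thesis using x_ok[of w f] f by simp
  qed
  then have "a \<notin> set (map etgt (e # P))" using less_irrefl by blast
  then show ?case using Cons by auto
qed simp

lemma devmap_path_verts:
  assumes w: "devmap D \<theta> \<eta> h" and p: "diagram_path D p" "set p \<subseteq> edges D" "p \<noteq> []"
  shows "map \<eta> (path_verts D p) = \<eta> (src D (hd p)) # map etgt (map \<theta> p)" "distinct (map \<eta> (path_verts D p))"
proof -
  show "map \<eta> (path_verts D p) = \<eta> (src D (hd p)) # map etgt (map \<theta> p)"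
    using wfdD(15)[OF w] p(2) by (auto simp: path_verts_def map_map)
  then show "distinct (map \<eta> (path_verts D p))"
    using chain_verts_distinct[OF devmap_chain[OF w p] devmap_okl[OF w p(2)]] by simp
qed

text \<open>No edge ends at a vertex before the vertex is made. This will show that inner vertices
  on the upper path of a dipole are not made by its lower cell.\<close>

lemma gen_rank:
  assumes w: "devmap D \<theta> \<eta> h" and e: "e \<in> edges D"
  shows "\<forall>c\<in>cells D. tgt D e \<in> dinner D (snd c) \<longrightarrow> (\<exists>g\<in>set (snd c). h g \<le> h e)"
  using w e
proof (induction e rule: rank_induct)
  case (top e)
  then have "tgt D e \<in> set (path_verts D (top_path D))" by (auto simp: path_verts_def)
  then show ?case using halfD(9)[OF wfdD(1)[OF w]] by blast
next
  case (cell c e)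
  note ne = devmap_cell[OF w cell(1)]
  show ?case
  proof (intro ballI impI)
    fix c' assume c': "c' \<in> cells D" "tgt D e \<in> dinner D (snd c')"
    show "\<exists>g\<in>set (snd c'). h g \<le> h e"
    proof (cases "e = last (snd c)")
      case True
      then have "tgt D e = tgt D (last (fst c))" using wfdD(5)[OF w cell(1)] by simp
      then obtain g where g: "g \<in> set (snd c')" "h g \<le> h (last (fst c))" using cell(4)[of "last (fst c)"] ne c' by auto
      have "h (last (fst c)) < h e" using wfdD(7)[OF w cell(1) _ cell(2)] ne by simp
      then have "h g \<le> h e" using g by linarith
      then show ?thesis using g(1) by blast
    next
      case False
      then have "e \<in> set (butlast (snd c))" using cell(2) ne(2)
        by (metis append_butlast_last_id in_set_conv_decomp_first rotate1.simps(2) set_ConsD set_rotate1)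
      then have "tgt D e \<in> dinner D (snd c)" by (auto simp: dinner_def)
      then have "c = c'" using halfD(10)[OF wfdD(1)[OF w] cell(1) c'(1)] c'(2) by blast
      then show ?thesis using cell(2) by blast
    qed
  qed
qed

text \<open>Flipping twice leads back, so the outer paths \<open>p\<close> and \<open>r\<close> have
  the same development. The maps \<theta> and \<eta> are therefore constant on what is identified
  and serve for the quotient unchanged.\<close>

lemma remove_dipole_develops:
  assumes dvD: "develops D T" and dip: "dipole D p q r"
  shows "develops (remove_dipole p q r D) T \<and> card (cells (remove_dipole p q r D)) < card (cells D) \<and>
    top_label (remove_dipole p q r D) = top_label D"
proof -
  obtain \<theta> \<eta> h where w: "devmap D \<theta> \<eta> h" and T: "T = map \<theta> (bot_path D)" using dvD unfolding develops_def by blast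
  have c: "(p, q) \<in> cells D" "(q, r) \<in> cells D" and lab_pr: "path_label D p = path_label D r" using dip by (auto simp: dipole_def)
  note H = wfdD(1)[OF w] and H' = wfdD(2)[OF w]
  note c1 = devmap_cell[OF w c(1), simplified] and c2 = devmap_cell[OF w c(2), simplified]
  have pE: "set p \<subseteq> edges D" "set q \<subseteq> edges D" "set r \<subseteq> edges D"
    using devmap_edges(3,4)[OF w c(1)] devmap_edges(4)[OF w c(2)] by auto
  have rk1: "h e < h f" if "e \<in> set p" "f \<in> set q" for e f using wfdD(7)[OF w c(1)] that by simp
  have rk2: "h e < h f" if "e \<in> set q" "f \<in> set r" for e f using wfdD(7)[OF w c(2)] that by simp
  have rk3: "h e < h f" if "e \<in> set p" "f \<in> set r" for e f using rk1[OF that(1)] rk2[OF _ that(2)] c1(2) by (meson hd_in_set less_trans)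
  have pq: "set p \<inter> set q = {}" and qr: "set q \<inter> set r = {}" and pr: "set p \<inter> set r = {}"
    using rk1 rk2 rk3 by force+
  have cne: "(p, q) \<noteq> (q, r)" using pq c1 by auto
  have len: "length r = length p" using lab_pr by (metis length_map path_label_def)
  have chp: "chain (\<eta> (src D (hd p))) (map \<theta> p) (\<eta> (tgt D (last p)))" using devmap_chain[OF w c1(3) pE(1) c1(1)] .
  have R1: "(map elab (map \<theta> p), path_label D q) \<in> R" using wfdD(6)[OF w c(1)] devmap_elab[OF w pE(1)] by simp
  have thr: "map \<theta> r = map \<theta> p"
  proof -
    have "map \<theta> r = flip (map \<theta> q) (path_label D r)" using wfdD(8)[OF w c(2)] by simp
    also have "map \<theta> q = flip (map \<theta> p) (path_label D q)" using wfdD(8)[OF w c(1)] by simp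
    also have "path_label D r = map elab (map \<theta> p)" using lab_pr devmap_elab[OF w pE(1)] by simp
    also have "flip (flip (map \<theta> p) (path_label D q)) (map elab (map \<theta> p)) = map \<theta> p"
      using flip_flip[OF devmap_okl[OF w pE(1)] R1 chp] .
    finally show ?thesis .
  qed
  let ?vr = "path_verts D r" and ?vp = "path_verts D p"
  have srcs: "src D (hd r) = src D (hd p)" "tgt D (last r) = tgt D (last p)"
    using wfdD(4,5)[OF w c(1)] wfdD(4,5)[OF w c(2)] by auto
  have etas: "map \<eta> ?vr = map \<eta> ?vp"
    using devmap_path_verts(1)[OF w c2(4) pE(3) c2(2)] devmap_path_verts(1)[OF w c1(3) pE(1) c1(1)] thr srcs by simp
  have dvr: "distinct (map \<eta> ?vr)" "distinct (map \<eta> ?vp)"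
    using devmap_path_verts(2)[OF w c2(4) pE(3) c2(2)] devmap_path_verts(2)[OF w c1(3) pE(1) c1(1)] by auto
  then have dist: "distinct ?vr" "distinct ?vp" by (auto simp: distinct_map)
  have lv: "length ?vr = Suc (length p)" "length ?vp = Suc (length p)" using len by (auto simp: path_verts_def)
  define \<phi> where "\<phi> = subst_list ?vr ?vp"
  define \<psi> where "\<psi> = subst_list r p"
  let ?D0 = "D\<lparr>verts := verts D - tgt D ` set (butlast q), edges := edges D - set q, cells := cells D - {(p, q), (q, r)}\<rparr>"
  let ?N = "remove_dipole p q r D"
  have N: "?N = collapse \<phi> \<psi> ?D0" unfolding remove_dipole_def identify_paths_def \<phi>_def \<psi>_def by (simp add: path_verts_def)
  have \<psi>r: "\<psi> (r ! i) = p ! i" if "i < length p" for i unfolding \<psi>_def using subst_list_nth[of r p i] c2 len that by simp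
  have \<psi>n: "\<psi> e = e" if "e \<notin> set r" for e unfolding \<psi>_def using subst_list_notin that len by metis
  have \<phi>r: "\<phi> (?vr ! i) = ?vp ! i" if "i \<le> length p" for i unfolding \<phi>_def using subst_list_nth[OF dist(1)] lv that by simp
  have innr: "x \<in> dinner D r \<longleftrightarrow> (\<exists>i. 0 < i \<and> i < length p \<and> x = ?vr ! i)" for x
    unfolding dinner_iff len[symmetric] by (auto simp: path_verts_def) (metis Suc_pred nth_Cons_Suc gr0_conv_Suc length_map nth_map Suc_lessD)+
  have innp: "x \<in> dinner D p \<longleftrightarrow> (\<exists>i. 0 < i \<and> i < length p \<and> x = ?vp ! i)" for x
    unfolding dinner_iff by (auto simp: path_verts_def) (metis Suc_pred nth_Cons_Suc gr0_conv_Suc length_map nth_map Suc_lessD)+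
  have vend: "?vr ! 0 = ?vp ! 0" "?vr ! length p = ?vp ! length p"
    using srcs c1(1) c2(2) len by (auto simp: path_verts_def last_conv_nth nth_Cons')
  have \<phi>n: "\<phi> x = x" if "x \<notin> dinner D r" for x
  proof (cases "x \<in> set ?vr")
    case True
    then obtain i where i: "i \<le> length p" "x = ?vr ! i" using lv by (metis in_set_conv_nth less_Suc_eq_le)
    then have "i = 0 \<or> i = length p" using innr that by (metis le_neq_implies_less neq0_conv)
    then show ?thesis using \<phi>r[OF i(1)] i vend by auto
  next
    case False
    then show ?thesis unfolding \<phi>_def using subst_list_notin lv by metis
  qed
  have thps: "\<theta> (\<psi> e) = \<theta> e" for e
  proof (cases "e \<in> set r")
    case True
    then obtain i where i: "i < length p" "e = r ! i" using len by (auto simp: in_set_conv_nth)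
    then show ?thesis using \<psi>r thr len by (metis nth_map)
  qed (simp add: \<psi>n)
  have etph: "\<eta> (\<phi> x) = \<eta> x" for x
  proof (cases "x \<in> dinner D r")
    case True
    then obtain i where i: "i < length p" "x = ?vr ! i" using innr by blast
    then show ?thesis using \<phi>r[of i] etas lv by (metis less_SucI nth_map less_imp_le)
  qed (simp add: \<phi>n)
  have rp_disj: "dinner D r \<inter> dinner D p = {}"
  proof (rule ccontr)
    assume "\<not> ?thesis"
    then obtain x where x: "x \<in> dinner D r" "x \<in> dinner D p" by blast
    then obtain e where e: "e \<in> set (butlast p)" "tgt D e \<in> dinner D r" unfolding dinner_def[of D p] by blast
    then have ep: "e \<in> set p" by (auto dest: in_set_butlastD)
    then obtain g where "g \<in> set r" "h g \<le> h e" using gen_rank[OF w, of e] c(2) e(2) pE(1) by fastforce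
    then show False using rk3[OF ep] by force
  qed
  have rq_disj: "dinner D r \<inter> dinner D q = {}" using halfD(10)[OF H c(2,1)] cne by auto
  have pq_disj: "dinner D p \<inter> dinner D q = {}" using top_generated_mirrorD(10)[OF H' c(1,2)] cne by auto
  have \<phi>_vp: "\<phi> (?vp ! i) = ?vp ! i" if "i \<le> length p" for i
  proof (rule \<phi>n)
    show "?vp ! i \<notin> dinner D r"
    proof
      assume a: "?vp ! i \<in> dinner D r"
      then obtain j where j: "0 < j" "j < length p" "?vp ! i = ?vr ! j" using innr by blast
      have "map \<eta> ?vp ! i = map \<eta> ?vp ! j" using j etas lv that by (metis less_SucI less_Suc_eq_le nth_map)
      then have "i = j" using nth_eq_iff_index_eq[OF dvr(2), of i j] lv that j(2) by (simp add: path_verts_def)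
      then have "?vp ! i \<in> dinner D p" using innp j by blast
      then show False using a rp_disj by blast
    qed
  qed
  have src_i: "src D (s ! i) = path_verts D s ! i" "tgt D (s ! i) = path_verts D s ! Suc i" if "diagram_path D s" "i < length s" for s i
  proof -
    show "tgt D (s ! i) = path_verts D s ! Suc i" using that by (simp add: path_verts_def)
    show "src D (s ! i) = path_verts D s ! i"
      using that by (cases i) (auto simp: path_verts_def diagram_path_def hd_conv_nth)
  qed
  have hom: "src ?N (\<psi> e) = \<phi> (src D e) \<and> tgt ?N (\<psi> e) = \<phi> (tgt D e)" for e
  proof (cases "e \<in> set r")
    case True
    then obtain i where i: "i < length p" "e = r ! i" using len by (auto simp: in_set_conv_nth)
    have "\<phi> (src D (p ! i)) = \<phi> (src D (r ! i))" "\<phi> (tgt D (p ! i)) = \<phi> (tgt D (r ! i))"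
      using src_i[OF c1(3), of i] src_i[OF c2(4), of i] i len \<phi>_vp[of i] \<phi>_vp[of "Suc i"] \<phi>r[of i] \<phi>r[of "Suc i"] by auto
    then show ?thesis unfolding N using \<psi>r[of i] i by simp
  qed (simp add: N \<psi>n)
  have labh: "lab ?N (\<psi> e) = lab D e" for e
  proof (cases "e \<in> set r")
    case True
    then obtain i where i: "i < length p" "e = r ! i" using len by (auto simp: in_set_conv_nth)
    then have "lab D (p ! i) = lab D (r ! i)" using lab_pr len unfolding path_label_def by (metis nth_map)
    then show ?thesis unfolding N using \<psi>r i by simp
  qed (simp add: N \<psi>n)
  have pl: "path_label ?N (map \<psi> s) = path_label D s" for s using labh by (simp add: path_label_def map_map)
  have cellsN: "cells ?N = (\<lambda>c. (map \<psi> (fst c), map \<psi> (snd c))) ` (cells D - {(p, q), (q, r)})"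
    unfolding N by (simp add: split_beta)
  have edgesN: "edges ?N = \<psi> ` (edges D - set q)" unfolding N by simp
  have vertsN: "verts ?N = \<phi> ` (verts D - dinner D q)" unfolding N by (simp add: dinner_def)
  have topN: "top_path ?N = map \<psi> (top_path D)" "bot_path ?N = map \<psi> (bot_path D)" unfolding N by simp_all
  have \<psi>_in: "\<psi> e \<in> set p" if "e \<in> set r" for e
    using that \<psi>r len c1 by (auto simp: in_set_conv_nth)
  have \<phi>_in: "\<phi> x \<in> dinner D p" if "x \<in> dinner D r" for x
    using that innr innp \<phi>r by (metis less_imp_le)
  have \<psi>_inj_r: "e = f" if ef: "e \<in> set r" "f \<in> set r" and eq: "\<psi> e = \<psi> f" for e f
  proof -
    obtain i where i: "i < length p" "e = r ! i" using ef(1) len by (auto simp: in_set_conv_nth)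
    obtain j where j: "j < length p" "f = r ! j" using ef(2) len by (auto simp: in_set_conv_nth)
    have "p ! i = p ! j" using eq \<psi>r i j by simp
    then show ?thesis using nth_eq_iff_index_eq[OF c1(5) i(1) j(1)] i j by simp
  qed
  have \<phi>_inj_r: "x = y" if xy: "x \<in> dinner D r" "y \<in> dinner D r" and eq: "\<phi> x = \<phi> y" for x y
  proof -
    obtain i where i: "i < length p" "x = ?vr ! i" using xy(1) innr by blast
    obtain j where j: "j < length p" "y = ?vr ! j" using xy(2) innr by blast
    note ij = i j
    have "?vp ! i = ?vp ! j" using eq \<phi>r[of i] \<phi>r[of j] ij by simp
    then have "i = j" using nth_eq_iff_index_eq[OF dist(2), of i j] ij lv by simp
    then show ?thesis using ij by simp
  qed
  have half1: "top_generated ?N"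
  proof (rule top_generated_quotient[OF H _ _ _ _ _ _ _ _ _ vertsN edgesN cellsN topN(1)])
    show "{(p, q), (q, r)} \<subseteq> cells D" using c by blast
    show "(\<Union>c\<in>{(p, q), (q, r)}. set (snd c)) = set q \<union> set r" "(\<Union>c\<in>{(p, q), (q, r)}. dinner D (snd c)) = dinner D q \<union> dinner D r"
      by auto
    show "set r \<inter> set q = {}" using qr by blast
    show "dinner D r \<inter> dinner D q = {}" by (rule rq_disj)
    show "e = f \<or> e \<in> set r \<or> f \<in> set r" if "\<psi> e = \<psi> f" for e f using \<psi>n that by metis
    show "\<exists>f\<in>edges D. \<psi> f = \<psi> e \<and> f \<notin> set q \<and> f \<notin> set r" if "e \<in> set r" for e
    proof -
      have 1: "\<psi> e \<in> set p" using \<psi>_in that .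
      then have "\<psi> e \<notin> set r" "\<psi> e \<notin> set q" "\<psi> e \<in> edges D" using pr pq pE by blast+
      then show ?thesis using \<psi>n by blast
    qed
    show "x = y \<or> x \<in> dinner D r \<or> y \<in> dinner D r" if "\<phi> x = \<phi> y" for x y using \<phi>n that by metis
    show "\<exists>y\<in>verts D. \<phi> y = \<phi> x \<and> y \<notin> dinner D q \<and> y \<notin> dinner D r" if "x \<in> dinner D r" for x
    proof -
      have 1: "\<phi> x \<in> dinner D p" using \<phi>_in that .
      then have "\<phi> x \<notin> dinner D r" "\<phi> x \<notin> dinner D q" using rp_disj pq_disj by blast+
      moreover have "\<phi> x \<in> verts D" using 1 top_generated_mirrorD(8)[OF H'] c(1) by force
      ultimately show ?thesis using \<phi>n by blast
    qed
  qed (rule hom)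
  \<comment> \<open>Seen from below, \<open>p\<close> takes over the role of \<open>r\<close>: it is
    now the outer path made by a removed cell, and its elements are represented by those of
    \<open>r\<close>.\<close>
  have half2: "top_generated (mirror ?N)"
  proof (rule top_generated_quotient[OF H', of "{(r, q), (q, p)}" "set q" "set p" "dinner D q" "dinner D p"])
    show "{(r, q), (q, p)} \<subseteq> cells (mirror D)" using c by force
    show "(\<Union>c\<in>{(r, q), (q, p)}. set (snd c)) = set q \<union> set p"
      "(\<Union>c\<in>{(r, q), (q, p)}. dinner (mirror D) (snd c)) = dinner D q \<union> dinner D p" by auto
    show "set p \<inter> set q = {}" "dinner D p \<inter> dinner D q = {}" using pq pq_disj by auto
    show "e = f \<or> e \<in> set p \<or> f \<in> set p" if "\<psi> e = \<psi> f" for e f using \<psi>n \<psi>_in \<psi>_inj_r that by metis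
    show "\<exists>f\<in>edges (mirror D). \<psi> f = \<psi> e \<and> f \<notin> set q \<and> f \<notin> set p" if e: "e \<in> set p" for e
    proof -
      obtain i where i: "i < length p" "e = p ! i" using e by (metis in_set_conv_nth)
      have 1: "r ! i \<in> set r" using i len by simp
      then have "\<psi> (r ! i) = \<psi> e" using \<psi>r i \<psi>n e pr by fastforce
      then show ?thesis using 1 pE qr pr by auto
    qed
    show "x = y \<or> x \<in> dinner D p \<or> y \<in> dinner D p" if "\<phi> x = \<phi> y" for x y
      using \<phi>n \<phi>_in \<phi>_inj_r that by metis
    show "\<exists>y\<in>verts (mirror D). \<phi> y = \<phi> x \<and> y \<notin> dinner D q \<and> y \<notin> dinner D p" if x: "x \<in> dinner D p" for x
    proof -
      obtain i where i: "0 < i" "i < length p" "x = ?vp ! i" using x innp by auto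
      have 1: "?vr ! i \<in> dinner D r" using innr i by blast
      then have "\<phi> (?vr ! i) = \<phi> x" using \<phi>r \<phi>_vp i by simp
      moreover have "?vr ! i \<in> verts D" using 1 halfD(8)[OF H] c(2) by force
      ultimately show ?thesis using 1 rq_disj rp_disj by auto
    qed
    show "verts (mirror ?N) = \<phi> ` (verts (mirror D) - dinner D q)" using vertsN by simp
    show "edges (mirror ?N) = \<psi> ` (edges (mirror D) - set q)" using edgesN by simp
    show "top_path (mirror ?N) = map \<psi> (top_path (mirror D))" using topN by simp
    show "cells (mirror ?N) = (\<lambda>c. (map \<psi> (fst c), map \<psi> (snd c))) ` (cells (mirror D) - {(r, q), (q, p)})"
    proof -
      have "cells (mirror D) - {(r, q), (q, p)} = prod.swap ` (cells D - {(p, q), (q, r)})" by force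
      then show ?thesis by (simp add: cellsN image_image)
    qed
  qed (use hom in simp)
  have bE: "set (bot_path D) \<subseteq> edges D - set q" using top_generated_mirrorD(5,6)[OF H'] c(2) by fastforce
  have tE: "set (top_path D) \<subseteq> edges D - set q" using halfD(5,6)[OF H] c(1) by fastforce
  have ne: "top_path D \<noteq> []" "bot_path D \<noteq> []" using halfD(1)[OF H] top_generated_mirrorD(1)[OF H'] by auto
  have mth: "map \<theta> (map \<psi> s) = map \<theta> s" for s using thps by (simp add: map_map)
  have tl: "top_label ?N = top_label D" "bot_label ?N = bot_label D" using pl topN by (simp_all add: top_label_def bot_label_def)
  have "devmap ?N \<theta> \<eta> h" unfolding devmap_def
  proof (intro conjI ballI)
    show "top_generated ?N" "top_generated (mirror ?N)" by (rule half1, rule half2)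
    show "finite (cells ?N)" unfolding cellsN using wfdD(3)[OF w] by simp
    show "src ?N (hd (top_path ?N)) = src ?N (hd (bot_path ?N))" using topN ne hom wfdD(9)[OF w] by (simp add: hd_map)
    show "tgt ?N (last (top_path ?N)) = tgt ?N (last (bot_path ?N))" using topN ne hom wfdD(10)[OF w] by (simp add: last_map)
    show "map \<theta> (top_path ?N) = base (top_label ?N)" using topN mth tl wfdD(11)[OF w] by simp
    show "mor (top_label ?N) (bot_label ?N) (map \<theta> (bot_path ?N))" using topN mth tl wfdD(16)[OF w] by simp
  next
    fix k assume "k \<in> cells ?N"
    then obtain k0 where k0: "k0 \<in> cells D" "k0 \<noteq> (p, q)" "k0 \<noteq> (q, r)" "k = (map \<psi> (fst k0), map \<psi> (snd k0))" unfolding cellsN by blast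
    note kn = devmap_cell[OF w k0(1)]
    show "src ?N (hd (fst k)) = src ?N (hd (snd k))" using k0 kn hom wfdD(4)[OF w k0(1)] by (simp add: hd_map)
    show "tgt ?N (last (fst k)) = tgt ?N (last (snd k))" using k0 kn hom wfdD(5)[OF w k0(1)] by (simp add: last_map)
    show "(path_label ?N (fst k), path_label ?N (snd k)) \<in> R" using k0 pl wfdD(6)[OF w k0(1)] by simp
    show "map \<theta> (snd k) = flip (map \<theta> (fst k)) (path_label ?N (snd k))" using k0 pl mth wfdD(8)[OF w k0(1)] by simp
    fix e f assume "e \<in> set (fst k)" "f \<in> set (snd k)"
    then obtain e0 f0 where ef: "e0 \<in> set (fst k0)" "e = \<psi> e0" "f0 \<in> set (snd k0)" "f = \<psi> f0" using k0 by auto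
    have "f0 \<notin> set r" using halfD(7)[OF H k0(1) c(2) ef(3)] k0 by auto
    then have f: "f = f0" using ef \<psi>n by simp
    have lt: "h e0 < h f0" using wfdD(7)[OF w k0(1) ef(1,3)] .
    \<comment> \<open>On a top, replacing edges of \<open>r\<close> by those of \<open>p\<close>
      lowers ranks. No edge of \<open>r\<close> is on the bottom of a remaining cell, so ranks still
      increase across cells.\<close>
    show "h e < h f"
    proof (cases "e0 \<in> set r")
      case True
      then have "h e < h e0" using rk3[OF \<psi>_in[OF True] True] ef by simp
      then show ?thesis using lt f by simp
    qed (use ef \<psi>n lt f in simp)
  next
    fix e assume "e \<in> edges ?N"
    then obtain e0 where e0: "e0 \<in> edges D" "e = \<psi> e0" unfolding edgesN by blast
    show "ok (top_label ?N) (\<theta> e)" using e0 tl thps wfdD(12)[OF w e0(1)] by simp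
    show "elab (\<theta> e) = lab ?N e" using e0 labh thps wfdD(13)[OF w e0(1)] by simp
    show "esrc (\<theta> e) = \<eta> (src ?N e)" using e0 hom thps etph wfdD(14)[OF w e0(1)] by simp
    show "etgt (\<theta> e) = \<eta> (tgt ?N e)" using e0 hom thps etph wfdD(15)[OF w e0(1)] by simp
  qed
  then have "develops ?N T" unfolding develops_def using T topN mth by metis
  moreover have "card (cells ?N) < card (cells D)"
  proof -
    have "card (cells ?N) \<le> card (cells D - {(p, q), (q, r)})" unfolding cellsN using wfdD(3)[OF w] by (intro card_image_le) simp
    also have "\<dots> < card (cells D)" using wfdD(3)[OF w] c by (intro psubset_card_mono) auto
    finally show ?thesis .
  qed
  ultimately show ?thesis using tl by blast
qed

lemma reduced_form_develops: "reduced_form D E \<Longrightarrow> develops D T \<Longrightarrow> develops E T \<and> reduced E \<and> top_label E = top_label D \<and> card (cells E) \<le> card (cells D)"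
proof -
  assume a: "reduced_form D E" "develops D T"
  then have s: "dipole_step\<^sup>*\<^sup>* D E" and r: "reduced E" by (auto simp: reduced_form_def)
  from s a(2) have "develops E T \<and> top_label E = top_label D \<and> card (cells E) \<le> card (cells D)"
  proof (induction rule: rtranclp_induct)
    case (step E F)
    then obtain p q r where "dipole E p q r" "F = remove_dipole p q r E" unfolding dipole_step_def by blast
    then show ?case using remove_dipole_develops[of E T p q r] step by auto
  qed simp
  then show ?thesis using r by blast
qed

lemma ex_reduced_form: "develops D T \<Longrightarrow> \<exists>E. reduced_form D E"
proof (induction "card (cells D)" arbitrary: D rule: less_induct)
  case less
  show ?case
  proof (cases "reduced D")
    case True
    then show ?thesis unfolding reduced_form_def by blast
  next
    case False
    then obtain p q r where d: "dipole D p q r" unfolding reduced_def by blast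
    let ?F = "remove_dipole p q r D"
    have s: "dipole_step D ?F" unfolding dipole_step_def using d by blast
    obtain E where "reduced_form ?F E" using less(1)[of ?F] remove_dipole_develops[OF less(2) d] by blast
    then have "reduced_form D E" unfolding reduced_form_def using s by (meson converse_rtranclp_into_rtranclp)
    then show ?thesis by blast
  qed
qed

text \<open>A reduced form has exactly \<open>card (lcells T)\<close> cells, so no dipole can be
  removed from a diagram that has no more cells than this.\<close>

lemma few_cells_reduced:
  assumes "develops D T" "card (cells D) \<le> card (lcells T)"
  shows "reduced D"
proof (rule ccontr)
  assume "\<not> reduced D"
  then obtain p q r where d: "dipole D p q r" unfolding reduced_def by blast
  let ?F = "remove_dipole p q r D"
  have F: "develops ?F T" "card (cells ?F) < card (cells D)" using remove_dipole_develops[OF assms(1) d] by auto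
  obtain E where E: "reduced_form ?F E" using ex_reduced_form F by blast
  have "card (cells E) = card (lcells T)" "card (cells E) \<le> card (cells ?F)"
    using reduced_form_develops[OF E F(1)] reduced_card by auto
  then show False using F assms(2) by linarith
qed

lemma dequiv_iff_aux:
  assumes "develops D T" "develops E T" "top_label D = top_label E"
  shows "dequiv D E"
proof -
  obtain D' E' where r: "reduced_form D D'" "reduced_form E E'" using ex_reduced_form assms by blast
  have "isotopic D' E'"
    using reduced_isotopic[of D' T E'] reduced_form_develops[OF r(1) assms(1)] reduced_form_develops[OF r(2) assms(2)] assms(3) by simp
  then show ?thesis unfolding dequiv_def using r by blast
qed

end

section \<open>Composition, sum and mirror image of diagrams\<close>

lemma path_verts_cong: "src D = src N \<Longrightarrow> tgt D = tgt N \<Longrightarrow> path_verts D = path_verts N"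
  by (simp add: path_verts_def fun_eq_iff)

lemma dinner_cong: "tgt D = tgt N \<Longrightarrow> dinner D = dinner N"
  by (simp add: dinner_def fun_eq_iff)

lemma diagram_path_cong: "src D = src N \<Longrightarrow> tgt D = tgt N \<Longrightarrow> diagram_path D = diagram_path N"
  by (simp add: diagram_path_def fun_eq_iff)

lemma path_label_cong: "lab D = lab N \<Longrightarrow> path_label D = path_label N"
  by (simp add: path_label_def fun_eq_iff)

lemma diagram_path_append:
  assumes "diagram_path D p" "diagram_path D q" "p \<noteq> []" "q \<noteq> []" "tgt D (last p) = src D (hd q)"
  shows "diagram_path D (p @ q)"
  unfolding diagram_path_def
proof (intro allI impI)
  fix i assume i: "Suc i < length (p @ q)"
  consider "Suc i < length p" | "Suc i = length p" | "length p \<le> i" by linarith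
  then show "tgt D ((p @ q) ! i) = src D ((p @ q) ! Suc i)"
  proof cases
    case 1
    then show ?thesis using assms(1) by (simp add: diagram_path_def nth_append)
  next
    case 2
    then have "i = length p - 1" by simp
    then show ?thesis using 2 assms(3-5) by (simp add: nth_append last_conv_nth hd_conv_nth)
  next
    case 3
    then have "Suc (i - length p) < length q" using i by simp
    then have "tgt D (q ! (i - length p)) = src D (q ! Suc (i - length p))" using assms(2) unfolding diagram_path_def by blast
    then show ?thesis using 3 by (simp add: nth_append Suc_diff_le)
  qed
qed

lemma diagram_path_nth:
  assumes "diagram_path D p" "i < length p"
  shows "src D (p ! i) = path_verts D p ! i" "tgt D (p ! i) = path_verts D p ! Suc i"
proof -
  show "tgt D (p ! i) = path_verts D p ! Suc i" using assms by (simp add: path_verts_def)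
  show "src D (p ! i) = path_verts D p ! i"
    using assms by (cases i) (auto simp: path_verts_def diagram_path_def hd_conv_nth)
qed

lemma union_glue:
  "A = S \<union> X \<Longrightarrow> B = T \<union> Y \<Longrightarrow> S \<subseteq> U \<Longrightarrow> U \<subseteq> S \<union> T \<Longrightarrow> T \<subseteq> A \<union> U \<Longrightarrow> A \<union> B = U \<union> (X \<union> Y)"
  by blast

lemma meet_glue: "x \<in> S \<Longrightarrow> T \<subseteq> B \<Longrightarrow> A \<inter> B \<subseteq> {x} \<Longrightarrow> A \<inter> (S \<union> T) \<subseteq> S"
  by blast

text \<open>The parts overlap at most in the top path of \<open>E\<close>. The top path of
  \<open>N\<close> is left open enough to be that of \<open>D\<close>, as for stacking, or the
  concatenation of both, as for juxtaposition.\<close>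

lemma top_generated_glue:
  assumes D: "top_generated D" and E: "top_generated E"
    and st: "src D = src N" "tgt D = tgt N" "src E = src N" "tgt E = tgt N"
    and N: "edges N = edges D \<union> edges E" "verts N = verts D \<union> verts E" "cells N = cells D \<union> cells E"
    and ov: "edges D \<inter> edges E \<subseteq> set (top_path E)" "verts D \<inter> verts E \<subseteq> set (path_verts N (top_path E))"
    and p: "top_path N \<noteq> []" "diagram_path N (top_path N)"
    and t: "set (top_path D) \<subseteq> set (top_path N)" "set (top_path N) \<subseteq> set (top_path D) \<union> set (top_path E)"
      "set (top_path E) \<subseteq> edges D \<union> set (top_path N)" "edges D \<inter> set (top_path N) \<subseteq> set (top_path D)"
    and v: "set (path_verts N (top_path D)) \<subseteq> set (path_verts N (top_path N))"
      "set (path_verts N (top_path N)) \<subseteq> set (path_verts N (top_path D)) \<union> set (path_verts N (top_path E))"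
      "set (path_verts N (top_path E)) \<subseteq> verts D \<union> set (path_verts N (top_path N))"
      "verts D \<inter> set (path_verts N (top_path N)) \<subseteq> set (path_verts N (top_path D))"
  shows "top_generated N"
proof -
  have c: "dinner D = dinner N" "dinner E = dinner N" "path_verts D = path_verts N" "path_verts E = path_verts N"
    "diagram_path D = diagram_path N" "diagram_path E = diagram_path N"
    by (rule dinner_cong path_verts_cong diagram_path_cong; fact st)+
  note d = halfD[OF D, unfolded c] and e = halfD[OF E, unfolded c]
  have de: "x \<in> edges D" if "k \<in> cells D" "x \<in> set (snd k)" for k x using d(5) that by blast
  have ee: "x \<in> edges E" if "k \<in> cells E" "x \<in> set (snd k)" for k x using e(5) that by blast
  have dv: "x \<in> verts D" if "k \<in> cells D" "x \<in> dinner N (snd k)" for k x using d(8) that by blast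
  have ev: "x \<in> verts E" if "k \<in> cells E" "x \<in> dinner N (snd k)" for k x using e(8) that by blast
  have dt: "x \<in> edges D" if "x \<in> set (top_path D)" for x using d(5) that by blast
  have dvt: "x \<in> verts D" if "x \<in> set (path_verts N (top_path D))" for x using d(8) that by blast
  have no: False if "k \<in> cells D" "l \<in> cells E" "x \<in> set (snd k)" "x \<in> set (snd l)" for k l x
    using de[of k x] ee[of l x] e(6)[of l x] ov(1) that by blast
  have nov: False if "k \<in> cells D" "l \<in> cells E" "x \<in> dinner N (snd k)" "x \<in> dinner N (snd l)" for k l x
    using dv[of k x] ev[of l x] e(9)[of l x] ov(2) that by blast
  show ?thesis unfolding top_generated_def
  proof (intro conjI ballI impI)
    show "top_path N \<noteq> []" "diagram_path N (top_path N)" by (fact p)+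
    show "k \<in> cells N \<Longrightarrow> snd k \<noteq> []" "k \<in> cells N \<Longrightarrow> diagram_path N (snd k)" for k
      using d(3,4)[of k] e(3,4)[of k] N(3) by blast+
    show "edges N = set (top_path N) \<union> (\<Union>c\<in>cells N. set (snd c))" unfolding N(1,3) UN_Un by (rule union_glue[OF d(5) e(5) t(1-3)])
    show "verts N = set (path_verts N (top_path N)) \<union> (\<Union>c\<in>cells N. dinner N (snd c))"
      unfolding N(2,3) UN_Un by (rule union_glue[OF d(8) e(8) v(1-3)])
  next
    fix k assume k: "k \<in> cells N"
    show "set (top_path N) \<inter> set (snd k) = {}"
    proof (rule ccontr)
      assume "\<not> ?thesis"
      then obtain x where x: "x \<in> set (top_path N)" "x \<in> set (snd k)" by blast
      show False
      proof (cases "k \<in> cells D")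
        case True
        then show False using x d(6)[of k x] de[of k x] t(4) by blast
      next
        case False
        then have "k \<in> cells E" using k N(3) by blast
        then show False using x e(6)[of k x] ee[of k x] t(2) dt[of x] ov(1) by blast
      qed
    qed
    show "set (path_verts N (top_path N)) \<inter> dinner N (snd k) = {}"
    proof (rule ccontr)
      assume "\<not> ?thesis"
      then obtain x where x: "x \<in> set (path_verts N (top_path N))" "x \<in> dinner N (snd k)" by blast
      show False
      proof (cases "k \<in> cells D")
        case True
        then show False using x d(9)[of k x] dv[of k x] v(4) by blast
      next
        case False
        then have "k \<in> cells E" using k N(3) by blast
        then show False using x e(9)[of k x] ev[of k x] v(2) dvt[of x] ov(2) by blast
      qed
    qed
    fix l assume l: "l \<in> cells N"
    show "k = l" if ne: "set (snd k) \<inter> set (snd l) \<noteq> {}"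
    proof -
      obtain x where x: "x \<in> set (snd k)" "x \<in> set (snd l)" using ne by blast
      show ?thesis using k l x d(7)[of k l x] e(7)[of k l x] no[of k l x] no[of l k x] unfolding N(3) by blast
    qed
    show "k = l" if ne: "dinner N (snd k) \<inter> dinner N (snd l) \<noteq> {}"
    proof -
      obtain x where x: "x \<in> dinner N (snd k)" "x \<in> dinner N (snd l)" using ne by blast
      show ?thesis using k l x d(10)[of k l x] e(10)[of k l x] nov[of k l x] nov[of l k x] unfolding N(3) by blast
    qed
  qed
qed

context symmetric_relation
begin

lemma devmap_image:
  assumes w: "devmap D \<theta> \<eta> h" and inj: "inj_on \<psi> (edges D)" "inj_on \<phi> (verts D)"
    and N: "verts N = \<phi> ` verts D" "edges N = \<psi> ` edges D"
      "cells N = (\<lambda>c. (map \<psi> (fst c), map \<psi> (snd c))) ` cells D"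
      "top_path N = map \<psi> (top_path D)" "bot_path N = map \<psi> (bot_path D)"
    and hom: "\<And>e. e \<in> edges D \<Longrightarrow> src N (\<psi> e) = \<phi> (src D e) \<and> tgt N (\<psi> e) = \<phi> (tgt D e) \<and> lab N (\<psi> e) = lab D e"
  shows "\<exists>\<eta>' h'. devmap N (\<theta> \<circ> inv_into (edges D) \<psi>) \<eta>' h'"
    "top_label N = top_label D" "bot_label N = bot_label D"
    "map (\<theta> \<circ> inv_into (edges D) \<psi>) (bot_path N) = map \<theta> (bot_path D)"
proof -
  define \<theta>' \<eta>' h' where d: "\<theta>' = \<theta> \<circ> inv_into (edges D) \<psi>" "\<eta>' = \<eta> \<circ> inv_into (verts D) \<phi>" "h' = h \<circ> inv_into (edges D) \<psi>"
  have \<theta>': "\<theta>' (\<psi> e) = \<theta> e" "h' (\<psi> e) = h e" if "e \<in> edges D" for e using that inj by (simp_all add: d)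
  have \<eta>': "\<eta>' (\<phi> x) = \<eta> x" if "x \<in> verts D" for x using that inj by (simp add: d)
  have mt: "map \<theta>' (map \<psi> p) = map \<theta> p" if "set p \<subseteq> edges D" for p using that \<theta>' by (auto simp: map_map)
  have pl: "path_label N (map \<psi> p) = path_label D p" if "set p \<subseteq> edges D" for p using that hom by (auto simp: path_label_def map_map)
  note E = devmap_edges[OF w]
  show tl: "top_label N = top_label D" "bot_label N = bot_label D" using pl E N by (simp_all add: top_label_def bot_label_def)
  have ne: "top_path D \<noteq> []" "bot_path D \<noteq> []" using halfD(1)[OF wfdD(1)[OF w]] top_generated_mirrorD(1)[OF wfdD(2)[OF w]] by auto
  have el: "hd (top_path D) \<in> edges D" "hd (bot_path D) \<in> edges D" "last (top_path D) \<in> edges D" "last (bot_path D) \<in> edges D"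
    using ne E(1,2) by auto
  have "devmap N \<theta>' \<eta>' h'" unfolding devmap_def
  proof (intro conjI ballI)
    show "top_generated N" by (rule top_generated_image[OF wfdD(1)[OF w] inj N(1-4)]) (use hom in blast)
    show "top_generated (mirror N)"
      by (rule top_generated_image[OF wfdD(2)[OF w], of \<psi> \<phi>]) (use inj N hom in \<open>auto simp: image_image\<close>)
    show "finite (cells N)" using N wfdD(3)[OF w] by simp
    show "src N (hd (top_path N)) = src N (hd (bot_path N))" "tgt N (last (top_path N)) = tgt N (last (bot_path N))"
      using wfdD(9,10)[OF w] ne el hom N by (simp_all add: hd_map last_map)
    show "map \<theta>' (top_path N) = base (top_label N)" "mor (top_label N) (bot_label N) (map \<theta>' (bot_path N))"
      using N tl mt E wfdD(11,16)[OF w] by simp_all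
  next
    fix k assume "k \<in> cells N"
    then obtain k0 where k0: "k0 \<in> cells D" "k = (map \<psi> (fst k0), map \<psi> (snd k0))" unfolding N by blast
    note kn = devmap_cell[OF w k0(1)] and ke = E(3,4)[OF k0(1)]
    have el: "hd (fst k0) \<in> edges D" "hd (snd k0) \<in> edges D" "last (fst k0) \<in> edges D" "last (snd k0) \<in> edges D"
      using kn ke by auto
    show "src N (hd (fst k)) = src N (hd (snd k))" "tgt N (last (fst k)) = tgt N (last (snd k))"
      using wfdD(4,5)[OF w k0(1)] k0 kn el hom by (simp_all add: hd_map last_map)
    show "(path_label N (fst k), path_label N (snd k)) \<in> R" using k0 ke pl wfdD(6)[OF w k0(1)] by simp
    show "map \<theta>' (snd k) = flip (map \<theta>' (fst k)) (path_label N (snd k))" using k0 ke pl mt wfdD(8)[OF w k0(1)] by simp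
    fix e f assume "e \<in> set (fst k)" "f \<in> set (snd k)"
    then obtain e0 f0 where ef: "e0 \<in> set (fst k0)" "e = \<psi> e0" "f0 \<in> set (snd k0)" "f = \<psi> f0" using k0 by auto
    have "e0 \<in> edges D" "f0 \<in> edges D" using ef ke by blast+
    then show "h' e < h' f" using wfdD(7)[OF w k0(1) ef(1,3)] ef \<theta>'(2) by simp
  next
    fix e assume "e \<in> edges N"
    then obtain e0 where e0: "e0 \<in> edges D" "e = \<psi> e0" unfolding N by blast
    show "ok (top_label N) (\<theta>' e)" "elab (\<theta>' e) = lab N e" "esrc (\<theta>' e) = \<eta>' (src N e)" "etgt (\<theta>' e) = \<eta>' (tgt N e)"
      using e0 tl \<theta>' \<eta>' hom wfdD(12-15)[OF w e0(1)] devmap_verts(3,4)[OF w e0(1)] by simp_all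
  qed
  then show "\<exists>\<eta>' h'. devmap N (\<theta> \<circ> inv_into (edges D) \<psi>) \<eta>' h'" using d by blast
  show "map (\<theta> \<circ> inv_into (edges D) \<psi>) (bot_path N) = map \<theta> (bot_path D)" using mt[OF E(2)] N d by simp
qed

lemma devmap_finite: "devmap D \<theta> \<eta> h \<Longrightarrow> finite (edges D)"
  using halfD(5)[OF wfdD(1)] wfdD(3) by fastforce

text \<open>The development of \<open>E\<close> is transported by \<open>act S\<close>, where
  \<open>S\<close> is the place of its top path in the complex of \<open>N\<close>. Its ranks are
  raised above those of \<open>D\<close>, because cells of \<open>E\<close> may be attached to edges
  of \<open>D\<close>.\<close>

lemma devmap_glue:
  assumes D: "devmap D \<theta>1 \<eta>1 h1" and E: "devmap E \<theta>2 \<eta>2 h2"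
    and st: "src D = src N" "tgt D = tgt N" "lab D = lab N" "src E = src N" "tgt E = tgt N" "lab E = lab N"
    and N: "edges N = edges D \<union> edges E" "cells N = cells D \<union> cells E" "top_generated N" "top_generated (mirror N)"
    and ov: "edges D \<inter> edges E \<subseteq> set (top_path E)"
    and S: "lpath (top_label N) (top_label E) S"
    and okD: "\<And>e. e \<in> edges D \<Longrightarrow> ok (top_label N) (\<theta>1 e)"
    and ag: "\<And>e. e \<in> edges D \<Longrightarrow> e \<in> edges E \<Longrightarrow> act S (\<theta>2 e) = \<theta>1 e"
      "\<And>x. x \<in> verts D \<Longrightarrow> x \<in> verts E \<Longrightarrow> actv S (\<eta>2 x) = \<eta>1 x"
    and ends: "src N (hd (top_path N)) = src N (hd (bot_path N))" "tgt N (last (top_path N)) = tgt N (last (bot_path N))"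
    and T: "\<And>\<theta>. (\<And>e. e \<in> edges D \<Longrightarrow> \<theta> e = \<theta>1 e) \<Longrightarrow> (\<And>e. e \<in> edges E \<Longrightarrow> \<theta> e = act S (\<theta>2 e)) \<Longrightarrow>
        map \<theta> (top_path N) = base (top_label N) \<and> map \<theta> (bot_path N) = T"
      "mor (top_label N) (bot_label N) T"
  shows "develops N T"
proof -
  define \<theta> where "\<theta> e = (if e \<in> edges D then \<theta>1 e else act S (\<theta>2 e))" for e
  define \<eta> where "\<eta> x = (if x \<in> verts D then \<eta>1 x else actv S (\<eta>2 x))" for x
  define M where "M = Suc (Max (insert 0 (h1 ` edges D)))"
  define h where "h e = (if e \<in> edges D then h1 e else M + h2 e)" for e
  have \<theta>D: "\<theta> e = \<theta>1 e" if "e \<in> edges D" for e using that by (simp add: \<theta>_def)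
  have \<theta>E: "\<theta> e = act S (\<theta>2 e)" if "e \<in> edges E" for e using that ag(1) by (simp add: \<theta>_def)
  have \<eta>D: "\<eta> x = \<eta>1 x" if "x \<in> verts D" for x using that by (simp add: \<eta>_def)
  have \<eta>E: "\<eta> x = actv S (\<eta>2 x)" if "x \<in> verts E" for x using that ag(2) by (simp add: \<eta>_def)
  have hM: "h1 e < M" if "e \<in> edges D" for e
    using that devmap_finite[OF D] unfolding M_def by (simp add: less_Suc_eq_le)
  have pl: "path_label D = path_label N" "path_label E = path_label N" using st by (simp_all add: path_label_def fun_eq_iff)
  have mE: "map \<theta> p = map (act S) (map \<theta>2 p)" if "set p \<subseteq> edges E" for p using that \<theta>E by (auto simp: map_map)
  have mD: "map \<theta> p = map \<theta>1 p" if "set p \<subseteq> edges D" for p using that \<theta>D by auto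
  have "devmap N \<theta> \<eta> h" unfolding devmap_def
  proof (intro conjI ballI)
    show "top_generated N" "top_generated (mirror N)" by (fact N)+
    show "finite (cells N)" using N(2) wfdD(3)[OF D] wfdD(3)[OF E] by simp
    show "src N (hd (top_path N)) = src N (hd (bot_path N))" "tgt N (last (top_path N)) = tgt N (last (bot_path N))" by (fact ends)+
    show "map \<theta> (top_path N) = base (top_label N)" "mor (top_label N) (bot_label N) (map \<theta> (bot_path N))"
      using T(1)[of \<theta>] \<theta>D \<theta>E T(2) by auto
  next
    fix k assume k: "k \<in> cells N"
    show "src N (hd (fst k)) = src N (hd (snd k))" "tgt N (last (fst k)) = tgt N (last (snd k))"
      "(path_label N (fst k), path_label N (snd k)) \<in> R"
      using k N(2) wfdD(4-6)[OF D, of k, unfolded pl st] wfdD(4-6)[OF E, of k, unfolded pl st] by blast+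
    show "map \<theta> (snd k) = flip (map \<theta> (fst k)) (path_label N (snd k))"
    proof (cases "k \<in> cells D")
      case True
      then show ?thesis unfolding mD[OF devmap_edges(3)[OF D True]] mD[OF devmap_edges(4)[OF D True]] using wfdD(8)[OF D True] pl by simp
    next
      case False
      then have kE: "k \<in> cells E" using k N(2) by blast
      note e = devmap_edges(3,4)[OF E kE] and c = devmap_cell[OF E kE]
      have "map \<theta> (snd k) = map (act S) (flip (map \<theta>2 (fst k)) (path_label N (snd k)))" using wfdD(8)[OF E kE] mE e pl by simp
      also have "\<dots> = flip (map (act S) (map \<theta>2 (fst k))) (path_label N (snd k))"
        by (rule act_flip[OF S devmap_okl[OF E e(1)] _ devmap_chain[OF E c(3) e(1) c(1)]])
          (use devmap_elab[OF E e(1)] wfdD(6)[OF E kE] pl in simp)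
      finally show ?thesis using mE[OF e(1)] by simp
    qed
    fix e f assume ef: "e \<in> set (fst k)" "f \<in> set (snd k)"
    show "h e < h f"
    proof (cases "k \<in> cells D")
      case True
      then have "e \<in> edges D" "f \<in> edges D" using devmap_edges(3,4)[OF D True] ef by blast+
      then show ?thesis using wfdD(7)[OF D True ef] by (simp add: h_def)
    next
      case False
      then have kE: "k \<in> cells E" using k N(2) by blast
      have "f \<in> edges E" "f \<notin> set (top_path E)" using devmap_edges(4)[OF E kE] halfD(6)[OF wfdD(1)[OF E] kE] ef by blast+
      then have "f \<notin> edges D" using ov by blast
      then show ?thesis using wfdD(7)[OF E kE ef] hM[of e] by (cases "e \<in> edges D") (simp_all add: h_def)
    qed
  next
    fix e assume e: "e \<in> edges N"
    show "ok (top_label N) (\<theta> e)" "elab (\<theta> e) = lab N e" "esrc (\<theta> e) = \<eta> (src N e)" "etgt (\<theta> e) = \<eta> (tgt N e)"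
    proof -
      have "ok (top_label N) (\<theta> e) \<and> elab (\<theta> e) = lab N e \<and> esrc (\<theta> e) = \<eta> (src N e) \<and> etgt (\<theta> e) = \<eta> (tgt N e)"
      proof (cases "e \<in> edges D")
        case True
        then show ?thesis using okD wfdD(13-15)[OF D True] devmap_verts(3,4)[OF D True] st \<theta>D \<eta>D by simp
      next
        case False
        then have eE: "e \<in> edges E" using e N(1) by blast
        note o = wfdD(12)[OF E eE]
        show ?thesis using act_ok[OF S o] act_elab[OF S o] act_esrc[OF S o] act_etgt[OF S o]
          wfdD(13-15)[OF E eE] devmap_verts(3,4)[OF E eE] st \<theta>E[OF eE] \<eta>E by simp
      qed
      then show "ok (top_label N) (\<theta> e)" "elab (\<theta> e) = lab N e" "esrc (\<theta> e) = \<eta> (src N e)" "etgt (\<theta> e) = \<eta> (tgt N e)" by blast+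
    qed
  qed
  moreover have "map \<theta> (bot_path N) = T" using T(1)[of \<theta>] \<theta>D \<theta>E by auto
  ultimately show ?thesis unfolding develops_def by blast
qed

lemma devmap_eta_ends:
  assumes w: "devmap D \<theta> \<eta> h"
  shows "\<eta> (src D (hd (top_path D))) = VBase 0" "\<eta> (tgt D (last (top_path D))) = VBase (length (top_label D))"
proof -
  have ne: "top_path D \<noteq> []" using halfD(1)[OF wfdD(1)[OF w]] .
  have "chain (\<eta> (src D (hd (top_path D)))) (base (top_label D)) (\<eta> (tgt D (last (top_path D))))"
    using devmap_chain[OF w halfD(2)[OF wfdD(1)[OF w]] devmap_edges(1)[OF w] ne] wfdD(11)[OF w] by simp
  moreover have "base (top_label D) \<noteq> []" using ne by (simp add: top_label_def path_label_def)
  ultimately have a: "chain (\<eta> (src D (hd (top_path D)))) (base (top_label D)) (\<eta> (tgt D (last (top_path D))))"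
    "\<eta> (src D (hd (top_path D))) = VBase 0"
    using chain_hd[of _ "base (top_label D)"] by (auto simp: hd_conv_nth)
  then show "\<eta> (src D (hd (top_path D))) = VBase 0" "\<eta> (tgt D (last (top_path D))) = VBase (length (top_label D))" by auto
qed

lemma develops_stack:
  assumes D: "devmap D \<theta>1 \<eta>1 h1" and E: "devmap E \<theta>2 \<eta>2 h2"
    and st: "src D = src N" "tgt D = tgt N" "lab D = lab N" "src E = src N" "tgt E = tgt N" "lab E = lab N"
    and N: "edges N = edges D \<union> edges E" "verts N = verts D \<union> verts E" "cells N = cells D \<union> cells E"
      "top_path N = top_path D" "bot_path N = bot_path E"
    and DE: "bot_path D = top_path E" "edges D \<inter> edges E \<subseteq> set (top_path E)" "verts D \<inter> verts E \<subseteq> set (path_verts N (top_path E))"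
  shows "develops N (map (act (map \<theta>1 (bot_path D))) (map \<theta>2 (bot_path E)))"
proof -
  let ?T = "map \<theta>1 (bot_path D)" and ?T' = "map \<theta>2 (bot_path E)"
  have c: "path_verts D = path_verts N" "path_verts E = path_verts N"
    "diagram_path D = diagram_path N" "diagram_path E = diagram_path N" "path_label D = path_label N" "path_label E = path_label N"
    by (rule path_verts_cong diagram_path_cong path_label_cong; fact st)+
  note d = halfD[OF wfdD(1)[OF D]] and e = top_generated_mirrorD[OF wfdD(2)[OF E]]
  note d' = top_generated_mirrorD[OF wfdD(2)[OF D]] and e' = halfD[OF wfdD(1)[OF E]]
  have lE: "top_label E = bot_label D" using DE c by (simp add: top_label_def bot_label_def)
  have lN: "top_label N = top_label D" "bot_label N = bot_label E" using N c by (simp_all add: top_label_def bot_label_def)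
  have h1: "top_generated N"
    by (rule top_generated_glue[OF wfdD(1)[OF D] wfdD(1)[OF E] st(1,2,4,5) N(1-3) DE(2,3)])
      (use N(4) d(1,2) devmap_edges(2)[OF D] d'(8) DE(1) c in auto)
  \<comment> \<open>Seen from below, \<open>E\<close> comes first and \<open>D\<close> is glued to
    it.\<close>
  have h2: "top_generated (mirror N)"
    by (rule top_generated_glue[OF wfdD(2)[OF E] wfdD(2)[OF D]])
      (use st N DE e(1,2) devmap_edges(1)[OF E] e'(8) c in auto)
  have mD: "mor (top_label D) (bot_label D) ?T" using wfdD(16)[OF D] .
  have mE: "mor (bot_label D) (bot_label E) ?T'" using wfdD(16)[OF E] lE by simp
  have tE: "map \<theta>2 (top_path E) = base (bot_label D)" using wfdD(11)[OF E] lE by simp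
  have lb: "map (act ?T) (map \<theta>2 (top_path E)) = map \<theta>1 (top_path E)" unfolding tE using mor_act_base[OF mD] DE(1) by simp
  have S: "lpath (top_label N) (top_label E) ?T" using mor_lpath[OF mD] lE lN by simp
  have ne: "top_path E \<noteq> []" using e'(1) .
  have lv: "map (actv ?T) (map \<eta>2 (path_verts N (top_path E))) = map \<eta>1 (path_verts N (top_path E))"
  proof -
    have 1: "map \<eta>2 (path_verts N (top_path E)) = \<eta>2 (src E (hd (top_path E))) # map etgt (base (bot_label D))"
      using devmap_path_verts(1)[OF E e'(2) devmap_edges(1)[OF E] ne] c tE by simp
    have 2: "map \<eta>1 (path_verts N (top_path E)) = \<eta>1 (src D (hd (top_path E))) # map etgt ?T"
      using devmap_path_verts(1)[OF D d'(2) devmap_edges(2)[OF D] d'(1)] c DE(1) by simp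
    have 3: "map (actv ?T) (map etgt (base (bot_label D))) = map etgt ?T"
    proof -
      have "map (actv ?T) (map etgt (base (bot_label D))) = map etgt (map (act ?T) (base (bot_label D)))"
        using act_etgt[OF mor_lpath[OF mD]] okl_base[of "bot_label D"] by (auto simp: map_map okl_def)
      then show ?thesis using mor_act_base[OF mD] by simp
    qed
    have he: "hd (top_path E) \<in> edges E" "hd (top_path E) \<in> edges D" using ne devmap_edges(1)[OF E] devmap_edges(2)[OF D] DE(1) by auto
    have "actv ?T (\<eta>2 (src E (hd (top_path E)))) = esrc (act ?T (\<theta>2 (hd (top_path E))))"
      using act_esrc[OF S wfdD(12)[OF E he(1)]] wfdD(14)[OF E he(1)] by simp
    also have "act ?T (\<theta>2 (hd (top_path E))) = \<theta>1 (hd (top_path E))" using lb ne by (cases "top_path E") auto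
    also have "esrc (\<theta>1 (hd (top_path E))) = \<eta>1 (src D (hd (top_path E)))" using wfdD(14)[OF D he(2)] by simp
    finally show ?thesis unfolding 1 2 using 3 by simp
  qed
  show ?thesis
  proof (rule devmap_glue[OF D E st N(1,3) h1 h2 DE(2) S])
    show "ok (top_label N) (\<theta>1 e)" if "e \<in> edges D" for e using wfdD(12)[OF D that] lN by simp
    show "act ?T (\<theta>2 e) = \<theta>1 e" if "e \<in> edges D" "e \<in> edges E" for e
    proof -
      have "e \<in> set (top_path E)" using that DE(2) by blast
      then show ?thesis using lb by (auto simp: map_map)
    qed
    show "actv ?T (\<eta>2 x) = \<eta>1 x" if "x \<in> verts D" "x \<in> verts E" for x
    proof -
      have "x \<in> set (path_verts N (top_path E))" using that DE(3) by blast
      then show ?thesis using lv by (auto simp: map_map)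
    qed
    show "src N (hd (top_path N)) = src N (hd (bot_path N))" "tgt N (last (top_path N)) = tgt N (last (bot_path N))"
      using wfdD(9,10)[OF D] wfdD(9,10)[OF E] st N DE by simp_all
    show "mor (top_label N) (bot_label N) (map (act ?T) ?T')" using mor_comp[OF mD mE] lN by simp
    fix \<theta> assume a: "\<And>e. e \<in> edges D \<Longrightarrow> \<theta> e = \<theta>1 e" "\<And>e. e \<in> edges E \<Longrightarrow> \<theta> e = act ?T (\<theta>2 e)"
    have "map \<theta> (top_path D) = map \<theta>1 (top_path D)" using a(1) devmap_edges(1)[OF D] by auto
    moreover have "map \<theta> (bot_path E) = map (act ?T) ?T'" using a(2) devmap_edges(2)[OF E] by (auto simp: map_map)
    ultimately show "map \<theta> (top_path N) = base (top_label N) \<and> map \<theta> (bot_path N) = map (act ?T) ?T'"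
      using N lN wfdD(11)[OF D] by simp
  qed
qed

lemma develops_juxtapose:
  assumes D: "devmap D \<theta>1 \<eta>1 h1" and E: "devmap E \<theta>2 \<eta>2 h2"
    and st: "src D = src N" "tgt D = tgt N" "lab D = lab N" "src E = src N" "tgt E = tgt N" "lab E = lab N"
    and N: "edges N = edges D \<union> edges E" "verts N = verts D \<union> verts E" "cells N = cells D \<union> cells E"
      "top_path N = top_path D @ top_path E" "bot_path N = bot_path D @ bot_path E"
    and DE: "tgt N (last (top_path D)) = src N (hd (top_path E))" "edges D \<inter> edges E = {}"
      "verts D \<inter> verts E \<subseteq> {src N (hd (top_path E))}"
  shows "develops N (ssum (top_label D) (map \<theta>1 (bot_path D)) (map \<theta>2 (bot_path E)))"
proof -
  let ?T = "map \<theta>1 (bot_path D)" and ?T' = "map \<theta>2 (bot_path E)"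
  have c: "path_verts D = path_verts N" "path_verts E = path_verts N"
    "diagram_path D = diagram_path N" "diagram_path E = diagram_path N" "path_label D = path_label N" "path_label E = path_label N"
    by (rule path_verts_cong diagram_path_cong path_label_cong; fact st)+
  note d = halfD[OF wfdD(1)[OF D], unfolded c] and e = top_generated_mirrorD[OF wfdD(2)[OF E], unfolded c]
  note d' = top_generated_mirrorD[OF wfdD(2)[OF D], unfolded c] and e' = halfD[OF wfdD(1)[OF E], unfolded c]
  have lN: "top_label N = top_label D @ top_label E" "bot_label N = bot_label D @ bot_label E"
    using N c by (simp_all add: top_label_def bot_label_def) (simp_all add: path_label_def)
  have ends: "src N (hd (top_path D)) = src N (hd (bot_path D))" "tgt N (last (top_path D)) = tgt N (last (bot_path D))"
    "src N (hd (top_path E)) = src N (hd (bot_path E))" "tgt N (last (top_path E)) = tgt N (last (bot_path E))"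
    using wfdD(9,10)[OF D] wfdD(9,10)[OF E] st by simp_all
  have pv: "set (path_verts N (p @ q)) = set (path_verts N p) \<union> tgt N ` set q" if "p \<noteq> []" for p q
    using that by (simp add: path_verts_def)
  have pv2: "set (path_verts N q) = insert (src N (hd q)) (tgt N ` set q)" for q by (simp add: path_verts_def)
  have lastp: "tgt N (last p) \<in> set (path_verts N p)" if "p \<noteq> []" for p using that by (simp add: path_verts_def)
  have h1: "top_generated N"
  proof (rule top_generated_glue[OF wfdD(1)[OF D] wfdD(1)[OF E] st(1,2,4,5) N(1-3)])
    have l: "src N (hd (top_path E)) \<in> set (path_verts N (top_path D))" using lastp[OF d(1)] DE(1) by simp
    have vE: "tgt N ` set (top_path E) \<subseteq> verts E" using e'(8) pv2 by blast
    show "diagram_path N (top_path N)" unfolding N using diagram_path_append[OF d(2) e'(2) d(1) e'(1) DE(1)] .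
    show "verts D \<inter> verts E \<subseteq> set (path_verts N (top_path E))" using DE(3) pv2 by blast
    show "set (path_verts N (top_path N)) \<subseteq> set (path_verts N (top_path D)) \<union> set (path_verts N (top_path E))"
      unfolding N pv[OF d(1)] pv2[of "top_path E"] by blast
    show "set (path_verts N (top_path E)) \<subseteq> verts D \<union> set (path_verts N (top_path N))"
      unfolding N pv[OF d(1)] pv2[of "top_path E"] using l by blast
    show "verts D \<inter> set (path_verts N (top_path N)) \<subseteq> set (path_verts N (top_path D))"
      unfolding N pv[OF d(1)] by (rule meet_glue[OF l vE DE(3)])
    show "set (path_verts N (top_path D)) \<subseteq> set (path_verts N (top_path N))" unfolding N pv[OF d(1)] by blast
    show "edges D \<inter> set (top_path N) \<subseteq> set (top_path D)" using N(4) DE(2) devmap_edges(1)[OF E] by auto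
  qed (use N d(1) DE(2) in auto)
  have h2: "top_generated (mirror N)"
  proof (rule top_generated_glue[OF wfdD(2)[OF D] wfdD(2)[OF E]])
    have l: "src N (hd (bot_path E)) \<in> set (path_verts N (bot_path D))" using lastp[OF d'(1)] DE(1) ends by simp
    have vE: "tgt N ` set (bot_path E) \<subseteq> verts E" using e(8) pv2 by blast
    have "diagram_path N (bot_path N)" unfolding N by (rule diagram_path_append[OF d'(2) e(2) d'(1) e(1)]) (use DE(1) ends in simp)
    then show "diagram_path (mirror N) (top_path (mirror N))" by simp
    show "verts (mirror D) \<inter> verts (mirror E) \<subseteq> set (path_verts (mirror N) (top_path (mirror E)))" using DE(3) pv2 ends by auto
    have "set (path_verts N (bot_path N)) \<subseteq> set (path_verts N (bot_path D)) \<union> set (path_verts N (bot_path E))"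
      unfolding N pv[OF d'(1)] pv2[of "bot_path E"] by blast
    then show "set (path_verts (mirror N) (top_path (mirror N))) \<subseteq> set (path_verts (mirror N) (top_path (mirror D))) \<union> set (path_verts (mirror N) (top_path (mirror E)))"
      by simp
    have "set (path_verts N (bot_path E)) \<subseteq> verts D \<union> set (path_verts N (bot_path N))"
      unfolding N pv[OF d'(1)] pv2[of "bot_path E"] using l by blast
    then show "set (path_verts (mirror N) (top_path (mirror E))) \<subseteq> verts (mirror D) \<union> set (path_verts (mirror N) (top_path (mirror N)))" by simp
    have "verts D \<inter> set (path_verts N (bot_path N)) \<subseteq> set (path_verts N (bot_path D))"
      unfolding N pv[OF d'(1)] by (rule meet_glue[OF l vE DE(3)[unfolded ends(3)]])
    then show "verts (mirror D) \<inter> set (path_verts (mirror N) (top_path (mirror N))) \<subseteq> set (path_verts (mirror N) (top_path (mirror D)))" by simp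
    have "set (path_verts N (bot_path D)) \<subseteq> set (path_verts N (bot_path N))" unfolding N pv[OF d'(1)] by blast
    then show "set (path_verts (mirror N) (top_path (mirror D))) \<subseteq> set (path_verts (mirror N) (top_path (mirror N)))" by simp
    show "edges (mirror D) \<inter> set (top_path (mirror N)) \<subseteq> set (top_path (mirror D))" using N(5) DE(2) devmap_edges(2)[OF E] by auto
    show "cells (mirror N) = cells (mirror D) \<union> cells (mirror E)" using N(3) by auto
  qed (use st N d'(1) DE(2) in auto)
  have mD: "mor (top_label D) (bot_label D) ?T" and mE: "mor (top_label E) (bot_label E) ?T'"
    using wfdD(16)[OF D] wfdD(16)[OF E] by auto
  have wne: "top_label D \<noteq> []" "top_label E \<noteq> []" using mor_ne[OF mD] mor_ne[OF mE] by auto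
  \<comment> \<open>The second summand is developed over the final segment of the base path.\<close>
  let ?S = "sbase (length (top_label D)) (top_label E)"
  have S: "lpath (top_label N) (top_label E) ?S" using lpath_sbase[OF wne(2)] lN by simp
  show ?thesis
  proof (rule devmap_glue[OF D E st N(1,3) h1 h2 _ S])
    show "edges D \<inter> edges E \<subseteq> set (top_path E)" using DE(2) by simp
    show "ok (top_label N) (\<theta>1 e)" if "e \<in> edges D" for e using ok_append[OF wne(1) wfdD(12)[OF D that]] lN by simp
    show "act ?S (\<theta>2 e) = \<theta>1 e" if "e \<in> edges D" "e \<in> edges E" for e using DE(2) that by blast
    show "actv ?S (\<eta>2 x) = \<eta>1 x" if "x \<in> verts D" "x \<in> verts E" for x
    proof -
      have x: "x = src N (hd (top_path E))" "x = tgt N (last (top_path D))" using that DE(1,3) by auto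
      have "\<eta>2 x = VBase 0" "\<eta>1 x = VBase (length (top_label D))"
        using devmap_eta_ends(1)[OF E] devmap_eta_ends(2)[OF D] x st by auto
      then show ?thesis using wne by (simp add: actv.simps)
    qed
    show "src N (hd (top_path N)) = src N (hd (bot_path N))" "tgt N (last (top_path N)) = tgt N (last (bot_path N))"
      using ends N d(1) d'(1) e(1) e'(1) by simp_all
    show "mor (top_label N) (bot_label N) (ssum (top_label D) ?T ?T')" using mor_ssum[OF mD mE] lN by simp
    fix \<theta> assume a: "\<And>e. e \<in> edges D \<Longrightarrow> \<theta> e = \<theta>1 e" "\<And>e. e \<in> edges E \<Longrightarrow> \<theta> e = act ?S (\<theta>2 e)"
    have 1: "map \<theta> p = map \<theta>1 p" if "set p \<subseteq> edges D" for p using a(1) that by auto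
    have 2: "map \<theta> p = map (shift_edge (length (top_label D))) (map \<theta>2 p)" if "set p \<subseteq> edges E" for p
      using a(2) that map_act_sbase[OF devmap_okl[OF E that]] by (auto simp: map_map)
    show "map \<theta> (top_path N) = base (top_label N) \<and> map \<theta> (bot_path N) = ssum (top_label D) ?T ?T'"
      using N lN 1[OF devmap_edges(1)[OF D]] 1[OF devmap_edges(2)[OF D]] 2[OF devmap_edges(1)[OF E]] 2[OF devmap_edges(2)[OF E]]
        wfdD(11)[OF D] wfdD(11)[OF E]
      by (simp add: ssum_def sbase_append shift_edge_sbase)
  qed
qed

end

lemma copy_simps [simp]:
  "even_copy a = even_copy b \<longleftrightarrow> a = b" "odd_copy a = odd_copy b \<longleftrightarrow> a = b"
  "even_copy a \<noteq> odd_copy b" "odd_copy b \<noteq> even_copy a"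
  "even (even_copy a)" "odd (odd_copy a)" "even_copy a div 2 = a" "odd_copy a div 2 = a"
  by (simp_all add: even_copy_def odd_copy_def) presburger+

text \<open>The two glued paths have no repetitions, so the identification is injective on each of
  the two copies; only points of the glued paths get identified.\<close>

lemma subst_copies:
  assumes xs: "distinct xs" and ys: "distinct ys" and len: "length xs = length ys"
  defines "s \<equiv> subst_list (map odd_copy xs) (map even_copy ys)"
  shows "s (even_copy a) = even_copy a" "i < length xs \<Longrightarrow> s (odd_copy (xs ! i)) = even_copy (ys ! i)"
    "b \<notin> set xs \<Longrightarrow> s (odd_copy b) = odd_copy b" "inj (s \<circ> odd_copy)"
    "even_copy a = s (odd_copy b) \<Longrightarrow> b \<in> set xs"
proof -
  show "s (even_copy a) = even_copy a" unfolding s_def by (rule subst_list_notin) (use len in auto)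
  have "distinct (map odd_copy xs)" using xs by (simp add: distinct_map inj_on_def)
  then show 1: "s (odd_copy (xs ! i)) = even_copy (ys ! i)" if "i < length xs" for i
    unfolding s_def using subst_list_nth[of "map odd_copy xs" "map even_copy ys" i] len that by simp
  show 2: "s (odd_copy b) = odd_copy b" if "b \<notin> set xs" for b
    unfolding s_def by (rule subst_list_notin) (use len that in auto)
  show "inj (s \<circ> odd_copy)"
  proof (rule injI)
    fix a b assume "(s \<circ> odd_copy) a = (s \<circ> odd_copy) b"
    then have ab: "s (odd_copy a) = s (odd_copy b)" by simp
    consider i j where "i < length xs" "a = xs ! i" "j < length xs" "b = xs ! j" | "a \<notin> set xs" | "b \<notin> set xs"
      by (metis in_set_conv_nth)
    then show "a = b"
    proof cases
      case 1
      then have "ys ! i = ys ! j" using ab \<open>\<And>i. i < length xs \<Longrightarrow> s (odd_copy (xs ! i)) = even_copy (ys ! i)\<close> by simp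
      then have "i = j" using nth_eq_iff_index_eq[OF ys] 1 len by simp
      then show ?thesis using 1 by simp
    next
      case 2
      have "b \<notin> set xs"
      proof
        assume "b \<in> set xs"
        then obtain i where "i < length xs" "b = xs ! i" by (metis in_set_conv_nth)
        then show False using ab \<open>\<And>b. b \<notin> set xs \<Longrightarrow> s (odd_copy b) = odd_copy b\<close>[OF 2]
            \<open>\<And>i. i < length xs \<Longrightarrow> s (odd_copy (xs ! i)) = even_copy (ys ! i)\<close> by simp
      qed
      then show ?thesis using ab 2 \<open>\<And>b. b \<notin> set xs \<Longrightarrow> s (odd_copy b) = odd_copy b\<close> by simp
    next
      case 3
      have "a \<notin> set xs"
      proof
        assume "a \<in> set xs"
        then obtain i where "i < length xs" "a = xs ! i" by (metis in_set_conv_nth)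
        then show False using ab \<open>\<And>b. b \<notin> set xs \<Longrightarrow> s (odd_copy b) = odd_copy b\<close>[OF 3]
            \<open>\<And>i. i < length xs \<Longrightarrow> s (odd_copy (xs ! i)) = even_copy (ys ! i)\<close> by simp
      qed
      then show ?thesis using ab 3 \<open>\<And>b. b \<notin> set xs \<Longrightarrow> s (odd_copy b) = odd_copy b\<close> by simp
    qed
  qed
  show "even_copy a = s (odd_copy b) \<Longrightarrow> b \<in> set xs" using 2[of b] by fastforce
qed

lemma dcomp_simps:
  assumes "top_path E \<noteq> []" "bot_path D \<noteq> []"
  defines "\<psi> \<equiv> subst_list (map odd_copy (top_path E)) (map even_copy (bot_path D))"
    and "\<phi> \<equiv> subst_list (map odd_copy (path_verts E (top_path E))) (map even_copy (path_verts D (bot_path D)))"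
  shows "verts (dcomp D E) = (\<phi> \<circ> even_copy) ` verts D \<union> (\<phi> \<circ> odd_copy) ` verts E"
    "edges (dcomp D E) = (\<psi> \<circ> even_copy) ` edges D \<union> (\<psi> \<circ> odd_copy) ` edges E"
    "src (dcomp D E) (even_copy e) = \<phi> (even_copy (src D e))" "src (dcomp D E) (odd_copy e) = \<phi> (odd_copy (src E e))"
    "tgt (dcomp D E) (even_copy e) = \<phi> (even_copy (tgt D e))" "tgt (dcomp D E) (odd_copy e) = \<phi> (odd_copy (tgt E e))"
    "lab (dcomp D E) (even_copy e) = lab D e" "lab (dcomp D E) (odd_copy e) = lab E e"
    "cells (dcomp D E) = (\<lambda>c. (map (\<psi> \<circ> even_copy) (fst c), map (\<psi> \<circ> even_copy) (snd c))) ` cells D \<union>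
       (\<lambda>c. (map (\<psi> \<circ> odd_copy) (fst c), map (\<psi> \<circ> odd_copy) (snd c))) ` cells E"
    "top_path (dcomp D E) = map (\<psi> \<circ> even_copy) (top_path D)" "bot_path (dcomp D E) = map (\<psi> \<circ> odd_copy) (bot_path E)"
proof -
  let ?U = "disjoint_union D E\<lparr>top_path := map even_copy (top_path D), bot_path := map odd_copy (bot_path E)\<rparr>"
  have "path_verts ?U (map odd_copy (top_path E)) = map odd_copy (path_verts E (top_path E))"
    "path_verts ?U (map even_copy (bot_path D)) = map even_copy (path_verts D (bot_path D))"
    using assms(1,2) by (simp_all add: path_verts_def disjoint_union_def hd_map map_map)
  then have "dcomp D E = collapse \<phi> \<psi> ?U" unfolding dcomp_def identify_paths_def \<phi>_def \<psi>_def by simp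
  then show "verts (dcomp D E) = (\<phi> \<circ> even_copy) ` verts D \<union> (\<phi> \<circ> odd_copy) ` verts E"
    "edges (dcomp D E) = (\<psi> \<circ> even_copy) ` edges D \<union> (\<psi> \<circ> odd_copy) ` edges E"
    "src (dcomp D E) (even_copy e) = \<phi> (even_copy (src D e))" "src (dcomp D E) (odd_copy e) = \<phi> (odd_copy (src E e))"
    "tgt (dcomp D E) (even_copy e) = \<phi> (even_copy (tgt D e))" "tgt (dcomp D E) (odd_copy e) = \<phi> (odd_copy (tgt E e))"
    "lab (dcomp D E) (even_copy e) = lab D e" "lab (dcomp D E) (odd_copy e) = lab E e"
    "cells (dcomp D E) = (\<lambda>c. (map (\<psi> \<circ> even_copy) (fst c), map (\<psi> \<circ> even_copy) (snd c))) ` cells D \<union>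
       (\<lambda>c. (map (\<psi> \<circ> odd_copy) (fst c), map (\<psi> \<circ> odd_copy) (snd c))) ` cells E"
    "top_path (dcomp D E) = map (\<psi> \<circ> even_copy) (top_path D)" "bot_path (dcomp D E) = map (\<psi> \<circ> odd_copy) (bot_path E)"
    by (simp_all add: disjoint_union_def image_Un image_image split_beta map_map image_comp)
qed

lemma dsum_simps:
  defines "\<phi> D E \<equiv> id(odd_copy (initial_vertex E) := even_copy (terminal_vertex D))"
  shows "verts (dsum D E) = even_copy ` verts D \<union> (\<phi> D E \<circ> odd_copy) ` verts E"
    "edges (dsum D E) = even_copy ` edges D \<union> odd_copy ` edges E"
    "src (dsum D E) (even_copy e) = even_copy (src D e)" "src (dsum D E) (odd_copy e) = \<phi> D E (odd_copy (src E e))"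
    "tgt (dsum D E) (even_copy e) = even_copy (tgt D e)" "tgt (dsum D E) (odd_copy e) = \<phi> D E (odd_copy (tgt E e))"
    "lab (dsum D E) (even_copy e) = lab D e" "lab (dsum D E) (odd_copy e) = lab E e"
    "cells (dsum D E) = (\<lambda>c. (map even_copy (fst c), map even_copy (snd c))) ` cells D \<union>
       (\<lambda>c. (map odd_copy (fst c), map odd_copy (snd c))) ` cells E"
    "top_path (dsum D E) = map even_copy (top_path D) @ map odd_copy (top_path E)"
    "bot_path (dsum D E) = map even_copy (bot_path D) @ map odd_copy (bot_path E)"
proof -
  have e: "\<phi> D E (even_copy x) = even_copy x" for x by (simp add: \<phi>_def)
  show "verts (dsum D E) = even_copy ` verts D \<union> (\<phi> D E \<circ> odd_copy) ` verts E"
    by (simp add: dsum_def disjoint_union_def image_Un image_comp \<phi>_def[symmetric] o_def e)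
  show "edges (dsum D E) = even_copy ` edges D \<union> odd_copy ` edges E"
    "src (dsum D E) (even_copy e) = even_copy (src D e)" "src (dsum D E) (odd_copy e) = \<phi> D E (odd_copy (src E e))"
    "tgt (dsum D E) (even_copy e) = even_copy (tgt D e)" "tgt (dsum D E) (odd_copy e) = \<phi> D E (odd_copy (tgt E e))"
    "lab (dsum D E) (even_copy e) = lab D e" "lab (dsum D E) (odd_copy e) = lab E e"
    "cells (dsum D E) = (\<lambda>c. (map even_copy (fst c), map even_copy (snd c))) ` cells D \<union>
       (\<lambda>c. (map odd_copy (fst c), map odd_copy (snd c))) ` cells E"
    "top_path (dsum D E) = map even_copy (top_path D) @ map odd_copy (top_path E)"
    "bot_path (dsum D E) = map even_copy (bot_path D) @ map odd_copy (bot_path E)"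
    by (simp_all add: dsum_def disjoint_union_def image_Un image_image split_beta map_map \<phi>_def)
qed

text \<open>A factor as it lies inside the result \<open>N\<close>, with the incidence functions of
  \<open>N\<close>, as the gluing lemmas require.\<close>

abbreviation subdiagram :: "'a diagram \<Rightarrow> (nat \<Rightarrow> nat) \<Rightarrow> (nat \<Rightarrow> nat) \<Rightarrow> 'a diagram \<Rightarrow> 'a diagram" where
  "subdiagram N \<psi> \<phi> D \<equiv> N\<lparr>verts := \<phi> ` verts D, edges := \<psi> ` edges D,
     cells := (\<lambda>c. (map \<psi> (fst c), map \<psi> (snd c))) ` cells D,
     top_path := map \<psi> (top_path D), bot_path := map \<psi> (bot_path D)\<rparr>"

context symmetric_relation
begin

lemma card_Un_images: "finite A \<Longrightarrow> finite B \<Longrightarrow> card (f ` A \<union> g ` B) \<le> card A + card B"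
  by (meson add_mono card_Un_le card_image_le order_trans)

lemma devmap_subdiagram:
  assumes w: "devmap D \<theta> \<eta> h" and i: "inj \<psi>" "inj \<phi>"
    and hom: "\<And>e. src N (\<psi> e) = \<phi> (src D e) \<and> tgt N (\<psi> e) = \<phi> (tgt D e) \<and> lab N (\<psi> e) = lab D e"
  shows "\<exists>\<theta>' \<eta>' h'. devmap (subdiagram N \<psi> \<phi> D) \<theta>' \<eta>' h' \<and> map \<theta>' (bot_path (subdiagram N \<psi> \<phi> D)) = map \<theta> (bot_path D)"
    "top_label (subdiagram N \<psi> \<phi> D) = top_label D" "bot_label (subdiagram N \<psi> \<phi> D) = bot_label D"
proof -
  let ?N = "subdiagram N \<psi> \<phi> D"
  have hom': "src ?N (\<psi> e) = \<phi> (src D e) \<and> tgt ?N (\<psi> e) = \<phi> (tgt D e) \<and> lab ?N (\<psi> e) = lab D e" for e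
    using hom by simp
  have n: "verts ?N = \<phi> ` verts D" "edges ?N = \<psi> ` edges D" "cells ?N = (\<lambda>c. (map \<psi> (fst c), map \<psi> (snd c))) ` cells D"
    "top_path ?N = map \<psi> (top_path D)" "bot_path ?N = map \<psi> (bot_path D)" by simp_all
  note W = devmap_image[OF w inj_on_subset[OF i(1) subset_UNIV] inj_on_subset[OF i(2) subset_UNIV] n hom']
  show "top_label ?N = top_label D" "bot_label ?N = bot_label D" by (rule W(2), rule W(3))
  show "\<exists>\<theta>' \<eta>' h'. devmap ?N \<theta>' \<eta>' h' \<and> map \<theta>' (bot_path ?N) = map \<theta> (bot_path D)"
    using W(1,4) by blast
qed

lemma develops_dcomp:
  assumes "develops D T" "develops E T'" and l: "bot_label D = top_label E"
  shows "develops (dcomp D E) (map (act T) T')" "top_label (dcomp D E) = top_label D" "bot_label (dcomp D E) = bot_label E"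
    "card (cells (dcomp D E)) \<le> card (cells D) + card (cells E)"
proof -
  obtain \<theta>1 \<eta>1 h1 where D: "devmap D \<theta>1 \<eta>1 h1" and T: "T = map \<theta>1 (bot_path D)" using assms(1) unfolding develops_def by blast
  obtain \<theta>2 \<eta>2 h2 where E: "devmap E \<theta>2 \<eta>2 h2" and T': "T' = map \<theta>2 (bot_path E)" using assms(2) unfolding develops_def by blast
  note d = top_generated_mirrorD(1,2)[OF wfdD(2)[OF D]] and e = halfD(1,2)[OF wfdD(1)[OF E]]
  let ?xs = "top_path E" and ?ys = "bot_path D" and ?xv = "path_verts E (top_path E)" and ?yv = "path_verts D (bot_path D)"
  define \<psi> where "\<psi> = subst_list (map odd_copy ?xs) (map even_copy ?ys)"
  define \<phi> where "\<phi> = subst_list (map odd_copy ?xv) (map even_copy ?yv)"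
  let ?N = "dcomp D E"
  note N = dcomp_simps[OF e(1) d(1), folded \<psi>_def \<phi>_def]
  have len: "length ?xs = length ?ys" using l by (metis length_map bot_label_def path_label_def top_label_def)
  have lenv: "length ?xv = length ?yv" using len by (simp add: path_verts_def)
  have ds: "distinct ?xs" "distinct ?ys" using devmap_distinct[OF E e(2) devmap_edges(1)[OF E]] devmap_distinct[OF D d(2) devmap_edges(2)[OF D]] .
  have dvs: "distinct ?xv" "distinct ?yv"
    using devmap_path_verts(2)[OF E e(2) devmap_edges(1)[OF E] e(1)] devmap_path_verts(2)[OF D d(2) devmap_edges(2)[OF D] d(1)] by (auto simp: distinct_map)
  note s = subst_copies[OF ds len, folded \<psi>_def] and sv = subst_copies[OF dvs lenv, folded \<phi>_def]
  let ?D = "subdiagram ?N (\<psi> \<circ> even_copy) (\<phi> \<circ> even_copy) D" and ?E = "subdiagram ?N (\<psi> \<circ> odd_copy) (\<phi> \<circ> odd_copy) E"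
  have homD: "src ?N ((\<psi> \<circ> even_copy) e) = (\<phi> \<circ> even_copy) (src D e) \<and> tgt ?N ((\<psi> \<circ> even_copy) e) = (\<phi> \<circ> even_copy) (tgt D e) \<and>
      lab ?N ((\<psi> \<circ> even_copy) e) = lab D e" for e
    using N(3,5,7) s(1) by simp
  have homE: "src ?N ((\<psi> \<circ> odd_copy) e) = (\<phi> \<circ> odd_copy) (src E e) \<and> tgt ?N ((\<psi> \<circ> odd_copy) e) = (\<phi> \<circ> odd_copy) (tgt E e) \<and>
      lab ?N ((\<psi> \<circ> odd_copy) e) = lab E e" for e
  proof (cases "e \<in> set ?xs")
    case True
    then obtain i where i: "i < length ?xs" "e = ?xs ! i" by (metis in_set_conv_nth)
    have "lab D (?ys ! i) = lab E (?xs ! i)" using l i len unfolding bot_label_def top_label_def path_label_def by (metis nth_map)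
    have iv: "i < length ?xv" "Suc i < length ?xv" using i by (simp_all add: path_verts_def)
    have iy: "i < length ?ys" using i len by simp
    show ?thesis
      unfolding o_apply i(2) s(2)[OF i(1)] N(3,5,7) diagram_path_nth[OF d(2) iy] diagram_path_nth[OF e(2) i(1)] sv(1) sv(2)[OF iv(1)] sv(2)[OF iv(2)]
      using \<open>lab D (?ys ! i) = lab E (?xs ! i)\<close> by simp
  next
    case False
    then show ?thesis using N(4,6,8) s(3) by simp
  qed
  have ie: "inj (\<psi> \<circ> even_copy)" "inj (\<phi> \<circ> even_copy)" using s(1) sv(1) by (simp_all add: inj_def)
  note wD = devmap_subdiagram[OF D ie homD] and wE = devmap_subdiagram[OF E s(4) sv(4) homE]
  have bt: "bot_path ?D = top_path ?E"
    using s(1,2) len by (auto intro: nth_equalityI)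
  have pvE: "path_verts ?E (top_path ?E) = map (\<phi> \<circ> odd_copy) ?xv"
    using homE e(1) by (simp add: path_verts_def hd_map map_map)
  have "develops ?N (map (act T) T')"
  proof -
    obtain \<theta>1' \<eta>1' h1' where 1: "devmap ?D \<theta>1' \<eta>1' h1'" "map \<theta>1' (bot_path ?D) = T" using wD(1)[folded T] by blast
    obtain \<theta>2' \<eta>2' h2' where 2: "devmap ?E \<theta>2' \<eta>2' h2'" "map \<theta>2' (bot_path ?E) = T'" using wE(1)[folded T'] by blast
    have "develops ?N (map (act (map \<theta>1' (bot_path ?D))) (map \<theta>2' (bot_path ?E)))"
    proof (rule develops_stack[OF 1(1) 2(1) _ _ _ _ _ _ _ _ _ _ _ bt])
      show "edges ?D \<inter> edges ?E \<subseteq> set (top_path ?E)" using s(1,5) by auto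
      have "verts ?D \<inter> verts ?E \<subseteq> set (map (\<phi> \<circ> odd_copy) ?xv)" using sv(1,5) by auto
      then show "verts ?D \<inter> verts ?E \<subseteq> set (path_verts ?N (top_path ?E))" using pvE by (simp add: path_verts_def)
    qed (use N in simp_all)
    then show ?thesis unfolding 1(2) 2(2) .
  qed
  then show "develops (dcomp D E) (map (act T) T')" .
  have lN: "top_label ?N = top_label ?D" "bot_label ?N = bot_label ?E"
    unfolding top_label_def bot_label_def path_label_def N(10,11) by simp_all
  show "top_label ?N = top_label D" by (rule trans[OF lN(1) wD(2)])
  show "bot_label ?N = bot_label E" by (rule trans[OF lN(2) wE(3)])
  show "card (cells ?N) \<le> card (cells D) + card (cells E)"
    unfolding N(9) using wfdD(3)[OF D] wfdD(3)[OF E] by (rule card_Un_images)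
qed

lemma develops_dsum:
  assumes "develops D T" "develops E T'"
  shows "develops (dsum D E) (ssum (top_label D) T T')" "top_label (dsum D E) = top_label D @ top_label E"
    "bot_label (dsum D E) = bot_label D @ bot_label E"
proof -
  obtain \<theta>1 \<eta>1 h1 where D: "devmap D \<theta>1 \<eta>1 h1" and T: "T = map \<theta>1 (bot_path D)" using assms(1) unfolding develops_def by blast
  obtain \<theta>2 \<eta>2 h2 where E: "devmap E \<theta>2 \<eta>2 h2" and T': "T' = map \<theta>2 (bot_path E)" using assms(2) unfolding develops_def by blast
  note d = halfD(1,2)[OF wfdD(1)[OF D]] and e = halfD(1,2)[OF wfdD(1)[OF E]]
  define \<phi> where "\<phi> = id(odd_copy (initial_vertex E) := even_copy (terminal_vertex D))"
  let ?N = "dsum D E"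
  note N = dsum_simps[of D E, folded \<phi>_def]
  let ?D = "subdiagram ?N even_copy even_copy D" and ?E = "subdiagram ?N odd_copy (\<phi> \<circ> odd_copy) E"
  have homD: "src ?N (even_copy e) = even_copy (src D e) \<and> tgt ?N (even_copy e) = even_copy (tgt D e) \<and>
      lab ?N (even_copy e) = lab D e" for e
    using N(3,5,7) by simp
  have homE: "src ?N (odd_copy e) = (\<phi> \<circ> odd_copy) (src E e) \<and> tgt ?N (odd_copy e) = (\<phi> \<circ> odd_copy) (tgt E e) \<and>
      lab ?N (odd_copy e) = lab E e" for e
    using N(4,6,8) by simp
  have i: "inj even_copy" "inj odd_copy" "inj (\<phi> \<circ> odd_copy)" by (auto simp: inj_def \<phi>_def split: if_splits)
  note wD = devmap_subdiagram[OF D i(1) i(1) homD] and wE = devmap_subdiagram[OF E i(2) i(3) homE]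
  have tl: "tgt ?N (last (map even_copy (top_path D))) = even_copy (terminal_vertex D)"
    using d(1) N(5) by (simp add: last_map terminal_vertex_def)
  have sl: "src ?N (hd (map odd_copy (top_path E))) = even_copy (terminal_vertex D)"
    using e(1) N(4) by (simp add: hd_map initial_vertex_def \<phi>_def)
  note l = wD(2)
  have "develops ?N (ssum (top_label D) T T')"
  proof -
    obtain \<theta>1' \<eta>1' h1' where 1: "devmap ?D \<theta>1' \<eta>1' h1'" "map \<theta>1' (bot_path ?D) = T" using wD(1)[folded T] by blast
    obtain \<theta>2' \<eta>2' h2' where 2: "devmap ?E \<theta>2' \<eta>2' h2'" "map \<theta>2' (bot_path ?E) = T'" using wE(1)[folded T'] by blast
    have "develops ?N (ssum (top_label ?D) (map \<theta>1' (bot_path ?D)) (map \<theta>2' (bot_path ?E)))"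
    proof (rule develops_juxtapose[OF 1(1) 2(1)])
      show "edges ?D \<inter> edges ?E = {}" by auto
      show "verts ?D \<inter> verts ?E \<subseteq> {src ?N (hd (top_path ?E))}" using sl by (auto simp: \<phi>_def split: if_splits)
      show "tgt ?N (last (top_path ?D)) = src ?N (hd (top_path ?E))" using sl tl by simp
    qed (use N in simp_all)
    then show ?thesis unfolding 1(2) 2(2) l(1) .
  qed
  then show "develops (dsum D E) (ssum (top_label D) T T')" .
  show "top_label ?N = top_label D @ top_label E" "bot_label ?N = bot_label D @ bot_label E"
    using N(7,8,10,11) by (simp_all add: top_label_def bot_label_def path_label_def map_map)
qed

lemma develops_isotopic:
  assumes "develops D T" "isotopic D E"
  shows "develops E T \<and> top_label E = top_label D \<and> bot_label E = bot_label D"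
proof -
  obtain \<theta> \<eta> h where D: "devmap D \<theta> \<eta> h" and T: "T = map \<theta> (bot_path D)" using assms(1) unfolding develops_def by blast
  obtain \<phi> \<psi> where i: "bij_betw \<phi> (verts D) (verts E)" "bij_betw \<psi> (edges D) (edges E)"
    "\<forall>e\<in>edges D. src E (\<psi> e) = \<phi> (src D e) \<and> tgt E (\<psi> e) = \<phi> (tgt D e) \<and> lab E (\<psi> e) = lab D e"
    "cells E = (\<lambda>(p, q). (map \<psi> p, map \<psi> q)) ` cells D" "top_path E = map \<psi> (top_path D)" "bot_path E = map \<psi> (bot_path D)"
    using assms(2) unfolding isotopic_def by blast
  have image: "verts E = \<phi> ` verts D" "edges E = \<psi> ` edges D"
      "cells E = (\<lambda>c. (map \<psi> (fst c), map \<psi> (snd c))) ` cells D"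
    using i by (auto simp: bij_betw_def split_beta)
  have j: "inj_on \<psi> (edges D)" "inj_on \<phi> (verts D)" using i by (auto simp: bij_betw_def)
  have h: "\<And>e. e \<in> edges D \<Longrightarrow> src E (\<psi> e) = \<phi> (src D e) \<and> tgt E (\<psi> e) = \<phi> (tgt D e) \<and> lab E (\<psi> e) = lab D e" using i(3) by blast
  note w = devmap_image[OF D j image i(5,6) h]
  show ?thesis using w T unfolding develops_def by metis
qed

text \<open>Applying the inverse of \<open>T\<close> to the old development takes the bottom path to
  a base path, and flips are involutions, so the cells can be read upwards. Ranks are
  reversed.\<close>

lemma develops_mirror:
  assumes "develops D T"
  shows "develops (mirror D) (minv (top_label D) T)" "top_label (mirror D) = bot_label D" "bot_label (mirror D) = top_label D"
    "card (cells (mirror D)) = card (cells D)"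
proof -
  obtain \<theta> \<eta> h where w: "devmap D \<theta> \<eta> h" and T: "T = map \<theta> (bot_path D)" using assms(1) unfolding develops_def by blast
  show l: "top_label (mirror D) = bot_label D" "bot_label (mirror D) = top_label D" by (simp_all add: top_label_def bot_label_def)
  show "card (cells (mirror D)) = card (cells D)" by (simp add: card_image)
  let ?I = "minv (top_label D) T"
  have m: "mor (top_label D) (bot_label D) T" using wfdD(16)[OF w] T by simp
  note I = minv[OF m]
  have S: "lpath (bot_label D) (top_label D) ?I" using mor_lpath I by blast
  define M where "M = Max (insert 0 (h ` edges D))"
  have hM: "h e \<le> M" if "e \<in> edges D" for e using that devmap_finite[OF w] unfolding M_def by simp
  have "devmap (mirror D) (act ?I \<circ> \<theta>) (actv ?I \<circ> \<eta>) (\<lambda>e. M - h e)" unfolding devmap_def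
  proof (intro conjI ballI)
    show "top_generated (mirror D)" "top_generated (mirror (mirror D))" using wfdD(1,2)[OF w] by simp_all
    show "finite (cells (mirror D))" using wfdD(3)[OF w] by simp
    show "src (mirror D) (hd (top_path (mirror D))) = src (mirror D) (hd (bot_path (mirror D)))"
      "tgt (mirror D) (last (top_path (mirror D))) = tgt (mirror D) (last (bot_path (mirror D)))"
      using wfdD(9,10)[OF w] by simp_all
    show "map (act ?I \<circ> \<theta>) (top_path (mirror D)) = base (top_label (mirror D))" using I l T by (simp add: map_map)
    have "map (act ?I \<circ> \<theta>) (top_path D) = ?I" using wfdD(11)[OF w] mor_act_base I by (metis map_map)
    then show "mor (top_label (mirror D)) (bot_label (mirror D)) (map (act ?I \<circ> \<theta>) (bot_path (mirror D)))"
      using I l by simp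
  next
    fix c assume "c \<in> cells (mirror D)"
    then obtain k where k: "k \<in> cells D" "c = prod.swap k" by auto
    show "src (mirror D) (hd (fst c)) = src (mirror D) (hd (snd c))" "tgt (mirror D) (last (fst c)) = tgt (mirror D) (last (snd c))"
      "(path_label (mirror D) (fst c), path_label (mirror D) (snd c)) \<in> R"
      using k wfdD(4-6)[OF w k(1)] R_sym by simp_all
    note e = devmap_edges(3,4)[OF w k(1)] and kc = devmap_cell[OF w k(1)]
    note ch = devmap_chain[OF w kc(3) e(1) kc(1)]
    have 1: "(map elab (map \<theta> (fst k)), path_label D (snd k)) \<in> R" using devmap_elab[OF w e(1)] wfdD(6)[OF w k(1)] by simp
    have 2: "flip (map \<theta> (snd k)) (path_label D (fst k)) = map \<theta> (fst k)"
      using flip_flip[OF devmap_okl[OF w e(1)] 1 ch] wfdD(8)[OF w k(1)] devmap_elab[OF w e(1)] by simp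
    have 3: "(map elab (map \<theta> (snd k)), path_label D (fst k)) \<in> R" using devmap_elab[OF w e(2)] wfdD(6)[OF w k(1)] R_sym by simp
    have "map (act ?I) (map \<theta> (fst k)) = flip (map (act ?I) (map \<theta> (snd k))) (path_label D (fst k))"
      using act_flip[OF S devmap_okl[OF w e(2)] 3 devmap_chain[OF w kc(4) e(2) kc(2)]] 2 by simp
    then show "map (act ?I \<circ> \<theta>) (snd c) = flip (map (act ?I \<circ> \<theta>) (fst c)) (path_label (mirror D) (snd c))"
      using k by (simp add: map_map)
    fix x y assume "x \<in> set (fst c)" "y \<in> set (snd c)"
    then have xy: "x \<in> set (snd k)" "y \<in> set (fst k)" using k by auto
    then have "h y < h x" "h x \<le> M" using wfdD(7)[OF w k(1)] hM e by blast+
    then show "M - h x < M - h y" by linarith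
  next
    fix e assume "e \<in> edges (mirror D)"
    then have e: "e \<in> edges D" by simp
    note o = wfdD(12)[OF w e]
    show "ok (top_label (mirror D)) ((act ?I \<circ> \<theta>) e)" "elab ((act ?I \<circ> \<theta>) e) = lab (mirror D) e"
      "esrc ((act ?I \<circ> \<theta>) e) = (actv ?I \<circ> \<eta>) (src (mirror D) e)" "etgt ((act ?I \<circ> \<theta>) e) = (actv ?I \<circ> \<eta>) (tgt (mirror D) e)"
      using act_ok[OF S o] act_elab[OF S o] act_esrc[OF S o] act_etgt[OF S o] wfdD(13-15)[OF w e] l by simp_all
  qed
  moreover have "map (act ?I \<circ> \<theta>) (bot_path (mirror D)) = ?I" using wfdD(11)[OF w] mor_act_base I by (metis map_map mirror_simps(8))
  ultimately show "develops (mirror D) ?I" unfolding develops_def by metis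
qed

lemma develops_triv:
  assumes "w \<noteq> []"
  shows "develops (triv w) (base w)" "top_label (triv w) = w" "bot_label (triv w) = w" "cells (triv w) = {}"
proof -
  show l: "top_label (triv w) = w" "bot_label (triv w) = w" "cells (triv w) = {}"
    by (simp_all add: triv_def top_label_def bot_label_def path_label_def map_nth)
  have m: "mirror (triv w) = triv w" by (simp add: mirror_def triv_def)
  have pv: "path_verts (triv w) [0..<length w] = [0..<Suc (length w)]"
    using assms by (simp add: path_verts_def triv_def hd_upt map_Suc_upt upt_conv_Cons del: upt_Suc)
  have h: "top_generated (triv w)" unfolding top_generated_def using assms pv
    by (simp add: triv_def diagram_path_def) auto
  have "map (\<lambda>e. base w ! e) [0..<length w] = base w" by (rule nth_equalityI) simp_all
  then have "devmap (triv w) (\<lambda>e. base w ! e) VBase (\<lambda>_. 0) \<and> base w = map (\<lambda>e. base w ! e) (bot_path (triv w))"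
    unfolding devmap_def m l using h l assms mor_base by (simp add: triv_def ok_Base)
  then show "develops (triv w) (base w)" unfolding develops_def by blast
qed

end

section \<open>Elementary diagrams and realization\<close>

lemma append3_eq:
  "A @ B @ C = A' @ B' @ C' \<Longrightarrow> length A = length A' \<Longrightarrow> length B = length B' \<Longrightarrow> A = A' \<and> B = B' \<and> C = C'"
  by simp

lemma diagram_path_append0:
  "diagram_path D p \<Longrightarrow> diagram_path D q \<Longrightarrow> (p \<noteq> [] \<Longrightarrow> q \<noteq> [] \<Longrightarrow> tgt D (last p) = src D (hd q)) \<Longrightarrow> diagram_path D (p @ q)"
  by (cases "p = []"; cases "q = []") (auto intro: diagram_path_append)

lemma diagram_path_upt: "(\<And>k. i \<le> k \<Longrightarrow> Suc k < j \<Longrightarrow> tgt D k = src D (Suc k)) \<Longrightarrow> diagram_path D [i..<j]"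
  by (simp add: diagram_path_def)

lemma dinner_upt: "(\<And>k. i \<le> k \<Longrightarrow> Suc k < j \<Longrightarrow> tgt D k = Suc k) \<Longrightarrow> dinner D [i..<j] = {Suc i..<j}"
proof -
  assume a: "\<And>k. i \<le> k \<Longrightarrow> Suc k < j \<Longrightarrow> tgt D k = Suc k"
  have "tgt D ` {i..<j - 1} = Suc ` {i..<j - 1}" by (rule image_cong) (use a in auto)
  also have "\<dots> = {Suc i..<j}" by (cases j) (auto simp: image_Suc_atLeastLessThan)
  finally have "tgt D ` {i..<j - 1} = {Suc i..<j}" .
  moreover have "butlast [i..<j] = [i..<j - 1]" by (cases j) auto
  ultimately show ?thesis by (simp add: dinner_def)
qed

context symmetric_relation
begin

lemma develops_elementary:
  assumes uv: "(u, v) \<in> R"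
  shows "develops (elementary x u v y) (sbase 0 x @ flip (sbase (length x) u) v @ sbase (length x + length u) y)"
    "top_label (elementary x u v y) = x @ u @ y" "bot_label (elementary x u v y) = x @ v @ y"
    "card (cells (elementary x u v y)) = 1"
proof -
  define a b N M where d: "a = length x" "b = length x + length u" "N = length (x @ u @ y)" "M = N + length v"
  let ?D = "elementary x u v y" and ?p = "sbase (length x) u"
  have une: "u \<noteq> []" "v \<noteq> []" using uv R_ne R_ne2 by auto
  have n: "a < b" "b \<le> N" "N < M" "length v = M - N" "a = length x" "length u = b - a" "length y = N - b" using une d by auto
  have E: "verts ?D = {0..<M}" "edges ?D = {0..<M}" "src ?D = (\<lambda>e. if e = N then a else e)"
    "tgt ?D = (\<lambda>e. if e = M - 1 then b else Suc e)" "lab ?D = (\<lambda>e. (x @ u @ y @ v) ! e)"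
    "cells ?D = {([a..<b], [N..<M])}" "top_path ?D = [0..<N]" "bot_path ?D = [0..<a] @ [N..<M] @ [b..<N]"
    unfolding elementary_def Let_def d by simp_all
  have lu: "map (\<lambda>e. (x @ u @ y @ v) ! e) [a..<b] = u" "map (\<lambda>e. (x @ u @ y @ v) ! e) [N..<M] = v"
    "map (\<lambda>e. (x @ u @ y @ v) ! e) [0..<N] = x @ u @ y" "map (\<lambda>e. (x @ u @ y @ v) ! e) [0..<a] = x"
    "map (\<lambda>e. (x @ u @ y @ v) ! e) [b..<N] = y"
    by (rule nth_equalityI; auto simp: d nth_append)+
  show tl: "top_label ?D = x @ u @ y" "bot_label ?D = x @ v @ y"
    using lu by (simp_all add: top_label_def bot_label_def path_label_def E)
  show "card (cells ?D) = 1" by (simp add: E)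
  \<comment> \<open>A base segment is never the bottom of a cell, so this flip glues a new
    cell.\<close>
  have flp: "flip ?p v = bots ?p v" using une by (simp add: flip_def hd_conv_nth split: edge.split)
  let ?W = "x @ u @ y"
  have bW: "base ?W = sbase 0 x @ ?p @ sbase (length x + length u) y" by (simp add: sbase_append)
  define \<theta> where "\<theta> e = (if e < N then base ?W ! e else New ?p v (e - N))" for e
  define \<eta> where "\<eta> i = (if i \<le> N then VBase i else VNew ?p v (i - N))" for i
  have mt: "map \<theta> [0..<N] = base ?W" by (rule nth_equalityI) (simp_all add: \<theta>_def d)
  have \<theta>b: "\<theta> e = Base e (?W ! e)" if "e < N" for e using that by (simp add: \<theta>_def d)
  have "[0..<N] = [0..<a] @ [a..<b] @ [b..<N]" using upt_add_eq_append[of 0 a "N - a"] upt_add_eq_append[of a b "N - b"] n(1,2) by simp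
  then have 1: "map \<theta> [0..<a] @ map \<theta> [a..<b] @ map \<theta> [b..<N] = sbase 0 x @ ?p @ sbase (length x + length u) y"
    using mt bW by (metis map_append)
  have "map \<theta> [0..<a] = sbase 0 x \<and> map \<theta> [a..<b] = ?p \<and> map \<theta> [b..<N] = sbase (length x + length u) y"
    by (rule append3_eq[OF 1]) (simp_all add: d)
  then have mx: "map \<theta> [0..<a] = sbase 0 x" and mu: "map \<theta> [a..<b] = ?p"
    and my: "map \<theta> [b..<N] = sbase (length x + length u) y" by blast+
  have mv: "map \<theta> [N..<M] = bots ?p v" by (rule nth_equalityI) (use n in \<open>simp_all add: \<theta>_def\<close>)
  have mb: "map \<theta> (bot_path ?D) = sbase 0 x @ flip ?p v @ sbase (length x + length u) y"
    using mx my mv flp E by simp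
  have tS: "tgt ?D ` X = Suc ` X" if "X \<subseteq> {..<M - 1}" for X by (rule image_cong) (use that E in auto)
  have di: "dinner ?D [N..<M] = {Suc N..<M}" "dinner ?D [a..<b] = {Suc a..<b}"
    by (rule dinner_upt; use E(4) n(1-3) in auto)+
  have dp: "diagram_path ?D [0..<N]" "diagram_path ?D [N..<M]" "diagram_path ?D [a..<b]" "diagram_path ?D [0..<a]" "diagram_path ?D [b..<N]"
    by (rule diagram_path_upt; use E(3,4) n(1-3) in auto)+
  have dpb: "diagram_path ?D (bot_path ?D)" unfolding E(8)
    by (intro diagram_path_append0 dp) (use E(3,4) n in \<open>auto simp: last_append\<close>)
  have pvt: "set (path_verts ?D (top_path ?D)) = {0..N}"
  proof -
    have "tgt ?D ` {0..<N} = Suc ` {0..<N}" by (rule tS) (use n in auto)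
    then show ?thesis using n E(3) by (auto simp: path_verts_def E(7) image_Suc_atLeastLessThan hd_upt)
  qed
  have pvb: "set (path_verts ?D (bot_path ?D)) = {0..a} \<union> {Suc N..<M} \<union> {b..N}"
  proof -
    have 1: "tgt ?D ` {0..<a} = Suc ` {0..<a}" "tgt ?D ` {b..<N} = Suc ` {b..<N}" "tgt ?D ` {N..<M - 1} = Suc ` {N..<M - 1}"
      by (rule tS; use n in auto)+
    have "{N..<M} = insert (M - 1) {N..<M - 1}" using n by auto
    then have "tgt ?D ` {N..<M} = insert (tgt ?D (M - 1)) (tgt ?D ` {N..<M - 1})" by (metis image_insert)
    moreover have "tgt ?D (M - 1) = b" by (simp add: E(4))
    moreover have "Suc ` {N..<M - 1} = {Suc N..<M}" using n(3) by (auto simp: image_Suc_atLeastLessThan)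
    ultimately have 2: "tgt ?D ` {N..<M} = insert b {Suc N..<M}" unfolding 1(3) by metis
    have "hd (bot_path ?D) = (if a = 0 then N else 0)" unfolding E(8) using n(3) by (simp add: hd_append hd_upt)
    then have 3: "src ?D (hd (bot_path ?D)) = 0" using n(1,2) unfolding E(3) by simp
    have "set (path_verts ?D (bot_path ?D)) = insert 0 ({Suc 0..a} \<union> (insert b {Suc N..<M} \<union> {Suc b..N}))"
      unfolding path_verts_def list.set 3 by (simp add: E(8) image_Un 1(1,2) 2 image_Suc_atLeastLessThan atLeastLessThanSuc_atLeastAtMost del: mk_disjoint_insert)
    then show ?thesis using n by auto
  qed
  have "top_generated ?D" unfolding top_generated_def pvt using dp n di E(1,2) by (simp add: E(6,7)) auto
  moreover have "top_generated (mirror ?D)" unfolding top_generated_def mirror_simps mirror_paths pvb using dp dpb n di E(1,2)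
    by (simp add: E(6,8)) auto
  moreover have "mor (x @ u @ y) (x @ v @ y) (map \<theta> (bot_path ?D))"
  proof -
    have "flip1 (base ?W) (map \<theta> (bot_path ?D))" unfolding flip1_def mb bW using uv by (metis map_elab_sbase)
    then have "reach ?W (map \<theta> (bot_path ?D))" using reach_flip1 reach_base by blast
    moreover have "map elab (map \<theta> (bot_path ?D)) = x @ v @ y" unfolding mb by simp
    ultimately show ?thesis using une unfolding mor_def by simp
  qed
  moreover have "\<forall>e\<in>edges ?D. ok (x @ u @ y) (\<theta> e) \<and> elab (\<theta> e) = lab ?D e \<and> esrc (\<theta> e) = \<eta> (src ?D e) \<and> etgt (\<theta> e) = \<eta> (tgt ?D e)"
  proof
    fix e assume "e \<in> edges ?D"
    then have e: "e < M" by (simp add: E)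
    have op: "okl ?W ?p" "chain (VBase a) ?p (VBase b)" using okl_base[of ?W] unfolding bW by (simp_all add: d)
    show "ok (x @ u @ y) (\<theta> e) \<and> elab (\<theta> e) = lab ?D e \<and> esrc (\<theta> e) = \<eta> (src ?D e) \<and> etgt (\<theta> e) = \<eta> (tgt ?D e)"
    proof (cases "e < N")
      case True
      have "(x @ u @ y @ v) ! e = ?W ! e" using True nth_append[of ?W v e] d by simp
      moreover have "ok ?W (Base e (?W ! e))" using True d by (intro ok_Base) simp
      moreover have "e \<noteq> M - 1" using True n(3) by linarith
      ultimately show ?thesis using \<theta>b[OF True] True by (simp add: \<eta>_def E(3,4,5))
    next
      case False
      have \<theta>: "\<theta> e = New ?p v (e - N)" using False by (simp add: \<theta>_def)
      have "ok ?W (\<theta> e)" unfolding \<theta>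
      proof (rule ok_New)
        show "\<exists>a b. chain a ?p b" using op(2) by blast
      qed (use op(1) uv flp e n False in \<open>auto simp: okl_def\<close>)
      moreover have "elab (\<theta> e) = lab ?D e"
      proof -
        have "(x @ u @ y @ v) ! e = v ! (e - N)" using False nth_append[of ?W v e] d by simp
        then show ?thesis using \<theta> E(5) by simp
      qed
      moreover have "esrc (hd ?p) = VBase a" "etgt (last ?p) = VBase b"
        using chain_hd[OF op(2)] chain_last[OF op(2)] une by auto
      ultimately show ?thesis using \<theta> E(3,4) n e False une by (auto simp: \<eta>_def Suc_diff_le)
    qed
  qed
  moreover have "src ?D (hd (top_path ?D)) = src ?D (hd (bot_path ?D))"
  proof -
    have "hd (bot_path ?D) = (if a = 0 then N else 0)" "hd (top_path ?D) = 0" unfolding E(7,8) using n(1-3) by (simp_all add: hd_append hd_upt)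
    then show ?thesis using n(1,2) unfolding E(3) by simp
  qed
  moreover have "tgt ?D (last (top_path ?D)) = tgt ?D (last (bot_path ?D))"
  proof -
    have "last (bot_path ?D) = (if b < N then N - 1 else M - 1)" "last (top_path ?D) = N - 1"
      unfolding E(7,8) using n(1-3) by (simp_all add: last_append)
    then show ?thesis using n(1-3) unfolding E(4) by auto
  qed
  moreover have "src ?D (hd [a..<b]) = src ?D (hd [N..<M])" "tgt ?D (last [a..<b]) = tgt ?D (last [N..<M])"
    using n(1-3) by (auto simp: hd_upt E(3,4))
  moreover have "path_label ?D [a..<b] = u" "path_label ?D [N..<M] = v" using lu(1,2) by (simp_all only: path_label_def E(5))
  moreover have "\<forall>e\<in>set [a..<b]. \<forall>f\<in>set [N..<M]. id e < id f" using n(2) by auto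
  moreover have "map \<theta> [N..<M] = flip (map \<theta> [a..<b]) v" "map \<theta> (top_path ?D) = base (x @ u @ y)" using mu mv flp mt E(7) by simp_all
  ultimately have "devmap ?D \<theta> \<eta> id" unfolding devmap_def tl using uv by (simp only: E(6)) simp
  then show "develops ?D (sbase 0 x @ flip ?p v @ sbase (length x + length u) y)" unfolding develops_def using mb by metis
qed

lemma dequiv_develops:
  assumes "dequiv D E" "develops D T" "develops E T'"
  shows "T = T' \<and> top_label D = top_label E"
proof -
  obtain D' E' where d: "reduced_form D D'" "reduced_form E E'" "isotopic D' E'" using assms(1) unfolding dequiv_def by blast
  have "develops E' T" "top_label E' = top_label D" using develops_isotopic d(3) reduced_form_develops[OF d(1) assms(2)] by metis+
  then show ?thesis using reduced_form_develops[OF d(2) assms(3)] develops_unique by metis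
qed

lemma develops_mor: "develops D T \<Longrightarrow> mor (top_label D) (bot_label D) T"
  unfolding develops_def using wfdD(16) by blast

text \<open>The bound on the number of cells will meet the count of \<open>min_disp_powers\<close>,
  which makes the powers reduced by \<open>few_cells_reduced\<close>.\<close>

lemma develops_dpow:
  assumes D: "develops D T" and l: "bot_label D = top_label D"
  shows "develops (dpow D k) (pw (top_label D) T k) \<and> top_label (dpow D k) = top_label D \<and> bot_label (dpow D k) = top_label D \<and>
    card (cells (dpow D k)) \<le> k * card (cells D)"
proof (induction k)
  case 0
  have "top_label D \<noteq> []" using develops_mor[OF D] by (simp add: mor_def)
  then show ?case using develops_triv by simp
next
  case (Suc k)
  then show ?case using develops_dcomp[of "dpow D k" "pw (top_label D) T k" D T] D l by (simp add: pw_Suc)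
qed

lemma develops_dpowi:
  assumes D: "develops D T" and l: "bot_label D = top_label D"
  shows "develops (dpowi D k) (pwi (top_label D) T k) \<and> top_label (dpowi D k) = top_label D \<and> bot_label (dpowi D k) = top_label D"
proof (cases "k \<ge> 0")
  case True
  then have "pwi (top_label D) T k = pw (top_label D) T (nat k)" using pwi_nat[of _ _ "nat k"] by simp
  then show ?thesis using develops_dpow[OF D l, of "nat k"] True by (simp add: dpowi_def)
next
  case False
  let ?w = "top_label D"
  have m: "mor ?w ?w T" using develops_mor[OF D] l by simp
  have "?w \<noteq> []" using m by (simp add: mor_def)
  then interpret G: group "path_group ?w" by (rule path_group_group)
  have "pwi ?w T k = pw ?w (inv\<^bsub>path_group ?w\<^esub> T) (nat (- k))"
  proof -
    have "T \<in> carrier (path_group ?w)" using m by simp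
    then have "(inv\<^bsub>path_group ?w\<^esub> T) [^]\<^bsub>path_group ?w\<^esub> nat (- k) = inv\<^bsub>path_group ?w\<^esub> (pw ?w T (nat (- k)))" by (rule G.nat_pow_inv)
    moreover have "pwi ?w T k = inv\<^bsub>path_group ?w\<^esub> (pw ?w T (nat (- k)))" unfolding int_pow_def2 using False by (simp del: path_group_simps)
    ultimately show ?thesis by metis
  qed
  then have "pwi ?w T k = pw ?w (minv ?w T) (nat (- k))" using path_group_inv[OF m] by simp
  then show ?thesis using develops_dpow[OF develops_mirror(1)[OF D], of "nat (- k)"] develops_mirror(2,3)[OF D] l False by (simp add: dpowi_def)
qed

end

section \<open>Developments of the diagrams over a presentation\<close>

locale semigroup_pres =
  fixes P :: "'a presentation"
  assumes semigroup_presentation: "semigroup_presentation P"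
begin

definition rels :: "('a list \<times> 'a list) set" where
  "rels = {(u, v). (u, v) \<in> relations P \<or> (v, u) \<in> relations P}"

lemma rels_words: "(u, v) \<in> rels \<Longrightarrow> u \<in> plus_words (alphabet P) \<and> v \<in> plus_words (alphabet P)"
  using semigroup_presentation unfolding rels_def semigroup_presentation_def by blast

sublocale symmetric_relation rels
proof
  show "(v, u) \<in> rels" if "(u, v) \<in> rels" for u v using that by (auto simp: rels_def)
  show "u \<noteq> []" if "(u, v) \<in> rels" for u v using rels_words[OF that] by (simp add: plus_words_def)
  show "(u, u) \<notin> rels" for u using semigroup_presentation unfolding rels_def semigroup_presentation_def by blast
qed

lemma diagram_over_develops:
  "diagram_over P D \<Longrightarrow> (\<exists>T. develops D T) \<and> top_label D \<in> plus_words (alphabet P) \<and> bot_label D \<in> plus_words (alphabet P)"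
proof (induction rule: diagram_over.induct)
  case (trivial w)
  then show ?case using develops_triv[of w] by (auto simp: plus_words_def)
next
  case (elementary x y u v)
  then have uv: "(u, v) \<in> rels" by (auto simp: rels_def)
  show ?case using develops_elementary[OF uv, of x y] elementary(1,2) rels_words[OF uv] R_ne[OF uv] R_ne2[OF uv]
    by (auto simp: plus_words_def)
next
  case (composition D E)
  then show ?case using develops_dcomp[of D _ E] by fastforce
next
  case (isotopy D E)
  then show ?case using develops_isotopic by metis
qed

text \<open>\<open>S\<close> arises from the base path by gluing new cells only, one for each cell
  of its history. Each of these moves is realised by composing with an elementary diagram.\<close>

lemma ex_diagram:
  assumes w: "w \<in> plus_words (alphabet P)" and S: "mor w w' S"
  shows "\<exists>D. wdiagram P w w' D \<and> develops D S \<and> card (cells D) \<le> card (lcells S)"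
proof -
  have "(new1 ^^ n) (base w) Q \<Longrightarrow> \<exists>D. diagram_over P D \<and> top_label D = w \<and> develops D Q \<and> card (cells D) \<le> n" for n Q
  proof (induction n arbitrary: Q)
    case 0
    then show ?case using develops_triv[of w] w diagram_over.trivial[of w P] by (auto simp: plus_words_def intro!: exI[of _ "triv w"])
  next
    case (Suc n)
    then obtain Q0 where Q0: "(new1 ^^ n) (base w) Q0" "new1 Q0 Q" by auto
    obtain D where D: "diagram_over P D" "top_label D = w" "develops D Q0" "card (cells D) \<le> n" using Suc(1)[OF Q0(1)] by blast
    obtain X p Y v where Q: "(map elab p, v) \<in> rels" "flip p v = bots p v" "Q0 = X @ p @ Y" "Q = X @ bots p v @ Y"
      using Q0(2) unfolding new1_def by blast
    let ?x = "map elab X" and ?u = "map elab p" and ?y = "map elab Y"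
    have m: "mor w (?x @ ?u @ ?y) Q0"
      using develops_mor[OF D(3)] D(2) Q(3) unfolding mor_def by auto
    then have bl: "bot_label D = ?x @ ?u @ ?y" using develops_mor[OF D(3)] D(2) by (simp add: mor_def)
    have "bot_label D \<in> plus_words (alphabet P)" using diagram_over_develops[OF D(1)] by blast
    then have xy: "?x \<in> lists (alphabet P)" "?y \<in> lists (alphabet P)" unfolding bl by (auto simp: plus_words_def)
    let ?E = "elementary ?x ?u v ?y"
    have E: "diagram_over P ?E" using xy Q(1) by (intro diagram_over.elementary) (auto simp: rels_def)
    note e = develops_elementary[OF Q(1), of ?x ?y]
    let ?p = "sbase (length ?x) ?u"
    \<comment> \<open>The action of \<open>Q0\<close> takes the base path over the bottom label of
      \<open>D\<close> to \<open>Q0\<close> itself, so it carries the development of the elementary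
      diagram to the required flip.\<close>
    have "map (act Q0) (base (?x @ ?u @ ?y)) = Q0" using mor_act_base[OF m] .
    then have 1: "map (act Q0) (sbase 0 ?x) @ map (act Q0) ?p @ map (act Q0) (sbase (length ?x + length ?u) ?y) = X @ p @ Y"
      using Q(3) by (simp add: sbase_append)
    have a: "map (act Q0) (sbase 0 ?x) = X" "map (act Q0) ?p = p" "map (act Q0) (sbase (length ?x + length ?u) ?y) = Y"
      using append3_eq[OF 1] by simp_all
    have ob: "okl (?x @ ?u @ ?y) ?p" using okl_base[of "?x @ ?u @ ?y"] by (simp add: sbase_append)
    have "map (act Q0) (flip ?p v) = flip (map (act Q0) ?p) v"
      by (rule act_flip[OF mor_lpath[OF m] ob, of v "VBase (length ?x)" "VBase (length ?x + length ?u)"]) (use Q(1) in auto)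
    then have "map (act Q0) (sbase 0 ?x @ flip ?p v @ sbase (length ?x + length ?u) ?y) = Q" using a Q(2,4) by simp
    then have "develops (dcomp D ?E) Q" using develops_dcomp(1)[OF D(3) e(1)] e(2) bl by simp
    moreover have "diagram_over P (dcomp D ?E)" using diagram_over.composition[OF D(1) E] bl e(2) by simp
    moreover have "top_label (dcomp D ?E) = w" "card (cells (dcomp D ?E)) \<le> Suc n"
      using develops_dcomp(2,4)[OF D(3) e(1)] bl e(2,4) D(2,4) by simp_all
    ultimately show ?case by blast
  qed
  then obtain D where D: "diagram_over P D" "top_label D = w" "develops D S" "card (cells D) \<le> card (lcells S)"
    using up_base S unfolding mor_def by blast
  moreover have "bot_label D = w'" using develops_mor[OF D(3)] S D(2) by (simp add: mor_def)
  ultimately show ?thesis unfolding wdiagram_def by blast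
qed

end

context semigroup_pres
begin

lemma dequiv_refl: "diagram_over P D \<Longrightarrow> dequiv D D"
  using diagram_over_develops dequiv_iff_aux by blast

text \<open>The product of classes is a union over representatives, so equality of the products
  makes \<open>dcomp A B\<close> equivalent to a composite of some representatives of the classes of
  \<open>B\<close> and \<open>A\<close>. Equivalent diagrams have the same development.\<close>

lemma dclass_commute:
  assumes A: "spherical P w A" "develops A S" and B: "spherical P w B" "develops B T"
    and c: "dclass P A \<otimes>\<^bsub>diagram_group P w\<^esub> dclass P B = dclass P B \<otimes>\<^bsub>diagram_group P w\<^esub> dclass P A"
  shows "map (act S) T = map (act T) S"
proof -
  have a: "diagram_over P A" "top_label A = w" "bot_label A = w" and b: "diagram_over P B" "top_label B = w" "bot_label B = w"
    using A(1) B(1) by (auto simp: spherical_def wdiagram_def)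
  have AB: "diagram_over P (dcomp A B)" using a b diagram_over.composition by metis
  have "dcomp A B \<in> dclass P A \<otimes>\<^bsub>diagram_group P w\<^esub> dclass P B"
    using dequiv_refl[OF a(1)] dequiv_refl[OF b(1)] dequiv_refl[OF AB] a b AB
    unfolding diagram_group_def dclass_def by auto
  then obtain D E where D: "D \<in> dclass P B" "E \<in> dclass P A" "dcomp A B \<in> dclass P (dcomp D E)"
    unfolding c unfolding diagram_group_def by auto
  obtain T' S' where d: "develops D T'" "develops E S'" using D(1,2) diagram_over_develops unfolding dclass_def by blast
  have "dequiv B D" "dequiv A E" using D(1,2) by (auto simp: dclass_def)
  then have e: "T = T'" "top_label D = w" "S = S'" "top_label E = w"
    using dequiv_develops[of B D T T'] dequiv_develops[of A E S S'] A B a b d by auto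
  have "bot_label D = w" using develops_mor[OF d(1)] develops_mor[OF B(2)] b e by (auto simp: mor_def)
  then have "develops (dcomp D E) (map (act T) S)" using develops_dcomp(1)[OF d] e by simp
  moreover have "develops (dcomp A B) (map (act S) T)" using develops_dcomp(1)[OF A(2) B(2)] a b by simp
  moreover have "dequiv (dcomp D E) (dcomp A B)" using D(3) by (simp add: dclass_def)
  ultimately show ?thesis using dequiv_develops by metis
qed

text \<open>A power of the diagram has no more cells than the history of its development, hence is
  reduced. A decomposition into a sum would cut the base path and \<open>D\<close> into matching
  pieces, against \<open>simple_abs\<close>.\<close>

lemma simple_abs_diagram:
  assumes s: "simple_abs v D" and \<Delta>: "wdiagram P v v \<Delta>" "develops \<Delta> D" "card (cells \<Delta>) \<le> card (lcells D)"
  shows "simple_diagram P \<Delta> \<and> absolutely_reduced \<Delta>"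
proof
  have l: "top_label \<Delta> = v" "bot_label \<Delta> = v" using \<Delta>(1) by (auto simp: wdiagram_def)
  have m: "mor v v D" using develops_mor[OF \<Delta>(2)] l by simp
  have "reduced (dpow \<Delta> k)" for k
  proof (rule few_cells_reduced)
    show "develops (dpow \<Delta> k) (pw v D k)" using develops_dpow[OF \<Delta>(2)] l by simp
    have "card (cells (dpow \<Delta> k)) \<le> k * card (cells \<Delta>)" using develops_dpow[OF \<Delta>(2), of k] l by simp
    also have "\<dots> \<le> k * card (lcells D)" using \<Delta>(3) by simp
    also have "\<dots> = card (lcells (pw v D k))" using s unfolding simple_abs_def by simp
    finally show "card (cells (dpow \<Delta> k)) \<le> card (lcells (pw v D k))" .
  qed
  then show "absolutely_reduced \<Delta>" by (simp add: absolutely_reduced_def)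
  have "\<not> trivial_diagram \<Delta>"
  proof
    assume "trivial_diagram \<Delta>"
    then obtain u where u: "isotopic \<Delta> (triv u)" unfolding trivial_diagram_def by blast
    have "top_label (triv u) = u" by (simp add: triv_def top_label_def path_label_def map_nth)
    then have "u = v" "develops (triv u) D" using develops_isotopic[OF \<Delta>(2) u] l by auto
    then have "D = base v" using develops_triv(1)[of v] develops_unique m unfolding mor_def by blast
    then show False using s unfolding simple_abs_def by blast
  qed
  moreover have "\<not> (\<exists>D1 D2. diagram_over P D1 \<and> diagram_over P D2 \<and> isotopic \<Delta> (dsum D1 D2))"
  proof
    assume "\<exists>D1 D2. diagram_over P D1 \<and> diagram_over P D2 \<and> isotopic \<Delta> (dsum D1 D2)"
    then obtain D1 D2 where d: "diagram_over P D1" "diagram_over P D2" "isotopic \<Delta> (dsum D1 D2)" by blast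
    obtain T1 T2 where T: "develops D1 T1" "develops D2 T2" using d diagram_over_develops by blast
    let ?v1 = "top_label D1" and ?v2 = "top_label D2"
    have m1: "mor ?v1 (bot_label D1) T1" "mor ?v2 (bot_label D2) T2" using develops_mor T by auto
    have "develops (dsum D1 D2) D" "?v1 @ ?v2 = v" using develops_isotopic[OF \<Delta>(2) d(3)] develops_dsum(2)[OF T] l by auto
    then have "D = ssum ?v1 T1 T2" "base v = base ?v1 @ map (shift_edge (length ?v1)) (base ?v2)"
      using develops_unique develops_dsum(1)[OF T] by (auto simp: sbase_append shift_edge_sbase)
    moreover have "(flip1 ^^ cdist (base ?v1) T1) (base ?v1) T1" using geo[of ?v1 "base ?v1" T1] m1(1) unfolding mor_def by simp
    moreover have "(flip1 ^^ cdist (base ?v2) T2) (map (shift_edge (length ?v1)) (base ?v2)) (map (shift_edge (length ?v1)) T2)"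
      using flipn_shift_edge[of ?v2 "base ?v2"] geo[of ?v2 "base ?v2" T2] m1(2) unfolding mor_def by simp
    moreover have "T1 \<noteq> []" "T2 \<noteq> []" "?v1 \<noteq> []" "?v2 \<noteq> []" using mor_ne m1 by blast+
    ultimately show False using s unfolding simple_abs_def ssum_def by (metis Nil_is_map_conv sbase_eq_Nil)
  qed
  ultimately show "simple_diagram P \<Delta>" by (simp add: simple_diagram_def)
qed

lemma ex_component:
  assumes v: "v \<in> plus_words (alphabet P)" and D: "mor v v D" "D = base v \<or> simple_abs v D"
  shows "\<exists>\<Delta>. wdiagram P v v \<Delta> \<and> develops \<Delta> D \<and> (trivial_diagram \<Delta> \<or> simple_diagram P \<Delta> \<and> absolutely_reduced \<Delta>)"
proof (cases "D = base v")
  case True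
  have "isotopic (triv v) (triv v)" unfolding isotopic_def by (rule exI[of _ id], rule exI[of _ id]) auto
  then have "trivial_diagram (triv v)" unfolding trivial_diagram_def by blast
  moreover have "v \<noteq> []" using D(1) by (simp add: mor_def)
  ultimately show ?thesis using True develops_triv[of v] diagram_over.trivial[OF v] unfolding wdiagram_def by blast
next
  case False
  then show ?thesis using ex_diagram[OF v D(1)] simple_abs_diagram D(2) by blast
qed

lemma develops_dsum_list:
  "list_all2 (\<lambda>E (v, D, f). develops E (pwi v D (f i)) \<and> top_label E = v) Es cs \<Longrightarrow> cs \<noteq> [] \<Longrightarrow>
   develops (dsum_list Es) (sum_powers i cs) \<and> top_label (dsum_list Es) = comps_word cs"
proof (induction rule: list_all2_induct)
  case (Cons E Es c cs)
  obtain v D f where c: "c = (v, D, f)" by (cases c)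
  show ?case
  proof (cases cs)
    case Nil
    then have "Es = []" using Cons(2) by simp
    then show ?thesis using Cons(1) Nil c by (simp add: ssum_def comps_word_def)
  next
    case (Cons c' cs')
    then obtain E' Es' where Es: "Es = E' # Es'" using \<open>list_all2 _ Es cs\<close> by (cases Es) auto
    have "develops (dsum_list Es) (sum_powers i cs)" "top_label (dsum_list Es) = comps_word cs" using Cons.IH Cons by auto
    then show ?thesis using develops_dsum[of E "pwi v D (f i)" "dsum_list Es" "sum_powers i cs"] \<open>case c of (v, D, f) \<Rightarrow> _ v D f\<close> c Es
      by (simp add: comps_word_def)
  qed
qed simp

end

lemma map_shifted_upt: "map (\<lambda>j. g (xs ! (j - 1))) [1..<Suc (length xs)] = map g xs"
  by (rule nth_equalityI) (auto simp del: upt_Suc)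

theorem theorem17:
  fixes P :: "'a presentation" and w :: "'a list"
    and m :: nat and A :: "nat \<Rightarrow> 'a diagram"
  assumes "semigroup_presentation P"
    and "w \<in> plus_words (alphabet P)"
    and "\<And>i. i \<in> {1..m} \<Longrightarrow> spherical P w (A i)"
    and "\<And>i j. i \<in> {1..m} \<Longrightarrow> j \<in> {1..m} \<Longrightarrow>
           dclass P (A i) \<otimes>\<^bsub>diagram_group P w\<^esub> dclass P (A j) =
           dclass P (A j) \<otimes>\<^bsub>diagram_group P w\<^esub> dclass P (A i)"
  shows "\<exists>(n::nat) (v :: 'a list) (vs :: nat \<Rightarrow> 'a list) (\<Delta> :: nat \<Rightarrow> 'a diagram)
            (d :: nat \<Rightarrow> nat \<Rightarrow> int) (\<Gamma> :: 'a diagram).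
           n \<ge> 1 \<and>
           v = concat (map vs [1..<Suc n]) \<and>
           (\<forall>j\<in>{1..n}. spherical P (vs j) (\<Delta> j)) \<and>
           wdiagram P w v \<Gamma> \<and>
           (\<forall>i\<in>{1..m}.
              dequiv (dcomp (dcomp (mirror \<Gamma>) (A i)) \<Gamma>)
                     (dsum_list (map (\<lambda>j. dpowi (\<Delta> j) (d i j)) [1..<Suc n]))) \<and>
           (\<forall>j\<in>{1..n}. trivial_diagram (\<Delta> j) \<or>
              (simple_diagram P (\<Delta> j) \<and> absolutely_reduced (\<Delta> j)))"
proof -
  interpret semigroup_pres P using assms(1) by unfold_locales
  have A: "diagram_over P (A i)" "top_label (A i) = w" "bot_label (A i) = w" if "i \<in> {1..m}" for i
    using assms(3)[OF that] by (auto simp: spherical_def wdiagram_def)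
  define S where "S i = (SOME T. develops (A i) T)" for i
  have S: "develops (A i) (S i)" if "i \<in> {1..m}" for i unfolding S_def by (rule someI_ex) (use diagram_over_develops A[OF that] in blast)
  have mS: "mor w w (S i)" if "i \<in> {1..m}" for i using develops_mor[OF S[OF that]] A[OF that] by simp
  have "normal_form {1..m} w S"
  proof (rule commuting_normal_form)
    show "w \<noteq> []" using assms(2) by (simp add: plus_words_def)
    show "map (act (S i)) (S j) = map (act (S j)) (S i)" if "i \<in> {1..m}" "j \<in> {1..m}" for i j
      using dclass_commute[OF assms(3)[OF that(1)] S[OF that(1)] assms(3)[OF that(2)] S[OF that(2)] assms(4)[OF that]] .
  qed (use mS in auto)
  then obtain G cs where cs: "comps cs" "mor w (comps_word cs) G" "\<And>i. i \<in> {1..m} \<Longrightarrow> map (act (S i)) G = map (act G) (sum_powers i cs)"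
    unfolding normal_form_def by blast
  obtain \<Gamma> where \<Gamma>: "wdiagram P w (comps_word cs) \<Gamma>" "develops \<Gamma> G" using ex_diagram[OF assms(2) cs(2)] by blast
  have \<Gamma>': "diagram_over P \<Gamma>" "bot_label \<Gamma> = comps_word cs" using \<Gamma>(1) unfolding wdiagram_def by blast+
  \<comment> \<open>The component words use only letters of the alphabet, because \<Gamma> is a
    diagram over the presentation with their concatenation as bottom label.\<close>
  have "bot_label \<Gamma> \<in> plus_words (alphabet P)" using diagram_over_develops[OF \<Gamma>'(1)] by blast
  then have "comps_word cs \<in> lists (alphabet P)" unfolding \<Gamma>'(2) plus_words_def by blast
  then have fl: "fst c \<in> lists (alphabet P)" if "c \<in> set cs" for c using that unfolding comps_word_def by auto
  have cmp: "mor (fst c) (fst c) (fst (snd c)) \<and> (fst (snd c) = base (fst c) \<or> simple_abs (fst c) (fst (snd c)))"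
    if "c \<in> set cs" for c using cs(1) that unfolding comps_def by fastforce
  have "\<exists>\<Delta>. wdiagram P (fst c) (fst c) \<Delta> \<and> develops \<Delta> (fst (snd c)) \<and> (trivial_diagram \<Delta> \<or> simple_diagram P \<Delta> \<and> absolutely_reduced \<Delta>)"
    if "c \<in> set cs" for c
    by (rule ex_component) (use fl[OF that] cmp[OF that] in \<open>auto simp: plus_words_def mor_def\<close>)
  then obtain F where F: "\<And>c. c \<in> set cs \<Longrightarrow> wdiagram P (fst c) (fst c) (F c) \<and> develops (F c) (fst (snd c)) \<and>
      (trivial_diagram (F c) \<or> simple_diagram P (F c) \<and> absolutely_reduced (F c))" by metis
  define n where "n = length cs"
  \<comment> \<open>Components are numbered from 1 in the theorem and from 0 in the list
    \<open>cs\<close>.\<close>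
  define vs where "vs j = fst (cs ! (j - 1))" for j
  define \<Delta> where "\<Delta> j = F (cs ! (j - 1))" for j
  define d where "d i j = snd (snd (cs ! (j - 1))) i" for i j :: nat
  have inset: "cs ! (j - 1) \<in> set cs" if "j \<in> {1..n}" for j using that by (auto simp: n_def)
  have eq: "dequiv (dcomp (dcomp (mirror \<Gamma>) (A i)) \<Gamma>) (dsum_list (map (\<lambda>j. dpowi (\<Delta> j) (d i j)) [1..<Suc n]))"
    if i: "i \<in> {1..m}" for i
  proof (rule dequiv_iff_aux)
    have l: "top_label \<Gamma> = w" "bot_label \<Gamma> = comps_word cs" using \<Gamma>(1) by (auto simp: wdiagram_def)
    note mir = develops_mirror[OF \<Gamma>(2), unfolded l]
    note c1 = develops_dcomp[OF mir(1) S[OF i], unfolded mir A[OF i], OF refl]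
    note c2 = develops_dcomp[OF c1(1) \<Gamma>(2), unfolded c1 l, OF refl]
    have "map (act (map (act (minv w G)) (S i))) G = map (act (minv w G)) (map (act (S i)) G)"
      using mor_act_act[OF minv[OF cs(2), THEN conjunct1] mS[OF i]] reach_okl cs(2) unfolding mor_def by metis
    also have "\<dots> = map (act (minv w G)) (map (act G) (sum_powers i cs))" using cs(3)[OF i] by simp
    also have "\<dots> = sum_powers i cs" using minv_act[OF cs(2)] sum_powers_mor[OF cs(1), of i] reach_okl unfolding mor_def by blast
    finally show "develops (dcomp (dcomp (mirror \<Gamma>) (A i)) \<Gamma>) (sum_powers i cs)" using c2(1) by simp
    have "map (\<lambda>j. dpowi (\<Delta> j) (d i j)) [1..<Suc n] = map (\<lambda>c. dpowi (F c) (snd (snd c) i)) cs"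
      unfolding n_def \<Delta>_def d_def by (rule map_shifted_upt)
    moreover have "list_all2 (\<lambda>E (v, D, f). develops E (pwi v D (f i)) \<and> top_label E = v) (map (\<lambda>c. dpowi (F c) (snd (snd c) i)) cs) cs"
    proof -
      have "develops (dpowi (F c) (snd (snd c) i)) (pwi (fst c) (fst (snd c)) (snd (snd c) i)) \<and> top_label (dpowi (F c) (snd (snd c) i)) = fst c"
        if "c \<in> set cs" for c
        using F[OF that] develops_dpowi[of "F c" "fst (snd c)" "snd (snd c) i"] by (auto simp: wdiagram_def)
      then show ?thesis by (auto simp: list_all2_conv_all_nth split_beta)
    qed
    ultimately have "develops (dsum_list (map (\<lambda>j. dpowi (\<Delta> j) (d i j)) [1..<Suc n])) (sum_powers i cs) \<and>
      top_label (dsum_list (map (\<lambda>j. dpowi (\<Delta> j) (d i j)) [1..<Suc n])) = comps_word cs"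
      using develops_dsum_list[of i _ cs] cs(1) unfolding comps_def by simp
    then show "develops (dsum_list (map (\<lambda>j. dpowi (\<Delta> j) (d i j)) [1..<Suc n])) (sum_powers i cs)"
      "top_label (dcomp (dcomp (mirror \<Gamma>) (A i)) \<Gamma>) = top_label (dsum_list (map (\<lambda>j. dpowi (\<Delta> j) (d i j)) [1..<Suc n]))"
      using c2(2) by auto
  qed
  show ?thesis
  proof (intro exI conjI)
    show "n \<ge> 1" using cs(1) unfolding n_def comps_def by (cases cs) auto
    show "comps_word cs = concat (map vs [1..<Suc n])" unfolding comps_word_def n_def vs_def by (simp only: map_shifted_upt)
    show "\<forall>j\<in>{1..n}. spherical P (vs j) (\<Delta> j)" using F inset unfolding spherical_def vs_def \<Delta>_def by blast
    show "wdiagram P w (comps_word cs) \<Gamma>" by (rule \<Gamma>(1))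
    show "\<forall>i\<in>{1..m}. dequiv (dcomp (dcomp (mirror \<Gamma>) (A i)) \<Gamma>) (dsum_list (map (\<lambda>j. dpowi (\<Delta> j) (d i j)) [1..<Suc n]))"
      using eq by blast
    show "\<forall>j\<in>{1..n}. trivial_diagram (\<Delta> j) \<or> (simple_diagram P (\<Delta> j) \<and> absolutely_reduced (\<Delta> j))"
      using F inset unfolding \<Delta>_def by blast
  qed
qed

end
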